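(* Let $P$ be a real-valued function that is smooth in a neighborhood of $1$ with $P'(1)>0$, and let $V>\sqrt{P'(1)}$. The instability index $\Gamma=\Gamma(V)$ takes the form $$\Gamma=\big\langle JV_+,\,\mathcal{N}\,V_-\big\rangle$$ where $$\mathcal{N}:=(L^{[3]})_{-3}^{j}+(L^{[1]})_{-1}^{j-2}G_{j-2}(L^{[2]})_{-2}^{j}+(L^{[2]})_{-2}^{j-1}G_{j-1}(L^{[1]})_{-1}^{j}+(L^{[1]})_{-1}^{j-2}G_{j-2}(L^{[1]})_{-1}^{j-1}G_{j-1}(L^{[1]})_{-1}^{j}.$$ Here $\langle\cdot,\cdot\rangle$ is the canonical scalar product on $\mathbb{C}^2$, skew-linear in its first component.
   Context: $F$ is a smooth function near $1$ with $F''(\rho)=P'(\rho)/\rho$; $h(\rho;V):=\frac{V^2}{\rho^3}-F''(\rho)$, so $h(1;V)=V^2-P'(1)$; $\mathcal{W}(\cdot;V)$ satisfies $\partial_\rho\mathcal{W}(\rho;V)=(\rho-1)h(\rho;V)$, $\mathcal{W}(1;V)=0$. Waves. For $V>\sqrt{P'(1)}$ let $\mathcal{W}^\dagger(\cdot;V)$ be the smooth function near $0$ with $\mathcal{W}^\dagger(0;V)=1$ and $\mathcal{W}(1+\zeta\,\mathcal{W}^\dagger(\zeta;V);V)=\zeta^2h(1;V)/2$. For $\delta\ge0$ small, define $k^{(\delta,V)}>0$ by $\frac{1}{k^{(\delta,V)}}=\sqrt{h(1;V)}\int_{-\pi}^{\pi}\frac{d\theta}{\mathcal{W}^\dagger(\delta\cos\theta;V)}$,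 let $\underline{E}=\underline{E}^{(\delta,V)}$ be the ($1$-periodic) solution of $$\underline{E}''=-\frac{\underline{E}}{(k^{(\delta,V)})^2\,h(1+k^{(\delta,V)}\underline{E}';V)},\qquad \underline{E}(0)=0,\quad \underline{E}'(0)=\delta\,\frac{\mathcal{W}^\dagger(\delta;V)}{k^{(\delta,V)}},$$ and $\underline{u}^{(\delta,V)}:=V\frac{k^{(\delta,V)}\underline{E}'}{1+k^{(\delta,V)}\underline{E}'}$. Then $(t,x)\mapsto(\underline{E},\underline{u})(k(x-tV))$ is a traveling wave of $\partial_tE+(1+\partial_xE)u=0$, $\partial_tu+u\partial_xu+\partial_x(F'(1+\partial_xE))=E$. Operators (dependence on $V$ omitted). For $\xi\in\mathbb{R}$, with $D:=k^{(\delta)}(\partial_x+i\xi)$, $$L_\xi^\delta\begin{pmatrix}E\\ u\end{pmatrix}=\begin{pmatrix}(V-\underline{u}^\delta)DE-(1+k^{(\delta)}(\underline{E}^\delta)')u\\ E-F''(1+k^{(\delta)}(\underline{E}^\delta)')D^2E-F'''(1+k^{(\delta)}(\underline{E}^\delta)')(k^{(\delta)})^2(\underline{E}^\delta)''DE+(V-\underline{u}^\delta)Du-k^{(\delta)}(\underline{u}^\delta)'u\end{pmatrix},$$ acting on $H^1(\mathbb{R}/\mathbb{Z})\times L^2(\mathbb{R}/\mathbb{Z})$ with domain $H^2(\mathbb{R}/\mathbb{Z})\times H^1(\mathbb{R}/\mathbb{Z})$. Let $J:=\begin{pmatrix}0&-1\\1&0\end{pmatrix}$ and $A^\delta_\xi:=J^{-1}L^\delta_\xi$.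 Definition of the index $\Gamma(V)$. Let $k_0:=k^{(0)}=\frac{1}{2\pi\sqrt{V^2-P'(1)}}$, $\omega_m(\xi):=\sqrt{1+P'(1)k_0^2(2\pi m+\xi)^2}$ and $\lambda^m_\pm(\xi):=i\big(Vk_0(2\pi m+\xi)\pm\omega_m(\xi)\big)$ for $m\in\mathbb{Z}$. Let $z:=\frac12\Big(4+\frac{\sqrt5\,V}{\sqrt{P'(1)}}\Big)$, $j:=\lfloor z\rfloor$, $j':=j-3$, $\xi_0:=2\pi\big((z-\lfloor z\rfloor)-\frac12\big)$; then $\lambda_0:=\lambda_-^j(\xi_0)=\lambda_+^{j'}(\xi_0)$ is a double eigenvalue of $L^0_{\xi_0}$. Set $$V_+:=\begin{pmatrix}1\\-i\omega_{j'}(\xi_0)\end{pmatrix},\qquad V_-:=\begin{pmatrix}1\\ i\omega_{j}(\xi_0)\end{pmatrix}.$$ For $\epsilon_1>0$ small and $0\le\delta\le\epsilon_1$, let $\Pi^\delta:=\frac{1}{2i\pi}\oint_{\partial B_{\epsilon_1}(\lambda_0)}(\lambda I-L^\delta_{\xi_0})^{-1}d\lambda$, where $B_r(\lambda_0)$ is the open disc in $\mathbb{C}$ of center $\lambda_0$ and radius $r$, and let $\mathcal{U}(\delta)$ solve $\partial_\delta\mathcal{U}(\delta)=[\partial_\delta\Pi^\delta,\Pi^\delta]\,\mathcal{U}(\delta)$, $\mathcal{U}(0)=I$, with $[A,B]=AB-BA$. Set $q_+^\delta:=\mathcal{U}(\delta)(e^{2\pi ij'\cdot}V_+)$, $q_-^\delta:=\mathcal{U}(\delta)(e^{2\pi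 ij\cdot}V_-)$, and $a(\delta):=\int_0^1\overline{q_+^\delta}\cdot A^\delta_{\xi_0}q_-^\delta$. Then $\Gamma(V):=\frac16\,\partial_\delta^3a(0)$. Further notation. $L^{[m]}:=\frac{1}{m!}\partial_\delta^mL^\delta_{\xi_0}\big|_{\delta=0}$. For an operator $M$ on $\mathbb{C}^2$-valued $1$-periodic functions and $m,p\in\mathbb{Z}$, $M^m_p:\mathbb{C}^2\to\mathbb{C}^2$ is defined by $M^m_p(X):=\int_0^1e^{-2\pi i(m+p)x}\,\big(M(e^{2\pi im\,\cdot}X)\big)(x)\,dx$. For $\zeta\in\mathbb{C}$, $\Sigma_0(\zeta):=\begin{pmatrix}V\zeta&-1\\1-F''(1)\zeta^2&V\zeta\end{pmatrix}$, and for $m\in\mathbb{Z}\setminus\{j,j'\}$, $G_m:=\big(\lambda_0I-\Sigma_0(ik_0(2\pi m+\xi_0))\big)^{-1}$. *)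

theory Defs
  imports "HOL-Complex_Analysis.Complex_Analysis"
begin

definition smooth_on :: "real set \<Rightarrow> (real \<Rightarrow> 'a::real_normed_vector) \<Rightarrow> bool" where
  "smooth_on S f \<longleftrightarrow>
     (\<forall>n. \<forall>x\<in>S. ((\<lambda>g y. vector_derivative g (at y)) ^^ n) f differentiable (at x))"

definition smooth_near :: "real \<Rightarrow> (real \<Rightarrow> 'a::real_normed_vector) \<Rightarrow> bool" where
  "smooth_near a f \<longleftrightarrow> (\<exists>r>0. smooth_on (ball a r) f)"

definition periodic1 :: "(real \<Rightarrow> 'a) \<Rightarrow> bool" where
  "periodic1 f \<longleftrightarrow> (\<forall>x. f (x + 1) = f x)"

definition sq_int :: "(real \<Rightarrow> complex) \<Rightarrow> bool" where
  "sq_int f \<longleftrightarrow> f \<in> borel_measurable borel \<and> periodic1 f \<and>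
     set_integrable lborel {0..1} (\<lambda>x. (cmod (f x))\<^sup>2)"

lemma borel_measurable_cnj [measurable (raw)]:
  "f \<in> borel_measurable M \<Longrightarrow> (\<lambda>x. cnj (f x)) \<in> borel_measurable M"
  by (rule measurable_compose[OF _ borel_measurable_continuous_onI]) (auto intro: continuous_intros)

lemma sq_int_prod:
  assumes "sq_int f" "sq_int g"
  shows "set_integrable lborel {0..1} (\<lambda>x. cnj (f x) * g x)"
proof -
  have [measurable]: "f \<in> borel_measurable borel" "g \<in> borel_measurable borel"
    using assms by (auto simp: sq_int_def)
  have i: "set_integrable lborel {0..1} (\<lambda>x. (cmod (f x))\<^sup>2 + (cmod (g x))\<^sup>2)"
    using assms by (intro set_integral_add) (auto simp: sq_int_def)
  show ?thesis
    unfolding set_integrable_def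
  proof (rule Bochner_Integration.integrable_bound[OF i[unfolded set_integrable_def]])
    have "cmod (f x) * cmod (g x) \<le> (cmod (f x))\<^sup>2 + (cmod (g x))\<^sup>2" for x
    proof -
      have "2 * (cmod (f x) * cmod (g x)) \<le> (cmod (f x))\<^sup>2 + (cmod (g x))\<^sup>2"
        using sum_squares_bound[of "cmod (f x)" "cmod (g x)"] by (simp add: mult.assoc)
      moreover have "0 \<le> cmod (f x) * cmod (g x)" by simp
      ultimately show ?thesis by linarith
    qed
    then show "AE x in lborel. norm (indicat_real {0..1} x *\<^sub>R (cnj (f x) * g x))
        \<le> norm (indicat_real {0..1} x *\<^sub>R ((cmod (f x))\<^sup>2 + (cmod (g x))\<^sup>2))"
      by (auto simp: indicator_def norm_mult)
  qed measurable
qed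

lemma sq_int_add:
  assumes "sq_int f" "sq_int g"
  shows "sq_int (\<lambda>x. f x + g x)"
proof -
  have [measurable]: "f \<in> borel_measurable borel" "g \<in> borel_measurable borel"
    using assms by (auto simp: sq_int_def)
  have i: "set_integrable lborel {0..1} (\<lambda>x. 2 * (cmod (f x))\<^sup>2 + 2 * (cmod (g x))\<^sup>2)"
    using assms by (intro set_integral_add set_integrable_mult_right) (auto simp: sq_int_def)
  have "set_integrable lborel {0..1} (\<lambda>x. (cmod (f x + g x))\<^sup>2)"
    unfolding set_integrable_def
  proof (rule Bochner_Integration.integrable_bound[OF i[unfolded set_integrable_def]])
    have "(cmod (f x + g x))\<^sup>2 \<le> 2 * (cmod (f x))\<^sup>2 + 2 * (cmod (g x))\<^sup>2" for x
    proof -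
      have "(cmod (f x + g x))\<^sup>2 \<le> (cmod (f x) + cmod (g x))\<^sup>2"
        by (intro power_mono norm_triangle_ineq) simp
      then show ?thesis
        using sum_squares_bound[of "cmod (f x)" "cmod (g x)"] by (simp add: power2_sum)
    qed
    then show "AE x in lborel. norm (indicat_real {0..1} x *\<^sub>R (cmod (f x + g x))\<^sup>2)
        \<le> norm (indicat_real {0..1} x *\<^sub>R (2 * (cmod (f x))\<^sup>2 + 2 * (cmod (g x))\<^sup>2))"
      by (auto simp: indicator_def)
  qed measurable
  then show ?thesis using assms by (auto simp: sq_int_def periodic1_def)
qed

lemma sq_int_cmul:
  assumes "sq_int f"
  shows "sq_int (\<lambda>x. c * f x)"
proof -
  have "set_integrable lborel {0..1} (\<lambda>x. (cmod c)\<^sup>2 * (cmod (f x))\<^sup>2)"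
    using assms by (intro set_integrable_mult_right) (auto simp: sq_int_def)
  then show ?thesis
    using assms by (auto simp: sq_int_def periodic1_def norm_mult power_mult_distrib)
qed

lemma sq_int_zero: "sq_int (\<lambda>x. 0)"
  by (auto simp: sq_int_def periodic1_def set_integrable_def)

lemma AE_zero_periodic1:
  fixes f :: "real \<Rightarrow> complex"
  assumes [measurable]: "f \<in> borel_measurable borel"
    and p: "periodic1 f" and ae: "AE x in lborel. x \<in> {0..1} \<longrightarrow> f x = 0"
  shows "AE x in lborel. f x = 0"
proof -
  have shift: "f (x + of_int n) = f x" for x n
  proof -
    have nat_shift: "f (y + of_nat m) = f y" for y m
    proof (induction m)
      case (Suc m)
      have "f (y + of_nat m + 1) = f (y + of_nat m)"
        using p by (simp add: periodic1_def)
      then show ?case using Suc by (simp add: algebra_simps)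
    qed simp
    show ?thesis
    proof (cases n)
      case (nonneg m) then show ?thesis using nat_shift[of x m] by simp
    next
      case (neg m)
      then show ?thesis using nat_shift[of "x + of_int n" "Suc m"] by simp
    qed
  qed
  have "AE x in lborel. real_of_int n + x \<in> {0..1} \<longrightarrow> f (real_of_int n + x) = 0" for n
  proof -
    have "AE x in distr lborel borel ((+) (real_of_int n)). x \<in> {0..1} \<longrightarrow> f x = 0"
      using ae by (subst lborel_distr_plus) (auto simp: lborel_distr_plus)
    then show ?thesis by (subst (asm) AE_distr_iff) auto
  qed
  then have "AE x in lborel. \<forall>n. real_of_int n + x \<in> {0..1} \<longrightarrow> f (real_of_int n + x) = 0"
    by (subst AE_all_countable) auto
  then show ?thesis
  proof (eventually_elim)
    case (elim x)
    have "real_of_int (- \<lfloor>x\<rfloor>) + x \<in> {0..1}"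
      using floor_correct[of x] by (auto, linarith)
    then show ?case using elim shift[of x "- \<lfloor>x\<rfloor>"] by (metis add.commute)
  qed
qed

quotient_type l2 = "real \<Rightarrow> complex" / partial:
  "\<lambda>f g. sq_int f \<and> sq_int g \<and> (AE x in lborel. f x = g x)"
proof (rule part_equivpI)
  show "\<exists>f. sq_int f \<and> sq_int f \<and> (AE x in lborel. f x = f x)"
    using sq_int_zero by auto
  show "symp (\<lambda>f g. sq_int f \<and> sq_int g \<and> (AE x in lborel. f x = g x))"
    by (auto simp: symp_def eq_commute)
  show "transp (\<lambda>f g. sq_int f \<and> sq_int g \<and> (AE x in lborel. f x = g x))"
    by (auto simp: transp_def elim: eventually_elim2)
qed

lift_definition cmul_l2 :: "complex \<Rightarrow> l2 \<Rightarrow> l2" is "\<lambda>c f x. c * f x"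
  by (auto intro: sq_int_cmul)

lemma set_lint_cong_AE':
  fixes f g :: "real \<Rightarrow> complex"
  assumes "f \<in> borel_measurable borel" "g \<in> borel_measurable borel" "AE x in lborel. f x = g x"
  shows "(LINT x:{0..1}|lborel. f x) = (LINT x:{0..1}|lborel. g x)"
  unfolding set_lebesgue_integral_def
  using assms by (intro integral_cong_AE) auto

instantiation l2 :: real_inner
begin

lift_definition zero_l2 :: l2 is "\<lambda>x. 0" by (simp add: sq_int_zero)
lift_definition plus_l2 :: "l2 \<Rightarrow> l2 \<Rightarrow> l2" is "\<lambda>f g x. f x + g x"
  by (auto intro: sq_int_add elim: eventually_elim2)
lift_definition uminus_l2 :: "l2 \<Rightarrow> l2" is "\<lambda>f x. - f x"
  using sq_int_cmul[of _ "-1"] by auto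
definition minus_l2 :: "l2 \<Rightarrow> l2 \<Rightarrow> l2" where "minus_l2 f g = f + (- g)"
definition scaleR_l2 :: "real \<Rightarrow> l2 \<Rightarrow> l2" where "scaleR_l2 r f = cmul_l2 (of_real r) f"
lift_definition inner_l2 :: "l2 \<Rightarrow> l2 \<Rightarrow> real" is
  "\<lambda>f g. Re (LINT x:{0..1}|lborel. cnj (f x) * g x)"
proof -
  fix f f' g g' :: "real \<Rightarrow> complex"
  assume "sq_int f \<and> sq_int f' \<and> (AE x in lborel. f x = f' x)"
    and "sq_int g \<and> sq_int g' \<and> (AE x in lborel. g x = g' x)"
  then show "Re (LINT x:{0..1}|lborel. cnj (f x) * g x) = Re (LINT x:{0..1}|lborel. cnj (f' x) * g' x)"
    by (intro arg_cong[where f = Re] set_lint_cong_AE')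
      (auto simp: sq_int_def elim: eventually_elim2)
qed
definition norm_l2 :: "l2 \<Rightarrow> real" where "norm_l2 f = sqrt (inner f f)"
definition sgn_l2 :: "l2 \<Rightarrow> l2" where "sgn_l2 f = scaleR (inverse (norm f)) f"
definition dist_l2 :: "l2 \<Rightarrow> l2 \<Rightarrow> real" where "dist_l2 f g = norm (f - g)"
definition uniformity_l2 :: "(l2 \<times> l2) filter" where
  "uniformity_l2 = (INF e\<in>{0<..}. principal {(x, y). dist x y < e})"
definition open_l2 :: "l2 set \<Rightarrow> bool" where
  "open_l2 U \<longleftrightarrow> (\<forall>x\<in>U. \<forall>\<^sub>F (x', y) in uniformity. x' = x \<longrightarrow> y \<in> U)"

instance
proof
  fix a b :: real and f g h :: l2
  show "f + g + h = f + (g + h)" by transfer (auto intro: sq_int_add simp: add.assoc)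
  show "f + g = g + f" by transfer (auto intro: sq_int_add simp: add.commute)
  show "0 + f = f" by transfer auto
  show "- f + f = 0" by transfer (auto intro: sq_int_zero)
  show "f - g = f + - g" by (rule minus_l2_def)
  show "a *\<^sub>R (f + g) = a *\<^sub>R f + a *\<^sub>R g"
    unfolding scaleR_l2_def
    by transfer (auto intro: sq_int_add sq_int_cmul simp: distrib_left)
  show "(a + b) *\<^sub>R f = a *\<^sub>R f + b *\<^sub>R f"
    unfolding scaleR_l2_def
    by transfer (auto intro: sq_int_add sq_int_cmul simp: distrib_right)
  show "a *\<^sub>R b *\<^sub>R f = (a * b) *\<^sub>R f"
    unfolding scaleR_l2_def
    by transfer (auto intro: sq_int_cmul simp: mult.assoc)
  show "1 *\<^sub>R f = f" unfolding scaleR_l2_def by transfer auto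
  show "dist f g = norm (f - g)" by (rule dist_l2_def)
  show "sgn f = scaleR (inverse (norm f)) f" by (rule sgn_l2_def)
  show "uniformity = (INF e\<in>{0<..}. principal {(x, y). dist (x::l2) y < e})"
    by (rule uniformity_l2_def)
  show "open U \<longleftrightarrow> (\<forall>x\<in>U. \<forall>\<^sub>F (x', y) in uniformity. x' = x \<longrightarrow> y \<in> U)" for U :: "l2 set"
    by (rule open_l2_def)
  show "inner f g = inner g f"
  proof transfer
    fix f g :: "real \<Rightarrow> complex"
    assume "sq_int f \<and> sq_int f \<and> (AE x in lborel. f x = f x)"
      and "sq_int g \<and> sq_int g \<and> (AE x in lborel. g x = g x)"
    then have i: "set_integrable lborel {0..1} (\<lambda>x. cnj (f x) * g x)"
      "set_integrable lborel {0..1} (\<lambda>x. cnj (g x) * f x)"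
      by (auto intro: sq_int_prod)
    have "Re (LINT x:{0..1}|lborel. cnj (f x) * g x) = (LINT x:{0..1}|lborel. Re (cnj (f x) * g x))"
      using i unfolding set_lebesgue_integral_def set_integrable_def
      by (subst integral_Re[symmetric]) auto
    also have "\<dots> = (LINT x:{0..1}|lborel. Re (cnj (g x) * f x))"
      by (simp add: mult.commute)
    also have "\<dots> = Re (LINT x:{0..1}|lborel. cnj (g x) * f x)"
      using i unfolding set_lebesgue_integral_def set_integrable_def
      by (subst integral_Re[symmetric]) auto
    finally show "Re (LINT x:{0..1}|lborel. cnj (f x) * g x)
      = Re (LINT x:{0..1}|lborel. cnj (g x) * f x)" .
  qed
  show "inner (f + g) h = inner f h + inner g h"
  proof transfer
    fix f g h :: "real \<Rightarrow> complex"
    assume "sq_int f \<and> sq_int f \<and> (AE x in lborel. f x = f x)"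
      and "sq_int g \<and> sq_int g \<and> (AE x in lborel. g x = g x)"
      and "sq_int h \<and> sq_int h \<and> (AE x in lborel. h x = h x)"
    then show "Re (LINT x:{0..1}|lborel. cnj (f x + g x) * h x) =
       Re (LINT x:{0..1}|lborel. cnj (f x) * h x) + Re (LINT x:{0..1}|lborel. cnj (g x) * h x)"
      by (simp add: distrib_right sq_int_prod set_integral_add)
  qed
  show "inner (a *\<^sub>R f) g = a * inner f g"
    unfolding scaleR_l2_def by transfer (simp add: mult.assoc)
  have re: "Re (LINT x:{0..1}|lborel. cnj (f x) * f x) = (LINT x:{0..1}|lborel. (cmod (f x))\<^sup>2)"
    if "sq_int f" for f
  proof -
    have "(LINT x:{0..1}|lborel. cnj (f x) * f x)
        = (LINT x:{0..1}|lborel. complex_of_real ((cmod (f x))\<^sup>2))"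
      by (simp only: complex_norm_square mult.commute)
    then show ?thesis
      by (simp add: set_integral_complex_of_real flip: of_real_power)
  qed
  show "0 \<le> inner f f"
    by transfer (subst re, simp, simp add: set_lebesgue_integral_def)
  show "(inner f f = 0) = (f = 0)"
  proof transfer
    fix f :: "real \<Rightarrow> complex"
    assume "sq_int f \<and> sq_int f \<and> (AE x in lborel. f x = f x)"
    then have f: "sq_int f" by simp
    then have "(LINT x:{0..1}|lborel. (cmod (f x))\<^sup>2) = 0 \<longleftrightarrow>
        (AE x in lborel. x \<in> {0..1} \<longrightarrow> f x = 0)"
      unfolding set_lebesgue_integral_def
      by (subst integral_nonneg_eq_0_iff_AE)
        (auto simp: sq_int_def set_integrable_def indicator_def intro!: AE_cong)
    also have "\<dots> \<longleftrightarrow> (AE x in lborel. f x = 0)"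
      using f AE_zero_periodic1[of f] unfolding sq_int_def
      by (metis (mono_tags, lifting) eventually_mono)
    finally show "(Re (LINT x:{0..1}|lborel. cnj (f x) * f x) = 0) =
       (sq_int f \<and> sq_int (\<lambda>x. 0) \<and> (AE x in lborel. f x = 0))"
      using f by (simp add: re sq_int_zero)
  qed
  show "norm f = sqrt (inner f f)" by (rule norm_l2_def)
qed

end

text \<open>
  The products below do not depend on the chosen representatives. They are used for bounded
  measurable $1$-periodic \<open>c\<close> only; otherwise \<open>abs_l2\<close> may be applied outside $L^2$.
\<close>

definition mul_l2 :: "(real \<Rightarrow> real) \<Rightarrow> l2 \<Rightarrow> l2" where
  "mul_l2 c f = abs_l2 (\<lambda>x. of_real (c x) * rep_l2 f x)"

lemma smooth_on_continuous:
  assumes "smooth_on UNIV f"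
  shows "continuous_on UNIV f" "continuous_on UNIV (\<lambda>x. vector_derivative f (at x))"
proof -
  have "\<forall>x. f differentiable (at x)" "\<forall>x. (\<lambda>x. vector_derivative f (at x)) differentiable (at x)"
    using assms[unfolded smooth_on_def, rule_format, of _ 0]
      assms[unfolded smooth_on_def, rule_format, of _ 1] by auto
  then show "continuous_on UNIV f" "continuous_on UNIV (\<lambda>x. vector_derivative f (at x))"
    by (auto intro!: continuous_at_imp_continuous_on differentiable_imp_continuous_within)
qed

lemma smooth_on_measurable:
  assumes "smooth_on UNIV f"
  shows "f \<in> borel_measurable borel" "(\<lambda>x. vector_derivative f (at x)) \<in> borel_measurable borel"
  using smooth_on_continuous[OF assms] by (auto intro: borel_measurable_continuous_onI)

lemma sq_int_times_continuous:
  assumes f: "sq_int f" and c: "continuous_on UNIV c"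
  shows "set_integrable lborel {0..1} (\<lambda>x. f x * c x)"
proof -
  have [measurable]: "f \<in> borel_measurable borel" "c \<in> borel_measurable borel"
    using assms by (auto simp: sq_int_def intro: borel_measurable_continuous_onI)
  have "set_integrable lborel {0..1} (\<lambda>x. (cmod (c x))\<^sup>2)"
    unfolding set_integrable_def
    by (rule borel_integrable_compact)
      (auto intro!: continuous_intros continuous_on_subset[OF c])
  then have i: "set_integrable lborel {0..1} (\<lambda>x. (cmod (f x))\<^sup>2 + (cmod (c x))\<^sup>2)"
    using f by (intro set_integral_add) (auto simp: sq_int_def)
  show ?thesis
    unfolding set_integrable_def
  proof (rule Bochner_Integration.integrable_bound[OF i[unfolded set_integrable_def]])
    have "cmod (f x) * cmod (c x) \<le> (cmod (f x))\<^sup>2 + (cmod (c x))\<^sup>2" for x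
    proof -
      have "2 * (cmod (f x) * cmod (c x)) \<le> (cmod (f x))\<^sup>2 + (cmod (c x))\<^sup>2"
        using sum_squares_bound[of "cmod (f x)" "cmod (c x)"] by (simp add: mult.assoc)
      moreover have "0 \<le> cmod (f x) * cmod (c x)" by simp
      ultimately show ?thesis by linarith
    qed
    then show "AE x in lborel. norm (indicat_real {0..1} x *\<^sub>R (f x * c x))
        \<le> norm (indicat_real {0..1} x *\<^sub>R ((cmod (f x))\<^sup>2 + (cmod (c x))\<^sup>2))"
      by (auto simp: indicator_def norm_mult)
  qed measurable
qed

lift_definition weak_deriv :: "l2 \<Rightarrow> l2 \<Rightarrow> bool" is
  "\<lambda>f g. \<forall>\<phi>. smooth_on UNIV \<phi> \<and> periodic1 \<phi> \<longrightarrow>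
     (LINT x:{0..1}|lborel. f x * vector_derivative \<phi> (at x)) =
     - (LINT x:{0..1}|lborel. g x * \<phi> x)"
proof (intro all_cong arg_cong2[where f = "(=)"] arg_cong[where f = uminus])
  fix f f' g g' :: "real \<Rightarrow> complex" and \<phi> :: "real \<Rightarrow> complex"
  assume 1: "sq_int f \<and> sq_int f' \<and> (AE x in lborel. f x = f' x)"
    and 2: "sq_int g \<and> sq_int g' \<and> (AE x in lborel. g x = g' x)"
    and "smooth_on UNIV \<phi> \<and> periodic1 \<phi>"
  then have \<phi>: "smooth_on UNIV \<phi>" by simp
  note [measurable] = smooth_on_measurable[OF \<phi>]
  show "(LINT x:{0..1}|lborel. f x * vector_derivative \<phi> (at x)) =
        (LINT x:{0..1}|lborel. f' x * vector_derivative \<phi> (at x))"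
    using 1 by (intro set_lint_cong_AE') (auto simp: sq_int_def elim: eventually_mono)
  show "(LINT x:{0..1}|lborel. g x * \<phi> x) = (LINT x:{0..1}|lborel. g' x * \<phi> x)"
    using 2 by (intro set_lint_cong_AE') (auto simp: sq_int_def elim: eventually_mono)
qed

lemma weak_deriv_zero: "weak_deriv 0 0"
  by transfer (auto simp: sq_int_zero)

lemma weak_deriv_add: "weak_deriv f g \<Longrightarrow> weak_deriv f' g' \<Longrightarrow> weak_deriv (f + f') (g + g')"
proof (transfer, intro allI impI)
  fix f g f' g' \<phi> :: "real \<Rightarrow> complex"
  assume s: "sq_int f \<and> sq_int f \<and> (AE x in lborel. f x = f x)"
      "sq_int g \<and> sq_int g \<and> (AE x in lborel. g x = g x)"
      "sq_int f' \<and> sq_int f' \<and> (AE x in lborel. f' x = f' x)"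
      "sq_int g' \<and> sq_int g' \<and> (AE x in lborel. g' x = g' x)"
    and w: "\<forall>\<phi>. smooth_on UNIV \<phi> \<and> periodic1 \<phi> \<longrightarrow>
        (LINT x:{0..1}|lborel. f x * vector_derivative \<phi> (at x)) = - (LINT x:{0..1}|lborel. g x * \<phi> x)"
      "\<forall>\<phi>. smooth_on UNIV \<phi> \<and> periodic1 \<phi> \<longrightarrow>
        (LINT x:{0..1}|lborel. f' x * vector_derivative \<phi> (at x)) = - (LINT x:{0..1}|lborel. g' x * \<phi> x)"
    and \<phi>: "smooth_on UNIV \<phi> \<and> periodic1 \<phi>"
  show "(LINT x:{0..1}|lborel. (f x + f' x) * vector_derivative \<phi> (at x)) =
      - (LINT x:{0..1}|lborel. (g x + g' x) * \<phi> x)"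
    using s w[rule_format, OF \<phi>] \<phi>
    by (simp add: distrib_right set_integral_add sq_int_times_continuous smooth_on_continuous)
qed

lemma weak_deriv_cmul: "weak_deriv f g \<Longrightarrow> weak_deriv (cmul_l2 c f) (cmul_l2 c g)"
  by transfer (simp add: mult.assoc)

text \<open>
  A function in $H^1$ is stored together with its weak derivative (which it determines), so that
  the inner product inherited from $L^2\times L^2$ is the usual one of $H^1$.
\<close>

typedef h1 = "{(f :: l2, g :: l2). weak_deriv f g}"
  using weak_deriv_zero by blast

lifting_forget l2.lifting
setup_lifting type_definition_h1

lift_definition h1_fun :: "h1 \<Rightarrow> l2" is fst .

lift_definition cmul_h1 :: "complex \<Rightarrow> h1 \<Rightarrow> h1" is "\<lambda>c (f, g). (cmul_l2 c f, cmul_l2 c g)"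
  by (auto intro: weak_deriv_cmul)

instantiation h1 :: real_inner
begin

lift_definition zero_h1 :: h1 is 0 by (simp add: zero_prod_def weak_deriv_zero)
lift_definition plus_h1 :: "h1 \<Rightarrow> h1 \<Rightarrow> h1" is "(+)" by (auto intro: weak_deriv_add)
lift_definition scaleR_h1 :: "real \<Rightarrow> h1 \<Rightarrow> h1" is scaleR
  by (auto simp: scaleR_l2_def intro: weak_deriv_cmul)
definition uminus_h1 :: "h1 \<Rightarrow> h1" where "uminus_h1 f = scaleR (-1) f"
definition minus_h1 :: "h1 \<Rightarrow> h1 \<Rightarrow> h1" where "minus_h1 f g = f + (- g)"
lift_definition inner_h1 :: "h1 \<Rightarrow> h1 \<Rightarrow> real" is inner .
definition norm_h1 :: "h1 \<Rightarrow> real" where "norm_h1 f = sqrt (inner f f)"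
definition sgn_h1 :: "h1 \<Rightarrow> h1" where "sgn_h1 f = scaleR (inverse (norm f)) f"
definition dist_h1 :: "h1 \<Rightarrow> h1 \<Rightarrow> real" where "dist_h1 f g = norm (f - g)"
definition uniformity_h1 :: "(h1 \<times> h1) filter" where
  "uniformity_h1 = (INF e\<in>{0<..}. principal {(x, y). dist x y < e})"
definition open_h1 :: "h1 set \<Rightarrow> bool" where
  "open_h1 U \<longleftrightarrow> (\<forall>x\<in>U. \<forall>\<^sub>F (x', y) in uniformity. x' = x \<longrightarrow> y \<in> U)"

instance
proof
  fix a b :: real and f g h :: h1
  show "f + g + h = f + (g + h)" by transfer (auto simp: add.assoc)
  show "f + g = g + f" by transfer (auto simp: add.commute)
  show "0 + f = f" by transfer auto
  show "- f + f = 0" unfolding uminus_h1_def by transfer auto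
  show "f - g = f + - g" by (rule minus_h1_def)
  show "a *\<^sub>R (f + g) = a *\<^sub>R f + a *\<^sub>R g" by transfer (auto simp: scaleR_add_right)
  show "(a + b) *\<^sub>R f = a *\<^sub>R f + b *\<^sub>R f" by transfer (auto simp: scaleR_add_left)
  show "a *\<^sub>R b *\<^sub>R f = (a * b) *\<^sub>R f" by transfer auto
  show "1 *\<^sub>R f = f" by transfer auto
  show "dist f g = norm (f - g)" by (rule dist_h1_def)
  show "sgn f = scaleR (inverse (norm f)) f" by (rule sgn_h1_def)
  show "uniformity = (INF e\<in>{0<..}. principal {(x, y). dist (x::h1) y < e})"
    by (rule uniformity_h1_def)
  show "open U \<longleftrightarrow> (\<forall>x\<in>U. \<forall>\<^sub>F (x', y) in uniformity. x' = x \<longrightarrow> y \<in> U)" for U :: "h1 set"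
    by (rule open_h1_def)
  show "inner f g = inner g f" by transfer (rule inner_commute)
  show "inner (f + g) h = inner f h + inner g h" by transfer (rule inner_add_left)
  show "inner (a *\<^sub>R f) g = a * inner f g" by transfer (rule inner_scaleR_left)
  show "0 \<le> inner f f" by transfer (rule inner_ge_zero)
  show "(inner f f = 0) = (f = 0)" by transfer (rule inner_eq_zero_iff)
  show "norm f = sqrt (inner f f)" by (rule norm_h1_def)
qed

end

text \<open>\<open>dx\<close> and \<open>to_h1\<close> are unspecified outside $H^1$.\<close>

definition in_H1 :: "l2 \<Rightarrow> bool" where
  "in_H1 f \<longleftrightarrow> (\<exists>g. weak_deriv f g)"

definition dx :: "l2 \<Rightarrow> l2" where
  "dx f = (THE g. weak_deriv f g)"

definition in_H2 :: "l2 \<Rightarrow> bool" where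
  "in_H2 f \<longleftrightarrow> in_H1 f \<and> in_H1 (dx f)"

definition to_h1 :: "l2 \<Rightarrow> h1" where
  "to_h1 f = (THE w. h1_fun w = f)"

type_synonym state = "h1 \<times> l2"

definition cmul_state :: "complex \<Rightarrow> state \<Rightarrow> state" where
  "cmul_state c w = (cmul_h1 c (fst w), cmul_l2 c (snd w))"

definition cmul_op :: "complex \<Rightarrow> state \<Rightarrow>\<^sub>L state" where
  "cmul_op c = Blinfun (cmul_state c)"

definition of_fun :: "(real \<Rightarrow> complex^2) \<Rightarrow> state" where
  "of_fun f = (to_h1 (abs_l2 (\<lambda>x. f x $ 1)), abs_l2 (\<lambda>x. f x $ 2))"

definition to_fun :: "state \<Rightarrow> real \<Rightarrow> complex^2" where
  "to_fun w x = vector [rep_l2 (h1_fun (fst w)) x, rep_l2 (snd w) x]"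

definition mode :: "int \<Rightarrow> complex^2 \<Rightarrow> state" where
  "mode m X = of_fun (\<lambda>x. exp (2 * pi * \<i> * of_int m * x) *s X)"

definition coef :: "(state \<Rightarrow> state) \<Rightarrow> int \<Rightarrow> int \<Rightarrow> complex^2 \<Rightarrow> complex^2" where
  "coef M m p X =
     (LINT x:{0..1}|lborel. exp (- 2 * pi * \<i> * of_int (m + p) * x) *s to_fun (M (mode m X)) x)"

definition cdot :: "complex^2 \<Rightarrow> complex^2 \<Rightarrow> complex" where
  "cdot X Y = (\<Sum>i\<in>UNIV. cnj (X $ i) * Y $ i)"

definition J :: "complex^2^2" where
  "J = vector [vector [0, -1], vector [1, 0]]"

text \<open>The parameter $\delta$ ranges over $\delta\ge 0$: derivatives in $\delta$ at $0$ are right derivatives.\<close>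

definition ddelta :: "(real \<Rightarrow> 'a::real_normed_vector) \<Rightarrow> real \<Rightarrow> 'a" where
  "ddelta f \<delta> = vector_derivative f (at \<delta> within {0..})"

text \<open>
  The members of this locale are functions of arbitrary data; the equations that tie
  \<open>F\<close>, \<open>Wd\<close> (for $\mathcal{W}^\dagger(\cdot;V)$) and \<open>E\<close> (with \<open>E \<delta>\<close> the wave profile
  $\underline{E}^{(\delta,V)}$) to \<open>P\<close> and \<open>V\<close> are left to the theorems about them.
\<close>

locale wave_data =
  fixes P F Wd :: "real \<Rightarrow> real" and V :: real and E :: "real \<Rightarrow> real \<Rightarrow> real"
begin

definition h :: "real \<Rightarrow> real" where
  "h \<rho> = V\<^sup>2 / \<rho> ^ 3 - deriv (deriv F) \<rho>"

definition k :: "real \<Rightarrow> real" where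
  "k \<delta> = 1 / (sqrt (h 1) * integral {-pi..pi} (\<lambda>\<theta>. 1 / Wd (\<delta> * cos \<theta>)))"

definition rho :: "real \<Rightarrow> real \<Rightarrow> real" where
  "rho \<delta> x = 1 + k \<delta> * deriv (E \<delta>) x"

definition u :: "real \<Rightarrow> real \<Rightarrow> real" where
  "u \<delta> x = V * (k \<delta> * deriv (E \<delta>) x) / rho \<delta> x"

definition D :: "real \<Rightarrow> real \<Rightarrow> l2 \<Rightarrow> l2" where
  "D \<xi> \<delta> f = k \<delta> *\<^sub>R (dx f + cmul_l2 (\<i> * \<xi>) f)"

definition dom :: "state set" where
  "dom = {w. in_H2 (h1_fun (fst w)) \<and> in_H1 (snd w)}"

text \<open>The following expression is meaningful for arguments in \<^term>\<open>dom\<close> only.\<close>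

definition L :: "real \<Rightarrow> real \<Rightarrow> state \<Rightarrow> state" where
  "L \<xi> \<delta> w = (let e = h1_fun (fst w); v = snd w in
     (to_h1 (mul_l2 (\<lambda>x. V - u \<delta> x) (D \<xi> \<delta> e) - mul_l2 (rho \<delta>) v),
      e
      - mul_l2 (\<lambda>x. (deriv ^^ 2) F (rho \<delta> x)) (D \<xi> \<delta> (D \<xi> \<delta> e))
      - mul_l2 (\<lambda>x. (deriv ^^ 3) F (rho \<delta> x) * (k \<delta>)\<^sup>2 * (deriv ^^ 2) (E \<delta>) x) (D \<xi> \<delta> e)
      + mul_l2 (\<lambda>x. V - u \<delta> x) (D \<xi> \<delta> v)
      - mul_l2 (\<lambda>x. k \<delta> * deriv (u \<delta>) x) v))"

definition A :: "real \<Rightarrow> real \<Rightarrow> state \<Rightarrow> real \<Rightarrow> complex^2" where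
  "A \<xi> \<delta> w x = matrix_inv J *v to_fun (L \<xi> \<delta> w) x"

definition resolvent :: "real \<Rightarrow> real \<Rightarrow> complex \<Rightarrow> state \<Rightarrow>\<^sub>L state" where
  "resolvent \<xi> \<delta> \<mu> = Blinfun (\<lambda>f. THE w. w \<in> dom \<and> cmul_state \<mu> w - L \<xi> \<delta> w = f)"

definition k0 :: real where "k0 = k 0"

definition omega :: "int \<Rightarrow> real \<Rightarrow> real" where
  "omega m \<xi> = sqrt (1 + deriv P 1 * k0\<^sup>2 * (2 * pi * m + \<xi>)\<^sup>2)"

definition lambda_minus :: "int \<Rightarrow> real \<Rightarrow> complex" where
  "lambda_minus m \<xi> = \<i> * of_real (V * k0 * (2 * pi * m + \<xi>) - omega m \<xi>)"

definition lambda_plus :: "int \<Rightarrow> real \<Rightarrow> complex" where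
  "lambda_plus m \<xi> = \<i> * of_real (V * k0 * (2 * pi * m + \<xi>) + omega m \<xi>)"

definition z :: real where "z = 1/2 * (4 + sqrt 5 * V / sqrt (deriv P 1))"
definition j :: int where "j = \<lfloor>z\<rfloor>"
definition j' :: int where "j' = j - 3"
definition xi0 :: real where "xi0 = 2 * pi * ((z - \<lfloor>z\<rfloor>) - 1/2)"
definition lambda0 :: complex where "lambda0 = lambda_minus j xi0"  \<comment> \<open>equals \<open>lambda_plus j' xi0\<close>\<close>

definition V_plus :: "complex^2" where "V_plus = vector [1, - \<i> * of_real (omega j' xi0)]"
definition V_minus :: "complex^2" where "V_minus = vector [1, \<i> * of_real (omega j xi0)]"

text \<open>The contour integral is written out as in \<^const>\<open>has_contour_integral\<close>, which is
  restricted to complex-valued integrands.\<close>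

definition Proj :: "real \<Rightarrow> real \<Rightarrow> state \<Rightarrow>\<^sub>L state" where
  "Proj \<epsilon> \<delta> = cmul_op (1 / (2 * \<i> * pi)) o\<^sub>L
     integral {0..1} (\<lambda>t. cmul_op (vector_derivative (circlepath lambda0 \<epsilon>) (at t within {0..1}))
       o\<^sub>L resolvent xi0 \<delta> (circlepath lambda0 \<epsilon> t))"

definition kato_flow :: "real \<Rightarrow> (real \<Rightarrow> state \<Rightarrow>\<^sub>L state) \<Rightarrow> bool" where
  "kato_flow \<epsilon> U \<longleftrightarrow> U 0 = id_blinfun \<and>
     (\<forall>\<delta>\<in>{0..\<epsilon>}. let Pr = Proj \<epsilon> \<delta>; Pr' = vector_derivative (Proj \<epsilon>) (at \<delta> within {0..\<epsilon>}) in
        (U has_vector_derivative ((Pr' o\<^sub>L Pr) - (Pr o\<^sub>L Pr')) o\<^sub>L U \<delta>) (at \<delta> within {0..\<epsilon>}))"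

definition a :: "(real \<Rightarrow> state \<Rightarrow>\<^sub>L state) \<Rightarrow> real \<Rightarrow> complex" where
  "a U \<delta> = (let q_plus = U \<delta> (mode j' V_plus); q_minus = U \<delta> (mode j V_minus) in
     LINT x:{0..1}|lborel. cdot (to_fun q_plus x) (A xi0 \<delta> q_minus x))"

definition Gamma :: "(real \<Rightarrow> state \<Rightarrow>\<^sub>L state) \<Rightarrow> complex" where
  "Gamma U = 1/6 * (ddelta ^^ 3) (a U) 0"

definition L_taylor :: "nat \<Rightarrow> state \<Rightarrow> state" where
  "L_taylor m w = (1 / fact m) *\<^sub>R (ddelta ^^ m) (\<lambda>\<delta>. L xi0 \<delta> w) 0"

definition Sigma0 :: "complex \<Rightarrow> complex^2^2" where
  "Sigma0 \<zeta> =
    vector [vector [of_real V * \<zeta>, -1],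
      vector [1 - of_real (deriv (deriv F) 1) * \<zeta>\<^sup>2, of_real V * \<zeta>]]"

definition G :: "int \<Rightarrow> complex^2^2" where
  "G m = matrix_inv (mat lambda0 - Sigma0 (\<i> * k0 * (2 * pi * m + xi0)))"

definition N :: "complex^2 \<Rightarrow> complex^2" where
  "N X = coef (L_taylor 3) j (-3) X
     + coef (L_taylor 1) (j - 2) (-1) (G (j - 2) *v coef (L_taylor 2) j (-2) X)
     + coef (L_taylor 2) (j - 1) (-2) (G (j - 1) *v coef (L_taylor 1) j (-1) X)
     + coef (L_taylor 1) (j - 2) (-1) (G (j - 2) *v
         coef (L_taylor 1) (j - 1) (-1) (G (j - 1) *v coef (L_taylor 1) j (-1) X))"

end

end

theory Submission
  imports Defs
begin

text \<open>
  The spectral projections commute with \<open>L\<close> and are intertwined by the flow \<open>U\<close>, and \<open>L\<close> is skew for the symplectic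
  form \<open>om\<close>, so the flow preserves \<open>om\<close>. Hence, with $q_\pm$ the transported vectors, \<open>a\<close> equals
  $\lambda_0\,\mathrm{om}(q_+, q_-)$, which is constant, plus $\mathrm{om}(q_+, r)$ with
  $r = (L - \lambda_0) q_-$ in the range of the projection. The coefficient of $\delta^m$ in \<open>L\<close> is a trigonometric
  polynomial of degree at most $m$ and of the parity of $m$ for $m = 1, 2$, while the resonant modes
  differ by three: \<open>r\<close> vanishes to second order, and the third derivative of \<open>a\<close> is
  the pairing of $q_+$ with the third-order term of the formal expansion of $r$, which is
  solved mode by mode with the symbols \<open>G\<close>. The profiles are explicit up to the inversion of
  $\theta \mapsto \int_0^\theta d s / \mathcal{W}^\dagger(\delta\cos s)$, which makes
  all coefficients smooth in $(\delta, x)$ and yields their jets at $\delta = 0$.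
\<close>

subsection \<open>The space of square-integrable periodic functions\<close>

text \<open>The distance three comes from sqrt 5 in \<open>z\<close>: it makes the determinant of
  the symbol at \<open>lambda0\<close> equal to -(n - j)(n - j + 3), so exactly the modes j and j -
  3 are resonant. Besides intertwining and preserving \<open>om\<close>, the flow contributes one
  fact: at amplitude 0 its generator maps the range of the projection into the kernel. This removes
  the term with the first derivative of q_+ from the third derivative of the pairing, and it fixes
  the kernel part of the first-order corrector of q_-. The second-order corrector is ambiguous in
  the resonant modes, but the last application of the first-order part of L, which reaches mode j -
  3 from j - 2 and j - 4, does not see them. The wave is prescribed for nonnegative amplitude; the
  explicit profiles extend to both signs, so that two-variable calculus works on an open strip, and
  uniqueness for the profile equation identifies them with \<open>E\<close> on the half-interval
  where the operators are compared.\<close>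

definition cip :: "l2 \<Rightarrow> l2 \<Rightarrow> complex" where
  "cip f g = (LINT x:{0..1}|lborel. cnj (rep_l2 f x) * rep_l2 g x)"

lemma sq_int_rep: "sq_int (rep_l2 f)"
  using Quotient3_rep_reflp[OF Quotient3_l2, of f] by simp

lemma abs_rep_l2: "abs_l2 (rep_l2 f) = f"
  by (rule Quotient3_abs_rep[OF Quotient3_l2])

lemma rep_abs_l2: "sq_int \<phi> \<Longrightarrow> AE x in lborel. rep_l2 (abs_l2 \<phi>) x = \<phi> x"
  using rep_abs_rsp_left[OF Quotient3_l2, of \<phi> \<phi>] by simp

lemma abs_l2_eqI: "sq_int \<phi> \<Longrightarrow> sq_int \<psi> \<Longrightarrow> AE x in lborel. \<phi> x = \<psi> x \<Longrightarrow> abs_l2 \<phi> = abs_l2 \<psi>"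
  using Quotient3_rel_abs[OF Quotient3_l2, of \<phi> \<psi>] by simp

lemma rep_l2_measurable [measurable]: "rep_l2 f \<in> borel_measurable borel"
  using sq_int_rep[of f] by (simp add: sq_int_def)

lemma l2_eqI:
  assumes "AE x in lborel. rep_l2 f x = rep_l2 g x"
  shows "f = g"
  using abs_l2_eqI[OF sq_int_rep sq_int_rep assms] by (simp add: abs_rep_l2)

lemma rep_add_l2: "AE x in lborel. rep_l2 (f + g) x = rep_l2 f x + rep_l2 g x"
proof -
  have "f + g = abs_l2 (\<lambda>x. rep_l2 f x + rep_l2 g x)" by (simp add: plus_l2_def)
  then show ?thesis using rep_abs_l2[OF sq_int_add[OF sq_int_rep sq_int_rep]] by simp
qed

lemma rep_cmul_l2: "AE x in lborel. rep_l2 (cmul_l2 c f) x = c * rep_l2 f x"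
proof -
  have "cmul_l2 c f = abs_l2 (\<lambda>x. c * rep_l2 f x)" by (simp add: cmul_l2_def)
  then show ?thesis using rep_abs_l2[OF sq_int_cmul[OF sq_int_rep]] by simp
qed

lemma scaleR_l2: "r *\<^sub>R f = cmul_l2 (of_real r) f" for f :: l2
  by (simp add: scaleR_l2_def)

lemma cip_abs:
  assumes "sq_int \<phi>" "sq_int \<psi>"
  shows "cip (abs_l2 \<phi>) (abs_l2 \<psi>) = (LINT x:{0..1}|lborel. cnj (\<phi> x) * \<psi> x)"
  unfolding cip_def
  using assms rep_abs_l2[OF assms(1)] rep_abs_l2[OF assms(2)]
  by (intro set_lint_cong_AE') (auto simp: sq_int_def)

lemma cip_abs_left:
  assumes "sq_int \<phi>"
  shows "cip (abs_l2 \<phi>) g = (LINT x:{0..1}|lborel. cnj (\<phi> x) * rep_l2 g x)"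
  using cip_abs[OF assms sq_int_rep, of g] by (simp add: abs_rep_l2)

lemma cip_abs_right:
  assumes "sq_int \<phi>"
  shows "cip g (abs_l2 \<phi>) = (LINT x:{0..1}|lborel. cnj (rep_l2 g x) * \<phi> x)"
  using cip_abs[OF sq_int_rep assms, of g] by (simp add: abs_rep_l2)

lemma cip_add_right: "cip f (g + h) = cip f g + cip f h"
proof -
  have "cip f (g + h) = (LINT x:{0..1}|lborel. cnj (rep_l2 f x) * (rep_l2 g x + rep_l2 h x))"
    unfolding cip_def using rep_add_l2[of g h] by (intro set_lint_cong_AE') auto
  then show ?thesis
    by (simp add: cip_def distrib_left set_integral_add sq_int_prod sq_int_rep)
qed

lemma cip_cmul_right: "cip f (cmul_l2 c g) = c * cip f g"
proof -
  have "cip f (cmul_l2 c g) = (LINT x:{0..1}|lborel. c * (cnj (rep_l2 f x) * rep_l2 g x))"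
    unfolding cip_def using rep_cmul_l2[of c g] by (intro set_lint_cong_AE') auto
  then show ?thesis by (simp add: cip_def)
qed

lemma cip_commute: "cip f g = cnj (cip g f)"
proof -
  have "cnj (cip g f) = (LINT x|lborel. cnj (indicat_real {0..1} x *\<^sub>R (cnj (rep_l2 g x) * rep_l2 f x)))"
    unfolding cip_def set_lebesgue_integral_def
    by (rule Bochner_Integration.integral_bounded_linear[OF bounded_linear_cnj, symmetric])
      (use sq_int_prod[OF sq_int_rep sq_int_rep, of g f] in \<open>simp add: set_integrable_def\<close>)
  then show ?thesis
    by (simp add: cip_def set_lebesgue_integral_def mult.commute del: integral_cnj)
qed

lemma cip_add_left: "cip (f + g) h = cip f h + cip g h"
  using cip_add_right[of h f g] by (metis cip_commute complex_cnj_add)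

lemma cip_cmul_left: "cip (cmul_l2 c f) g = cnj c * cip f g"
  using cip_cmul_right[of g c f] by (metis cip_commute complex_cnj_mult)

lemma inner_l2_eq: "inner f g = Re (cip f g)" for f g :: l2
  by (simp add: inner_l2_def cip_def)

lemma cip_scaleR_right: "cip f (r *\<^sub>R g) = r *\<^sub>R cip f g"
  by (simp add: scaleR_l2 cip_cmul_right scaleR_conv_of_real)

lemma cip_scaleR_left: "cip (r *\<^sub>R f) g = r *\<^sub>R cip f g"
  by (simp add: scaleR_l2 cip_cmul_left scaleR_conv_of_real)

lemma cip_self: "cip f f = of_real ((norm f)\<^sup>2)"
proof -
  have "Im (cip f f) = 0" using cip_commute[of f f] by (metis Reals_cnj_iff complex_is_Real_iff)
  moreover have "Re (cip f f) = (norm f)\<^sup>2"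
    using inner_l2_eq[of f f] by (simp add: power2_norm_eq_inner)
  ultimately show ?thesis by (simp add: complex_eq_iff)
qed

lemma norm_cmul_l2: "norm (cmul_l2 c f) = cmod c * norm f"
proof -
  have "complex_of_real ((norm (cmul_l2 c f))\<^sup>2) = (c * cnj c) * cip f f"
    by (simp only: cip_self[symmetric] cip_cmul_left cip_cmul_right mult_ac)
  also have "\<dots> = of_real ((cmod c * norm f)\<^sup>2)"
    by (simp only: cip_self complex_norm_square[symmetric] power_mult_distrib of_real_mult)
  finally have "(norm (cmul_l2 c f))\<^sup>2 = (cmod c * norm f)\<^sup>2"
    by (simp only: of_real_eq_iff)
  then show ?thesis by (simp add: power2_eq_iff_nonneg)
qed

text \<open>Rotating \<open>g\<close> by the unit scalar \<open>c\<close> makes the pairing real and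
  nonnegative, so that the Cauchy-Schwarz inequality of the real inner product applies.\<close>

lemma cip_norm_le: "cmod (cip f g) \<le> norm f * norm g"
proof (cases "cip f g = 0")
  case False
  define c where "c = cnj (cip f g) / cmod (cip f g)"
  have c: "cmod c = 1" using False by (simp add: c_def norm_divide)
  have "of_real (cmod (cip f g)) = c * cip f g"
    using False complex_norm_square[of "cip f g"]
    by (simp add: c_def field_simps power2_eq_square)
  then have "cmod (cip f g) = inner f (cmul_l2 c g)"
    by (metis Re_complex_of_real cip_cmul_right inner_l2_eq)
  also have "\<dots> \<le> norm f * norm (cmul_l2 c g)" by (rule norm_cauchy_schwarz)
  finally show ?thesis by (simp add: norm_cmul_l2 c)
qed simp

lemma bounded_bilinear_cip: "bounded_bilinear cip"
proof
  show "\<exists>K. \<forall>a b. norm (cip a b) \<le> norm a * norm b * K"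
    using cip_norm_le by (intro exI[of _ 1]) auto
qed (auto simp: cip_add_left cip_add_right cip_scaleR_left cip_scaleR_right)

interpretation cip: bounded_bilinear cip by (rule bounded_bilinear_cip)

lemma cmul_l2_add: "cmul_l2 c (f + g) = cmul_l2 c f + cmul_l2 c g"
proof (rule l2_eqI)
  show "AE x in lborel. rep_l2 (cmul_l2 c (f + g)) x = rep_l2 (cmul_l2 c f + cmul_l2 c g) x"
    using rep_cmul_l2[of c "f + g"] rep_cmul_l2[of c f] rep_cmul_l2[of c g] rep_add_l2[of f g]
      rep_add_l2[of "cmul_l2 c f" "cmul_l2 c g"]
    by eventually_elim (simp add: algebra_simps)
qed

lemma cmul_l2_mult: "cmul_l2 c (cmul_l2 d f) = cmul_l2 (c * d) f"
proof (rule l2_eqI)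
  show "AE x in lborel. rep_l2 (cmul_l2 c (cmul_l2 d f)) x = rep_l2 (cmul_l2 (c * d) f) x"
    using rep_cmul_l2[of c "cmul_l2 d f"] rep_cmul_l2[of d f] rep_cmul_l2[of "c * d" f]
    by eventually_elim simp
qed

lemma cmul_l2_add_left: "cmul_l2 (c + d) f = cmul_l2 c f + cmul_l2 d f"
proof (rule l2_eqI)
  show "AE x in lborel. rep_l2 (cmul_l2 (c + d) f) x = rep_l2 (cmul_l2 c f + cmul_l2 d f) x"
    using rep_cmul_l2[of c f] rep_cmul_l2[of d f] rep_cmul_l2[of "c + d" f]
      rep_add_l2[of "cmul_l2 c f" "cmul_l2 d f"]
    by eventually_elim (simp add: algebra_simps)
qed

lemma bounded_bilinear_cmul_l2: "bounded_bilinear cmul_l2"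
proof
  show "cmul_l2 (r *\<^sub>R a) b = r *\<^sub>R cmul_l2 a b" "cmul_l2 a (r *\<^sub>R b) = r *\<^sub>R cmul_l2 a b" for r a b
    by (simp_all add: scaleR_l2 cmul_l2_mult scaleR_conv_of_real mult.commute)
  show "\<exists>K. \<forall>a b. norm (cmul_l2 a b) \<le> norm a * norm b * K"
    by (intro exI[of _ 1]) (auto simp: norm_cmul_l2)
qed (auto simp: cmul_l2_add cmul_l2_add_left)

interpretation cmul_l2: bounded_bilinear cmul_l2 by (rule bounded_bilinear_cmul_l2)

lemma cmul_l2_1: "cmul_l2 1 f = f"
  using scaleR_l2[of 1 f] by simp

lemma norm_l2_square: "(norm f)\<^sup>2 = (LINT x:{0..1}|lborel. (cmod (rep_l2 f x))\<^sup>2)"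
proof -
  have "complex_of_real ((norm f)\<^sup>2) = (LINT x:{0..1}|lborel. complex_of_real ((cmod (rep_l2 f x))\<^sup>2))"
    unfolding cip_self[symmetric] cip_def by (simp only: complex_norm_square mult.commute)
  then show ?thesis
    by (simp only: set_integral_complex_of_real of_real_eq_iff)
qed

lemma nn_integral_norm_l2:
  "(\<integral>\<^sup>+x. ennreal (indicat_real {0..1} x * (cmod (rep_l2 f x))\<^sup>2) \<partial>lborel) = ennreal ((norm f)\<^sup>2)"
  unfolding norm_l2_square set_lebesgue_integral_def real_scaleR_def
  using sq_int_rep[of f] by (intro nn_integral_eq_integral) (auto simp: sq_int_def set_integrable_def)

text \<open>An L^2 Cauchy sequence is Cauchy in L^1 of one period, hence has a subsequence
  converging almost everywhere; Fatou's lemma then bounds the L^2 distance from \<open>X n\<close>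
  to the pointwise limit. Neumann inversion and operator-valued contour integrals rest on this
  completeness.\<close>

instance l2 :: complete_space
proof
  fix X :: "nat \<Rightarrow> l2"
  assume X: "Cauchy X"
  define s where "s n x = indicat_real {0..1} x *\<^sub>R rep_l2 (X n) x" for n x
  have d: "AE x in lborel. rep_l2 (f - g) x = rep_l2 f x - rep_l2 g x" for f g
  proof -
    have "f - g = f + cmul_l2 (-1) g" using scaleR_l2[of "-1" g] by (simp only: diff_conv_add_uminus) simp
    moreover have "AE x in lborel. rep_l2 (f + cmul_l2 (-1) g) x = rep_l2 f x - rep_l2 g x"
      using rep_add_l2[of f "cmul_l2 (-1) g"] rep_cmul_l2[of "-1" g] by eventually_elim simp
    ultimately show ?thesis by (simp only:)
  qed
  have one: "sq_int (\<lambda>x. 1)" by (auto simp: sq_int_def periodic1_def set_integrable_def)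
  have sint: "set_integrable lborel {0..1} (rep_l2 f)" for f
    using sq_int_prod[OF one sq_int_rep, of f] by simp
  \<comment> \<open>Weighted arithmetic-geometric mean: it turns an L^2 bound below \<open>e\<close>
    into an L^1 bound below the same \<open>e\<close>.\<close>
  have amgm: "a \<le> e / 2 + a\<^sup>2 / (2 * e)" if "e > 0" for a e :: real
  proof -
    have "0 \<le> (a - e)\<^sup>2 / (2 * e)" using that by simp
    also have "\<dots> = e / 2 + a\<^sup>2 / (2 * e) - a"
      using that by (simp add: power2_eq_square field_simps)
    finally show ?thesis by simp
  qed
  have "integrable lborel (s n)" for n using sint unfolding s_def set_integrable_def .
  moreover have "\<exists>N. \<forall>i\<ge>N. \<forall>j\<ge>N. (LINT x|lborel. norm (s i x - s j x)) < e" if "e > 0" for e :: real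
  proof -
    obtain N where N: "\<And>i j. i \<ge> N \<Longrightarrow> j \<ge> N \<Longrightarrow> norm (X i - X j) < e"
      using X \<open>e > 0\<close> unfolding Cauchy_def dist_norm by metis
    have "(LINT x|lborel. norm (s i x - s j x)) < e" if "i \<ge> N" "j \<ge> N" for i j
    proof -
      let ?D = "X i - X j"
      have "(LINT x|lborel. norm (s i x - s j x)) = (LINT x:{0..1}|lborel. cmod (rep_l2 ?D x))"
        unfolding set_lebesgue_integral_def s_def
        using d[of "X i" "X j"] by (intro integral_cong_AE) (auto simp: indicator_def)
      also have "\<dots> \<le> (LINT x:{0..1}|lborel. e / 2 + (cmod (rep_l2 ?D x))\<^sup>2 / (2 * e))"
      proof (rule set_integral_mono)
        show "set_integrable lborel {0..1} (\<lambda>x. cmod (rep_l2 ?D x))"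
          using sint by (simp add: set_integrable_norm)
        show "set_integrable lborel {0..1} (\<lambda>x. e / 2 + (cmod (rep_l2 ?D x))\<^sup>2 / (2 * e))"
          using sq_int_rep[of ?D]
          by (intro set_integral_add set_integrable_divide) (auto simp: sq_int_def set_integrable_def)
        show "cmod (rep_l2 ?D x) \<le> e / 2 + (cmod (rep_l2 ?D x))\<^sup>2 / (2 * e)" for x
          by (rule amgm[OF \<open>e > 0\<close>])
      qed
      also have "\<dots> = (LINT x:{0..1::real}|lborel. e / 2) + (LINT x:{0..1}|lborel. (cmod (rep_l2 ?D x))\<^sup>2 / (2 * e))"
        using sq_int_rep[of ?D]
        by (subst set_integral_add(2)) (auto intro!: set_integrable_divide simp: sq_int_def set_integrable_def)
      also have "\<dots> = e / 2 + (norm ?D)\<^sup>2 / (2 * e)"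
        by (simp add: norm_l2_square set_lebesgue_integral_def)
      also have "\<dots> < e / 2 + e\<^sup>2 / (2 * e)"
        using N[OF that] \<open>e > 0\<close> by (intro add_strict_left_mono divide_strict_right_mono power_strict_mono) auto
      also have "\<dots> = e" using \<open>e > 0\<close> by (simp add: power2_eq_square)
      finally show ?thesis .
    qed
    then show ?thesis by blast
  qed
  ultimately obtain r where r: "strict_mono r" "AE x in lborel. Cauchy (\<lambda>i. s (r i) x)"
    by (rule cauchy_L1_AE_cauchy_subseq)
  \<comment> \<open>\<open>lim\<close> is total, so measurability and exact periodicity of
    \<open>f\<close> hold also at the points of divergence.\<close>
  define f where "f x = lim (\<lambda>i. rep_l2 (X (r i)) x)" for x
  have fm [measurable]: "f \<in> borel_measurable borel" unfolding f_def by measurable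
  have fp: "periodic1 f" using sq_int_rep by (auto simp: f_def sq_int_def periodic1_def)
  have conv: "AE x in lborel. x \<in> {0..1} \<longrightarrow> (\<lambda>i. rep_l2 (X (r i)) x) \<longlonglongrightarrow> f x"
    using r(2) by eventually_elim
      (auto simp: s_def f_def intro!: Cauchy_convergent convergent_LIMSEQ_iff[THEN iffD1])
  \<comment> \<open>Fatou's lemma along the subsequence \<open>r\<close>; as
    \<open>r i \<ge> i\<close>, its late members are within \<open>e\<close> of
    \<open>X n\<close>.\<close>
  have key: "(\<integral>\<^sup>+x. ennreal (indicat_real {0..1} x * (cmod (f x - rep_l2 (X n) x))\<^sup>2) \<partial>lborel) \<le> ennreal (e\<^sup>2)"
    if N: "\<And>i. i \<ge> n \<Longrightarrow> norm (X i - X n) < e" for n e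
  proof -
    have "(\<integral>\<^sup>+x. ennreal (indicat_real {0..1} x * (cmod (f x - rep_l2 (X n) x))\<^sup>2) \<partial>lborel)
       = (\<integral>\<^sup>+x. liminf (\<lambda>i. ennreal (indicat_real {0..1} x * (cmod (rep_l2 (X (r i)) x - rep_l2 (X n) x))\<^sup>2)) \<partial>lborel)"
    proof (rule nn_integral_cong_AE)
      show "AE x in lborel. ennreal (indicat_real {0..1} x * (cmod (f x - rep_l2 (X n) x))\<^sup>2)
        = liminf (\<lambda>i. ennreal (indicat_real {0..1} x * (cmod (rep_l2 (X (r i)) x - rep_l2 (X n) x))\<^sup>2))"
        using conv
      proof eventually_elim
        case (elim x)
        have "(\<lambda>i. ennreal (indicat_real {0..1} x * (cmod (rep_l2 (X (r i)) x - rep_l2 (X n) x))\<^sup>2))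
          \<longlonglongrightarrow> ennreal (indicat_real {0..1} x * (cmod (f x - rep_l2 (X n) x))\<^sup>2)"
          using elim by (cases "x \<in> {0..1}") (auto intro!: tendsto_intros)
        then show ?case by (metis lim_imp_Liminf trivial_limit_sequentially)
      qed
    qed
    also have "\<dots> \<le> liminf (\<lambda>i. \<integral>\<^sup>+x. ennreal (indicat_real {0..1} x * (cmod (rep_l2 (X (r i)) x - rep_l2 (X n) x))\<^sup>2) \<partial>lborel)"
      by (rule nn_integral_liminf) measurable
    also have "\<dots> = liminf (\<lambda>i. ennreal ((norm (X (r i) - X n))\<^sup>2))"
    proof -
      have "(\<integral>\<^sup>+x. ennreal (indicat_real {0..1} x * (cmod (rep_l2 (X (r i)) x - rep_l2 (X n) x))\<^sup>2) \<partial>lborel)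
        = ennreal ((norm (X (r i) - X n))\<^sup>2)" for i
        unfolding nn_integral_norm_l2[symmetric]
        using d[of "X (r i)" "X n"] by (intro nn_integral_cong_AE) auto
      then show ?thesis by simp
    qed
    also have "\<dots> \<le> ennreal (e\<^sup>2)"
    proof (rule Liminf_le)
      show "\<forall>\<^sub>F i in sequentially. ennreal ((norm (X (r i) - X n))\<^sup>2) \<le> ennreal (e\<^sup>2)"
        using eventually_ge_at_top[of n]
      proof eventually_elim
        case (elim i)
        then have "r i \<ge> n" using seq_suble[OF r(1), of i] by linarith
        then have "norm (X (r i) - X n) \<le> e" using N[of "r i"] by simp
        then show ?case by (intro ennreal_leI power_mono) auto
      qed
    qed simp
    finally show ?thesis .
  qed
  have diff: "sq_int (\<lambda>x. f x - rep_l2 (X n) x) \<and> norm (abs_l2 (\<lambda>x. f x - rep_l2 (X n) x)) \<le> e"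
    if N: "\<And>i. i \<ge> n \<Longrightarrow> norm (X i - X n) < e" and "e > 0" for n e
  proof -
    have "integrable lborel (\<lambda>x. indicat_real {0..1} x * (cmod (f x - rep_l2 (X n) x))\<^sup>2)"
      using le_less_trans[OF key[OF N] ennreal_less_top] by (intro integrableI_nonneg) auto
    then have sq: "sq_int (\<lambda>x. f x - rep_l2 (X n) x)"
      using fp sq_int_rep[of "X n"] by (auto simp: sq_int_def periodic1_def set_integrable_def)
    have "ennreal ((norm (abs_l2 (\<lambda>x. f x - rep_l2 (X n) x)))\<^sup>2) \<le> ennreal (e\<^sup>2)"
    proof -
      have "ennreal ((norm (abs_l2 (\<lambda>x. f x - rep_l2 (X n) x)))\<^sup>2) =
        (\<integral>\<^sup>+x. ennreal (indicat_real {0..1} x * (cmod (f x - rep_l2 (X n) x))\<^sup>2) \<partial>lborel)"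
        unfolding nn_integral_norm_l2[symmetric]
        using rep_abs_l2[OF sq] by (intro nn_integral_cong_AE) auto
      then show ?thesis using key[OF N] by simp
    qed
    then have "(norm (abs_l2 (\<lambda>x. f x - rep_l2 (X n) x)))\<^sup>2 \<le> e\<^sup>2" by (simp add: ennreal_le_iff)
    then show ?thesis using sq \<open>e > 0\<close> by (auto intro: power2_le_imp_le)
  qed
  have ex: "\<exists>N. \<forall>i\<ge>N. \<forall>n\<ge>N. norm (X i - X n) < e" if "e > 0" for e
    using X that unfolding Cauchy_def dist_norm by metis
  obtain N where "\<And>i. i \<ge> N \<Longrightarrow> norm (X i - X N) < 1" using ex[of 1] by auto
  then have "sq_int (\<lambda>x. f x - rep_l2 (X N) x)" using diff[of N 1] by auto
  then have "sq_int (\<lambda>x. (f x - rep_l2 (X N) x) + rep_l2 (X N) x)"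
    by (rule sq_int_add[OF _ sq_int_rep])
  then have f: "sq_int f" by simp
  have "X \<longlonglongrightarrow> abs_l2 f"
  proof (rule LIMSEQ_I)
    fix e :: real assume "e > 0"
    then obtain N where N: "\<And>i n. i \<ge> N \<Longrightarrow> n \<ge> N \<Longrightarrow> norm (X i - X n) < e / 2"
      using ex[of "e / 2"] by auto
    have "norm (X n - abs_l2 f) < e" if "n \<ge> N" for n
    proof -
      have "abs_l2 f - X n = abs_l2 (\<lambda>x. f x - rep_l2 (X n) x)"
      proof (rule l2_eqI)
        have sq: "sq_int (\<lambda>x. f x - rep_l2 (X n) x)" using diff[of n "e/2"] N that \<open>e > 0\<close> by auto
        show "AE x in lborel. rep_l2 (abs_l2 f - X n) x = rep_l2 (abs_l2 (\<lambda>x. f x - rep_l2 (X n) x)) x"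
          using d[of "abs_l2 f" "X n"] rep_abs_l2[OF f] rep_abs_l2[OF sq] by eventually_elim simp
      qed
      moreover have "norm (abs_l2 (\<lambda>x. f x - rep_l2 (X n) x)) \<le> e / 2"
        using diff[of n "e/2"] N that \<open>e > 0\<close> by auto
      ultimately show ?thesis using \<open>e > 0\<close> by (metis field_sum_of_halves less_add_same_cancel1 
            norm_minus_commute order_le_less_trans half_gt_zero)
    qed
    then show "\<exists>N. \<forall>n\<ge>N. norm (X n - abs_l2 f) < e" by blast
  qed
  then show "convergent X" by (auto simp: convergent_def)
qed

instance l2 :: banach ..

subsection \<open>Fourier coefficients\<close>

definition ex :: "int \<Rightarrow> real \<Rightarrow> complex" where
  "ex n x = exp (complex_of_real (2 * pi) * \<i> * of_int n * of_real x)"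

lemma ex_add: "ex (n + m) x = ex n x * ex m x"
  by (simp add: ex_def distrib_left distrib_right flip: exp_add)

lemma ex_0 [simp]: "ex 0 x = 1" by (simp add: ex_def)

lemma cnj_ex: "cnj (ex n x) = ex (- n) x"
  by (simp add: ex_def exp_cnj)

lemma norm_ex [simp]: "cmod (ex n x) = 1"
  by (simp add: ex_def norm_exp_eq_Re)

lemma ex_int: "ex n (of_int k) = 1"
proof -
  have "ex n (of_int k) = exp (2 * of_int (n * k) * pi * \<i>)" by (simp add: ex_def algebra_simps)
  then show ?thesis by (simp only: exp_integer_2pi[OF Ints_of_int])
qed

lemma ex_shift: "ex n (x + y) = ex n x * ex n y"
  by (simp add: ex_def distrib_left flip: exp_add)

lemma periodic_ex: "periodic1 (ex n)"
  using ex_int[of n 1] by (simp add: periodic1_def ex_shift)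

definition dfac :: "int \<Rightarrow> complex" where "dfac n = 2 * pi * \<i> * of_int n"

lemma ex_deriv: "(ex n has_vector_derivative dfac n * ex n x) (at x within S)"
  unfolding ex_def dfac_def
  by (auto intro!: derivative_eq_intros has_vector_derivative_real_field)

lemma continuous_ex [continuous_intros]: "continuous_on S (ex n)"
  unfolding ex_def by (intro continuous_intros)

lemma ex_measurable [measurable]: "ex n \<in> borel_measurable borel"
  by (intro borel_measurable_continuous_onI continuous_ex)

lemma smooth_ex: "smooth_on UNIV (ex n)"
proof -
  have "((\<lambda>g y. vector_derivative g (at y)) ^^ k) (ex n) = (\<lambda>x. dfac n ^ k * ex n x)" for k
  proof (induction k)
    case (Suc k)
    have "((\<lambda>x. dfac n ^ k * ex n x) has_vector_derivative dfac n ^ Suc k * ex n x) (at x)" for x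
      using has_vector_derivative_mult_right[OF ex_deriv, of "dfac n ^ k"] by (simp add: mult_ac)
    then show ?case using Suc by (auto intro!: ext vector_derivative_at)
  qed simp
  moreover have "(\<lambda>x. dfac n ^ k * ex n x) differentiable (at x)" for k x
    using has_vector_derivative_mult_right[OF ex_deriv, of "dfac n ^ k" n x UNIV]
    by (auto simp: differentiable_def has_vector_derivative_def)
  ultimately show ?thesis by (simp add: smooth_on_def)
qed

lemma sq_int_continuous:
  assumes "continuous_on UNIV f" "periodic1 f"
  shows "sq_int f"
proof -
  have "set_integrable lborel {0..1} (\<lambda>x. (cmod (f x))\<^sup>2)"
    by (rule borel_integrable_atLeastAtMost')
      (intro continuous_intros continuous_on_subset[OF assms(1)] subset_UNIV)
  then show ?thesis
    using assms by (simp add: sq_int_def borel_measurable_continuous_onI)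
qed

lemma sq_int_ex: "sq_int (ex n)"
  by (intro sq_int_continuous continuous_ex periodic_ex)

definition em :: "int \<Rightarrow> l2" where "em n = abs_l2 (ex n)"

definition fc :: "l2 \<Rightarrow> int \<Rightarrow> complex" where "fc f n = cip (em n) f"

lemma fc_lint: "fc f n = (LINT x:{0..1}|lborel. ex (- n) x * rep_l2 f x)"
  by (simp add: fc_def em_def cip_abs_left[OF sq_int_ex] cnj_ex)

lemma fc_abs: "sq_int \<phi> \<Longrightarrow> fc (abs_l2 \<phi>) n = (LINT x:{0..1}|lborel. ex (- n) x * \<phi> x)"
  by (simp add: fc_def em_def cip_abs[OF sq_int_ex] cnj_ex)

lemma fc_add: "fc (f + g) n = fc f n + fc g n" by (simp add: fc_def cip.add_right)
lemma fc_diff: "fc (f - g) n = fc f n - fc g n" by (simp add: fc_def cip.diff_right)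
lemma fc_minus: "fc (- f) n = - fc f n" by (simp add: fc_def cip.minus_right)
lemma fc_zero: "fc 0 n = 0" by (simp add: fc_def cip.zero_right)
lemma fc_cmul: "fc (cmul_l2 c f) n = c * fc f n" by (simp add: fc_def cip_cmul_right)
lemma fc_scaleR: "fc (r *\<^sub>R f) n = r *\<^sub>R fc f n" by (simp add: fc_def cip.scaleR_right)
lemma fc_sum: "fc (sum f A) n = (\<Sum>i\<in>A. fc (f i) n)" by (simp add: fc_def cip.sum_right)

lemmas fc_simps = fc_add fc_diff fc_minus fc_zero fc_cmul fc_scaleR fc_sum

lemma bounded_linear_fc: "bounded_linear (\<lambda>f. fc f n)"
  unfolding fc_def by (rule cip.bounded_linear_right)

lemma lint_ex: "(LINT x:{0..1}|lborel. ex n x) = (if n = 0 then 1 else 0)"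
proof (cases "n = 0")
  case False
  have "(LINT x|lborel. indicator {0..1} x *\<^sub>R ex n x) = ex n 1 / dfac n - ex n 0 / dfac n"
  proof (rule integral_FTC_atLeastAtMost)
    show "((\<lambda>x. ex n x / dfac n) has_vector_derivative ex n x) (at x within {0..1})" for x
      using has_vector_derivative_mult_right[OF ex_deriv, of "1 / dfac n" n x] False
      by (simp add: dfac_def)
  qed (auto intro: continuous_intros)
  then show ?thesis using False ex_int[of n 1] ex_int[of n 0] by (simp add: set_lebesgue_integral_def)
qed (simp add: set_lebesgue_integral_def)

lemma fc_em: "fc (em m) n = (if n = m then 1 else 0)"
  unfolding em_def fc_abs[OF sq_int_ex] by (simp add: lint_ex flip: ex_add)

section \<open>Completeness of the exponential system\<close>

inductive trigpoly :: "(real \<Rightarrow> complex) \<Rightarrow> bool" where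
  tp_ex: "trigpoly (ex n)"
| tp_add: "trigpoly f \<Longrightarrow> trigpoly g \<Longrightarrow> trigpoly (\<lambda>x. f x + g x)"
| tp_cmul: "trigpoly f \<Longrightarrow> trigpoly (\<lambda>x. c * f x)"

lemma trigpoly_mult: "trigpoly f \<Longrightarrow> trigpoly g \<Longrightarrow> trigpoly (\<lambda>x. f x * g x)"
proof (induction rule: trigpoly.induct)
  case (tp_ex n)
  then show ?case
  proof (induction rule: trigpoly.induct)
    case (tp_ex m)
    have "(\<lambda>x. ex n x * ex m x) = ex (n + m)" by (auto simp: ex_add)
    then show ?case using trigpoly.tp_ex[of "n + m"] by simp
  next
    case (tp_add f g)
    then show ?case using trigpoly.tp_add by (simp add: distrib_left)
  next
    case (tp_cmul f c)
    then show ?case using trigpoly.tp_cmul[OF tp_cmul(2), of c] by (simp add: mult_ac)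
  qed
next
  case (tp_add f g)
  then show ?case using trigpoly.tp_add by (simp add: distrib_right)
next
  case (tp_cmul f c)
  then show ?case using trigpoly.tp_cmul[OF tp_cmul(2), of c] by (simp add: mult_ac)
qed

lemma trigpoly_continuous: "trigpoly f \<Longrightarrow> continuous_on UNIV f"
  by (induction rule: trigpoly.induct) (auto intro: continuous_intros)

text \<open>A real-linear functional on the complex plane is a combination of \<open>z\<close> and
  its conjugate, and on the unit circle these are the exponentials of index 1 and -1.\<close>

lemma trigpoly_real_polynomial:
  assumes "real_polynomial_function p"
  shows "trigpoly (\<lambda>x. complex_of_real (p (ex 1 x)))"
  using assms
proof (induction rule: real_polynomial_function.induct)
  case (linear f)
  interpret bounded_linear f by fact
  have lin: "f z = Re z * f 1 + Im z * f \<i>" for z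
  proof -
    have "z = Re z *\<^sub>R 1 + Im z *\<^sub>R \<i>" by (simp add: complex_eq_iff)
    then have "f z = f (Re z *\<^sub>R 1 + Im z *\<^sub>R \<i>)" by simp
    then show ?thesis by (simp add: add scaleR)
  qed
  have "complex_of_real (f z) = Complex (f 1 / 2) (- f \<i> / 2) * z + Complex (f 1 / 2) (f \<i> / 2) * cnj z" for z
    by (subst lin) (simp add: complex_eq_iff)
  then have "complex_of_real (f (ex 1 x)) =
      Complex (f 1 / 2) (- f \<i> / 2) * ex 1 x + Complex (f 1 / 2) (f \<i> / 2) * ex (-1) x" for x
    by (simp only: cnj_ex)
  then show ?case by (auto intro!: trigpoly.intros)
next
  case (const c)
  show ?case using tp_cmul[OF tp_ex, of c 0] by simp
qed (auto intro: tp_add trigpoly_mult)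

lemma lint_trigpoly_zero:
  assumes "\<And>n. fc f n = 0" "trigpoly t"
  shows "(LINT x:{0..1}|lborel. rep_l2 f x * t x) = 0"
  using assms(2)
proof (induction rule: trigpoly.induct)
  case (tp_ex n)
  then show ?case using assms(1)[of "- n"] by (simp add: fc_lint mult.commute)
next
  case (tp_add s t)
  then show ?case
    by (simp add: distrib_left set_integral_add sq_int_times_continuous sq_int_rep trigpoly_continuous)
next
  case (tp_cmul t c)
  have "(LINT x:{0..1}|lborel. rep_l2 f x * (c * t x)) = (LINT x:{0..1}|lborel. c * (rep_l2 f x * t x))"
    by (simp add: mult_ac)
  then show ?case using tp_cmul by simp
qed

lemma rep_l2_integrable: "set_integrable lborel {0..1} (rep_l2 f)"
  using sq_int_times_continuous[OF sq_int_rep, of "\<lambda>x. 1" f] by simp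

text \<open>Stone-Weierstrass on the unit circle: an \<open>e\<close>-approximation of
  \<open>g\<close> changes the integral by at most \<open>e\<close> times the L^1 norm of
  \<open>f\<close>. Pulling functions back from the circle makes periodicity automatic.\<close>

lemma lint_circle_zero:
  fixes g :: "complex \<Rightarrow> real"
  assumes "\<And>n. fc f n = 0" "continuous_on UNIV g"
  shows "(LINT x:{0..1}|lborel. rep_l2 f x * g (ex 1 x)) = 0"
proof -
  let ?I = "LINT x:{0..1}|lborel. rep_l2 f x * g (ex 1 x)"
  let ?N = "LINT x:{0..1}|lborel. cmod (rep_l2 f x)"
  have gc: "continuous_on UNIV (\<lambda>x. complex_of_real (g (ex 1 x)))"
    by (intro continuous_intros continuous_on_compose2[OF assms(2)]) auto
  have "cmod ?I \<le> e * ?N" if e: "e > 0" for e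
  proof -
    obtain p where p: "real_polynomial_function p" "\<And>z. z \<in> sphere 0 1 \<Longrightarrow> \<bar>g z - p z\<bar> < e"
      using Stone_Weierstrass_real_polynomial_function[OF compact_sphere
          continuous_on_subset[OF assms(2) subset_UNIV] e] by blast
    note tp = trigpoly_real_polynomial[OF p(1)]
    have i1: "set_integrable lborel {0..1} (\<lambda>x. rep_l2 f x * g (ex 1 x))"
      by (intro sq_int_times_continuous sq_int_rep gc)
    have i2: "set_integrable lborel {0..1} (\<lambda>x. rep_l2 f x * p (ex 1 x))"
      by (intro sq_int_times_continuous sq_int_rep trigpoly_continuous tp)
    have "?I = ?I - (LINT x:{0..1}|lborel. rep_l2 f x * p (ex 1 x))"
      using lint_trigpoly_zero[OF assms(1) tp] by simp
    also have "\<dots> = (LINT x:{0..1}|lborel. rep_l2 f x * g (ex 1 x) - rep_l2 f x * p (ex 1 x))"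
      using i1 i2 by (simp add: set_integral_diff)
    finally have "cmod ?I \<le> (LINT x:{0..1}|lborel. cmod (rep_l2 f x * g (ex 1 x) - rep_l2 f x * p (ex 1 x)))"
      using set_integral_norm_bound[OF set_integral_diff(1)[OF i1 i2]] by simp
    also have "\<dots> \<le> (LINT x:{0..1}|lborel. e * cmod (rep_l2 f x))"
    proof (rule set_integral_mono)
      show "set_integrable lborel {0..1} (\<lambda>x. cmod (rep_l2 f x * g (ex 1 x) - rep_l2 f x * p (ex 1 x)))"
        using set_integral_diff(1)[OF i1 i2] by (rule set_integrable_norm)
      show "set_integrable lborel {0..1} (\<lambda>x. e * cmod (rep_l2 f x))"
        by (intro set_integrable_mult_right set_integrable_norm) (rule rep_l2_integrable)
      show "cmod (rep_l2 f x * g (ex 1 x) - rep_l2 f x * p (ex 1 x)) \<le> e * cmod (rep_l2 f x)" for x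
      proof -
        have "cmod (rep_l2 f x * g (ex 1 x) - rep_l2 f x * p (ex 1 x)) = cmod (rep_l2 f x) * \<bar>g (ex 1 x) - p (ex 1 x)\<bar>"
          by (simp only: right_diff_distrib[symmetric] norm_mult of_real_diff[symmetric] norm_of_real)
        also have "\<dots> \<le> cmod (rep_l2 f x) * e"
          using p(2)[of "ex 1 x"] by (intro mult_left_mono) (auto simp: less_imp_le)
        finally show ?thesis by (simp add: mult.commute)
      qed
    qed
    finally show ?thesis by simp
  qed
  then have "cmod ?I \<le> e" if "e > 0" for e
  proof -
    have N: "?N \<ge> 0" unfolding set_lebesgue_integral_def by simp
    have "e / (?N + 1) > 0" using N that by (auto intro!: divide_pos_pos)
    from \<open>\<And>e. e > 0 \<Longrightarrow> cmod ?I \<le> e * ?N\<close>[OF this] have "cmod ?I \<le> e / (?N + 1) * ?N" .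
    also have "\<dots> \<le> e / (?N + 1) * (?N + 1)" using N that by (intro mult_left_mono) auto
    also have "\<dots> = e" using N by simp
    finally show ?thesis .
  qed
  then have "cmod ?I \<le> 0" by (meson dense_ge)
  then show ?thesis by simp
qed

text \<open>\<open>x\<close> is kept in the open interval because 0 and 1 are the same point of the
  circle.\<close>

lemma ex1_inj:
  assumes "ex 1 x = ex 1 y" "0 < x" "x < 1" "0 \<le> y" "y \<le> 1"
  shows "x = y"
proof -
  have "ex 1 (x - y) = 1"
    using assms(1) ex_shift[of 1 "x - y" y] by (auto simp: ex_def)
  then obtain n :: int where "2 * pi * (x - y) = of_int (2 * n) * pi"
    unfolding ex_def by (auto simp: exp_eq_1)
  then have "x - y = of_int n" by simp
  then have "\<bar>real_of_int n\<bar> < 1" using assms by auto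
  then have "n = 0" by linarith
  then show ?thesis using \<open>x - y = of_int n\<close> by simp
qed

text \<open>The indicator of the arc \<open>K\<close> is the pointwise limit of the tent functions
  \<open>g n\<close> in the distance to \<open>K\<close>, and dominated convergence applies. The arc
  determines its interval only up to the common image of 0 and 1, hence the exclusion of these two
  points as a null set.\<close>

lemma lint_interval_zero:
  assumes "\<And>n. fc f n = 0" "0 \<le> a" "a \<le> b" "b \<le> 1"
  shows "(LINT x:{a..b}|lborel. rep_l2 f x) = 0"
proof -
  define K where "K = ex 1 ` {a..b}"
  have K: "closed K" "K \<noteq> {}"
    using assms unfolding K_def
    by (auto intro!: compact_imp_closed compact_continuous_image continuous_intros)
  define g where "g n z = max 0 (1 - real n * infdist z K)" for n z
  have gc: "continuous_on UNIV (g n)" for n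
    unfolding g_def by (intro continuous_intros)
  have lim: "(\<lambda>n. g n z) \<longlonglongrightarrow> indicat_real K z" for z
  proof (cases "z \<in> K")
    case False
    then have d: "infdist z K > 0" using K
      by (metis in_closed_iff_infdist_zero infdist_nonneg order_le_less)
    have "\<forall>\<^sub>F n in sequentially. g n z = 0"
      using eventually_ge_at_top[of "nat \<lceil>1 / infdist z K\<rceil>"]
    proof eventually_elim
      case (elim n)
      then have "1 / infdist z K \<le> real n" by linarith
      then have "1 \<le> real n * infdist z K" using d by (simp add: field_simps)
      then show ?case by (simp add: g_def)
    qed
    then show ?thesis using False by (simp add: tendsto_eventually)
  qed (simp add: g_def)
  have g1: "0 \<le> g n z" "g n z \<le> 1" for n z
    by (auto simp: g_def infdist_nonneg)
  have [measurable]: "g n \<in> borel_measurable borel" for n by (intro borel_measurable_continuous_onI gc)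
  have Kb [measurable]: "K \<in> sets borel" using K by auto
  let ?h = "\<lambda>x. indicat_real {0..1} x *\<^sub>R (rep_l2 f x * complex_of_real (indicat_real K (ex 1 x)))"
  have "(\<lambda>n. LINT x|lborel. indicat_real {0..1} x *\<^sub>R (rep_l2 f x * g n (ex 1 x))) \<longlonglongrightarrow> (LINT x|lborel. ?h x)"
  proof (rule integral_dominated_convergence)
    show "integrable lborel (\<lambda>x. indicat_real {0..1} x *\<^sub>R cmod (rep_l2 f x))"
      using set_integrable_norm[OF rep_l2_integrable[of f]] by (simp add: set_integrable_def)
    show "AE x in lborel. (\<lambda>n. indicat_real {0..1} x *\<^sub>R (rep_l2 f x * g n (ex 1 x))) \<longlonglongrightarrow> ?h x"
      by (intro AE_I2 tendsto_intros lim)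
    show "AE x in lborel. norm (indicat_real {0..1} x *\<^sub>R (rep_l2 f x * g n (ex 1 x)))
       \<le> indicat_real {0..1} x *\<^sub>R cmod (rep_l2 f x)" for n
      using g1 by (intro AE_I2) (auto simp: indicator_def norm_mult intro: mult_left_le)
  qed measurable
  then have "(LINT x|lborel. ?h x) = 0"
    using lint_circle_zero[OF assms(1) gc]
    by (simp add: set_lebesgue_integral_def LIMSEQ_const_iff)
  also have "(LINT x|lborel. ?h x) = (LINT x:{a..b}|lborel. rep_l2 f x)"
    unfolding set_lebesgue_integral_def
  proof (rule integral_cong_AE)
    have "AE x in lborel. x \<notin> {0, 1 :: real}" by (rule AE_not_in) (simp add: countable_imp_null_set_lborel)
    then show "AE x in lborel. ?h x = indicat_real {a..b} x *\<^sub>R rep_l2 f x"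
    proof eventually_elim
      case (elim x)
      have "ex 1 x \<in> K \<longleftrightarrow> x \<in> {a..b}" if "0 \<le> x" "x \<le> 1"
      proof
        assume "ex 1 x \<in> K"
        then obtain y where y: "y \<in> {a..b}" "ex 1 x = ex 1 y" by (auto simp: K_def)
        then have "x = y" using elim that assms(2-4) by (intro ex1_inj) auto
        then show "x \<in> {a..b}" using y by simp
      qed (simp add: K_def)
      then show ?case using assms(2-4) by (auto simp: indicator_def)
    qed
  qed measurable
  finally show ?thesis .
qed

text \<open>Vanishing integrals pass from intervals to all Borel sets by induction over the
  sigma-algebra; the real and the imaginary part then have the same integrals as 0 over every Borel
  set and vanish almost everywhere.\<close>

lemma fc_zero_imp_zero:
  assumes "\<And>n. fc f n = 0"
  shows "f = 0"
proof -
  let ?h = "\<lambda>x. indicat_real {0..1} x *\<^sub>R rep_l2 f x"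
  have hi: "integrable lborel ?h" using rep_l2_integrable by (simp add: set_integrable_def)
  have h0: "(LINT x|lborel. ?h x) = 0"
    using lint_interval_zero[OF assms, of 0 1] by (simp add: set_lebesgue_integral_def)
  have z: "(LINT x:A|lborel. ?h x) = 0" if "A \<in> sets borel" for A
    using that
  proof (induction rule: borel_set_induct)
    case (interval a b)
    show ?case
    proof (cases "max a 0 \<le> min b 1")
      case True
      have "(LINT x:{a..b}|lborel. ?h x) = (LINT x:{max a 0..min b 1}|lborel. rep_l2 f x)"
        unfolding set_lebesgue_integral_def
        by (intro Bochner_Integration.integral_cong) (auto simp: indicator_def)
      then show ?thesis using lint_interval_zero[OF assms _ True] by simp
    next
      case False
      have "(LINT x:{a..b}|lborel. ?h x) = (LINT x::real|lborel. 0)"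
        unfolding set_lebesgue_integral_def
        by (rule Bochner_Integration.integral_cong) (use False in \<open>auto simp: indicator_def\<close>)
      then show ?thesis by simp
    qed
  next
    case (compl A)
    have "(LINT x:-A|lborel. ?h x) = (LINT x|lborel. ?h x - indicat_real A x *\<^sub>R ?h x)"
      unfolding set_lebesgue_integral_def
      by (rule Bochner_Integration.integral_cong) (simp_all add: indicator_def)
    also have "\<dots> = (LINT x|lborel. ?h x) - (LINT x:A|lborel. ?h x)"
      unfolding set_lebesgue_integral_def
      by (rule Bochner_Integration.integral_diff[OF hi integrable_mult_indicator[OF _ hi]]) (simp add: compl(1))
    finally show ?case unfolding compl(2) h0 by simp
  next
    case (union A)
    have "(LINT x:(\<Union>i. A i)|lborel. ?h x) = (\<Sum>i. (LINT x:A i|lborel. ?h x))"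
    proof (rule lebesgue_integral_countable_add)
      show "A i \<in> sets lborel" for i using union(2)[of i] by simp
      show "A i \<inter> A j = {}" if "i \<noteq> j" for i j
        using union(1) that by (simp add: disjoint_family_on_def)
      have "(\<Union>i. A i) \<in> sets lborel" using union(2) by (intro sets.countable_UN) auto
      then show "set_integrable lborel (\<Union>i. A i) ?h"
        unfolding set_integrable_def by (rule integrable_mult_indicator[OF _ hi])
    qed
    then show ?case unfolding union(3) by simp
  qed (simp add: set_lebesgue_integral_def)
  have re: "AE x in lborel. L (?h x) = (0::real)" if L: "bounded_linear L" for L
  proof (rule density_unique_real)
    show "integrable lborel (\<lambda>x. L (?h x))" by (rule integrable_bounded_linear[OF L hi])
    fix A :: "real set" assume A: "A \<in> sets lborel"
    have "(LINT x|lborel. L (indicat_real A x *\<^sub>R ?h x)) = L (LINT x|lborel. indicat_real A x *\<^sub>R ?h x)"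
      using A by (intro integral_bounded_linear[OF L] integrable_mult_indicator hi)
    then show "(LINT x:A|lborel. L (?h x)) = (LINT x:A|lborel. 0)"
      using z[of A] A by (simp add: set_lebesgue_integral_def linear_simps(5)[OF L] linear_simps(3)[OF L] mult.assoc)
  qed simp
  have "AE x in lborel. x \<in> {0..1} \<longrightarrow> rep_l2 f x = 0"
    using re[OF bounded_linear_Re] re[OF bounded_linear_Im]
    by eventually_elim (auto simp: indicator_def complex_eq_iff)
  then have "AE x in lborel. rep_l2 f x = 0"
    using sq_int_rep[of f] by (intro AE_zero_periodic1) (auto simp: sq_int_def)
  then have "abs_l2 (rep_l2 f) = abs_l2 (\<lambda>x. 0)"
    by (intro abs_l2_eqI sq_int_rep sq_int_zero)
  then show ?thesis by (simp add: abs_rep_l2 zero_l2_def)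
qed

lemma fc_eqI: "(\<And>n. fc f n = fc g n) \<Longrightarrow> f = g"
  using fc_zero_imp_zero[of "f - g"] by (simp add: fc_diff)

section \<open>Partial Fourier sums, Riesz-Fischer and Parseval\<close>

definition zI :: "nat \<Rightarrow> int set" where "zI N = {- int N..int N}"

lemma finite_zI [simp]: "finite (zI N)" by (simp add: zI_def)

lemma zI_mono: "M \<le> N \<Longrightarrow> zI M \<subseteq> zI N" by (auto simp: zI_def)

definition ps :: "(int \<Rightarrow> complex) \<Rightarrow> nat \<Rightarrow> l2" where
  "ps c N = (\<Sum>n\<in>zI N. cmul_l2 (c n) (em n))"

lemma fc_ps: "fc (ps c N) n = (if n \<in> zI N then c n else 0)"
  by (simp add: ps_def fc_simps fc_em if_distrib[of "\<lambda>x. _ * x"] cong: if_cong)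

lemma cip_sum_em: "cip (\<Sum>n\<in>A. cmul_l2 (c n) (em n)) f = (\<Sum>n\<in>A. cnj (c n) * fc f n)"
  by (simp add: cip.sum_left cip_cmul_left fc_def)

lemma norm_sum_em:
  assumes "finite A"
  shows "(norm (\<Sum>n\<in>A. cmul_l2 (c n) (em n)))\<^sup>2 = (\<Sum>n\<in>A. (cmod (c n))\<^sup>2)"
proof -
  have "complex_of_real ((norm (\<Sum>n\<in>A. cmul_l2 (c n) (em n)))\<^sup>2) =
      (\<Sum>n\<in>A. cnj (c n) * fc (\<Sum>n\<in>A. cmul_l2 (c n) (em n)) n)"
    unfolding cip_self[symmetric] cip_sum_em ..
  also have "\<dots> = (\<Sum>n\<in>A. complex_of_real ((cmod (c n))\<^sup>2))"
  proof (rule sum.cong)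
    fix n assume "n \<in> A"
    then have "fc (\<Sum>n\<in>A. cmul_l2 (c n) (em n)) n = c n"
      using assms by (simp add: fc_simps fc_em if_distrib[of "\<lambda>x. _ * x"] cong: if_cong)
    then show "cnj (c n) * fc (\<Sum>n\<in>A. cmul_l2 (c n) (em n)) n = complex_of_real ((cmod (c n))\<^sup>2)"
      by (simp only: complex_norm_square mult.commute)
  qed simp
  finally show ?thesis by (simp only: of_real_sum[symmetric] of_real_eq_iff)
qed

definition ell2 :: "(int \<Rightarrow> complex) \<Rightarrow> bool" where
  "ell2 c \<longleftrightarrow> (\<exists>B. \<forall>N. (\<Sum>n\<in>zI N. (cmod (c n))\<^sup>2) \<le> B)"

text \<open>By orthonormality the squared distance of two partial sums is the difference of the
  scalar sums \<open>?P\<close>, a bounded increasing sequence; so \<open>ps c\<close> inherits the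
  Cauchy property.\<close>

lemma riesz_fischer:
  assumes "ell2 c"
  obtains f where "\<And>n. fc f n = c n" "ps c \<longlonglongrightarrow> f"
proof -
  let ?P = "\<lambda>N. \<Sum>n\<in>zI N. (cmod (c n))\<^sup>2"
  have inc: "incseq ?P" by (auto simp: incseq_def intro!: sum_mono2 dest: zI_mono)
  obtain B where "\<And>N. ?P N \<le> B" using assms by (auto simp: ell2_def)
  then have "convergent ?P" using inc by (metis incseq_convergent convergent_def)
  then have C: "Cauchy ?P" by (rule convergent_Cauchy)
  have le: "(norm (ps c N - ps c M))\<^sup>2 = ?P N - ?P M" if "M \<le> N" for M N
  proof -
    have s: "zI N = zI M \<union> (zI N - zI M)" using zI_mono[OF that] by blast
    have "ps c N = ps c M + (\<Sum>n\<in>zI N - zI M. cmul_l2 (c n) (em n))"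
      unfolding ps_def by (subst s, subst sum.union_disjoint) auto
    moreover have "?P N = ?P M + (\<Sum>n\<in>zI N - zI M. (cmod (c n))\<^sup>2)"
      by (subst s, subst sum.union_disjoint) auto
    ultimately show ?thesis by (simp add: norm_sum_em)
  qed
  have "Cauchy (ps c)"
  proof (rule metric_CauchyI)
    fix e :: real assume "e > 0"
    then obtain N0 where N0: "\<And>m n. m \<ge> N0 \<Longrightarrow> n \<ge> N0 \<Longrightarrow> dist (?P m) (?P n) < e\<^sup>2"
      using C unfolding Cauchy_def by (metis zero_less_power)
    have *: "norm (ps c n - ps c m) < e" if "m \<ge> N0" "n \<ge> m" for m n
    proof (rule power2_less_imp_less)
      show "(norm (ps c n - ps c m))\<^sup>2 < e\<^sup>2"
        using N0[of n m] that le[OF that(2)] by (auto simp: dist_real_def)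
    qed (use \<open>e > 0\<close> in simp)
    have "dist (ps c m) (ps c n) < e" if "m \<ge> N0" "n \<ge> N0" for m n
      using *[of m n] *[of n m] that by (cases "m \<le> n") (auto simp: dist_norm norm_minus_commute)
    then show "\<exists>M. \<forall>m\<ge>M. \<forall>n\<ge>M. dist (ps c m) (ps c n) < e" by blast
  qed
  then obtain f where f: "ps c \<longlonglongrightarrow> f" using Cauchy_convergent convergentD by blast
  have "fc f n = c n" for n
  proof -
    have "(\<lambda>N. fc (ps c N) n) \<longlonglongrightarrow> fc f n"
      by (rule bounded_linear.tendsto[OF bounded_linear_fc f])
    moreover have "\<forall>\<^sub>F N in sequentially. fc (ps c N) n = c n"
      using eventually_ge_at_top[of "nat \<bar>n\<bar>"] by eventually_elim (auto simp: fc_ps zI_def)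
    ultimately show ?thesis by (metis LIMSEQ_unique tendsto_eventually)
  qed
  then show ?thesis using f that by blast
qed

lemma bessel: "(\<Sum>n\<in>zI N. (cmod (fc f n))\<^sup>2) \<le> (norm f)\<^sup>2"
proof -
  let ?s = "ps (fc f) N"
  have a: "cip ?s f = (\<Sum>n\<in>zI N. (cmod (fc f n))\<^sup>2)"
    unfolding ps_def cip_sum_em
    by (simp add: complex_norm_square mult.commute flip: of_real_power)
  have "(norm ?s)\<^sup>2 = (\<Sum>n\<in>zI N. (cmod (fc f n))\<^sup>2)" unfolding ps_def by (rule norm_sum_em) simp
  moreover have "inner ?s f = (\<Sum>n\<in>zI N. (cmod (fc f n))\<^sup>2)" by (simp add: inner_l2_eq a)
  moreover have "0 \<le> (norm (f - ?s))\<^sup>2" by simp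
  ultimately show ?thesis
    by (simp add: power2_norm_eq_inner inner_diff_left inner_diff_right inner_commute)
qed

lemma ell2_fc: "ell2 (fc f)"
  using bessel by (auto simp: ell2_def)

text \<open>The limit produced by \<open>riesz_fischer\<close> has the coefficients of
  \<open>f\<close>, and completeness of the exponentials identifies it with
  \<open>f\<close>.\<close>

lemma ps_tendsto: "ps (fc f) \<longlonglongrightarrow> f"
proof -
  obtain g where g: "\<And>n. fc g n = fc f n" "ps (fc f) \<longlonglongrightarrow> g" using riesz_fischer[OF ell2_fc] by blast
  then show ?thesis using fc_eqI[of g f] by simp
qed

lemma parseval: "(\<lambda>N. \<Sum>n\<in>zI N. (cmod (fc f n))\<^sup>2) \<longlonglongrightarrow> (norm f)\<^sup>2"
  using tendsto_power[OF tendsto_norm[OF ps_tendsto[of f]], of 2]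
  by (simp add: ps_def norm_sum_em)

lemma norm_le_fc:
  assumes "\<And>N. (\<Sum>n\<in>zI N. (cmod (fc f n))\<^sup>2) \<le> B\<^sup>2" "0 \<le> B"
  shows "norm f \<le> B"
proof (rule power2_le_imp_le)
  show "(norm f)\<^sup>2 \<le> B\<^sup>2" using assms(1) by (intro LIMSEQ_le_const2[OF parseval]) auto
qed fact

subsection \<open>Weak derivatives\<close>

lemma weak_deriv_iff: "weak_deriv f g \<longleftrightarrow>
    (\<forall>\<phi>. smooth_on UNIV \<phi> \<and> periodic1 \<phi> \<longrightarrow>
     (LINT x:{0..1}|lborel. rep_l2 f x * vector_derivative \<phi> (at x)) =
     - (LINT x:{0..1}|lborel. rep_l2 g x * \<phi> x))"
  by (simp add: weak_deriv_def)

lemma dfac_minus: "dfac (- n) = - dfac n" by (simp add: dfac_def)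

lemma weak_deriv_fc:
  assumes "weak_deriv f g"
  shows "fc g n = dfac n * fc f n"
proof -
  have d: "vector_derivative (ex (- n)) (at x) = - dfac n * ex (- n) x" for x
    using vector_derivative_at[OF ex_deriv, of "- n"] by (simp add: dfac_minus)
  have "(LINT x:{0..1}|lborel. rep_l2 f x * (- dfac n * ex (- n) x)) = - (LINT x:{0..1}|lborel. rep_l2 g x * ex (- n) x)"
    using assms smooth_ex periodic_ex unfolding weak_deriv_iff d[symmetric] by blast
  moreover have "(LINT x:{0..1}|lborel. rep_l2 f x * (- dfac n * ex (- n) x)) = (LINT x:{0..1}|lborel. - dfac n * (ex (- n) x * rep_l2 f x))"
    by (simp only: mult.assoc mult.left_commute mult.commute)
  ultimately show ?thesis unfolding fc_lint set_integral_mult_right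
    by (simp add: mult.commute[of "ex _ _"])
qed

lemma periodic_deriv:
  fixes f :: "real \<Rightarrow> 'a::real_normed_vector"
  assumes "periodic1 f" "\<And>x. (f has_vector_derivative f' x) (at x)"
  shows "periodic1 f'"
  unfolding periodic1_def
proof
  fix x
  have "((\<lambda>y. f (y + 1)) has_vector_derivative 1 *\<^sub>R f' (x + 1)) (at x)"
    by (rule vector_diff_chain_at[OF _ assms(2), of "\<lambda>y. y + 1" 1 x, unfolded o_def])
      (auto intro!: derivative_eq_intros)
  then have "(f has_vector_derivative f' (x + 1)) (at x)" using assms(1) by (simp add: periodic1_def)
  then show "f' (x + 1) = f' x" using assms(2) vector_derivative_unique_at by blast
qed

lemma lint_by_parts_ex:
  fixes \<psi> \<psi>' :: "real \<Rightarrow> complex"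
  assumes "periodic1 \<psi>" "\<And>x. (\<psi> has_vector_derivative \<psi>' x) (at x)" "continuous_on UNIV \<psi>'"
  shows "(LINT x:{0..1}|lborel. \<psi>' x * ex n x) = - dfac n * (LINT x:{0..1}|lborel. \<psi> x * ex n x)"
proof -
  have c: "continuous_on UNIV \<psi>"
    using assms(2) by (intro continuous_at_imp_continuous_on) (auto intro: has_vector_derivative_continuous)
  have i: "set_integrable lborel {0..1} (\<lambda>x. \<psi>' x * ex n x)" "set_integrable lborel {0..1} (\<lambda>x. dfac n * (\<psi> x * ex n x))"
    by (rule borel_integrable_atLeastAtMost'; intro continuous_intros continuous_on_subset[OF c] continuous_on_subset[OF assms(3)] subset_UNIV)+
  have "(LINT x|lborel. indicator {0..1} x *\<^sub>R (\<psi>' x * ex n x + dfac n * (\<psi> x * ex n x))) = \<psi> 1 * ex n 1 - \<psi> 0 * ex n 0"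
  proof (rule integral_FTC_atLeastAtMost)
    show "((\<lambda>x. \<psi> x * ex n x) has_vector_derivative \<psi>' x * ex n x + dfac n * (\<psi> x * ex n x)) (at x within {0..1})" for x
      using has_vector_derivative_mult[OF has_vector_derivative_at_within[OF assms(2)[of x]] ex_deriv[of n x "{0..1}"]]
      by (simp add: algebra_simps)
    show "continuous_on {0..1} (\<lambda>x. \<psi>' x * ex n x + dfac n * (\<psi> x * ex n x))"
      by (intro continuous_intros continuous_on_subset[OF c] continuous_on_subset[OF assms(3)] subset_UNIV)
  qed simp
  also have "\<dots> = 0" using assms(1) ex_int[of n 1] unfolding periodic1_def by (metis add_0 diff_self ex_int mult_1_right of_int_0 of_int_1)
  finally have "(LINT x:{0..1}|lborel. \<psi>' x * ex n x + dfac n * (\<psi> x * ex n x)) = 0"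
    by (simp add: set_lebesgue_integral_def)
  then show ?thesis using i by (simp add: set_integral_add add_eq_0_iff)
qed

text \<open>Classical against each exponential, then extended along the partial Fourier sums.
  \<open>f\<close> and \<open>g\<close> are tied on the Fourier side and \<open>\<psi>\<close> is
  merely continuously differentiable, a generality that the product rule
  \<open>weak_deriv_mul\<close> uses with \<open>\<psi>\<close> a coefficient times an
  exponential.\<close>

lemma lint_by_parts:
  fixes \<psi> \<psi>' :: "real \<Rightarrow> complex"
  assumes fg: "\<And>n. fc g n = dfac n * fc f n"
    and \<psi>: "periodic1 \<psi>" "\<And>x. (\<psi> has_vector_derivative \<psi>' x) (at x)" "continuous_on UNIV \<psi>'"
  shows "(LINT x:{0..1}|lborel. rep_l2 f x * \<psi>' x) = - (LINT x:{0..1}|lborel. rep_l2 g x * \<psi> x)"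
proof -
  have c: "continuous_on UNIV \<psi>"
    using assms(3) by (intro continuous_at_imp_continuous_on) (auto intro: has_vector_derivative_continuous)
  have p: "sq_int (\<lambda>x. cnj (\<psi> x))" "sq_int (\<lambda>x. cnj (\<psi>' x))"
    using \<psi> c periodic_deriv[OF \<psi>(1,2)] by (auto intro!: sq_int_continuous continuous_intros simp: periodic1_def)
  define p p' where "p = abs_l2 (\<lambda>x. cnj (\<psi> x))" and "p' = abs_l2 (\<lambda>x. cnj (\<psi>' x))"
  have e: "cip p' (em n) = - dfac n * cip p (em n)" for n
    unfolding p_def p'_def em_def cip_abs[OF p(1) sq_int_ex] cip_abs[OF p(2) sq_int_ex]
    using lint_by_parts_ex[OF \<psi>] by simp
  have "cip p' (ps (fc f) N) = - cip p (ps (fc g) N)" for N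
    by (simp add: ps_def cip.sum_right cip_cmul_right e fg sum_negf[symmetric] mult_ac)
  moreover have "(\<lambda>N. cip p' (ps (fc f) N)) \<longlonglongrightarrow> cip p' f" "(\<lambda>N. - cip p (ps (fc g) N)) \<longlonglongrightarrow> - cip p g"
    by (intro tendsto_intros cip.tendsto ps_tendsto)+
  ultimately have "cip p' f = - cip p g" using LIMSEQ_unique by fastforce
  then show ?thesis
    unfolding p_def p'_def cip_abs_left[OF p(1)] cip_abs_left[OF p(2)] by (simp add: mult.commute)
qed

text \<open>Differentiation becomes the multiplier \<open>dfac n\<close>. From here on membership in
  H^1 is a statement about Fourier coefficients, and smooth test functions are left behind.\<close>

lemma weak_deriv_iff_fc: "weak_deriv f g \<longleftrightarrow> (\<forall>n. fc g n = dfac n * fc f n)"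
proof
  assume *: "\<forall>n. fc g n = dfac n * fc f n"
  show "weak_deriv f g"
    unfolding weak_deriv_iff
  proof (intro allI impI, elim conjE)
    fix \<phi> :: "real \<Rightarrow> complex" assume \<phi>: "smooth_on UNIV \<phi>" "periodic1 \<phi>"
    have "\<phi> differentiable (at x)" for x
      using \<phi>(1)[unfolded smooth_on_def, rule_format, of x 0] by simp
    then show "(LINT x:{0..1}|lborel. rep_l2 f x * vector_derivative \<phi> (at x)) = - (LINT x:{0..1}|lborel. rep_l2 g x * \<phi> x)"
      using * \<phi> smooth_on_continuous(2)[OF \<phi>(1)]
      by (intro lint_by_parts) (auto simp: vector_derivative_works)
  qed
qed (simp add: weak_deriv_fc)

lemma weak_deriv_unique: "weak_deriv f g \<Longrightarrow> weak_deriv f g' \<Longrightarrow> g = g'"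
  by (rule fc_eqI) (simp add: weak_deriv_fc)

definition dh :: "h1 \<Rightarrow> l2" where "dh w = snd (Rep_h1 w)"

lemma h1_fun_Rep: "h1_fun w = fst (Rep_h1 w)" by (simp add: h1_fun.rep_eq)

lemma weak_deriv_h1: "weak_deriv (h1_fun w) (dh w)"
  using Rep_h1[of w] by (auto simp: dh_def h1_fun_Rep)

lemma fc_dh: "fc (dh w) n = dfac n * fc (h1_fun w) n"
  by (rule weak_deriv_fc[OF weak_deriv_h1])

lemma h1_eqI: "h1_fun w = h1_fun w' \<Longrightarrow> w = w'"
  by (metis Rep_h1_inject dh_def h1_fun_Rep prod_eqI weak_deriv_h1 weak_deriv_unique)

lemma h1_ex:
  assumes "weak_deriv f g"
  obtains w where "h1_fun w = f" "dh w = g"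
  using that[of "Abs_h1 (f, g)"] Abs_h1_inverse[of "(f, g)"] assms by (auto simp: dh_def h1_fun_Rep)

lemma to_h1_fun [simp]: "to_h1 (h1_fun w) = w"
  unfolding to_h1_def by (rule the_equality) (auto intro: h1_eqI)

lemma to_h1_eqI: "h1_fun w = f \<Longrightarrow> to_h1 f = w" by auto

lemma in_H1_fun [simp]: "in_H1 (h1_fun w)" using weak_deriv_h1 by (auto simp: in_H1_def)

lemma in_H1_D: "in_H1 f \<Longrightarrow> h1_fun (to_h1 f) = f"
  by (metis h1_ex in_H1_def to_h1_fun)

lemma dx_h1_fun [simp]: "dx (h1_fun w) = dh w"
  unfolding dx_def by (rule the_equality) (auto intro: weak_deriv_unique weak_deriv_h1)

lemma norm_h1: "(norm w)\<^sup>2 = (norm (h1_fun w))\<^sup>2 + (norm (dh w))\<^sup>2"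
  by (simp add: power2_norm_eq_inner inner_h1.rep_eq inner_prod_def h1_fun_Rep dh_def)

lemma norm_h1_fun_le: "norm (h1_fun w) \<le> norm w" and norm_dh_le: "norm (dh w) \<le> norm w"
  by (rule power2_le_imp_le; simp add: norm_h1)+

lemma norm_h1_le: "norm w \<le> norm (h1_fun w) + norm (dh w)"
  by (rule power2_le_imp_le) (simp_all add: norm_h1 power2_sum)

lemma h1_fun_add: "h1_fun (v + w) = h1_fun v + h1_fun w"
  and dh_add: "dh (v + w) = dh v + dh w"
  by (simp_all add: h1_fun_Rep dh_def plus_h1.rep_eq)

lemma h1_fun_scaleR: "h1_fun (r *\<^sub>R w) = r *\<^sub>R h1_fun w"
  and dh_scaleR: "dh (r *\<^sub>R w) = r *\<^sub>R dh w"
  by (simp_all add: h1_fun_Rep dh_def scaleR_h1.rep_eq)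

lemma h1_fun_cmul: "h1_fun (cmul_h1 c w) = cmul_l2 c (h1_fun w)"
  and dh_cmul: "dh (cmul_h1 c w) = cmul_l2 c (dh w)"
  by (simp_all add: h1_fun_Rep dh_def cmul_h1.rep_eq split_beta)

lemma bounded_linear_h1_fun: "bounded_linear h1_fun"
  by (rule bounded_linear_intro[of _ 1]) (auto simp: h1_fun_add h1_fun_scaleR norm_h1_fun_le)

lemma bounded_linear_dh: "bounded_linear dh"
  by (rule bounded_linear_intro[of _ 1]) (auto simp: dh_add dh_scaleR norm_dh_le)

lemmas h1_fun_diff = linear_diff[OF bounded_linear.linear[OF bounded_linear_h1_fun]]
lemmas dh_diff = linear_diff[OF bounded_linear.linear[OF bounded_linear_dh]]

text \<open>The graph of the weak derivative is closed in the product of L^2 with itself, because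
  its description by Fourier coefficients passes to the limit.\<close>

instance h1 :: complete_space
proof
  fix X :: "nat \<Rightarrow> h1" assume X: "Cauchy X"
  have "Cauchy (\<lambda>n. h1_fun (X n))" "Cauchy (\<lambda>n. dh (X n))"
    using X by (rule bounded_linear.Cauchy[OF bounded_linear_h1_fun], rule bounded_linear.Cauchy[OF bounded_linear_dh])
  then obtain f g where lim: "(\<lambda>n. h1_fun (X n)) \<longlonglongrightarrow> f" "(\<lambda>n. dh (X n)) \<longlonglongrightarrow> g"
    using Cauchy_convergent convergent_def by metis
  have "fc g n = dfac n * fc f n" for n
  proof (rule LIMSEQ_unique)
    show "(\<lambda>i. fc (dh (X i)) n) \<longlonglongrightarrow> fc g n" by (rule bounded_linear.tendsto[OF bounded_linear_fc lim(2)])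
    show "(\<lambda>i. fc (dh (X i)) n) \<longlonglongrightarrow> dfac n * fc f n"
      unfolding fc_dh by (intro tendsto_intros bounded_linear.tendsto[OF bounded_linear_fc lim(1)])
  qed
  then obtain w where w: "h1_fun w = f" "dh w = g" using h1_ex weak_deriv_iff_fc by blast
  have "X \<longlonglongrightarrow> w"
  proof (rule Lim_null[THEN iffD2], rule Lim_null_comparison)
    show "\<forall>\<^sub>F n in sequentially. norm (X n - w) \<le> norm (h1_fun (X n) - f) + norm (dh (X n) - g)"
      using norm_h1_le[of "X _ - w"] by (simp add: h1_fun_diff dh_diff w)
    have "(\<lambda>n. norm (h1_fun (X n) - f) + norm (dh (X n) - g)) \<longlonglongrightarrow> norm (f - f) + norm (g - g)"
      by (intro tendsto_intros lim)
    then show "(\<lambda>n. norm (h1_fun (X n) - f) + norm (dh (X n) - g)) \<longlonglongrightarrow> 0" by simp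
  qed
  then show "convergent X" by (auto simp: convergent_def)
qed

instance h1 :: banach ..

lemma norm_cmul_h1: "norm (cmul_h1 c w) = cmod c * norm w"
proof -
  have "(norm (cmul_h1 c w))\<^sup>2 = (cmod c * norm w)\<^sup>2"
    by (simp add: norm_h1 h1_fun_cmul dh_cmul norm_cmul_l2 power_mult_distrib algebra_simps)
  then show ?thesis by (simp add: power2_eq_iff_nonneg)
qed

lemma bounded_bilinear_cmul_h1: "bounded_bilinear cmul_h1"
proof
  show "\<exists>K. \<forall>a b. norm (cmul_h1 a b) \<le> norm a * norm b * K"
    by (intro exI[of _ 1]) (auto simp: norm_cmul_h1)
qed (auto intro!: h1_eqI simp: h1_fun_cmul h1_fun_add h1_fun_scaleR cmul_l2.add_left cmul_l2.add_right
    cmul_l2.scaleR_left cmul_l2.scaleR_right)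

interpretation cmul_h1: bounded_bilinear cmul_h1 by (rule bounded_bilinear_cmul_h1)

text \<open>Skew-adjointness of the derivative: \<open>dfac n\<close> is imaginary, and the identity
  for partial sums passes to the limit.\<close>

lemma cip_dh: "cip (h1_fun v) (dh w) = - cip (dh v) (h1_fun w)"
proof -
  have "cip (ps (fc (h1_fun v)) N) (dh w) = - cip (ps (fc (dh v)) N) (h1_fun w)" for N
    by (simp add: ps_def cip_sum_em fc_dh sum_negf[symmetric] dfac_def mult_ac)
  moreover have "(\<lambda>N. cip (ps (fc (h1_fun v)) N) (dh w)) \<longlonglongrightarrow> cip (h1_fun v) (dh w)"
    "(\<lambda>N. - cip (ps (fc (dh v)) N) (h1_fun w)) \<longlonglongrightarrow> - cip (dh v) (h1_fun w)"
    by (intro tendsto_intros cip.tendsto ps_tendsto)+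
  ultimately show ?thesis using LIMSEQ_unique by fastforce
qed

subsection \<open>Multiplication operators\<close>

definition cper :: "(real \<Rightarrow> real) \<Rightarrow> bool" where
  "cper c \<longleftrightarrow> continuous_on UNIV c \<and> periodic1 c"

lemma cper_bound:
  assumes "cper c"
  obtains B where "B \<ge> 0" "\<And>x. x \<in> {0..1} \<Longrightarrow> \<bar>c x\<bar> \<le> B"
proof -
  have "continuous_on {0..1} c" using assms continuous_on_subset unfolding cper_def by blast
  then have "bounded (c ` {0..1})"
    by (rule compact_imp_bounded[OF compact_continuous_image[OF _ compact_Icc]])
  then obtain B where "B > 0" "\<forall>x\<in>c ` {0..1}. norm x \<le> B" by (auto simp: bounded_pos)
  then show ?thesis using that[of B] by auto
qed

lemma cper_const [simp]: "cper (\<lambda>x. r)"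
  by (auto simp: cper_def periodic1_def)

lemma cper_add: "cper c \<Longrightarrow> cper d \<Longrightarrow> cper (\<lambda>x. c x + d x)"
  and cper_diff: "cper c \<Longrightarrow> cper d \<Longrightarrow> cper (\<lambda>x. c x - d x)"
  and cper_mult: "cper c \<Longrightarrow> cper d \<Longrightarrow> cper (\<lambda>x. c x * d x)"
  and cper_minus: "cper c \<Longrightarrow> cper (\<lambda>x. - c x)"
  by (auto simp: cper_def periodic1_def intro!: continuous_intros)

lemma sq_int_mul:
  assumes "cper c" "sq_int f"
  shows "sq_int (\<lambda>x. of_real (c x) * f x)"
proof -
  obtain B where B: "B \<ge> 0" "\<And>x. x \<in> {0..1} \<Longrightarrow> \<bar>c x\<bar> \<le> B" using cper_bound[OF assms(1)] by blast
  have [measurable]: "c \<in> borel_measurable borel" "f \<in> borel_measurable borel"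
    using assms by (auto simp: cper_def sq_int_def borel_measurable_continuous_onI)
  have i: "set_integrable lborel {0..1} (\<lambda>x. B\<^sup>2 * (cmod (f x))\<^sup>2)"
    using assms(2) by (intro set_integrable_mult_right) (auto simp: sq_int_def)
  have "set_integrable lborel {0..1} (\<lambda>x. (cmod (of_real (c x) * f x))\<^sup>2)"
    unfolding set_integrable_def
  proof (rule Bochner_Integration.integrable_bound[OF i[unfolded set_integrable_def]])
    show "AE x in lborel. norm (indicat_real {0..1} x *\<^sub>R (cmod (of_real (c x) * f x))\<^sup>2)
        \<le> norm (indicat_real {0..1} x *\<^sub>R (B\<^sup>2 * (cmod (f x))\<^sup>2))"
      using B by (intro AE_I2) (auto simp: indicator_def norm_mult power_mult_distrib intro!: mult_right_mono
          simp: abs_le_square_iff[symmetric])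
  qed measurable
  then show ?thesis using assms by (auto simp: sq_int_def periodic1_def cper_def)
qed

lemma rep_mul_l2: "cper c \<Longrightarrow> AE x in lborel. rep_l2 (mul_l2 c f) x = of_real (c x) * rep_l2 f x"
  unfolding mul_l2_def by (intro rep_abs_l2 sq_int_mul sq_int_rep)

lemma norm_mul_l2:
  assumes "cper c" "\<And>x. x \<in> {0..1} \<Longrightarrow> \<bar>c x\<bar> \<le> B" "B \<ge> 0"
  shows "norm (mul_l2 c f) \<le> B * norm f"
proof (rule power2_le_imp_le)
  have [measurable]: "c \<in> borel_measurable borel"
    using assms(1) by (auto simp: cper_def intro: borel_measurable_continuous_onI)
  have "(norm (mul_l2 c f))\<^sup>2 = (LINT x:{0..1}|lborel. (cmod (of_real (c x) * rep_l2 f x))\<^sup>2)"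
    unfolding norm_l2_square set_lebesgue_integral_def
    using rep_mul_l2[OF assms(1), of f]
    by (intro integral_cong_AE) auto
  also have "\<dots> \<le> (LINT x:{0..1}|lborel. B\<^sup>2 * (cmod (rep_l2 f x))\<^sup>2)"
  proof (rule set_integral_mono)
    show "set_integrable lborel {0..1} (\<lambda>x. (cmod (of_real (c x) * rep_l2 f x))\<^sup>2)"
      using sq_int_mul[OF assms(1) sq_int_rep, of f] by (simp add: sq_int_def)
    show "set_integrable lborel {0..1} (\<lambda>x. B\<^sup>2 * (cmod (rep_l2 f x))\<^sup>2)"
      using sq_int_rep[of f] by (intro set_integrable_mult_right) (auto simp: sq_int_def)
    show "(cmod (of_real (c x) * rep_l2 f x))\<^sup>2 \<le> B\<^sup>2 * (cmod (rep_l2 f x))\<^sup>2" if "x \<in> {0..1}" for x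
      using assms(2)[OF that] assms(3)
      by (auto simp: norm_mult power_mult_distrib abs_le_square_iff[symmetric] intro!: mult_right_mono)
  qed
  also have "\<dots> = (B * norm f)\<^sup>2" by (simp add: norm_l2_square power_mult_distrib)
  finally show "(norm (mul_l2 c f))\<^sup>2 \<le> (B * norm f)\<^sup>2" .
qed (use assms in simp)

lemma mul_l2_add:
  assumes "cper c" shows "mul_l2 c (f + g) = mul_l2 c f + mul_l2 c g"
proof (rule l2_eqI)
  show "AE x in lborel. rep_l2 (mul_l2 c (f + g)) x = rep_l2 (mul_l2 c f + mul_l2 c g) x"
    using rep_mul_l2[OF assms, of "f + g"] rep_mul_l2[OF assms, of f] rep_mul_l2[OF assms, of g]
      rep_add_l2[of f g] rep_add_l2[of "mul_l2 c f" "mul_l2 c g"]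
    by eventually_elim (simp add: algebra_simps)
qed

lemma mul_l2_cmul:
  assumes "cper c" shows "mul_l2 c (cmul_l2 r f) = cmul_l2 r (mul_l2 c f)"
proof (rule l2_eqI)
  show "AE x in lborel. rep_l2 (mul_l2 c (cmul_l2 r f)) x = rep_l2 (cmul_l2 r (mul_l2 c f)) x"
    using rep_mul_l2[OF assms, of "cmul_l2 r f"] rep_mul_l2[OF assms, of f]
      rep_cmul_l2[of r f] rep_cmul_l2[of r "mul_l2 c f"]
    by eventually_elim (simp add: algebra_simps)
qed

lemma mul_l2_add_left:
  assumes "cper c" "cper d" shows "mul_l2 (\<lambda>x. c x + d x) f = mul_l2 c f + mul_l2 d f"
proof (rule l2_eqI)
  show "AE x in lborel. rep_l2 (mul_l2 (\<lambda>x. c x + d x) f) x = rep_l2 (mul_l2 c f + mul_l2 d f) x"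
    using rep_mul_l2[OF assms(1), of f] rep_mul_l2[OF assms(2), of f]
      rep_mul_l2[OF cper_add[OF assms], of f] rep_add_l2[of "mul_l2 c f" "mul_l2 d f"]
    by eventually_elim (simp add: algebra_simps)
qed

lemma mul_l2_mult_left:
  assumes "cper c" "cper d" shows "mul_l2 (\<lambda>x. c x * d x) f = mul_l2 c (mul_l2 d f)"
proof (rule l2_eqI)
  show "AE x in lborel. rep_l2 (mul_l2 (\<lambda>x. c x * d x) f) x = rep_l2 (mul_l2 c (mul_l2 d f)) x"
    using rep_mul_l2[OF assms(1), of "mul_l2 d f"] rep_mul_l2[OF assms(2), of f]
      rep_mul_l2[OF cper_mult[OF assms], of f]
    by eventually_elim simp
qed

lemma mul_l2_const: "mul_l2 (\<lambda>x. r) f = r *\<^sub>R f"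
proof (rule l2_eqI)
  show "AE x in lborel. rep_l2 (mul_l2 (\<lambda>x. r) f) x = rep_l2 (r *\<^sub>R f) x"
    using rep_mul_l2[OF cper_const, of r f] rep_cmul_l2[of "of_real r" f] unfolding scaleR_l2
    by eventually_elim simp
qed

lemma mul_l2_scale: "cper c \<Longrightarrow> mul_l2 (\<lambda>x. r * c x) f = r *\<^sub>R mul_l2 c f"
  using mul_l2_mult_left[of "\<lambda>x. r" c] by (simp add: mul_l2_const)

lemma mul_l2_diff_left:
  "cper c \<Longrightarrow> cper d \<Longrightarrow> mul_l2 (\<lambda>x. c x - d x) f = mul_l2 c f - mul_l2 d f"
  using mul_l2_add_left[of c "\<lambda>x. - 1 * d x" f] mul_l2_scale[of d "- 1" f] cper_minus[of d] by simp

lemma mul_l2_scaleR: "cper c \<Longrightarrow> mul_l2 c (r *\<^sub>R f) = r *\<^sub>R mul_l2 c f"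
  by (simp add: scaleR_l2 mul_l2_cmul)

lemma bounded_linear_mul_l2:
  assumes "cper c" shows "bounded_linear (mul_l2 c)"
proof -
  obtain B where B: "B \<ge> 0" "\<And>x. x \<in> {0..1} \<Longrightarrow> \<bar>c x\<bar> \<le> B" using cper_bound[OF assms(1)] by blast
  show ?thesis
    using norm_mul_l2[OF assms B(2,1)]
    by (intro bounded_linear_intro[of _ B]) (simp_all add: mul_l2_add assms mul_l2_scaleR mult.commute)
qed

lemma cip_mul_l2:
  assumes "cper c" shows "cip (mul_l2 c f) g = cip f (mul_l2 c g)"
proof -
  have 1: "cip (mul_l2 c f) g = (LINT x:{0..1}|lborel. cnj (of_real (c x) * rep_l2 f x) * rep_l2 g x)"
    unfolding mul_l2_def by (intro cip_abs_left sq_int_mul sq_int_rep assms)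
  have 2: "cip f (mul_l2 c g) = (LINT x:{0..1}|lborel. cnj (rep_l2 f x) * (of_real (c x) * rep_l2 g x))"
    unfolding mul_l2_def by (intro cip_abs_right sq_int_mul sq_int_rep assms)
  show ?thesis unfolding 1 2 by (simp add: mult_ac)
qed

text \<open>The product rule, read off Fourier coefficients: the n-th coefficient of a product is
  the integral of \<open>h1_fun w\<close> against the coefficient times an exponential, and
  \<open>lint_by_parts\<close> with that test function yields both terms.\<close>

lemma weak_deriv_mul:
  assumes c: "\<And>x. (c has_real_derivative c' x) (at x)" and per: "periodic1 c" and c': "continuous_on UNIV c'"
  shows "weak_deriv (mul_l2 c (h1_fun w)) (mul_l2 c' (h1_fun w) + mul_l2 c (dh w))"
  unfolding weak_deriv_iff_fc
proof
  fix n
  have cc: "continuous_on UNIV c"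
    using c by (intro continuous_at_imp_continuous_on) (auto intro: DERIV_isCont)
  have "periodic1 c'"
    using periodic_deriv[OF per] c by (simp add: has_real_derivative_iff_has_vector_derivative)
  then have cp: "cper c" "cper c'" using cc c' per by (auto simp: cper_def)
  let ?\<psi> = "\<lambda>x. of_real (c x) * ex (- n) x" and ?\<psi>' = "\<lambda>x. of_real (c' x) * ex (- n) x + - dfac n * (of_real (c x) * ex (- n) x)"
  have "(LINT x:{0..1}|lborel. rep_l2 (h1_fun w) x * ?\<psi>' x) = - (LINT x:{0..1}|lborel. rep_l2 (dh w) x * ?\<psi> x)"
  proof (rule lint_by_parts)
    show "periodic1 ?\<psi>" using per periodic_ex[of "- n"] by (simp add: periodic1_def)
    show "(?\<psi> has_vector_derivative ?\<psi>' x) (at x)" for x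
      using has_vector_derivative_mult[OF has_vector_derivative_of_real[OF c[of x]] ex_deriv[of "- n" x UNIV]]
      by (simp add: dfac_minus algebra_simps)
    show "continuous_on UNIV ?\<psi>'" by (intro continuous_intros cc c')
  qed (rule fc_dh)
  moreover have "(LINT x:{0..1}|lborel. rep_l2 (h1_fun w) x * ?\<psi>' x) =
      (LINT x:{0..1}|lborel. rep_l2 (h1_fun w) x * (of_real (c' x) * ex (- n) x)) +
      (LINT x:{0..1}|lborel. rep_l2 (h1_fun w) x * (- dfac n * (of_real (c x) * ex (- n) x)))"
    unfolding distrib_left
    by (intro set_integral_add sq_int_times_continuous sq_int_rep continuous_intros cc c')
  moreover have "(LINT x:{0..1}|lborel. rep_l2 (h1_fun w) x * (- dfac n * (of_real (c x) * ex (- n) x))) =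
      (LINT x:{0..1}|lborel. - dfac n * (rep_l2 (h1_fun w) x * (of_real (c x) * ex (- n) x)))"
    by (simp only: mult.assoc mult.left_commute mult.commute)
  moreover have "fc (mul_l2 d f) n = (LINT x:{0..1}|lborel. rep_l2 f x * (of_real (d x) * ex (- n) x))" if "cper d" for d f
    unfolding mul_l2_def fc_abs[OF sq_int_mul[OF that sq_int_rep]] by (simp add: mult_ac)
  ultimately show "fc (mul_l2 c' (h1_fun w) + mul_l2 c (dh w)) n = dfac n * fc (mul_l2 c (h1_fun w)) n"
    unfolding fc_add using cp by (simp only: set_integral_mult_right) (simp add: algebra_simps)
qed

subsection \<open>An isomorphism onto the domain\<close>

lemma ell2_bound:
  assumes "\<And>n. cmod (c n) \<le> K * cmod (fc f n)" "K \<ge> 0"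
  shows "(\<Sum>n\<in>zI N. (cmod (c n))\<^sup>2) \<le> (K * norm f)\<^sup>2"
proof -
  have "(\<Sum>n\<in>zI N. (cmod (c n))\<^sup>2) \<le> (\<Sum>n\<in>zI N. K\<^sup>2 * (cmod (fc f n))\<^sup>2)"
    using power_mono[OF assms(1), of _ 2] by (intro sum_mono) (simp add: power_mult_distrib)
  also have "\<dots> \<le> K\<^sup>2 * (norm f)\<^sup>2"
    using bessel[of f N] by (simp add: sum_distrib_left[symmetric] mult_left_mono)
  finally show ?thesis by (simp add: power_mult_distrib)
qed

lemma multiplier_ex:
  assumes "\<And>n. cmod (c n) \<le> K * cmod (fc f n)" "K \<ge> 0"
  obtains g where "\<And>n. fc g n = c n"
  using riesz_fischer[of c] ell2_bound[OF assms] by (metis ell2_def)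

lemma norm_le_multiplier:
  assumes "\<And>n. cmod (fc g n) \<le> K * cmod (fc f n)" "K \<ge> 0"
  shows "norm g \<le> K * norm f"
  using assms by (intro norm_le_fc ell2_bound) auto

lemma dfac_norm: "cmod (dfac n) = 2 * pi * \<bar>n\<bar>"
  by (simp add: dfac_def norm_mult)

lemma dfac_nz: "1 + dfac n \<noteq> 0"
  by (auto simp: dfac_def complex_eq_iff)

lemma dfac_1: "1 \<le> cmod (1 + dfac n)" "cmod (dfac n) \<le> cmod (1 + dfac n)"
proof -
  show "1 \<le> cmod (1 + dfac n)"
    using abs_Re_le_cmod[of "1 + dfac n"] by (simp add: dfac_def)
  show "cmod (dfac n) \<le> cmod (1 + dfac n)"
    using abs_Im_le_cmod[of "1 + dfac n"] unfolding dfac_norm by (simp add: dfac_def abs_mult)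
qed

text \<open>The inverse of 1 + d/dx. The shift by 1 removes the constants from the kernel:
  \<open>dfac n\<close> is imaginary, so 1 + \<open>dfac n\<close> has modulus at least 1 and
  dominates \<open>dfac n\<close>, and the solution is one derivative smoother than
  \<open>f\<close>.\<close>

definition Bm :: "l2 \<Rightarrow> h1" where "Bm f = (THE w. h1_fun w + dh w = f)"

lemma Bm_ex1: "\<exists>!w. h1_fun w + dh w = f"
proof -
  have le: "cmod (fc f n / (1 + dfac n)) \<le> 1 * cmod (fc f n)" "cmod (dfac n * fc f n / (1 + dfac n)) \<le> 1 * cmod (fc f n)" for n
  proof -
    have "cmod (fc f n) * 1 \<le> cmod (fc f n) * cmod (1 + dfac n)" using dfac_1[of n] by (intro mult_left_mono) auto
    then show "cmod (fc f n / (1 + dfac n)) \<le> 1 * cmod (fc f n)"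
      using dfac_nz[of n] by (simp add: norm_divide pos_divide_le_eq)
    have "cmod (dfac n) * cmod (fc f n) \<le> cmod (1 + dfac n) * cmod (fc f n)" using dfac_1[of n] by (intro mult_right_mono) auto
    then show "cmod (dfac n * fc f n / (1 + dfac n)) \<le> 1 * cmod (fc f n)"
      using dfac_nz[of n] by (simp add: norm_divide norm_mult pos_divide_le_eq mult.commute)
  qed
  obtain g g' where g: "\<And>n. fc g n = fc f n / (1 + dfac n)" "\<And>n. fc g' n = dfac n * fc f n / (1 + dfac n)"
    using multiplier_ex[OF le(1)] multiplier_ex[OF le(2)] by (metis zero_le_one)
  then have "weak_deriv g g'" by (simp add: weak_deriv_iff_fc)
  then obtain w where w: "h1_fun w = g" "dh w = g'" by (rule h1_ex)
  have "h1_fun w + dh w = f"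
    using dfac_nz by (intro fc_eqI) (simp add: w fc_add g add_divide_distrib[symmetric] divide_eq_eq algebra_simps)
  moreover have "v = w" if "h1_fun v + dh v = h1_fun w + dh w" for v w
  proof (rule h1_eqI, rule fc_eqI)
    fix n
    have "fc (h1_fun v + dh v) n = fc (h1_fun w + dh w) n" using that by simp
    then have "(1 + dfac n) * fc (h1_fun v) n = (1 + dfac n) * fc (h1_fun w) n"
      by (simp add: fc_add fc_dh algebra_simps)
    then show "fc (h1_fun v) n = fc (h1_fun w) n" using dfac_nz[of n] by simp
  qed
  ultimately show ?thesis by blast
qed

lemma Bm: "h1_fun (Bm f) + dh (Bm f) = f"
  unfolding Bm_def by (rule theI'[OF Bm_ex1])

lemma Bm_unique: "h1_fun w + dh w = f \<Longrightarrow> Bm f = w"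
  using Bm_ex1[of f] Bm[of f] by blast

lemma dh_Bm: "dh (Bm f) = f - h1_fun (Bm f)"
  using Bm[of f] by (simp add: algebra_simps)

lemma fc_Bm: "fc (h1_fun (Bm f)) n = fc f n / (1 + dfac n)"
proof -
  have "fc f n = fc (h1_fun (Bm f) + dh (Bm f)) n" by (simp only: Bm)
  also have "\<dots> = (1 + dfac n) * fc (h1_fun (Bm f)) n" by (simp add: fc_add fc_dh algebra_simps)
  finally show ?thesis using dfac_nz[of n] by simp
qed

lemma bounded_linear_Bm: "bounded_linear Bm"
proof (rule bounded_linear_intro[of _ 3])
  show "Bm (f + g) = Bm f + Bm g" for f g
    by (rule Bm_unique) (simp add: h1_fun_add dh_add dh_Bm)
  show "Bm (r *\<^sub>R f) = r *\<^sub>R Bm f" for r f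
    by (rule Bm_unique) (simp add: h1_fun_scaleR dh_scaleR dh_Bm algebra_simps)
  show "norm (Bm f) \<le> norm f * 3" for f
  proof -
    have "norm (h1_fun (Bm f)) \<le> 1 * norm f"
    proof (rule norm_le_multiplier)
      show "cmod (fc (h1_fun (Bm f)) n) \<le> 1 * cmod (fc f n)" for n
        using dfac_1(1)[of n] mult_left_mono[OF dfac_1(1)[of n], of "cmod (fc f n)"] dfac_nz[of n]
        by (simp add: fc_Bm norm_divide pos_divide_le_eq)
    qed simp
    then show ?thesis
      using norm_h1_le[of "Bm f"] norm_triangle_ineq4[of f "h1_fun (Bm f)"] by (simp add: dh_Bm)
  qed
qed

lemma Bm_cmul: "Bm (cmul_l2 c f) = cmul_h1 c (Bm f)"
  by (rule Bm_unique) (simp add: h1_fun_cmul dh_cmul cmul_l2.add_right[symmetric] Bm)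

subsection \<open>Differentiable families on a half-open interval\<close>

text \<open>Families in the amplitude \<open>x\<close> with \<open>n\<close> derivatives, all
  jointly continuous with a parameter \<open>t\<close> in the unit interval, later the parameter of
  the contour. The interval is closed at 0 because derivatives in the amplitude at 0 are one-sided.
  Derivatives are existentially quantified so that closure under algebraic operations is an
  induction on \<open>n\<close>.\<close>

primrec CDT :: "nat \<Rightarrow> real \<Rightarrow> (real \<Rightarrow> real \<Rightarrow> 'a::real_normed_vector) \<Rightarrow> bool" where
  "CDT 0 d f \<longleftrightarrow> continuous_on ({0..<d} \<times> {0..1}) (\<lambda>(x, t). f x t)"
| "CDT (Suc n) d f \<longleftrightarrow> continuous_on ({0..<d} \<times> {0..1}) (\<lambda>(x, t). f x t) \<and>
     (\<exists>f'. (\<forall>x\<in>{0..<d}. \<forall>t\<in>{0..1}. ((\<lambda>x. f x t) has_vector_derivative f' x t) (at x within {0..<d})) \<and> CDT n d f')"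

abbreviation CD :: "nat \<Rightarrow> real \<Rightarrow> (real \<Rightarrow> 'a::real_normed_vector) \<Rightarrow> bool" where
  "CD n d f \<equiv> CDT n d (\<lambda>x t. f x)"

lemma continuous_on_fstI: "continuous_on S g \<Longrightarrow> continuous_on (S \<times> T) (\<lambda>p. g (fst p))"
  by (rule continuous_on_compose2[OF _ continuous_on_fst[OF continuous_on_id]]) auto

lemma continuous_on_sndI: "continuous_on T g \<Longrightarrow> continuous_on (S \<times> T) (\<lambda>p. g (snd p))"
  by (rule continuous_on_compose2[OF _ continuous_on_snd[OF continuous_on_id]]) auto

lemma continuous_on_section1:
  assumes "continuous_on (S \<times> T) (\<lambda>(x, t). f x t)" "x \<in> S"
  shows "continuous_on T (f x)"
proof -
  have "continuous_on T (\<lambda>t. (\<lambda>(x, t). f x t) (x, t))"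
    by (rule continuous_on_compose2[OF assms(1)]) (auto intro!: continuous_intros assms(2))
  then show ?thesis by simp
qed

lemma continuous_on_section2:
  assumes "continuous_on (S \<times> T) (\<lambda>(x, t). f x t)" "t \<in> T"
  shows "continuous_on S (\<lambda>x. f x t)"
proof -
  have "continuous_on S (\<lambda>x. (\<lambda>(x, t). f x t) (x, t))"
    by (rule continuous_on_compose2[OF assms(1)]) (auto intro!: continuous_intros assms(2))
  then show ?thesis by simp
qed

lemma CDT_cont: "CDT n d f \<Longrightarrow> continuous_on ({0..<d} \<times> {0..1}) (\<lambda>(x, t). f x t)"
  by (cases n) auto

lemma CDT_0: "CDT n d f \<Longrightarrow> CDT 0 d f" using CDT_cont by auto

lemma CDT_SucE:
  assumes "CDT (Suc n) d f"
  obtains f' where "\<forall>x\<in>{0..<d}. \<forall>t\<in>{0..1}. ((\<lambda>x. f x t) has_vector_derivative f' x t) (at x within {0..<d})" "CDT n d f'"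
  using assms by auto

lemma CDT_SucI:
  assumes "CDT 0 d f" "\<And>x t. 0 \<le> x \<Longrightarrow> x < d \<Longrightarrow> 0 \<le> t \<Longrightarrow> t \<le> 1 \<Longrightarrow>
      ((\<lambda>x. f x t) has_vector_derivative f' x t) (at x within {0..<d})" "CDT n d f'"
  shows "CDT (Suc n) d f"
  unfolding CDT.simps(2)
proof (intro conjI exI[of _ f'] ballI)
  show "continuous_on ({0..<d} \<times> {0..1}) (\<lambda>(x, t). f x t)" by (rule CDT_cont[OF assms(1)])
qed (use assms in auto)

declare CDT.simps(2) [simp del]

lemma CDT_Suc: "CDT (Suc n) d f \<Longrightarrow> CDT n d f"
proof (induction n arbitrary: f)
  case (Suc n)
  from CDT_SucE[OF Suc.prems] obtain f' where f': "\<forall>x\<in>{0..<d}. \<forall>t\<in>{0..1}. ((\<lambda>x. f x t) has_vector_derivative f' x t) (at x within {0..<d})" "CDT (Suc n) d f'" .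
  show ?case
    by (rule CDT_SucI[OF CDT_0[OF Suc.prems] _ Suc.IH[OF f'(2)]]) (use f' in auto)
qed (rule CDT_0)

lemma CDT_mono: "CDT n d f \<Longrightarrow> m \<le> n \<Longrightarrow> CDT m d f"
  by (induction n) (auto simp: le_Suc_eq dest: CDT_Suc)

lemma CDT_restrict: "CDT n d f \<Longrightarrow> e \<le> d \<Longrightarrow> CDT n e f"
proof (induction n arbitrary: f)
  case 0
  then show ?case by (auto elim!: continuous_on_subset)
next
  case (Suc n)
  obtain f' where f': "\<forall>x\<in>{0..<d}. \<forall>t\<in>{0..1}. ((\<lambda>x. f x t) has_vector_derivative f' x t) (at x within {0..<d})" "CDT n d f'"
    using CDT_SucE[OF Suc.prems(1)] by blast
  show ?case
  proof (rule CDT_SucI)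
    show "CDT 0 e f" using CDT_0[OF Suc.prems(1)] Suc.prems(2) by (auto elim!: continuous_on_subset)
    show "((\<lambda>x. f x t) has_vector_derivative f' x t) (at x within {0..<e})" if "0 \<le> x" "x < e" "0 \<le> t" "t \<le> 1" for x t
      using that Suc.prems(2) by (intro has_vector_derivative_within_subset[OF f'(1)[rule_format]]) auto
    show "CDT n e f'" by (rule Suc.IH[OF f'(2) Suc.prems(2)])
  qed
qed

lemma CDT_cong:
  assumes "CDT n d f" "\<And>x t. 0 \<le> x \<Longrightarrow> x < d \<Longrightarrow> 0 \<le> t \<Longrightarrow> t \<le> 1 \<Longrightarrow> f x t = g x t"
  shows "CDT n d g"
proof -
  have c: "CDT 0 d g"
    using CDT_cont[OF assms(1)] assms(2) unfolding CDT.simps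
    by (subst continuous_on_cong[OF refl, of _ _ "\<lambda>(x, t). f x t"]) auto
  show ?thesis
  proof (cases n)
    case (Suc m)
    then obtain f' where f': "\<forall>x\<in>{0..<d}. \<forall>t\<in>{0..1}. ((\<lambda>x. f x t) has_vector_derivative f' x t) (at x within {0..<d})" "CDT m d f'"
      using CDT_SucE[OF assms(1)[unfolded Suc]] by blast
    show ?thesis unfolding Suc
    proof (rule CDT_SucI[OF c _ f'(2)])
      show "((\<lambda>x. g x t) has_vector_derivative f' x t) (at x within {0..<d})" if "0 \<le> x" "x < d" "0 \<le> t" "t \<le> 1" for x t
        using f'(1) that assms(2)
        by (intro has_vector_derivative_transform[of x "{0..<d}" "\<lambda>x. g x t" "\<lambda>x. f x t"]) auto
    qed
  qed (use c in simp)
qed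

lemma CDT_const: "CDT n d (\<lambda>x t. c)"
  by (induction n arbitrary: c) (auto intro!: CDT_SucI[where f' = "\<lambda>x t. 0"] continuous_intros)

lemma CDT_param: "continuous_on {0..1} g \<Longrightarrow> CDT n d (\<lambda>x t. g t)"
proof (cases n)
  case 0
  assume "continuous_on {0..1} g"
  then have "continuous_on ({0..<d} \<times> {0..1}) (\<lambda>p. g (snd p))"
    by (rule continuous_on_sndI)
  then show ?thesis using 0 by (simp add: split_beta)
next
  case (Suc m)
  assume "continuous_on {0..1} g"
  then have "continuous_on ({0..<d} \<times> {0..1}) (\<lambda>p. g (snd p))"
    by (rule continuous_on_sndI)
  then show ?thesis unfolding Suc
    by (intro CDT_SucI[where f' = "\<lambda>x t. 0"] CDT_const) (auto simp: split_beta)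
qed

lemma CDT_linear:
  assumes L: "bounded_linear L"
  shows "CDT n d f \<Longrightarrow> CDT n d (\<lambda>x t. L (f x t))"
proof (induction n arbitrary: f)
  case 0
  then show ?case
    using bounded_linear.continuous_on[OF L, of "{0..<d} \<times> {0..1}" "\<lambda>(x, t). f x t"] by (simp add: split_beta)
next
  case (Suc n)
  obtain f' where f': "\<forall>x\<in>{0..<d}. \<forall>t\<in>{0..1}. ((\<lambda>x. f x t) has_vector_derivative f' x t) (at x within {0..<d})" "CDT n d f'"
    using CDT_SucE[OF Suc.prems(1)] by blast
  have "CDT 0 d (\<lambda>x t. L (f x t))"
    using bounded_linear.continuous_on[OF L CDT_cont[OF Suc.prems]] by (simp add: split_beta)
  then show ?case
    by (rule CDT_SucI[where f' = "\<lambda>x t. L (f' x t)"])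
      (use f' Suc.IH in \<open>auto intro: bounded_linear.has_vector_derivative[OF L]\<close>)
qed

lemma CDT_add: "CDT n d f \<Longrightarrow> CDT n d g \<Longrightarrow> CDT n d (\<lambda>x t. f x t + g x t)"
proof (induction n arbitrary: f g)
  case 0
  then show ?case by (auto simp: split_beta intro: continuous_intros)
next
  case (Suc n)
  obtain f' where f': "\<forall>x\<in>{0..<d}. \<forall>t\<in>{0..1}. ((\<lambda>x. f x t) has_vector_derivative f' x t) (at x within {0..<d})" "CDT n d f'"
    using CDT_SucE[OF Suc.prems(1)] by blast
  obtain g' where g': "\<forall>x\<in>{0..<d}. \<forall>t\<in>{0..1}. ((\<lambda>x. g x t) has_vector_derivative g' x t) (at x within {0..<d})" "CDT n d g'"
    using CDT_SucE[OF Suc.prems(2)] by blast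
  have "CDT 0 d (\<lambda>x t. f x t + g x t)"
    using Suc.prems[THEN CDT_cont] by (auto simp: split_beta intro: continuous_intros)
  then show ?case
    by (rule CDT_SucI[where f' = "\<lambda>x t. f' x t + g' x t"])
      (use f' g' Suc.IH in \<open>auto intro: has_vector_derivative_add\<close>)
qed

lemma CDT_minus: "CDT n d f \<Longrightarrow> CDT n d (\<lambda>x t. - f x t)"
  by (rule CDT_linear[OF bounded_linear_minus[OF bounded_linear_ident]])

lemma CDT_diff: "CDT n d f \<Longrightarrow> CDT n d g \<Longrightarrow> CDT n d (\<lambda>x t. f x t - g x t)"
  using CDT_add[OF _ CDT_minus, of n d f g] by simp

lemma CDT_bilinear:
  assumes B: "bounded_bilinear B"
  shows "CDT n d f \<Longrightarrow> CDT n d g \<Longrightarrow> CDT n d (\<lambda>x t. B (f x t) (g x t))"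
proof (induction n arbitrary: f g)
  case 0
  then show ?case
    using bounded_bilinear.continuous_on[OF B, of "{0..<d} \<times> {0..1}" "\<lambda>(x, t). f x t" "\<lambda>(x, t). g x t"]
    by (simp add: split_beta)
next
  case (Suc n)
  obtain f' where f': "\<forall>x\<in>{0..<d}. \<forall>t\<in>{0..1}. ((\<lambda>x. f x t) has_vector_derivative f' x t) (at x within {0..<d})" "CDT n d f'"
    using CDT_SucE[OF Suc.prems(1)] by blast
  obtain g' where g': "\<forall>x\<in>{0..<d}. \<forall>t\<in>{0..1}. ((\<lambda>x. g x t) has_vector_derivative g' x t) (at x within {0..<d})" "CDT n d g'"
    using CDT_SucE[OF Suc.prems(2)] by blast
  have "CDT 0 d (\<lambda>x t. B (f x t) (g x t))"
    using bounded_bilinear.continuous_on[OF B Suc.prems[THEN CDT_cont]] by (simp add: split_beta)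
  then show ?case
  proof (rule CDT_SucI[where f' = "\<lambda>x t. B (f x t) (g' x t) + B (f' x t) (g x t)"])
    show "((\<lambda>x. B (f x t) (g x t)) has_vector_derivative B (f x t) (g' x t) + B (f' x t) (g x t)) (at x within {0..<d})"
      if "0 \<le> x" "x < d" "0 \<le> t" "t \<le> 1" for x t
      using f' g' that by (auto intro: bounded_bilinear.has_vector_derivative[OF B])
    show "CDT n d (\<lambda>x t. B (f x t) (g' x t) + B (f' x t) (g x t))"
      using Suc.IH f' g' Suc.prems[THEN CDT_Suc] by (intro CDT_add) auto
  qed
qed

text \<open>Differentiation under the integral over \<open>t\<close>; it carries the smoothness of
  the resolvent over to the Riesz projection.\<close>

lemma CDT_integral:
  fixes f :: "real \<Rightarrow> real \<Rightarrow> 'a::banach"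
  shows "CDT n d f \<Longrightarrow> CD n d (\<lambda>x. integral {0..1} (f x))"
proof (induction n arbitrary: f)
  case 0
  then have "continuous_on ({0..<d}) (\<lambda>x. integral {0..1} (f x))"
    using integral_continuous_on_param[of "{0..<d}" 0 1 f] by (simp add: cbox_interval)
  then have "continuous_on ({0..<d} \<times> {0..1::real}) (\<lambda>p. integral {0..1} (f (fst p)))"
    by (rule continuous_on_fstI)
  then show ?case by (simp add: split_beta)
next
  case (Suc n)
  obtain f' where f': "\<forall>x\<in>{0..<d}. \<forall>t\<in>{0..1}. ((\<lambda>x. f x t) has_vector_derivative f' x t) (at x within {0..<d})" "CDT n d f'"
    using CDT_SucE[OF Suc.prems] by blast
  note c = CDT_cont[OF Suc.prems]
  have "continuous_on ({0..<d}) (\<lambda>x. integral {0..1} (f x))"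
    using c integral_continuous_on_param[of "{0..<d}" 0 1 f] by (simp add: cbox_interval)
  then have "continuous_on ({0..<d} \<times> {0..1::real}) (\<lambda>p. integral {0..1} (f (fst p)))"
    by (rule continuous_on_fstI)
  then have 0: "CD 0 d (\<lambda>x. integral {0..1} (f x))" by (simp add: split_beta)
  show ?case
  proof (rule CDT_SucI[OF 0, where f' = "\<lambda>x t. integral {0..1} (f' x)"])
    fix x t :: real assume "0 \<le> x" "x < d"
    have "((\<lambda>x. integral (cbox 0 1) (f x)) has_vector_derivative integral (cbox 0 1) (f' x)) (at x within {0..<d})"
    proof (rule leibniz_rule_vector_derivative)
      show "f x integrable_on cbox 0 1" if "x \<in> {0..<d}" for x
        using continuous_on_section1[OF c that] by (simp add: integrable_continuous_real)
    qed (use f' CDT_cont[OF f'(2)] \<open>0 \<le> x\<close> \<open>x < d\<close> in \<open>auto simp: cbox_interval\<close>)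
    then show "((\<lambda>x. integral {0..1} (f x)) has_vector_derivative integral {0..1} (f' x)) (at x within {0..<d})"
      by simp
  qed (rule Suc.IH[OF f'(2)])
qed

section \<open>Differentiability of operator inverses\<close>

definition binv :: "('a::real_normed_vector \<Rightarrow>\<^sub>L 'a) \<Rightarrow> ('a \<Rightarrow>\<^sub>L 'a) \<Rightarrow> bool" where
  "binv M N \<longleftrightarrow> M o\<^sub>L N = id_blinfun \<and> N o\<^sub>L M = id_blinfun"

lemmas bl_compose = bounded_bilinear_blinfun_compose

lemma blinfun_compose_assoc: "(A o\<^sub>L B) o\<^sub>L C = A o\<^sub>L (B o\<^sub>L C)"
  by (rule blinfun_eqI) simp

lemma blinfun_compose_id [simp]: "A o\<^sub>L id_blinfun = A" "id_blinfun o\<^sub>L A = A"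
  by (rule blinfun_eqI, simp)+

lemma binv_diff:
  assumes "binv M N" "binv M' N'"
  shows "N' - N = - (N' o\<^sub>L (M' - M) o\<^sub>L N)"
proof -
  have "N' o\<^sub>L (M' - M) o\<^sub>L N = ((N' o\<^sub>L M') o\<^sub>L N) - (N' o\<^sub>L (M o\<^sub>L N))"
    by (simp only: bounded_bilinear.diff_left[OF bl_compose] bounded_bilinear.diff_right[OF bl_compose] blinfun_compose_assoc)
  then show ?thesis using assms by (simp add: binv_def)
qed

text \<open>The identity of \<open>binv_diff\<close> bounds the difference by means of
  \<open>N'\<close> itself; the smallness assumption absorbs this and bounds \<open>N'\<close> by
  twice \<open>N\<close>.\<close>

lemma norm_binv_diff:
  assumes "binv M N" "binv M' N'" "norm (M' - M) * norm N \<le> 1 / 2"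
  shows "norm (N' - N) \<le> 2 * (norm N)\<^sup>2 * norm (M' - M)"
proof -
  have 1: "norm (N' - N) \<le> norm N' * norm (M' - M) * norm N"
    unfolding binv_diff[OF assms(1,2)] norm_minus_cancel
    by (rule order_trans[OF norm_blinfun_compose mult_right_mono[OF norm_blinfun_compose norm_ge_zero]])
  also have "\<dots> \<le> norm N' * (1 / 2)"
    using mult_left_mono[OF assms(3), of "norm N'"] by (simp add: mult.assoc)
  finally have "norm N' \<le> 2 * norm N" using norm_triangle_sub[of N' N] by simp
  then have "norm N' * (norm (M' - M) * norm N) \<le> 2 * norm N * (norm (M' - M) * norm N)"
    by (intro mult_right_mono) auto
  then show ?thesis using 1 by (simp add: power2_eq_square mult_ac)
qed

lemma binv_continuous:
  assumes M: "continuous_on S M" and inv: "\<And>s. s \<in> S \<Longrightarrow> binv (M s) (N s)"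
  shows "continuous_on S N"
  unfolding continuous_on_def
proof
  fix s assume s: "s \<in> S"
  have lim: "((\<lambda>x. norm (M x - M s)) \<longlongrightarrow> 0) (at s within S)"
    using M s by (auto simp: continuous_on_def tendsto_norm_zero Lim_null[symmetric])
  have ev: "\<forall>\<^sub>F x in at s within S. x \<in> S \<and> norm (M x - M s) < 1 / (2 * (norm (N s) + 1))"
    using order_tendstoD(2)[OF lim, of "1 / (2 * (norm (N s) + 1))"]
    by (intro eventually_conj) (auto simp: eventually_at_filter add_nonneg_pos)
  show "(N \<longlongrightarrow> N s) (at s within S)"
  proof (rule Lim_null[THEN iffD2], rule Lim_null_comparison)
    show "\<forall>\<^sub>F x in at s within S. norm (N x - N s) \<le> 2 * (norm (N s))\<^sup>2 * norm (M x - M s)"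
      using ev
    proof eventually_elim
      case (elim x)
      have "norm (M x - M s) * norm (N s) \<le> 1 / (2 * (norm (N s) + 1)) * norm (N s)"
        using elim by (intro mult_right_mono) auto
      also have "\<dots> = (norm (N s) / (norm (N s) + 1)) / 2" by (simp add: field_simps)
      also have "\<dots> \<le> 1 / 2" by (simp add: divide_le_eq add_nonneg_pos)
      finally show ?case using elim s by (intro norm_binv_diff inv) auto
    qed
    show "((\<lambda>x. 2 * (norm (N s))\<^sup>2 * norm (M x - M s)) \<longlongrightarrow> 0) (at s within S)"
      using tendsto_mult_right_zero[OF lim] by simp
  qed
qed

text \<open>By \<open>binv_diff\<close> the remainder has two parts: \<open>N y\<close> times the
  remainder of \<open>M\<close> times \<open>N x\<close>, small because \<open>M\<close> is
  differentiable, and the increment times \<open>(N x - N y) o\<^sub>L M' o\<^sub>L N x\<close>,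
  small because \<open>N\<close> is continuous.\<close>

lemma binv_deriv:
  assumes M: "(M has_vector_derivative M') (at x within S)" and x: "x \<in> S"
    and inv: "\<And>s. s \<in> S \<Longrightarrow> binv (M s) (N s)" and c: "continuous_on S N"
  shows "(N has_vector_derivative - (N x o\<^sub>L M' o\<^sub>L N x)) (at x within S)"
  unfolding has_vector_derivative_def has_derivative_within'
proof (intro conjI allI impI)
  show "bounded_linear (\<lambda>h. h *\<^sub>R - (N x o\<^sub>L M' o\<^sub>L N x))" by (rule bounded_linear_scaleR_left)
  have lim: "((\<lambda>y. (1 / norm (y - x)) *\<^sub>R (M y - M x - (y - x) *\<^sub>R M')) \<longlongrightarrow> 0) (at x within S)"
    using M unfolding has_vector_derivative_def has_derivative_within by (auto simp: diff_diff_eq)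
  have N: "(N \<longlongrightarrow> N x) (at x within S)" using c x by (auto simp: continuous_on_def)
  have "((\<lambda>y. - (N y o\<^sub>L ((1 / norm (y - x)) *\<^sub>R (M y - M x - (y - x) *\<^sub>R M')) o\<^sub>L N x)) \<longlongrightarrow> - (N x o\<^sub>L 0 o\<^sub>L N x)) (at x within S)"
    by (intro tendsto_minus bounded_bilinear.tendsto[OF bl_compose] N lim tendsto_const)
  moreover have "((\<lambda>y. ((y - x) / norm (y - x)) *\<^sub>R ((N x - N y) o\<^sub>L M' o\<^sub>L N x)) \<longlongrightarrow> 0) (at x within S)"
  proof (rule Lim_null_comparison)
    show "\<forall>\<^sub>F y in at x within S. norm (((y - x) / norm (y - x)) *\<^sub>R ((N x - N y) o\<^sub>L M' o\<^sub>L N x)) \<le> norm ((N x - N y) o\<^sub>L M' o\<^sub>L N x)"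
      by (intro always_eventually allI) (auto simp: divide_simps)
    have "((\<lambda>y. norm ((N x - N y) o\<^sub>L M' o\<^sub>L N x)) \<longlongrightarrow> norm ((N x - N x) o\<^sub>L M' o\<^sub>L N x)) (at x within S)"
      by (intro tendsto_norm bounded_bilinear.tendsto[OF bl_compose] tendsto_diff N tendsto_const)
    then show "((\<lambda>y. norm ((N x - N y) o\<^sub>L M' o\<^sub>L N x)) \<longlongrightarrow> 0) (at x within S)"
      by (simp add: bounded_bilinear.zero_left[OF bl_compose])
  qed
  ultimately have "((\<lambda>y. - (N y o\<^sub>L ((1 / norm (y - x)) *\<^sub>R (M y - M x - (y - x) *\<^sub>R M')) o\<^sub>L N x)
      + ((y - x) / norm (y - x)) *\<^sub>R ((N x - N y) o\<^sub>L M' o\<^sub>L N x)) \<longlongrightarrow> - (N x o\<^sub>L 0 o\<^sub>L N x) + 0) (at x within S)"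
    by (rule tendsto_add)
  then have L: "((\<lambda>y. - (N y o\<^sub>L ((1 / norm (y - x)) *\<^sub>R (M y - M x - (y - x) *\<^sub>R M')) o\<^sub>L N x)
      + ((y - x) / norm (y - x)) *\<^sub>R ((N x - N y) o\<^sub>L M' o\<^sub>L N x)) \<longlongrightarrow> 0) (at x within S)"
    by (simp add: bounded_bilinear.zero_left[OF bl_compose] bounded_bilinear.zero_right[OF bl_compose])
  fix e :: real assume "0 < e"
  from tendstoD[OF L this] obtain r where r: "r > 0" "\<And>y. y \<in> S \<Longrightarrow> y \<noteq> x \<Longrightarrow> dist y x < r \<Longrightarrow>
      norm (- (N y o\<^sub>L ((1 / norm (y - x)) *\<^sub>R (M y - M x - (y - x) *\<^sub>R M')) o\<^sub>L N x)
      + ((y - x) / norm (y - x)) *\<^sub>R ((N x - N y) o\<^sub>L M' o\<^sub>L N x)) < e"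
    unfolding eventually_at by auto
  have eq: "norm (N y - N x - (y - x) *\<^sub>R - (N x o\<^sub>L M' o\<^sub>L N x)) / norm (y - x) =
      norm (- (N y o\<^sub>L ((1 / norm (y - x)) *\<^sub>R (M y - M x - (y - x) *\<^sub>R M')) o\<^sub>L N x)
      + ((y - x) / norm (y - x)) *\<^sub>R ((N x - N y) o\<^sub>L M' o\<^sub>L N x))" if "y \<in> S" "y \<noteq> x" for y
  proof -
    have "N y - N x - (y - x) *\<^sub>R - (N x o\<^sub>L M' o\<^sub>L N x) =
       - (N y o\<^sub>L (M y - M x - (y - x) *\<^sub>R M') o\<^sub>L N x) + (y - x) *\<^sub>R ((N x - N y) o\<^sub>L M' o\<^sub>L N x)"
      unfolding binv_diff[OF inv[OF x] inv[OF that(1)]]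
      by (simp add: bounded_bilinear.diff_left[OF bl_compose] bounded_bilinear.diff_right[OF bl_compose]
          bounded_bilinear.scaleR_left[OF bl_compose] bounded_bilinear.scaleR_right[OF bl_compose] scaleR_diff_right)
    moreover define Q where "Q = M y - M x - (y - x) *\<^sub>R M'"
    ultimately have "N y - N x - (y - x) *\<^sub>R - (N x o\<^sub>L M' o\<^sub>L N x) =
       - (N y o\<^sub>L Q o\<^sub>L N x) + (y - x) *\<^sub>R ((N x - N y) o\<^sub>L M' o\<^sub>L N x)" by (simp only:)
    then have "(1 / norm (y - x)) *\<^sub>R (N y - N x - (y - x) *\<^sub>R - (N x o\<^sub>L M' o\<^sub>L N x)) =
       - (N y o\<^sub>L ((1 / norm (y - x)) *\<^sub>R Q) o\<^sub>L N x)
      + ((y - x) / norm (y - x)) *\<^sub>R ((N x - N y) o\<^sub>L M' o\<^sub>L N x)"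
      by (simp only: bounded_bilinear.scaleR_left[OF bl_compose] bounded_bilinear.scaleR_right[OF bl_compose]
          scaleR_add_right scaleR_minus_right scaleR_scaleR times_divide_eq_left mult_1)
    note this[unfolded Q_def]
    from arg_cong[OF this, of norm] show ?thesis by (simp add: divide_inverse mult.commute)
  qed
  show "\<exists>d>0. \<forall>x'\<in>S. 0 < norm (x' - x) \<and> norm (x' - x) < d \<longrightarrow>
      norm (N x' - N x - (x' - x) *\<^sub>R - (N x o\<^sub>L M' o\<^sub>L N x)) / norm (x' - x) < e"
    using r eq by (intro exI[of _ r]) (auto simp: dist_norm)
qed

text \<open>Bootstrap: the derivative of the inverse is built from \<open>N\<close> and
  \<open>M'\<close>, so each derivative of \<open>N\<close> is as regular as what has been shown
  already. Pointwise inverses suffice as input; continuity comes from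
  \<open>binv_continuous\<close>.\<close>

lemma CDT_inverse:
  assumes M: "CDT n d M"
    and inv: "\<And>x t. 0 \<le> x \<Longrightarrow> x < d \<Longrightarrow> 0 \<le> t \<Longrightarrow> t \<le> 1 \<Longrightarrow> binv (M x t) (N x t)"
  shows "CDT n d N"
proof -
  have "continuous_on ({0..<d} \<times> {0..1}) (\<lambda>p. N (fst p) (snd p))"
  proof (rule binv_continuous)
    show "continuous_on ({0..<d} \<times> {0..1}) (\<lambda>p. M (fst p) (snd p))"
      using CDT_cont[OF M] by (simp add: split_beta)
  qed (use inv in auto)
  then have 0: "CDT 0 d N" by (simp add: split_beta)
  have "CDT m d N" if "m \<le> n" for m
    using that
  proof (induction m)
    case (Suc m)
    obtain M' where M': "\<forall>x\<in>{0..<d}. \<forall>t\<in>{0..1}. ((\<lambda>x. M x t) has_vector_derivative M' x t) (at x within {0..<d})" "CDT m d M'"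
      using CDT_SucE[OF CDT_mono[OF M Suc.prems]] by blast
    show ?case
    proof (rule CDT_SucI[OF 0, where f' = "\<lambda>x t. - (N x t o\<^sub>L M' x t o\<^sub>L N x t)"])
      fix x t :: real assume xt: "0 \<le> x" "x < d" "0 \<le> t" "t \<le> 1"
      have "continuous_on {0..<d} (\<lambda>x. N x t)"
        using continuous_on_section2[OF CDT_cont[OF 0]] xt by simp
      then show "((\<lambda>x. N x t) has_vector_derivative - (N x t o\<^sub>L M' x t o\<^sub>L N x t)) (at x within {0..<d})"
        using xt M'(1) inv by (intro binv_deriv[where M = "\<lambda>x. M x t"]) auto
    next
      show "CDT m d (\<lambda>x t. - (N x t o\<^sub>L M' x t o\<^sub>L N x t))"
        using Suc M' by (intro CDT_minus CDT_bilinear[OF bl_compose]) auto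
    qed
  qed (rule 0)
  then show ?thesis by simp
qed

text \<open>The filters within \<open>{0..<d}\<close> and within \<open>{0..}\<close> agree at
  points below \<open>d\<close>, and each point of the half-line is a limit point of it, so
  one-sided derivatives are unique.\<close>

lemma ddelta_eq:
  assumes "(f has_vector_derivative f') (at x within {0..<d})" "0 \<le> x" "x < d"
  shows "ddelta f x = f'" "(f has_vector_derivative f') (at x within {0..})"
proof -
  have *: "at x within {0..<d} = at x within {0..}"
    using assms by (intro at_within_nhd[of x "{..<d}"]) auto
  then show w: "(f has_vector_derivative f') (at x within {0..})" using assms(1) by simp
  show "ddelta f x = f'"
    unfolding ddelta_def
  proof (rule vector_derivative_within[OF _ w])
    have "x islimpt {x<..<x + 1}" by (rule islimpt_greaterThanLessThan1) simp
    then have "x islimpt {0..}" by (rule islimpt_subset) (use assms(2) in auto)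
    then show "at x within {0..} \<noteq> bot" by (simp add: trivial_limit_within)
  qed
qed

lemma CD_ddelta:
  assumes "CD (Suc n) d f"
  shows "CD n d (ddelta f)"
    "0 \<le> x \<Longrightarrow> x < d \<Longrightarrow> (f has_vector_derivative ddelta f x) (at x within {0..<d})"
proof -
  obtain f' where f': "\<forall>x\<in>{0..<d}. \<forall>t\<in>{0..1::real}. (f has_vector_derivative f' x t) (at x within {0..<d})" "CDT n d f'"
    using CDT_SucE[OF assms] by blast
  have eq: "ddelta f x = f' x t" if "0 \<le> x" "x < d" "0 \<le> t" "t \<le> 1" for x t
    using f'(1) that by (intro ddelta_eq) auto
  show "CD n d (ddelta f)" by (rule CDT_cong[OF f'(2)]) (simp add: eq)
  show "(f has_vector_derivative ddelta f x) (at x within {0..<d})" if "0 \<le> x" "x < d"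
    using f'(1) eq[of x 0] that by auto
qed

text \<open>Iterated derivatives depend on the germ at each point only. This permits replacing the
  operators by explicit families that agree with them on a short interval.\<close>

lemma ddelta_cong:
  assumes "\<And>x. 0 \<le> x \<Longrightarrow> x < d \<Longrightarrow> f x = g x" "0 \<le> x" "x < d"
  shows "(ddelta ^^ n) f x = (ddelta ^^ n) g x"
  using assms
proof (induction n arbitrary: f g x)
  case (Suc n)
  have "ddelta f y = ddelta g y" if "0 \<le> y" "y < d" for y
    unfolding ddelta_def
  proof (rule vector_derivative_cong_eq)
    show "\<forall>\<^sub>F z in nhds y. z \<in> {0..} \<longrightarrow> f z = g z"
      using that Suc.prems(1) by (intro eventually_nhds_in_open[of "{..<d}" y, THEN eventually_mono]) auto
  qed (use that in auto)
  then show ?case using Suc.IH[of "ddelta f" "ddelta g"] Suc.prems by (simp add: funpow_swap1)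
qed simp

subsection \<open>Families of multiplication operators\<close>

primrec CX :: "nat \<Rightarrow> real \<Rightarrow> (real \<Rightarrow> real \<Rightarrow> real) \<Rightarrow> bool" where
  "CX 0 d c \<longleftrightarrow> continuous_on ({0..<d} \<times> UNIV) (\<lambda>(x, t). c x t) \<and> (\<forall>x\<in>{0..<d}. periodic1 (c x))"
| "CX (Suc n) d c \<longleftrightarrow> (continuous_on ({0..<d} \<times> UNIV) (\<lambda>(x, t). c x t) \<and> (\<forall>x\<in>{0..<d}. periodic1 (c x))) \<and>
     (\<exists>c'. (\<forall>x\<in>{0..<d}. \<forall>t. ((\<lambda>x. c x t) has_vector_derivative c' x t) (at x within {0..<d})) \<and> CX n d c')"

lemma CX_0: "CX n d c \<Longrightarrow> CX 0 d c"
  by (cases n) auto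

lemma CX_SucE:
  assumes "CX (Suc n) d c"
  obtains c' where "\<And>x t. 0 \<le> x \<Longrightarrow> x < d \<Longrightarrow> ((\<lambda>x. c x t) has_vector_derivative c' x t) (at x within {0..<d})" "CX n d c'"
proof -
  obtain c' where c': "\<forall>x\<in>{0..<d}. \<forall>t. ((\<lambda>x. c x t) has_vector_derivative c' x t) (at x within {0..<d})" "CX n d c'"
    using assms by auto
  show ?thesis by (rule that[of c']) (use c' in auto)
qed

lemma CX_SucI:
  assumes "CX 0 d c" "\<And>x t. 0 \<le> x \<Longrightarrow> x < d \<Longrightarrow> ((\<lambda>x. c x t) has_vector_derivative c' x t) (at x within {0..<d})" "CX n d c'"
  shows "CX (Suc n) d c"
  using assms unfolding CX.simps by (intro conjI exI[of _ c']) auto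

lemma CX_cper: "CX n d c \<Longrightarrow> 0 \<le> x \<Longrightarrow> x < d \<Longrightarrow> cper (c x)"
  using CX_0[of n d c] continuous_on_section1[of "{0..<d}" UNIV c x] by (auto simp: cper_def)

declare CX.simps [simp del]

definition mulop :: "(real \<Rightarrow> real) \<Rightarrow> l2 \<Rightarrow>\<^sub>L l2" where "mulop c = Blinfun (mul_l2 c)"

lemma mulop_apply [simp]: "cper c \<Longrightarrow> blinfun_apply (mulop c) f = mul_l2 c f"
  by (simp add: mulop_def bounded_linear_Blinfun_apply bounded_linear_mul_l2)

lemma norm_mulop:
  assumes "cper c" "\<And>x. x \<in> {0..1} \<Longrightarrow> \<bar>c x\<bar> \<le> B" "B \<ge> 0"
  shows "norm (mulop c) \<le> B"
  using assms by (intro norm_blinfun_bound) (auto intro: norm_mul_l2)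

text \<open>Shaped like a first-order Taylor remainder, so that the remainder of a family of
  operators is one multiplication operator whose norm is bounded by a supremum; \<open>r = 0\<close>
  gives plain differences.\<close>

lemma mulop_linear:
  assumes "cper c" "cper d" "cper e"
  shows "mulop (\<lambda>t. c t - d t - r * e t) = mulop c - mulop d - r *\<^sub>R mulop e"
  by (rule blinfun_eqI)
    (simp add: assms cper_diff cper_mult mul_l2_diff_left mul_l2_scale blinfun.diff_left blinfun.scaleR_left)

lemma CX_close:
  assumes "CX 0 d c" "0 \<le> x" "x < d" "e > 0"
  obtains r where "r > 0" "\<And>y t. 0 \<le> y \<Longrightarrow> y < d \<Longrightarrow> \<bar>y - x\<bar> < r \<Longrightarrow> t \<in> {0..1} \<Longrightarrow> \<bar>c y t - c x t\<bar> \<le> e"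
proof -
  have "continuous_on ({0..<d} \<times> {0..1}) (\<lambda>(x, t). c x t)"
    using assms(1) by (auto simp: CX.simps elim: continuous_on_subset)
  then obtain X where X: "x \<in> X" "open X" "\<forall>y\<in>X \<inter> {0..<d}. \<forall>t\<in>{0..1}. dist ((\<lambda>(x, t). c x t) (y, t)) ((\<lambda>(x, t). c x t) (x, t)) \<le> e"
    using continuous_on_prod_compactE[of "{0..<d}" "{0..1}" "\<lambda>(x, t). c x t" x e] assms by auto
  then obtain r where r: "r > 0" "ball x r \<subseteq> X" using open_contains_ball by metis
  show ?thesis
  proof (rule that[OF r(1)])
    fix y t :: real assume *: "0 \<le> y" "y < d" "\<bar>y - x\<bar> < r" "t \<in> {0..1}"
    then have "y \<in> X" using r(2) by (auto simp: dist_real_def abs_minus_commute)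
    then show "\<bar>c y t - c x t\<bar> \<le> e" using X(3) * by (auto simp: dist_real_def)
  qed
qed

text \<open>Joint continuity of \<open>c'\<close> is uniform in \<open>t\<close> over the compact
  period, and the mean value inequality in \<open>x\<close> turns this into a remainder estimate
  uniform in \<open>t\<close>, as differentiability in operator norm demands.\<close>

lemma CX_linearize:
  assumes c: "\<And>x t. 0 \<le> x \<Longrightarrow> x < d \<Longrightarrow> ((\<lambda>x. c x t) has_vector_derivative c' x t) (at x within {0..<d})"
    and c': "CX 0 d c'" and x: "0 \<le> x" "x < d" and "e > 0"
  obtains r where "r > 0" "\<And>y t. 0 \<le> y \<Longrightarrow> y < d \<Longrightarrow> \<bar>y - x\<bar> < r \<Longrightarrow> t \<in> {0..1} \<Longrightarrow>
    \<bar>c y t - c x t - (y - x) * c' x t\<bar> \<le> e * \<bar>y - x\<bar>"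
proof -
  obtain r where r: "r > 0" "\<And>y t. 0 \<le> y \<Longrightarrow> y < d \<Longrightarrow> \<bar>y - x\<bar> < r \<Longrightarrow> t \<in> {0..1} \<Longrightarrow> \<bar>c' y t - c' x t\<bar> \<le> e"
    using CX_close[OF c' x \<open>e > 0\<close>] by blast
  show ?thesis
  proof (rule that[OF r(1)])
    fix y t :: real assume *: "0 \<le> y" "y < d" "\<bar>y - x\<bar> < r" "t \<in> {0..1}"
    let ?S = "closed_segment x y"
    have S: "z \<in> {0..<d} \<and> \<bar>z - x\<bar> < r" if "z \<in> ?S" for z
      using that * x by (auto simp: closed_segment_eq_real_ivl split: if_splits)
    have "norm (c y t - c x t - (y - x) *\<^sub>R c' x t) \<le> norm (y - x) * e"
    proof (rule vector_differentiable_bound_linearization[where f' = "\<lambda>z. c' z t" and S = ?S])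
      show "((\<lambda>x. c x t) has_vector_derivative c' z t) (at z within ?S)" if "z \<in> ?S" for z
        using S that by (intro has_vector_derivative_within_subset[OF c]) auto
      show "norm (c' z t - c' x t) \<le> e" if "z \<in> ?S" for z using r(2) S[OF that] *(4) by auto
    qed auto
    then show "\<bar>c y t - c x t - (y - x) * c' x t\<bar> \<le> e * \<bar>y - x\<bar>" by (simp add: mult.commute)
  qed
qed

lemma mulop_deriv:
  assumes c: "CX 0 d c" "\<And>x t. 0 \<le> x \<Longrightarrow> x < d \<Longrightarrow> ((\<lambda>x. c x t) has_vector_derivative c' x t) (at x within {0..<d})"
    and c': "CX 0 d c'" and x: "0 \<le> x" "x < d"
  shows "((\<lambda>x. mulop (c x)) has_vector_derivative mulop (c' x)) (at x within {0..<d})"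
  unfolding has_vector_derivative_def has_derivative_within_alt
proof (intro conjI allI impI bounded_linear_scaleR_left)
  fix e :: real assume "0 < e"
  obtain r where r: "r > 0" "\<And>y t. 0 \<le> y \<Longrightarrow> y < d \<Longrightarrow> \<bar>y - x\<bar> < r \<Longrightarrow> t \<in> {0..1} \<Longrightarrow>
    \<bar>c y t - c x t - (y - x) * c' x t\<bar> \<le> e * \<bar>y - x\<bar>"
    using CX_linearize[OF c(2) c' x \<open>0 < e\<close>] by auto
  have "norm (mulop (c y) - mulop (c x) - (y - x) *\<^sub>R mulop (c' x)) \<le> e * norm (y - x)"
    if "y \<in> {0..<d}" "norm (y - x) < r" for y
  proof -
    have cp: "cper (c y)" "cper (c x)" "cper (c' x)" using that x by (auto intro: CX_cper[OF c(1)] CX_cper[OF c'])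
    show ?thesis
      unfolding mulop_linear[OF cp, symmetric]
      using r(2) that \<open>0 < e\<close> cp by (intro norm_mulop cper_diff cper_mult) auto
  qed
  then show "\<exists>r>0. \<forall>y\<in>{0..<d}. norm (y - x) < r \<longrightarrow>
      norm (mulop (c y) - mulop (c x) - (y - x) *\<^sub>R mulop (c' x)) \<le> e * norm (y - x)"
    using r(1) by blast
qed

lemma mulop_cont:
  assumes c: "CX 0 d c"
  shows "CD 0 d (\<lambda>x. mulop (c x))"
proof -
  have "continuous_on {0..<d} (\<lambda>x. mulop (c x))"
    unfolding continuous_on_iff
  proof (intro ballI allI impI)
    fix x e :: real assume x: "x \<in> {0..<d}" and "0 < e"
    then obtain r where r: "r > 0" "\<And>y t. 0 \<le> y \<Longrightarrow> y < d \<Longrightarrow> \<bar>y - x\<bar> < r \<Longrightarrow> t \<in> {0..1} \<Longrightarrow> \<bar>c y t - c x t\<bar> \<le> e / 2"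
      using CX_close[OF c, of x "e / 2"] by auto
    have "dist (mulop (c y)) (mulop (c x)) < e" if "y \<in> {0..<d}" "dist y x < r" for y
    proof -
      have cp: "cper (c y)" "cper (c x)" using CX_cper[OF c] x that by auto
      have "norm (mulop (\<lambda>t. c y t - c x t - 0 * c x t)) \<le> e / 2"
        using r(2) that \<open>0 < e\<close> cp by (intro norm_mulop cper_diff cper_mult) (auto simp: dist_real_def)
      then show ?thesis using \<open>0 < e\<close> unfolding mulop_linear[OF cp cp(2)] by (simp add: dist_norm)
    qed
    then show "\<exists>r>0. \<forall>y\<in>{0..<d}. dist y x < r \<longrightarrow> dist (mulop (c y)) (mulop (c x)) < e"
      using r(1) by blast
  qed
  then have "continuous_on ({0..<d} \<times> {0..1::real}) (\<lambda>p. mulop (c (fst p)))" by (rule continuous_on_fstI)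
  then show ?thesis by (simp add: split_beta)
qed

lemma CX_mulop: "CX n d c \<Longrightarrow> CD n d (\<lambda>x. mulop (c x))"
proof (induction n arbitrary: c)
  case (Suc n)
  obtain c' where c': "\<And>x t. 0 \<le> x \<Longrightarrow> x < d \<Longrightarrow> ((\<lambda>x. c x t) has_vector_derivative c' x t) (at x within {0..<d})" "CX n d c'"
    using CX_SucE[OF Suc.prems] by blast
  show ?case
  proof (rule CDT_SucI)
    show "CD 0 d (\<lambda>x. mulop (c x))" by (rule mulop_cont[OF CX_0[OF Suc.prems]])
    show "((\<lambda>x. mulop (c x)) has_vector_derivative mulop (c' x)) (at x within {0..<d})" if "0 \<le> x" "x < d" for x
      by (rule mulop_deriv[OF CX_0[OF Suc.prems] c'(1) CX_0[OF c'(2)] that])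
    show "CD n d (\<lambda>x. mulop (c' x))" by (rule Suc.IH[OF c'(2)])
  qed
qed (rule mulop_cont)

section \<open>Multiplication on H^1\<close>

definition C1p :: "(real \<Rightarrow> real) \<Rightarrow> (real \<Rightarrow> real) \<Rightarrow> bool" where
  "C1p c ct \<longleftrightarrow> cper c \<and> cper ct \<and> (\<forall>t. (c has_real_derivative ct t) (at t))"

definition mulh :: "(real \<Rightarrow> real) \<Rightarrow> h1 \<Rightarrow> h1" where "mulh c w = to_h1 (mul_l2 c (h1_fun w))"

lemma mulh:
  assumes "C1p c ct"
  shows "h1_fun (mulh c w) = mul_l2 c (h1_fun w)" "dh (mulh c w) = mul_l2 ct (h1_fun w) + mul_l2 c (dh w)"
proof -
  have "weak_deriv (mul_l2 c (h1_fun w)) (mul_l2 ct (h1_fun w) + mul_l2 c (dh w))"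
    using assms by (intro weak_deriv_mul) (auto simp: C1p_def cper_def)
  then obtain v where v: "h1_fun v = mul_l2 c (h1_fun w)" "dh v = mul_l2 ct (h1_fun w) + mul_l2 c (dh w)"
    by (rule h1_ex)
  have "mulh c w = v" unfolding mulh_def by (rule to_h1_eqI[OF v(1)])
  then show "h1_fun (mulh c w) = mul_l2 c (h1_fun w)" "dh (mulh c w) = mul_l2 ct (h1_fun w) + mul_l2 c (dh w)"
    using v by auto
qed

lemma C1pD: "C1p c ct \<Longrightarrow> cper c" "C1p c ct \<Longrightarrow> cper ct" by (auto simp: C1p_def)

lemma norm_mulh:
  assumes "C1p c ct" "\<And>x. x \<in> {0..1} \<Longrightarrow> \<bar>c x\<bar> \<le> B" "\<And>x. x \<in> {0..1} \<Longrightarrow> \<bar>ct x\<bar> \<le> B" "B \<ge> 0"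
  shows "norm (mulh c w) \<le> 3 * B * norm w"
proof -
  note cp = C1pD[OF assms(1)]
  have "norm (mulh c w) \<le> norm (mul_l2 c (h1_fun w)) + norm (mul_l2 ct (h1_fun w) + mul_l2 c (dh w))"
    using norm_h1_le[of "mulh c w"] by (simp add: mulh[OF assms(1)])
  also have "\<dots> \<le> norm (mul_l2 c (h1_fun w)) + (norm (mul_l2 ct (h1_fun w)) + norm (mul_l2 c (dh w)))"
    by (intro add_left_mono norm_triangle_ineq)
  also have "\<dots> \<le> B * norm w + (B * norm w + B * norm w)"
    using norm_mul_l2[OF cp(1) assms(2,4)] norm_mul_l2[OF cp(2) assms(3,4)]
      mult_left_mono[OF norm_h1_fun_le[of w] assms(4)] mult_left_mono[OF norm_dh_le[of w] assms(4)]
    by (intro add_mono) (meson order_trans)+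
  finally show ?thesis by simp
qed

lemma bounded_linear_mulh:
  assumes "C1p c ct" shows "bounded_linear (mulh c)"
proof -
  note cp = C1pD[OF assms(1)]
  obtain B where B: "B \<ge> 0" "\<And>x. x \<in> {0..1} \<Longrightarrow> \<bar>c x\<bar> \<le> B" using cper_bound[OF cp(1)] by blast
  obtain B' where B': "B' \<ge> 0" "\<And>x. x \<in> {0..1} \<Longrightarrow> \<bar>ct x\<bar> \<le> B'" using cper_bound[OF cp(2)] by blast
  show ?thesis
  proof (rule bounded_linear_intro)
    show "norm (mulh c w) \<le> norm w * (3 * max B B')" for w
      using norm_mulh[OF assms, of "max B B'" w] B B' by (simp add: mult.commute le_max_iff_disj)
  qed (rule h1_eqI, simp add: mulh[OF assms] h1_fun_add h1_fun_scaleR mul_l2_add[OF cp(1)] mul_l2_scaleR[OF cp(1)])+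
qed

definition mulhop :: "(real \<Rightarrow> real) \<Rightarrow> h1 \<Rightarrow>\<^sub>L h1" where "mulhop c = Blinfun (mulh c)"

lemma mulhop_apply: "C1p c ct \<Longrightarrow> blinfun_apply (mulhop c) f = mulh c f"
  by (simp add: mulhop_def bounded_linear_Blinfun_apply bounded_linear_mulh)

lemma norm_mulhop:
  assumes "C1p c ct" "\<And>x. x \<in> {0..1} \<Longrightarrow> \<bar>c x\<bar> \<le> B" "\<And>x. x \<in> {0..1} \<Longrightarrow> \<bar>ct x\<bar> \<le> B" "B \<ge> 0"
  shows "norm (mulhop c) \<le> 3 * B"
  using assms norm_mulh[OF assms] by (intro norm_blinfun_bound) (auto simp: mulhop_apply)

lemma C1p_linear:
  assumes "C1p c ct" "C1p d dt" "C1p e et"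
  shows "C1p (\<lambda>t. c t - d t - r * e t) (\<lambda>t. ct t - dt t - r * et t)"
  using assms by (auto simp: C1p_def intro!: cper_diff cper_mult derivative_eq_intros)

lemma mulhop_linear:
  assumes "C1p c ct" "C1p d dt" "C1p e et"
  shows "mulhop (\<lambda>t. c t - d t - r * e t) = mulhop c - mulhop d - r *\<^sub>R mulhop e"
proof (rule blinfun_eqI, rule h1_eqI)
  fix w
  note cp = C1pD(1)[OF assms(1)] C1pD(1)[OF assms(2)] C1pD(1)[OF assms(3)]
  show "h1_fun (blinfun_apply (mulhop (\<lambda>t. c t - d t - r * e t)) w) = h1_fun (blinfun_apply (mulhop c - mulhop d - r *\<^sub>R mulhop e) w)"
    by (simp add: mulhop_apply[OF C1p_linear[OF assms]] mulhop_apply[OF assms(1)] mulhop_apply[OF assms(2)] mulhop_apply[OF assms(3)]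
        blinfun.diff_left blinfun.scaleR_left h1_fun_diff h1_fun_scaleR mulh(1)[OF assms(1)] mulh(1)[OF assms(2)] mulh(1)[OF assms(3)]
        mulh(1)[OF C1p_linear[OF assms]] mul_l2_diff_left mul_l2_scale cp cper_diff cper_mult)
qed

text \<open>Multiplication by \<open>c\<close> on H^1 is controlled by \<open>c\<close> and its
  spatial derivative \<open>ct\<close>, so both are differentiated in \<open>x\<close>, and the
  results must again be a function and its spatial derivative. Commuting mixed derivatives will
  provide this.\<close>

primrec CH :: "nat \<Rightarrow> real \<Rightarrow> (real \<Rightarrow> real \<Rightarrow> real) \<Rightarrow> (real \<Rightarrow> real \<Rightarrow> real) \<Rightarrow> bool" where
  "CH 0 d c ct \<longleftrightarrow> CX 0 d c \<and> CX 0 d ct \<and> (\<forall>x\<in>{0..<d}. C1p (c x) (ct x))"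
| "CH (Suc n) d c ct \<longleftrightarrow> (CX 0 d c \<and> CX 0 d ct \<and> (\<forall>x\<in>{0..<d}. C1p (c x) (ct x))) \<and>
     (\<exists>c' ct'. (\<forall>x\<in>{0..<d}. \<forall>t. ((\<lambda>x. c x t) has_vector_derivative c' x t) (at x within {0..<d})) \<and>
        (\<forall>x\<in>{0..<d}. \<forall>t. ((\<lambda>x. ct x t) has_vector_derivative ct' x t) (at x within {0..<d})) \<and> CH n d c' ct')"

lemma CH_0: "CH n d c ct \<Longrightarrow> CH 0 d c ct"
  by (cases n) auto

lemma CH_0D:
  assumes "CH 0 d c ct"
  shows "CX 0 d c" "CX 0 d ct" "0 \<le> x \<Longrightarrow> x < d \<Longrightarrow> C1p (c x) (ct x)"
  using assms by auto

lemma CH_SucE: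
  assumes "CH (Suc n) d c ct"
  obtains c' ct' where "\<And>x t. 0 \<le> x \<Longrightarrow> x < d \<Longrightarrow> ((\<lambda>x. c x t) has_vector_derivative c' x t) (at x within {0..<d})"
    "\<And>x t. 0 \<le> x \<Longrightarrow> x < d \<Longrightarrow> ((\<lambda>x. ct x t) has_vector_derivative ct' x t) (at x within {0..<d})" "CH n d c' ct'"
proof -
  obtain c' ct' where c': "\<forall>x\<in>{0..<d}. \<forall>t. ((\<lambda>x. c x t) has_vector_derivative c' x t) (at x within {0..<d})"
    "\<forall>x\<in>{0..<d}. \<forall>t. ((\<lambda>x. ct x t) has_vector_derivative ct' x t) (at x within {0..<d})" "CH n d c' ct'"
    using assms by auto
  show ?thesis by (rule that[of c' ct']) (use c' in auto)
qed

lemma CH_SucI: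
  assumes "CH 0 d c ct" "\<And>x t. 0 \<le> x \<Longrightarrow> x < d \<Longrightarrow> ((\<lambda>x. c x t) has_vector_derivative c' x t) (at x within {0..<d})"
    "\<And>x t. 0 \<le> x \<Longrightarrow> x < d \<Longrightarrow> ((\<lambda>x. ct x t) has_vector_derivative ct' x t) (at x within {0..<d})" "CH n d c' ct'"
  shows "CH (Suc n) d c ct"
  using assms unfolding CH.simps by (intro conjI exI[of _ c'] exI[of _ ct']) auto

lemma CH_0I:
  assumes "CX 0 d c" "CX 0 d ct" "\<And>x. 0 \<le> x \<Longrightarrow> x < d \<Longrightarrow> C1p (c x) (ct x)"
  shows "CH 0 d c ct"
  using assms by auto

declare CH.simps [simp del]

lemma CH_CX: "CH n d c ct \<Longrightarrow> CX n d c"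
proof (induction n arbitrary: c ct)
  case (Suc n)
  obtain c' ct' where c': "\<And>x t. 0 \<le> x \<Longrightarrow> x < d \<Longrightarrow> ((\<lambda>x. c x t) has_vector_derivative c' x t) (at x within {0..<d})"
    "CH n d c' ct'" using CH_SucE[OF Suc.prems] by metis
  show ?case by (rule CX_SucI[OF CH_0D(1)[OF CH_0[OF Suc.prems]] c'(1) Suc.IH[OF c'(2)]])
qed (rule CH_0D)

lemma mulhop_deriv:
  assumes c: "CH 0 d c ct" "\<And>x t. 0 \<le> x \<Longrightarrow> x < d \<Longrightarrow> ((\<lambda>x. c x t) has_vector_derivative c' x t) (at x within {0..<d})"
      "\<And>x t. 0 \<le> x \<Longrightarrow> x < d \<Longrightarrow> ((\<lambda>x. ct x t) has_vector_derivative ct' x t) (at x within {0..<d})"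
    and c': "CH 0 d c' ct'" and x: "0 \<le> x" "x < d"
  shows "((\<lambda>x. mulhop (c x)) has_vector_derivative mulhop (c' x)) (at x within {0..<d})"
  unfolding has_vector_derivative_def has_derivative_within_alt
proof (intro conjI allI impI bounded_linear_scaleR_left)
  fix e :: real assume "0 < e"
  note cx = CH_0D(1,2)[OF c']
  obtain r where r: "r > 0" "\<And>y t. 0 \<le> y \<Longrightarrow> y < d \<Longrightarrow> \<bar>y - x\<bar> < r \<Longrightarrow> t \<in> {0..1} \<Longrightarrow>
    \<bar>c y t - c x t - (y - x) * c' x t\<bar> \<le> e / 3 * \<bar>y - x\<bar>"
    using CX_linearize[OF c(2) cx(1) x, of "e / 3"] \<open>0 < e\<close> by auto
  obtain s where s: "s > 0" "\<And>y t. 0 \<le> y \<Longrightarrow> y < d \<Longrightarrow> \<bar>y - x\<bar> < s \<Longrightarrow> t \<in> {0..1} \<Longrightarrow>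
    \<bar>ct y t - ct x t - (y - x) * ct' x t\<bar> \<le> e / 3 * \<bar>y - x\<bar>"
    using CX_linearize[OF c(3) cx(2) x, of "e / 3"] \<open>0 < e\<close> by auto
  have "norm (mulhop (c y) - mulhop (c x) - (y - x) *\<^sub>R mulhop (c' x)) \<le> e * norm (y - x)"
    if "y \<in> {0..<d}" "norm (y - x) < min r s" for y
  proof -
    have cp: "C1p (c y) (ct y)" "C1p (c x) (ct x)" "C1p (c' x) (ct' x)" using that x by (auto intro: CH_0D(3)[OF c(1)] CH_0D(3)[OF c'])
    have "norm (mulhop (\<lambda>t. c y t - c x t - (y - x) * c' x t)) \<le> 3 * (e / 3 * \<bar>y - x\<bar>)"
      by (rule norm_mulhop[OF C1p_linear[OF cp]]) (use r(2) s(2) that \<open>0 < e\<close> in auto)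
    then show ?thesis unfolding mulhop_linear[OF cp] by simp
  qed
  then show "\<exists>r>0. \<forall>y\<in>{0..<d}. norm (y - x) < r \<longrightarrow>
      norm (mulhop (c y) - mulhop (c x) - (y - x) *\<^sub>R mulhop (c' x)) \<le> e * norm (y - x)"
    using r(1) s(1) by (intro exI[of _ "min r s"]) auto
qed

lemma mulhop_cont:
  assumes c: "CH 0 d c ct"
  shows "CD 0 d (\<lambda>x. mulhop (c x))"
proof -
  note cx = CH_0D(1,2)[OF c]
  have "continuous_on {0..<d} (\<lambda>x. mulhop (c x))"
    unfolding continuous_on_iff
  proof (intro ballI allI impI)
    fix x e :: real assume x: "x \<in> {0..<d}" and "0 < e"
    then obtain r where r: "r > 0" "\<And>y t. 0 \<le> y \<Longrightarrow> y < d \<Longrightarrow> \<bar>y - x\<bar> < r \<Longrightarrow> t \<in> {0..1} \<Longrightarrow> \<bar>c y t - c x t\<bar> \<le> e / 6"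
      using CX_close[OF cx(1), of x "e / 6"] by auto
    obtain s where s: "s > 0" "\<And>y t. 0 \<le> y \<Longrightarrow> y < d \<Longrightarrow> \<bar>y - x\<bar> < s \<Longrightarrow> t \<in> {0..1} \<Longrightarrow> \<bar>ct y t - ct x t\<bar> \<le> e / 6"
      using CX_close[OF cx(2), of x "e / 6"] x \<open>0 < e\<close> by auto
    have "dist (mulhop (c y)) (mulhop (c x)) < e" if "y \<in> {0..<d}" "dist y x < min r s" for y
    proof -
      have cp: "C1p (c y) (ct y)" "C1p (c x) (ct x)" using that x by (auto intro: CH_0D(3)[OF c])
      have "norm (mulhop (\<lambda>t. c y t - c x t - 0 * c x t)) \<le> 3 * (e / 6)"
        by (rule norm_mulhop[OF C1p_linear[OF cp cp(2)]]) (use r(2) s(2) that \<open>0 < e\<close> in \<open>auto simp: dist_real_def\<close>)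
      then show ?thesis using \<open>0 < e\<close> unfolding mulhop_linear[OF cp cp(2)] by (simp add: dist_norm)
    qed
    then show "\<exists>r>0. \<forall>y\<in>{0..<d}. dist y x < r \<longrightarrow> dist (mulhop (c y)) (mulhop (c x)) < e"
      using r(1) s(1) by (intro exI[of _ "min r s"]) auto
  qed
  then have "continuous_on ({0..<d} \<times> {0..1::real}) (\<lambda>p. mulhop (c (fst p)))" by (rule continuous_on_fstI)
  then show ?thesis by (simp add: split_beta)
qed

lemma CH_mulhop: "CH n d c ct \<Longrightarrow> CD n d (\<lambda>x. mulhop (c x))"
proof (induction n arbitrary: c ct)
  case (Suc n)
  obtain c' ct' where c': "\<And>x t. 0 \<le> x \<Longrightarrow> x < d \<Longrightarrow> ((\<lambda>x. c x t) has_vector_derivative c' x t) (at x within {0..<d})"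
    "\<And>x t. 0 \<le> x \<Longrightarrow> x < d \<Longrightarrow> ((\<lambda>x. ct x t) has_vector_derivative ct' x t) (at x within {0..<d})" "CH n d c' ct'"
    using CH_SucE[OF Suc.prems] by metis
  show ?case
  proof (rule CDT_SucI)
    show "CD 0 d (\<lambda>x. mulhop (c x))" by (rule mulhop_cont[OF CH_0[OF Suc.prems]])
    show "((\<lambda>x. mulhop (c x)) has_vector_derivative mulhop (c' x)) (at x within {0..<d})" if "0 \<le> x" "x < d" for x
      by (rule mulhop_deriv[OF CH_0[OF Suc.prems] c'(1,2) CH_0[OF c'(3)] that])
    show "CD n d (\<lambda>x. mulhop (c' x))" by (rule Suc.IH[OF c'(3)])
  qed
qed (rule mulhop_cont)

subsection \<open>The linearized operator\<close>

definition hI :: "h1 \<Rightarrow>\<^sub>L l2" where "hI = Blinfun h1_fun"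
definition hD :: "h1 \<Rightarrow>\<^sub>L l2" where "hD = Blinfun dh"
definition bB :: "l2 \<Rightarrow>\<^sub>L h1" where "bB = Blinfun Bm"
definition pfst :: "state \<Rightarrow>\<^sub>L h1" where "pfst = Blinfun fst"
definition psnd :: "state \<Rightarrow>\<^sub>L l2" where "psnd = Blinfun snd"
definition inl :: "h1 \<Rightarrow>\<^sub>L state" where "inl = Blinfun (\<lambda>x. (x, 0))"
definition inr :: "l2 \<Rightarrow>\<^sub>L state" where "inr = Blinfun (\<lambda>x. (0, x))"
definition cmh :: "complex \<Rightarrow> h1 \<Rightarrow>\<^sub>L h1" where "cmh c = Blinfun (cmul_h1 c)"
definition cml :: "complex \<Rightarrow> l2 \<Rightarrow>\<^sub>L l2" where "cml c = Blinfun (cmul_l2 c)"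

lemma bl_apply [simp]:
  "blinfun_apply hI w = h1_fun w" "blinfun_apply hD w = dh w" "blinfun_apply bB f = Bm f"
  "blinfun_apply pfst y = fst y" "blinfun_apply psnd y = snd y"
  "blinfun_apply inl w = (w, 0)" "blinfun_apply inr f = (0, f)"
  "blinfun_apply (cmh c) w = cmul_h1 c w" "blinfun_apply (cml c) f = cmul_l2 c f"
  unfolding hI_def hD_def bB_def pfst_def psnd_def inl_def inr_def cmh_def cml_def
  by (simp_all add: bounded_linear_Blinfun_apply bounded_linear_h1_fun bounded_linear_dh bounded_linear_Bm
      bounded_linear_fst bounded_linear_snd bounded_linear_Pair bounded_linear_ident bounded_linear_zero
      cmul_h1.bounded_linear_right cmul_l2.bounded_linear_right)

text \<open>An isomorphism onto \<open>dom\<close>. The unbounded operators \<open>L\<close> are handled through the bounded compositions of \<open>L\<close> with \<open>Sop\<close>.\<close>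

definition Sop :: "state \<Rightarrow>\<^sub>L state" where
  "Sop = (inl o\<^sub>L bB o\<^sub>L hI o\<^sub>L pfst) + (inr o\<^sub>L hI o\<^sub>L bB o\<^sub>L psnd)"

lemma Sop_apply: "Sop y = (Bm (h1_fun (fst y)), h1_fun (Bm (snd y)))"
  by (simp add: Sop_def blinfun.add_left)

text \<open>The Bloch derivative d/dx + i \<xi> after \<open>Bm\<close>, as an operator on H^1:
  since d/dx after \<open>Bm\<close> is 1 - \<open>Bm\<close>, no derivative remains in the formula.
  The values have to lie in H^1 because the first component of L multiplies them by a coefficient
  there.\<close>

definition Gop :: "real \<Rightarrow> h1 \<Rightarrow>\<^sub>L h1" where
  "Gop \<xi> = id_blinfun + (cmh (\<i> * \<xi> - 1) o\<^sub>L bB o\<^sub>L hI)"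

lemma Gop_apply: "Gop \<xi> w = w + cmul_h1 (\<i> * \<xi> - 1) (Bm (h1_fun w))"
  by (simp add: Gop_def blinfun.add_left)

definition DX :: "real \<Rightarrow> h1 \<Rightarrow>\<^sub>L l2" where
  "DX \<xi> = hD + (cml (\<i> * \<xi>) o\<^sub>L hI)"

lemma DX_apply: "DX \<xi> w = dh w + cmul_l2 (\<i> * \<xi>) (h1_fun w)"
  by (simp add: DX_def blinfun.add_left)

text \<open>
  For $c_1 = kV/\rho$, $c_2 = \rho$, $c_3 = k^2 F''(\rho)$, $c_4 = \partial_x c_3$ and $c_5 = -\partial_x c_1$ the
  composition of \<open>L\<close> with \<open>Sop\<close> is \<open>IS + LSop\<close>; \<open>LSop\<close> is linear in the coefficients and the powers of $k$ are absorbed in them.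
\<close>

definition LSop :: "real \<Rightarrow> (real \<Rightarrow> real) \<Rightarrow> (real \<Rightarrow> real) \<Rightarrow> (real \<Rightarrow> real) \<Rightarrow> (real \<Rightarrow> real) \<Rightarrow> (real \<Rightarrow> real) \<Rightarrow> state \<Rightarrow>\<^sub>L state" where
  "LSop \<xi> c1 c2 c3 c4 c5 =
     (inl o\<^sub>L ((mulhop c1 o\<^sub>L (Gop \<xi> o\<^sub>L pfst)) - (mulhop c2 o\<^sub>L (bB o\<^sub>L psnd))))
   + (inr o\<^sub>L ((mulop c1 o\<^sub>L (DX \<xi> o\<^sub>L bB o\<^sub>L psnd)) - (mulop c3 o\<^sub>L (DX \<xi> o\<^sub>L Gop \<xi> o\<^sub>L pfst))
       - (mulop c4 o\<^sub>L (hI o\<^sub>L Gop \<xi> o\<^sub>L pfst)) - (mulop c5 o\<^sub>L (hI o\<^sub>L bB o\<^sub>L psnd))))"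

text \<open>The undifferentiated E in the second row of L, which does not depend on the
  amplitude.\<close>

definition IS :: "state \<Rightarrow>\<^sub>L state" where
  "IS = inr o\<^sub>L hI o\<^sub>L bB o\<^sub>L hI o\<^sub>L pfst"

lemma LSop_apply:
  assumes "C1p c1 c1t" "C1p c2 c2t" "cper c3" "cper c4" "cper c5"
  shows "(LSop \<xi> c1 c2 c3 c4 c5) y =
    (mulh c1 (Gop \<xi> (fst y)) - mulh c2 (Bm (snd y)),
     mul_l2 c1 (DX \<xi> (Bm (snd y))) - mul_l2 c3 (DX \<xi> (Gop \<xi> (fst y)))
      - mul_l2 c4 (h1_fun (Gop \<xi> (fst y))) - mul_l2 c5 (h1_fun (Bm (snd y))))"
  using assms
  by (simp add: LSop_def blinfun.add_left blinfun.diff_left mulhop_apply[OF assms(1)] mulhop_apply[OF assms(2)] C1pD(1)[OF assms(1)])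

lemma LSop_CD:
  assumes "CH n d c1 c1t" "CH n d c2 c2t" "CX n d c3" "CX n d c4" "CX n d c5"
  shows "CD n d (\<lambda>x. LSop \<xi> (c1 x) (c2 x) (c3 x) (c4 x) (c5 x))"
  unfolding LSop_def
  by (intro CDT_add CDT_diff CDT_bilinear[OF bl_compose] CDT_const CH_mulhop[OF assms(1)] CH_mulhop[OF assms(2)]
      CX_mulop assms CH_CX[OF assms(1)])

definition pdv :: "real \<Rightarrow> (real \<Rightarrow> real \<Rightarrow> real) \<Rightarrow> (real \<Rightarrow> real \<Rightarrow> real) \<Rightarrow> bool" where
  "pdv d c c' \<longleftrightarrow> (\<forall>x t. 0 \<le> x \<longrightarrow> x < d \<longrightarrow> ((\<lambda>x. c x t) has_vector_derivative c' x t) (at x within {0..<d}))"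

lemma pdvD: "pdv d c c' \<Longrightarrow> 0 \<le> x \<Longrightarrow> x < d \<Longrightarrow> ((\<lambda>x. c x t) has_vector_derivative c' x t) (at x within {0..<d})"
  by (simp add: pdv_def)

text \<open>Linearity in the coefficients: every amplitude derivative of L is again an operator of
  the form \<open>LSop\<close>, so one coupling argument for Fourier modes serves all
  orders.\<close>

lemma LSop_deriv:
  assumes c1: "CH 0 d c1 c1t" "CH 0 d c1' c1t'" and c2: "CH 0 d c2 c2t" "CH 0 d c2' c2t'"
    and c3: "CX 0 d c3" "CX 0 d c3'" and c4: "CX 0 d c4" "CX 0 d c4'" and c5: "CX 0 d c5" "CX 0 d c5'"
    and d: "pdv d c1 c1'" "pdv d c1t c1t'" "pdv d c2 c2'" "pdv d c2t c2t'" "pdv d c3 c3'" "pdv d c4 c4'" "pdv d c5 c5'"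
    and x: "0 \<le> x" "x < d"
  shows "((\<lambda>x. LSop \<xi> (c1 x) (c2 x) (c3 x) (c4 x) (c5 x)) has_vector_derivative
      LSop \<xi> (c1' x) (c2' x) (c3' x) (c4' x) (c5' x)) (at x within {0..<d})"
proof -
  have L: "((\<lambda>x. A o\<^sub>L f x) has_vector_derivative A o\<^sub>L f') F"
    if "(f has_vector_derivative f') F" for A :: "'b::real_normed_vector \<Rightarrow>\<^sub>L 'c::real_normed_vector" and f f' F
    by (rule bounded_linear.has_vector_derivative[OF bounded_bilinear.bounded_linear_right[OF bl_compose] that])
  have R: "((\<lambda>x. f x o\<^sub>L A) has_vector_derivative f' o\<^sub>L A) F"
    if "(f has_vector_derivative f') F" for A :: "'a::real_normed_vector \<Rightarrow>\<^sub>L 'b::real_normed_vector" and f f' F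
    by (rule bounded_linear.has_vector_derivative[OF bounded_bilinear.bounded_linear_left[OF bl_compose] that])
  note c1x = CH_0D(1)[OF c1(1)] CH_0D(1)[OF c1(2)]
  note m = mulop_deriv[OF c1x(1) pdvD[OF d(1)] c1x(2) x] mulop_deriv[OF c3(1) pdvD[OF d(5)] c3(2) x]
    mulop_deriv[OF c4(1) pdvD[OF d(6)] c4(2) x] mulop_deriv[OF c5(1) pdvD[OF d(7)] c5(2) x]
  note h = mulhop_deriv[OF c1(1) pdvD[OF d(1)] pdvD[OF d(2)] c1(2) x] mulhop_deriv[OF c2(1) pdvD[OF d(3)] pdvD[OF d(4)] c2(2) x]
  show ?thesis
    unfolding LSop_def
    by (intro has_vector_derivative_add has_vector_derivative_diff L R h m)
qed

subsection \<open>The complex structure of the state space\<close>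

lemma cmul_state_simps [simp]: "fst (cmul_state c w) = cmul_h1 c (fst w)" "snd (cmul_state c w) = cmul_l2 c (snd w)"
  by (simp_all add: cmul_state_def)

lemma norm_cmul_state: "norm (cmul_state c w) = cmod c * norm w"
  by (simp add: cmul_state_def norm_Pair norm_cmul_h1 norm_cmul_l2 norm_prod_def power_mult_distrib
      distrib_left[symmetric] real_sqrt_mult)

lemma bounded_bilinear_cmul_state: "bounded_bilinear cmul_state"
proof
  show "\<exists>K. \<forall>a b. norm (cmul_state a b) \<le> norm a * norm b * K"
    by (intro exI[of _ 1]) (auto simp: norm_cmul_state)
qed (auto simp: cmul_state_def cmul_h1.add_left cmul_h1.add_right cmul_h1.scaleR_left cmul_h1.scaleR_right
   cmul_l2.add_left cmul_l2.add_right cmul_l2.scaleR_left cmul_l2.scaleR_right)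

interpretation cms: bounded_bilinear cmul_state by (rule bounded_bilinear_cmul_state)

lemma cmul_op_apply [simp]: "blinfun_apply (cmul_op c) w = cmul_state c w"
  by (simp add: cmul_op_def bounded_linear_Blinfun_apply cms.bounded_linear_right)

lemma cmul_h1_mult: "cmul_h1 c (cmul_h1 d w) = cmul_h1 (c * d) w"
  by (rule h1_eqI) (simp add: h1_fun_cmul cmul_l2_mult)

lemma cmul_h1_1: "cmul_h1 1 w = w"
  by (rule h1_eqI) (simp add: h1_fun_cmul cmul_l2_1)

lemma cmul_state_mult: "cmul_state c (cmul_state d w) = cmul_state (c * d) w"
  by (simp add: cmul_state_def cmul_h1_mult cmul_l2_mult)

lemma cmul_state_1 [simp]: "cmul_state 1 w = w"
  by (simp add: cmul_state_def cmul_h1_1 cmul_l2_1)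

lemma bounded_linear_cmul_op: "bounded_linear cmul_op"
proof (rule bounded_linear_intro[of _ 1])
  show "cmul_op (c + d) = cmul_op c + cmul_op d" for c d
    by (rule blinfun_eqI) (simp add: blinfun.add_left cms.add_left)
  show "cmul_op (r *\<^sub>R c) = r *\<^sub>R cmul_op c" for r c
    by (rule blinfun_eqI) (simp add: blinfun.scaleR_left cms.scaleR_left)
  show "norm (cmul_op c) \<le> norm c * 1" for c
    by (rule norm_blinfun_bound) (auto simp: norm_cmul_state)
qed

text \<open>Bounded operators here are real-linear; complex linearity is carried as a separate
  property.\<close>

definition clin :: "(state \<Rightarrow>\<^sub>L state) \<Rightarrow> bool" where
  "clin T \<longleftrightarrow> (\<forall>c w. blinfun_apply T (cmul_state c w) = cmul_state c (blinfun_apply T w))"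

lemma clinD: "clin T \<Longrightarrow> blinfun_apply T (cmul_state c w) = cmul_state c (blinfun_apply T w)"
  unfolding clin_def by blast

lemma clin_compose: "clin S \<Longrightarrow> clin T \<Longrightarrow> clin (S o\<^sub>L T)"
  by (simp add: clin_def del: split_paired_All)

lemma clin_Sop: "clin Sop"
  by (simp add: clin_def Sop_apply h1_fun_cmul Bm_cmul cmul_state_def)

text \<open>Complex-linear functionals reduce operator-valued contour integrals to scalar Cauchy
  theory. The Fourier coefficients are among them and already separate states
  (\<open>cfun_eqI\<close>).\<close>

definition cfun :: "(state \<Rightarrow> complex) \<Rightarrow> bool" where
  "cfun \<phi> \<longleftrightarrow> bounded_linear \<phi> \<and> (\<forall>c w. \<phi> (cmul_state c w) = c * \<phi> w)"

lemma cfun_compose: "cfun \<phi> \<Longrightarrow> clin T \<Longrightarrow> cfun (\<lambda>w. \<phi> (blinfun_apply T w))"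
  by (simp add: cfun_def clin_def bounded_linear_compose[OF _ blinfun.bounded_linear_right] del: split_paired_All)

lemma cfun_diff: "cfun \<phi> \<Longrightarrow> \<phi> (v - w) = \<phi> v - \<phi> w"
  unfolding cfun_def by (blast intro: linear_diff bounded_linear.linear)

lemma cfun_cmul: "cfun \<phi> \<Longrightarrow> \<phi> (cmul_state c w) = c * \<phi> w"
  unfolding cfun_def by blast

lemma cfun_fc: "cfun (\<lambda>w. fc (h1_fun (fst w)) n)" "cfun (\<lambda>w. fc (snd w) n)"
  unfolding cfun_def
  by (auto simp: h1_fun_cmul fc_cmul intro: bounded_linear_compose[OF bounded_linear_fc]
      bounded_linear_compose[OF bounded_linear_h1_fun bounded_linear_fst] bounded_linear_snd)

lemma cfun_eqI:
  assumes "\<And>\<phi>. cfun \<phi> \<Longrightarrow> \<phi> v = \<phi> w"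
  shows "v = w"
proof (rule prod_eqI)
  show "fst v = fst w" by (rule h1_eqI, rule fc_eqI) (use assms[OF cfun_fc(1)] in simp)
  show "snd v = snd w" by (rule fc_eqI) (use assms[OF cfun_fc(2)] in simp)
qed

subsection \<open>Inverses of bounded operators\<close>

lemma binv_unique: "binv M N \<Longrightarrow> binv M N' \<Longrightarrow> N = N'"
  unfolding binv_def by (metis blinfun_compose_assoc blinfun_compose_id)

lemma binvD: "binv M N \<Longrightarrow> blinfun_apply M (blinfun_apply N x) = x" "binv M N \<Longrightarrow> blinfun_apply N (blinfun_apply M x) = x"
  unfolding binv_def by (metis blinfun_apply_blinfun_compose blinfun_apply_id_blinfun id_apply)+

text \<open>The solution of x + T x = f is the fixed point of the contraction x \<mapsto> f - T
  x.\<close>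

lemma neumann:
  fixes T :: "'a::banach \<Rightarrow>\<^sub>L 'a"
  assumes "norm T < 1"
  shows "\<exists>R. binv (id_blinfun + T) R"
proof -
  have "\<exists>!x. f - blinfun_apply T x = x" for f
  proof (rule banach_fix_type)
    show "\<forall>x y. dist (f - blinfun_apply T x) (f - blinfun_apply T y) \<le> norm T * dist x y"
    proof (intro allI)
      fix x y
      show "dist (f - blinfun_apply T x) (f - blinfun_apply T y) \<le> norm T * dist x y"
        using norm_blinfun[of T "y - x"] by (simp add: dist_norm blinfun.diff_right norm_minus_commute[of x y])
    qed
  qed (use assms in auto)
  note ex = this
  define g where "g f = (THE x. f - blinfun_apply T x = x)" for f
  have g: "f - blinfun_apply T (g f) = g f" for f
    unfolding g_def by (rule theI'[OF ex])
  have u: "x = g f" if "f - blinfun_apply T x = x" for f x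
    using ex[of f] g[of f] that by blast
  have "bounded_linear g"
  proof (rule bounded_linear_intro)
    show "g (x + y) = g x + g y" for x y
      by (rule u[symmetric]) (use g[of x] g[of y] in \<open>simp add: blinfun.add_right algebra_simps\<close>)
    show "g (r *\<^sub>R x) = r *\<^sub>R g x" for r x
      by (rule u[symmetric]) (metis g blinfun.scaleR_right scaleR_diff_right)
    show "norm (g x) \<le> norm x * (1 / (1 - norm T))" for x
    proof -
      have "norm (g x) \<le> norm x + norm (blinfun_apply T (g x))"
        using norm_triangle_ineq4[of x "blinfun_apply T (g x)"] by (simp add: g)
      also have "\<dots> \<le> norm x + norm T * norm (g x)" using norm_blinfun by auto
      finally show ?thesis using assms by (simp add: field_simps)
    qed
  qed
  then have ap: "blinfun_apply (Blinfun g) = g" by (rule bounded_linear_Blinfun_apply)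
  have "binv (id_blinfun + T) (Blinfun g)"
    unfolding binv_def
  proof (intro conjI blinfun_eqI)
    show "blinfun_apply ((id_blinfun + T) o\<^sub>L Blinfun g) x = blinfun_apply id_blinfun x" for x
      using g[of x] by (simp add: ap blinfun.add_left algebra_simps)
    show "blinfun_apply (Blinfun g o\<^sub>L (id_blinfun + T)) x = blinfun_apply id_blinfun x" for x
      using u[of "x + blinfun_apply T x" x] by (simp add: ap blinfun.add_left)
  qed
  then show ?thesis by blast
qed

text \<open>\<open>M'\<close> factors as \<open>M\<close> times a perturbation of the identity by
  \<open>N o\<^sub>L (M' - M)\<close>, to which \<open>neumann\<close> applies.\<close>

lemma binv_perturb:
  fixes M M' :: "'a::banach \<Rightarrow>\<^sub>L 'a"
  assumes "binv M N" "norm N * norm (M' - M) < 1"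
  shows "\<exists>N'. binv M' N'"
proof -
  have "norm (N o\<^sub>L (M' - M)) < 1" using norm_blinfun_compose[of N "M' - M"] assms(2) by linarith
  then obtain R where R: "binv (id_blinfun + (N o\<^sub>L (M' - M))) R" using neumann by blast
  have M': "M' = M o\<^sub>L (id_blinfun + (N o\<^sub>L (M' - M)))"
    using assms(1) by (intro blinfun_eqI) (simp add: blinfun.add_left blinfun.add_right blinfun.diff_left binvD)
  have "binv M' (R o\<^sub>L N)"
    unfolding binv_def
  proof (intro conjI blinfun_eqI)
    show "blinfun_apply (M' o\<^sub>L (R o\<^sub>L N)) x = blinfun_apply id_blinfun x" for x
      using binvD(1)[OF R, of "blinfun_apply N x"] binvD(1)[OF assms(1), of x] by (subst M') simp
    show "blinfun_apply ((R o\<^sub>L N) o\<^sub>L M') x = blinfun_apply id_blinfun x" for x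
    proof -
      have "blinfun_apply N (blinfun_apply M' x) = blinfun_apply (id_blinfun + (N o\<^sub>L (M' - M))) x"
        by (subst (1) M') (simp add: binvD(2)[OF assms(1)])
      then show ?thesis using binvD(2)[OF R, of x] by simp
    qed
  qed
  then show ?thesis by blast
qed

subsection \<open>Riesz projections\<close>

text \<open>
  If \<open>T\<close> is \<open>L\<close> composed with \<open>Sop\<close>, then \<open>MM T \<mu>\<close> is $\mu - L$ composed with \<open>Sop\<close>, \<open>NN T \<mu>\<close> its inverse, \<open>RR T \<mu>\<close> the
  resolvent of \<open>L\<close>, and \<open>PP T z r\<close> the Riesz projection of \<open>L\<close> for the circle of radius \<open>r\<close> about \<open>z\<close>, which is
  \<open>Sop\<close> after \<open>YY T z r\<close>.
\<close>

definition MM :: "(state \<Rightarrow>\<^sub>L state) \<Rightarrow> complex \<Rightarrow> state \<Rightarrow>\<^sub>L state" where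
  "MM T \<mu> = (cmul_op \<mu> o\<^sub>L Sop) - T"

definition NN :: "(state \<Rightarrow>\<^sub>L state) \<Rightarrow> complex \<Rightarrow> state \<Rightarrow>\<^sub>L state" where
  "NN T \<mu> = (SOME N. binv (MM T \<mu>) N)"

definition RR :: "(state \<Rightarrow>\<^sub>L state) \<Rightarrow> complex \<Rightarrow> state \<Rightarrow>\<^sub>L state" where
  "RR T \<mu> = Sop o\<^sub>L NN T \<mu>"

definition YY :: "(state \<Rightarrow>\<^sub>L state) \<Rightarrow> complex \<Rightarrow> real \<Rightarrow> state \<Rightarrow>\<^sub>L state" where
  "YY T z r = integral {0..1} (\<lambda>t. cmul_op (of_real r * ex 1 t) o\<^sub>L NN T (z + of_real r * ex 1 t))"

definition PP :: "(state \<Rightarrow>\<^sub>L state) \<Rightarrow> complex \<Rightarrow> real \<Rightarrow> state \<Rightarrow>\<^sub>L state" where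
  "PP T z r = integral {0..1} (\<lambda>t. cmul_op (of_real r * ex 1 t) o\<^sub>L RR T (z + of_real r * ex 1 t))"

lemma MM_apply: "(MM T \<mu>) y = cmul_state \<mu> (Sop y) - blinfun_apply T y"
  by (simp add: MM_def blinfun.diff_left)

text \<open>Invertibility is assumed on a closed annulus around the circle of integration. The room
  on both sides of the circle lets the radius vary, which the idempotence of the projection
  uses.\<close>

locale annulus =
  fixes T :: "state \<Rightarrow>\<^sub>L state" and z :: complex and a b :: real
  assumes clin: "clin T" and a0: "0 < a" and
    inv: "\<And>\<mu>. a \<le> cmod (\<mu> - z) \<Longrightarrow> cmod (\<mu> - z) \<le> b \<Longrightarrow> \<exists>N. binv (MM T \<mu>) N"
begin

definition K where "K = {\<mu>. a \<le> cmod (\<mu> - z) \<and> cmod (\<mu> - z) \<le> b}"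

lemma NN: "\<mu> \<in> K \<Longrightarrow> binv (MM T \<mu>) (NN T \<mu>)"
  unfolding NN_def by (rule someI_ex) (auto simp: K_def inv)

lemma continuous_MM: "continuous_on S (MM T)"
  unfolding MM_def
  by (intro continuous_intros bounded_bilinear.continuous_on[OF bl_compose]
      bounded_linear.continuous_on[OF bounded_linear_cmul_op])

lemma continuous_NN: "continuous_on K (NN T)"
  by (rule binv_continuous[OF continuous_MM NN])

lemma continuous_RR: "continuous_on K (RR T)"
  unfolding RR_def by (intro bounded_bilinear.continuous_on[OF bl_compose] continuous_NN continuous_intros)

lemma clin_MM: "clin (MM T \<mu>)"
  by (simp add: clin_def MM_apply clinD[OF clin] clinD[OF clin_Sop] cmul_state_mult mult.commute cms.diff_right
      del: split_paired_All)

lemma clin_NN: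
  assumes "\<mu> \<in> K" shows "clin (NN T \<mu>)"
  unfolding clin_def
proof (intro allI)
  fix c w
  have "(MM T \<mu>) (cmul_state c ((NN T \<mu>) w)) = cmul_state c w"
    by (simp add: clinD[OF clin_MM] binvD(1)[OF NN[OF assms]])
  then show "(NN T \<mu>) (cmul_state c w) = cmul_state c ((NN T \<mu>) w)"
    using binvD(2)[OF NN[OF assms]] by metis
qed

lemma clin_RR: "\<mu> \<in> K \<Longrightarrow> clin (RR T \<mu>)"
  unfolding RR_def by (intro clin_compose clin_Sop clin_NN)

lemma resolvent_identity:
  assumes "\<mu> \<in> K" "\<nu> \<in> K"
  shows "(RR T \<nu>) w - (RR T \<mu>) w =
    cmul_state (\<mu> - \<nu>) ((RR T \<mu>) ((RR T \<nu>) w))"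
proof -
  let ?y = "(NN T \<nu>) w"
  have "(MM T \<mu>) ?y = (MM T \<nu>) ?y + cmul_state (\<mu> - \<nu>) (blinfun_apply Sop ?y)"
    by (simp add: MM_apply cms.diff_left)
  also have "\<dots> = w + cmul_state (\<mu> - \<nu>) ((RR T \<nu>) w)"
    using binvD(1)[OF NN[OF assms(2)]] by (simp add: RR_def)
  finally have "?y = (NN T \<mu>) (w + cmul_state (\<mu> - \<nu>) ((RR T \<nu>) w))"
    using binvD(2)[OF NN[OF assms(1)]] by metis
  then have "(RR T \<nu>) w = (RR T \<mu>) (w + cmul_state (\<mu> - \<nu>) ((RR T \<nu>) w))"
    by (simp add: RR_def)
  then have "(RR T \<nu>) w = (RR T \<mu>) w + cmul_state (\<mu> - \<nu>) ((RR T \<mu>) ((RR T \<nu>) w))"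
    by (simp only: blinfun.add_right clinD[OF clin_RR[OF assms(1)]])
  then show ?thesis by (metis add_diff_cancel_left')
qed

text \<open>The resolvent identity writes the difference quotient as minus a product of two
  resolvents, and continuity of the resolvent gives the limit.\<close>

lemma holomorphic_RR:
  assumes \<phi>: "cfun \<phi>"
  shows "(\<lambda>\<mu>. \<phi> ((RR T \<mu>) w)) holomorphic_on {\<mu>. a < cmod (\<mu> - z) \<and> cmod (\<mu> - z) < b}"
proof -
  let ?S = "{\<mu>. a < cmod (\<mu> - z) \<and> cmod (\<mu> - z) < b}"
  have bl: "bounded_linear \<phi>" using \<phi> by (simp add: cfun_def)
  have op: "open ?S"
    by (intro open_Collect_conj open_Collect_less continuous_intros)
  have SK: "?S \<subseteq> K" by (auto simp: K_def)
  have c: "continuous_on ?S (\<lambda>\<mu>. \<phi> ((RR T \<mu>) v))" for v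
    by (intro bounded_linear.continuous_on[OF bl] continuous_intros continuous_on_subset[OF continuous_RR SK])
  have "((\<lambda>\<mu>. \<phi> ((RR T \<mu>) w)) has_field_derivative - \<phi> ((RR T \<mu>) ((RR T \<mu>) w))) (at \<mu>)"
    if "\<mu> \<in> ?S" for \<mu>
    unfolding has_field_derivative_iff
  proof (rule Lim_transform_eventually)
    let ?v = "(RR T \<mu>) w"
    have "isCont (\<lambda>\<nu>. - \<phi> ((RR T \<nu>) ?v)) \<mu>"
      using c[of ?v] op that by (intro continuous_intros) (simp add: continuous_on_eq_continuous_at)
    then show "((\<lambda>\<nu>. - \<phi> ((RR T \<nu>) ?v)) \<longlongrightarrow> - \<phi> ((RR T \<mu>) ?v)) (at \<mu>)"
      by (simp add: isCont_def)
    have "\<forall>\<^sub>F \<nu> in at \<mu>. \<nu> \<in> ?S \<and> \<nu> \<noteq> \<mu>"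
      using eventually_at_in_open[OF op that] by (auto elim: eventually_mono)
    then show "\<forall>\<^sub>F \<nu> in at \<mu>. - \<phi> ((RR T \<nu>) ?v) = (\<phi> ((RR T \<nu>) w) - \<phi> ((RR T \<mu>) w)) / (\<nu> - \<mu>)"
    proof eventually_elim
      case (elim \<nu>)
      have "\<phi> ((RR T \<mu>) w) - \<phi> ((RR T \<nu>) w) = (\<nu> - \<mu>) * \<phi> ((RR T \<nu>) ?v)"
        using arg_cong[OF resolvent_identity[of \<nu> \<mu> w], of \<phi>] elim that SK
        by (simp only: cfun_diff[OF \<phi>] cfun_cmul[OF \<phi>]) blast
      then show ?case using elim by (simp add: field_simps)
    qed
  qed
  then show ?thesis using op holomorphic_on_open by blast
qed

lemma circle_in_K: "a \<le> r \<Longrightarrow> r \<le> b \<Longrightarrow> z + of_real r * ex 1 t \<in> K"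
  using a0 by (auto simp: K_def norm_mult)

lemma integrable_NN:
  assumes "a \<le> r" "r \<le> b"
  shows "(\<lambda>t. cmul_op (of_real r * ex 1 t) o\<^sub>L NN T (z + of_real r * ex 1 t)) integrable_on {0..1}"
    "(\<lambda>t. cmul_op (of_real r * ex 1 t) o\<^sub>L RR T (z + of_real r * ex 1 t)) integrable_on {0..1}"
  by (intro integrable_continuous_real bounded_bilinear.continuous_on[OF bl_compose]
      bounded_linear.continuous_on[OF bounded_linear_cmul_op] continuous_intros
      continuous_on_compose2[OF continuous_NN] continuous_on_compose2[OF continuous_RR]; use circle_in_K assms in blast)+

lemma PP_YY:
  assumes "a \<le> r" "r \<le> b"
  shows "PP T z r = Sop o\<^sub>L YY T z r"
proof -
  have "Sop o\<^sub>L YY T z r = integral {0..1} ((\<lambda>A. Sop o\<^sub>L A) \<circ> (\<lambda>t. cmul_op (of_real r * ex 1 t) o\<^sub>L NN T (z + of_real r * ex 1 t)))"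
    unfolding YY_def
    by (rule integral_linear[OF integrable_NN(1)[OF assms] bounded_bilinear.bounded_linear_right[OF bl_compose], symmetric])
  also have "(\<lambda>A. Sop o\<^sub>L A) \<circ> (\<lambda>t. cmul_op (of_real r * ex 1 t) o\<^sub>L NN T (z + of_real r * ex 1 t)) =
      (\<lambda>t. cmul_op (of_real r * ex 1 t) o\<^sub>L RR T (z + of_real r * ex 1 t))"
    by (intro ext blinfun_eqI) (simp add: RR_def clinD[OF clin_Sop])
  finally show ?thesis by (simp add: PP_def)
qed

lemma YY_apply:
  assumes "a \<le> r" "r \<le> b" "bounded_linear L"
  shows "L ((YY T z r) w) = integral {0..1} (\<lambda>t. L (cmul_state (of_real r * ex 1 t) ((NN T (z + of_real r * ex 1 t)) w)))"
proof -
  have "bounded_linear (\<lambda>A. L (blinfun_apply A w))"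
    by (rule bounded_linear_compose[OF assms(3) blinfun.bounded_linear_left])
  from integral_linear[OF integrable_NN(1)[OF assms(1,2)] this] show ?thesis
    by (simp add: YY_def o_def)
qed

lemma PP_apply:
  assumes "a \<le> r" "r \<le> b" "bounded_linear L"
  shows "L ((PP T z r) w) = integral {0..1} (\<lambda>t. L (cmul_state (of_real r * ex 1 t) ((RR T (z + of_real r * ex 1 t)) w)))"
proof -
  have "bounded_linear (\<lambda>A. L (blinfun_apply A w))"
    by (rule bounded_linear_compose[OF assms(3) blinfun.bounded_linear_left])
  from integral_linear[OF integrable_NN(2)[OF assms(1,2)] this] show ?thesis
    by (simp add: PP_def o_def)
qed

lemma PP_contour:
  assumes "a \<le> r" "r \<le> b" "cfun \<phi>"
  shows "2 * pi * \<i> * \<phi> (blinfun_apply (PP T z r) w) = contour_integral (circlepath z r) (\<lambda>\<mu>. \<phi> (blinfun_apply (RR T \<mu>) w))"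
proof -
  have e: "exp (2 * of_real pi * \<i> * of_real t) = ex 1 t" for t by (simp add: ex_def)
  have vd: "vector_derivative (circlepath z r) (at t) = 2 * pi * \<i> * of_real r * ex 1 t" for t
    by (simp add: vector_derivative_circlepath e)
  have cp: "circlepath z r t = z + of_real r * ex 1 t" for t by (simp add: circlepath e)
  have "contour_integral (circlepath z r) (\<lambda>\<mu>. \<phi> ((RR T \<mu>) w)) =
     integral {0..1} (\<lambda>t. \<phi> ((RR T (circlepath z r t)) w) * vector_derivative (circlepath z r) (at t))"
    by (rule contour_integral_integral)
  also have "\<dots> = integral {0..1} (\<lambda>t. (2 * pi * \<i>) * \<phi> (cmul_state (of_real r * ex 1 t) (blinfun_apply (RR T (z + of_real r * ex 1 t)) w)))"
    by (simp add: vd cp cfun_cmul[OF assms(3)] mult_ac)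
  also have "\<dots> = 2 * pi * \<i> * \<phi> (blinfun_apply (PP T z r) w)"
    using assms by (simp add: PP_apply cfun_def)
  finally show ?thesis ..
qed

text \<open>The straight-line homotopy between the concentric circles stays in the open annulus,
  where the scalar resolvent is holomorphic.\<close>

lemma radius_independent:
  assumes "a < r" "r \<le> s" "s < b" "cfun \<phi>"
  shows "\<phi> ((PP T z r) w) = \<phi> ((PP T z s) w)"
proof -
  let ?S = "{\<mu>. a < cmod (\<mu> - z) \<and> cmod (\<mu> - z) < b}"
  have op: "open ?S"
    by (intro open_Collect_conj open_Collect_less continuous_intros)
  have "homotopic_loops ?S (circlepath z r) (circlepath z s)"
  proof (rule homotopic_loops_linear)
    fix t :: real
    show "closed_segment (circlepath z r t) (circlepath z s t) \<subseteq> ?S"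
    proof
      fix x assume "x \<in> closed_segment (circlepath z r t) (circlepath z s t)"
      then obtain u where u: "0 \<le> u" "u \<le> 1" "x = (1 - u) *\<^sub>R circlepath z r t + u *\<^sub>R circlepath z s t"
        by (auto simp: in_segment)
      define q where "q = (1 - u) * r + u * s"
      have "x - z = of_real q * exp (2 * of_real pi * \<i> * of_real t)"
        unfolding u(3) circlepath q_def by (simp add: scaleR_conv_of_real algebra_simps)
      moreover have qb: "r \<le> q" "q \<le> s"
      proof -
        have "0 \<le> u * (s - r)" "0 \<le> (1 - u) * (s - r)" using u assms by simp_all
        then show "r \<le> q" "q \<le> s" by (simp_all add: q_def algebra_simps)
      qed
      ultimately have "cmod (x - z) = q" using assms a0 by (simp add: norm_mult)
      then show "x \<in> ?S" using qb assms by auto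
    qed
  qed auto
  from Cauchy_theorem_homotopic_loops[OF this op holomorphic_RR[OF assms(4), of w]]
  have "contour_integral (circlepath z r) (\<lambda>\<mu>. \<phi> ((RR T \<mu>) w)) = contour_integral (circlepath z s) (\<lambda>\<mu>. \<phi> ((RR T \<mu>) w))"
    by auto
  then have "2 * pi * \<i> * \<phi> (blinfun_apply (PP T z r) w) = 2 * pi * \<i> * \<phi> (blinfun_apply (PP T z s) w)"
    using PP_contour[OF _ _ assms(4), of r w] PP_contour[OF _ _ assms(4), of s w] assms(1-3) by (simp only: less_imp_le order_trans)
  then show ?thesis by simp
qed

text \<open>With the inner of the two circles used for the inner projection, the resolvent identity turns
  the double integral into iterated integrals of \<open>1 / (\<mu> - \<nu>)\<close>, one of which vanishes.\<close>

lemma PP_idem: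
  assumes "a < r" "r < b"
  shows "(PP T z r) ((PP T z r) w) = (PP T z r) w"
proof (rule cfun_eqI)
  fix \<phi> assume \<phi>: "cfun \<phi>"
  define s where "s = (a + r) / 2"
  have s: "a < s" "s < r" "0 < s" "0 < r" using assms a0 by (auto simp: s_def)
  let ?f = "\<lambda>\<nu>. \<phi> ((RR T \<nu>) w)"
  have sph: "cmod (\<mu> - z) = q" if "\<mu> \<in> path_image (circlepath z q)" "q > 0" for \<mu> q
    using that by (auto simp: dist_norm norm_minus_commute)
  have inK: "\<mu> \<in> K" if "\<mu> \<in> path_image (circlepath z q)" "a < q" "q < b" for \<mu> q
    using sph[OF that(1)] that a0 by (auto simp: K_def)
  have c1: "(?f has_contour_integral contour_integral (circlepath z s) ?f) (circlepath z s)"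
  proof (rule has_contour_integral_integral, rule contour_integrable_continuous_circlepath)
    show "continuous_on (path_image (circlepath z s)) ?f"
      using s assms by (intro holomorphic_on_imp_continuous_on holomorphic_on_subset[OF holomorphic_RR[OF \<phi>]])
        (auto simp: dist_norm norm_minus_commute)
  qed
  have step1: "2 * pi * \<i> * \<phi> (blinfun_apply (RR T \<mu>) (blinfun_apply (PP T z r) w)) =
      contour_integral (circlepath z s) (\<lambda>\<nu>. ?f \<nu> / (\<mu> - \<nu>))" if \<mu>: "\<mu> \<in> path_image (circlepath z r)" for \<mu>
  proof -
    have \<mu>K: "\<mu> \<in> K" using inK[OF \<mu>] assms by simp
    have \<mu>r: "cmod (\<mu> - z) = r" using sph[OF \<mu>] s by simp
    let ?\<psi> = "\<lambda>v. \<phi> ((RR T \<mu>) v)"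
    have \<psi>: "cfun ?\<psi>" by (rule cfun_compose[OF \<phi> clin_RR[OF \<mu>K]])
    have "2 * pi * \<i> * ?\<psi> (blinfun_apply (PP T z r) w) = 2 * pi * \<i> * ?\<psi> (blinfun_apply (PP T z s) w)"
      using radius_independent[OF _ _ _ \<psi>, of s r w] s assms by simp
    also have "\<dots> = contour_integral (circlepath z s) (\<lambda>\<nu>. ?\<psi> ((RR T \<nu>) w))"
      using PP_contour[OF _ _ \<psi>, of s w] s assms by simp
    also have "\<dots> = contour_integral (circlepath z s) (\<lambda>\<nu>. ?f \<nu> / (\<mu> - \<nu>) - ?f \<mu> / (\<mu> - \<nu>))"
    proof (rule contour_integral_cong)
      fix \<nu> assume \<nu>: "\<nu> \<in> path_image (circlepath z s)"
      have ne: "\<mu> \<noteq> \<nu>" using sph[OF \<nu>] \<mu>r s by auto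
      have d: "?f \<nu> - ?f \<mu> = (\<mu> - \<nu>) * ?\<psi> ((RR T \<nu>) w)"
        using arg_cong[OF resolvent_identity[OF \<mu>K inK[OF \<nu>], of w], of \<phi>] s assms
        by (simp add: cfun_diff[OF \<phi>] cfun_cmul[OF \<phi>])
      then show "?\<psi> ((RR T \<nu>) w) = ?f \<nu> / (\<mu> - \<nu>) - ?f \<mu> / (\<mu> - \<nu>)"
        unfolding diff_divide_distrib[symmetric] d using ne by simp
    qed simp
    also have "\<dots> = contour_integral (circlepath z s) (\<lambda>\<nu>. ?f \<nu> / (\<mu> - \<nu>)) - contour_integral (circlepath z s) (\<lambda>\<nu>. ?f \<mu> / (\<mu> - \<nu>))"
    proof (rule contour_integral_diff; rule contour_integrable_continuous_circlepath)
      have ne: "\<forall>\<nu>\<in>path_image (circlepath z s). \<mu> - \<nu> \<noteq> 0" using sph[of _ s] \<mu>r s by force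
      have cf: "continuous_on (path_image (circlepath z s)) ?f"
        using s assms by (intro holomorphic_on_imp_continuous_on holomorphic_on_subset[OF holomorphic_RR[OF \<phi>]])
          (auto simp: dist_norm norm_minus_commute)
      show "continuous_on (path_image (circlepath z s)) (\<lambda>\<nu>. ?f \<nu> / (\<mu> - \<nu>))"
        by (intro continuous_intros cf ne)
      show "continuous_on (path_image (circlepath z s)) (\<lambda>\<nu>. ?f \<mu> / (\<mu> - \<nu>))"
        by (intro continuous_intros ne)
    qed
    also have "contour_integral (circlepath z s) (\<lambda>\<nu>. ?f \<mu> / (\<mu> - \<nu>)) = 0"
    proof (rule contour_integral_unique, rule Cauchy_theorem_disc_simple[of _ z r])
      show "(\<lambda>\<nu>. ?f \<mu> / (\<mu> - \<nu>)) holomorphic_on ball z r"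
        using \<mu>r by (intro holomorphic_intros) (auto simp: dist_norm norm_minus_commute)
    qed (use s in auto)
    finally show ?thesis by simp
  qed
  have "(2 * pi * \<i>) * (2 * pi * \<i> * \<phi> (blinfun_apply (PP T z r) (blinfun_apply (PP T z r) w))) =
     contour_integral (circlepath z r) (\<lambda>\<mu>. 2 * pi * \<i> * \<phi> (blinfun_apply (RR T \<mu>) (blinfun_apply (PP T z r) w)))"
  proof -
    have "(\<lambda>\<mu>. \<phi> ((RR T \<mu>) ((PP T z r) w))) contour_integrable_on circlepath z r"
      using s assms by (intro contour_integrable_continuous_circlepath holomorphic_on_imp_continuous_on
          holomorphic_on_subset[OF holomorphic_RR[OF \<phi>]]) (auto simp: dist_norm norm_minus_commute)
    then show ?thesis
      using PP_contour[OF _ _ \<phi>, of r] assms by (simp add: contour_integral_lmul)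
  qed
  also have "\<dots> = contour_integral (circlepath z r) (\<lambda>\<mu>. contour_integral (circlepath z s) (\<lambda>\<nu>. ?f \<nu> / (\<mu> - \<nu>)))"
    by (rule contour_integral_cong[OF refl step1])
  also have "\<dots> = contour_integral (circlepath z s) (\<lambda>\<nu>. contour_integral (circlepath z r) (\<lambda>\<mu>. ?f \<nu> / (\<mu> - \<nu>)))"
  proof (rule contour_integral_swap)
    have cf: "continuous_on (path_image (circlepath z s)) ?f"
      using s assms by (intro holomorphic_on_imp_continuous_on holomorphic_on_subset[OF holomorphic_RR[OF \<phi>]])
        (auto simp: dist_norm norm_minus_commute)
    have "\<mu> - \<nu> \<noteq> 0" if "\<mu> \<in> path_image (circlepath z r)" "\<nu> \<in> path_image (circlepath z s)" for \<mu> \<nu>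
      using sph[OF that(1)] sph[OF that(2)] s by auto
    then show "continuous_on (path_image (circlepath z r) \<times> path_image (circlepath z s)) (\<lambda>(\<mu>, \<nu>). ?f \<nu> / (\<mu> - \<nu>))"
      unfolding split_beta
      by (intro continuous_intros continuous_on_sndI[OF cf]) auto
  qed (auto simp: vector_derivative_circlepath intro!: continuous_intros)
  also have "\<dots> = contour_integral (circlepath z s) (\<lambda>\<nu>. (2 * pi * \<i>) * ?f \<nu>)"
  proof (rule contour_integral_cong)
    fix \<nu> assume \<nu>: "\<nu> \<in> path_image (circlepath z s)"
    have "((\<lambda>\<mu>. ?f \<nu> / (\<mu> - \<nu>)) has_contour_integral (2 * of_real pi * \<i> * ?f \<nu>)) (circlepath z r)"
      by (rule Cauchy_integral_circlepath_simple) (use sph[OF \<nu>] s in auto)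
    then show "contour_integral (circlepath z r) (\<lambda>\<mu>. ?f \<nu> / (\<mu> - \<nu>)) = (2 * pi * \<i>) * ?f \<nu>"
      by (simp add: contour_integral_unique)
  qed simp
  also have "\<dots> = (2 * pi * \<i>) * contour_integral (circlepath z s) ?f"
    using c1 by (intro contour_integral_lmul) (auto simp: contour_integrable_on_def)
  also have "contour_integral (circlepath z s) ?f = 2 * pi * \<i> * \<phi> (blinfun_apply (PP T z s) w)"
    using PP_contour[OF _ _ \<phi>, of s w] s assms by simp
  also have "\<phi> ((PP T z s) w) = \<phi> ((PP T z r) w)"
    using radius_independent[OF _ _ _ \<phi>, of s r w] s assms by simp
  finally show "\<phi> ((PP T z r) ((PP T z r) w)) = \<phi> ((PP T z r) w)"
    by simp
qed

text \<open>The resolvent commutes with L: both sides are \<mu> times the resolvent minus the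
  identity, applied to \<open>Sop y\<close>. On the right, \<open>NN\<close> is the resolvent with
  its outer \<open>Sop\<close> absorbed into \<open>T\<close>.\<close>

lemma RR_T:
  assumes "\<mu> \<in> K"
  shows "(RR T \<mu>) (blinfun_apply T y) = blinfun_apply T ((NN T \<mu>) (Sop y))"
proof -
  note N = NN[OF assms]
  have T: "blinfun_apply T x = cmul_state \<mu> (Sop x) - (MM T \<mu>) x" for x
    by (simp add: MM_apply)
  have "(RR T \<mu>) (blinfun_apply T y) =
      cmul_state \<mu> ((RR T \<mu>) (Sop y)) - Sop y"
    unfolding T[of y] using binvD(2)[OF N, of y]
    by (simp add: blinfun.diff_right clinD[OF clin_RR[OF assms]]) (simp add: RR_def)
  moreover have "blinfun_apply T ((NN T \<mu>) (Sop y)) =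
      cmul_state \<mu> ((RR T \<mu>) (Sop y)) - Sop y"
    unfolding T[of "(NN T \<mu>) _"] using binvD(1)[OF N] by (simp add: RR_def)
  ultimately show ?thesis by simp
qed

lemma PP_T:
  assumes "a \<le> r" "r \<le> b"
  shows "(PP T z r) (blinfun_apply T y) = blinfun_apply T ((YY T z r) (Sop y))"
  using PP_apply[OF assms bounded_linear_ident, of "blinfun_apply T y"]
    YY_apply[OF assms blinfun.bounded_linear_right[of T], of "Sop y"]
  by (simp add: RR_T circle_in_K assms clinD[OF clin])

text \<open>On an eigenvector the resolvent is division by \<open>\<mu> - z\<close>, which cancels
  the weight of the contour; the integrand is constant.\<close>

lemma PP_eigen:
  assumes "a \<le> r" "r \<le> b" "blinfun_apply T y = cmul_state z (Sop y)"
  shows "(PP T z r) (Sop y) = Sop y"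
proof -
  have "cmul_state (\<mu> - z) ((RR T \<mu>) (Sop y)) = Sop y" if "\<mu> \<in> K" for \<mu>
  proof -
    have "(MM T \<mu>) y = cmul_state (\<mu> - z) (Sop y)"
      by (simp add: MM_apply assms(3) cms.diff_left)
    then have "y = cmul_state (\<mu> - z) ((NN T \<mu>) (Sop y))"
      using binvD(2)[OF NN[OF that], of y] clinD[OF clin_NN[OF that]] by metis
    then show ?thesis using clinD[OF clin_Sop] unfolding RR_def by (metis blinfun_apply_blinfun_compose)
  qed
  from this[OF circle_in_K[OF assms(1,2)]] PP_apply[OF assms(1,2) bounded_linear_ident, of "Sop y"]
  show ?thesis by simp
qed

end

subsection \<open>The symplectic form\<close>

text \<open>The integral of the conjugate of f against J^{-1} g (\<open>om_lint\<close>), so that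
  the pairing defining \<open>a\<close> is \<open>om\<close> of the first vector with L of the
  second.\<close>

definition om :: "state \<Rightarrow> state \<Rightarrow> complex" where
  "om f g = cip (h1_fun (fst f)) (snd g) - cip (snd f) (h1_fun (fst g))"

lemma bounded_bilinear_om: "bounded_bilinear om"
proof
  show "\<exists>K. \<forall>f g. norm (om f g) \<le> norm f * norm g * K"
  proof (intro exI[of _ 2] allI)
    fix f g :: state
    have "norm (om f g) \<le> cmod (cip (h1_fun (fst f)) (snd g)) + cmod (cip (snd f) (h1_fun (fst g)))"
      unfolding om_def by (rule norm_triangle_ineq4)
    also have "\<dots> \<le> norm (h1_fun (fst f)) * norm (snd g) + norm (snd f) * norm (h1_fun (fst g))"
      by (intro add_mono cip_norm_le)
    also have "\<dots> \<le> norm f * norm g + norm f * norm g"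
    proof -
      have f: "norm (h1_fun (fst w)) \<le> norm w" "norm (snd w) \<le> norm w" for w :: state
        using order_trans[OF norm_h1_fun_le[of "fst w"] norm_fst_le[of "fst w" "snd w"]]
          norm_snd_le[of "snd w" "fst w"] by auto
      show ?thesis by (intro add_mono mult_mono f) auto
    qed
    finally show "norm (om f g) \<le> norm f * norm g * 2" by simp
  qed
qed (auto simp: om_def cip.add_left cip.add_right cip.scaleR_left cip.scaleR_right h1_fun_add h1_fun_scaleR scaleR_diff_right)

interpretation om: bounded_bilinear om by (rule bounded_bilinear_om)

lemma om_cmul_left: "om (cmul_state c f) g = cnj c * om f g"
  and om_cmul_right: "om f (cmul_state c g) = c * om f g"
  by (simp_all add: om_def h1_fun_cmul cip_cmul_left cip_cmul_right algebra_simps)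

text \<open>Serves circles about an imaginary centre: there \<mu> \<mapsto> - cnj \<mu> maps the
  circle to itself and acts on its parameter by t \<mapsto> 1/2 - t.\<close>

lemma integral_periodic_reflect:
  fixes H :: "real \<Rightarrow> complex"
  assumes c: "continuous_on UNIV H" and p: "\<And>t. H (t + 1) = H t"
  shows "integral {0..1} (\<lambda>t. H (1 / 2 - t)) = integral {0..1} H"
proof -
  have i: "H integrable_on {a..b}" for a b
    by (intro integrable_continuous_real continuous_on_subset[OF c]) auto
  have "integral {0..1} (\<lambda>t. H (1 / 2 - t)) = integral {-1..0} (\<lambda>t. H (1 / 2 + t))"
    using Henstock_Kurzweil_Integration.integral_reflect_real[of 0 "-1" "\<lambda>t. H (1 / 2 + t)"] by simp
  also have "\<dots> = integral {-1/2..1/2} H"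
    using integral_shift_Icc_real[of "-1" 0 H "1/2"] by (simp add: o_def)
  also have "\<dots> = integral {-1/2..0} H + integral {0..1/2} H"
    by (rule Henstock_Kurzweil_Integration.integral_combine[symmetric]) (auto intro: i)
  also have "integral {-1/2..0} H = integral {1/2..1} (\<lambda>t. H (t - 1))"
    using integral_shift_Icc_real[of "1/2" 1 H "-1"] by (simp add: o_def)
  also have "(\<lambda>t. H (t - 1)) = H" using p[of "_ - 1"] by auto
  also have "integral {1/2..1} H + integral {0..1/2} H = integral {0..1} H"
    using Henstock_Kurzweil_Integration.integral_combine[of 0 "1/2" 1 H] i by (simp add: add.commute)
  finally show ?thesis .
qed

lemma (in annulus) clin_PP:
  assumes r: "a \<le> r" "r \<le> b"
  shows "clin (PP T z r)"
  unfolding clin_def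
proof (intro allI)
  fix c w
  show "(PP T z r) (cmul_state c w) = cmul_state c ((PP T z r) w)"
    using PP_apply[OF r cms.bounded_linear_right, of c w] PP_apply[OF r bounded_linear_ident, of "cmul_state c w"]
    by (simp add: clinD[OF clin_RR] circle_in_K r cmul_state_mult mult_ac)
qed

lemma Sop_inj: "Sop y = Sop y' \<longleftrightarrow> y = y'"
proof
  assume "Sop y = Sop y'"
  then have "Bm (h1_fun (fst y)) = Bm (h1_fun (fst y'))" "Bm (snd y) = Bm (snd y')"
    by (auto simp: Sop_apply intro: h1_eqI)
  then have "h1_fun (fst y) = h1_fun (fst y')" "snd y = snd y'" using Bm by metis+
  then show "y = y'" by (auto intro: prod_eqI h1_eqI)
qed simp

locale annulus_sym = annulus +
  assumes z0: "Re z = 0"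
    and sym: "om (blinfun_apply T y) (Sop y') = - om (Sop y) (blinfun_apply T y')"
begin

lemma cnj_z: "cnj z = - z" using z0 by (simp add: complex_eq_iff)

text \<open>Skewness of L makes cnj \<mu> + L the adjoint of \<mu> - L with respect to
  \<open>om\<close>, and this is minus the operator \<nu> - L at \<nu> = - cnj \<mu>.\<close>

lemma om_RR:
  assumes "\<mu> \<in> K" "- cnj \<mu> \<in> K"
  shows "om ((RR T \<mu>) f) g = - om f ((RR T (- cnj \<mu>)) g)"
proof -
  let ?\<nu> = "- cnj \<mu>" let ?y = "(NN T \<mu>) f" let ?y' = "(NN T ?\<nu>) g"
  have f: "f = cmul_state \<mu> (blinfun_apply Sop ?y) - blinfun_apply T ?y"
    using binvD(1)[OF NN[OF assms(1)], of f] by (simp add: MM_apply)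
  have g: "g = cmul_state ?\<nu> (blinfun_apply Sop ?y') - blinfun_apply T ?y'"
    using binvD(1)[OF NN[OF assms(2)], of g] by (simp add: MM_apply)
  have "om (blinfun_apply Sop ?y) g = ?\<nu> * om (blinfun_apply Sop ?y) (blinfun_apply Sop ?y') - om (blinfun_apply Sop ?y) (blinfun_apply T ?y')"
    by (subst g) (simp only: om.diff_right om_cmul_right)
  moreover have "om f (blinfun_apply Sop ?y') = cnj \<mu> * om (blinfun_apply Sop ?y) (blinfun_apply Sop ?y') - om (blinfun_apply T ?y) (blinfun_apply Sop ?y')"
    by (subst f) (simp only: om.diff_left om_cmul_left)
  ultimately show ?thesis by (simp add: RR_def sym)
qed

text \<open>Two signs cancel: one from \<open>om_RR\<close>, the other from \<open>half\<close>,
  because the conjugate of the weight is minus the weight at the reflected parameter.\<close>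

lemma om_PP:
  assumes r: "a \<le> r" "r \<le> b"
  shows "om ((PP T z r) f) g = om f ((PP T z r) g)"
proof -
  define H where "H t = om f (cmul_state (of_real r * ex 1 t) ((RR T (z + of_real r * ex 1 t)) g))" for t
  have half: "ex 1 (1 / 2 - t) = - cnj (ex 1 t)" for t
  proof -
    have "ex 1 (1 / 2) = -1" by (simp add: ex_def exp_eq_polar cis.ctr complex_eq_iff mult.commute)
    then show ?thesis using ex_shift[of 1 "1/2" "-t"] by (simp add: cnj_ex) (simp add: ex_def)
  qed
  have c: "continuous_on UNIV H"
    unfolding H_def
    by (intro om.continuous_on cms.continuous_on continuous_intros continuous_on_compose2[OF continuous_RR])
      (use circle_in_K r in blast)
  have p: "H (t + 1) = H t" for t
    using periodic_ex[of 1] by (simp add: H_def periodic1_def)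
  have "om ((PP T z r) f) g = integral {0..1} (\<lambda>t. om (cmul_state (of_real r * ex 1 t) ((RR T (z + of_real r * ex 1 t)) f)) g)"
    by (rule PP_apply[OF r om.bounded_linear_left])
  also have "\<dots> = integral {0..1} (\<lambda>t. H (1 / 2 - t))"
  proof (rule integral_cong)
    fix t :: real
    have "- cnj (z + of_real r * ex 1 t) = z + of_real r * ex 1 (1 / 2 - t)"
      by (simp add: cnj_z half)
    then show "om (cmul_state (of_real r * ex 1 t) ((RR T (z + of_real r * ex 1 t)) f)) g = H (1 / 2 - t)"
      using om_RR[OF circle_in_K[OF r, of t], of f g] circle_in_K[OF r, of "1 / 2 - t"]
      by (simp add: om_cmul_left om_cmul_right H_def half)
  qed
  also have "\<dots> = integral {0..1} H" by (rule integral_periodic_reflect[OF c p])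
  also have "\<dots> = om f ((PP T z r) g)"
    unfolding H_def by (rule PP_apply[OF r om.bounded_linear_right, symmetric])
  finally show ?thesis .
qed

end

text \<open>Compactness of the closed annulus bounds all inverses by one \<open>C\<close>, and a
  perturbation of norm below \<open>1 / C\<close> keeps them invertible.\<close>

lemma annulus_neighborhood:
  assumes A: "annulus T z a b" and a: "0 < a"
  obtains e where "e > 0" "\<And>T' \<mu>. norm (T' - T) < e \<Longrightarrow> a \<le> cmod (\<mu> - z) \<Longrightarrow> cmod (\<mu> - z) \<le> b \<Longrightarrow> \<exists>N. binv (MM T' \<mu>) N"
proof -
  interpret annulus T z a b by fact
  have "K = cball z b - ball z a" by (auto simp: K_def dist_norm norm_minus_commute)
  then have "compact K" by (simp add: compact_diff)
  then have "bounded (NN T ` K)"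
    by (intro compact_imp_bounded compact_continuous_image continuous_NN)
  then obtain C where C: "C > 0" "\<And>\<mu>. \<mu> \<in> K \<Longrightarrow> norm (NN T \<mu>) \<le> C" by (auto simp: bounded_pos)
  show ?thesis
  proof (rule that[of "1 / C"])
    fix T' \<mu> assume *: "norm (T' - T) < 1 / C" "a \<le> cmod (\<mu> - z)" "cmod (\<mu> - z) \<le> b"
    then have \<mu>: "\<mu> \<in> K" by (simp add: K_def)
    have "norm (NN T \<mu>) * norm (MM T' \<mu> - MM T \<mu>) \<le> C * norm (T' - T)"
      using C(2)[OF \<mu>] by (intro mult_mono) (auto simp: MM_def norm_minus_commute less_imp_le[OF C(1)])
    also have "\<dots> < 1" using * C(1) by (simp add: field_simps)
    finally show "\<exists>N. binv (MM T' \<mu>) N" by (rule binv_perturb[OF NN[OF \<mu>]])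
  qed (use C in simp)
qed

subsection \<open>Iterated derivatives of products\<close>

lemma CD_ddelta1: "CD (Suc n) d f \<Longrightarrow> CD n d (ddelta f)" by (rule CD_ddelta)

lemma CD_cont: "CD n d f \<Longrightarrow> continuous_on {0..<d} f"
  using continuous_on_section2[OF CDT_cont, of n d "\<lambda>x t. f x" 0] by simp

lemma has_vector_derivative_continuous_on:
  assumes "\<And>x. x \<in> S \<Longrightarrow> (f has_vector_derivative f' x) (at x within S)"
  shows "continuous_on S f"
  unfolding continuous_on_eq_continuous_within
  by (intro ballI has_vector_derivative_continuous[OF assms])

lemma CD_SucI:
  assumes "\<And>x. 0 \<le> x \<Longrightarrow> x < d \<Longrightarrow> (f has_vector_derivative f' x) (at x within {0..<d})" "CD n d f'"
  shows "CD (Suc n) d f"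
proof (rule CDT_SucI)
  have "continuous_on {0..<d} f"
    by (rule has_vector_derivative_continuous_on) (use assms(1) in auto)
  then have "continuous_on ({0..<d} \<times> {0..1::real}) (\<lambda>p. f (fst p))" by (rule continuous_on_fstI)
  then show "CD 0 d f" by (simp add: split_beta)
qed (use assms in auto)

lemma ddelta_bilinear:
  assumes B: "bounded_bilinear B" and f: "CD (Suc n) d f" and g: "CD (Suc m) d g" and x: "0 \<le> x" "x < d"
  shows "ddelta (\<lambda>x. B (f x) (g x)) x = B (f x) (ddelta g x) + B (ddelta f x) (g x)"
  by (rule ddelta_eq(1)[OF bounded_bilinear.has_vector_derivative[OF B CD_ddelta(2)[OF f x] CD_ddelta(2)[OF g x]] x])

lemma ddelta_add:
  assumes f: "CD (Suc n) d f" and g: "CD (Suc m) d g" and x: "0 \<le> x" "x < d"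
  shows "ddelta (\<lambda>x. f x + g x) x = ddelta f x + ddelta g x"
  by (rule ddelta_eq(1)[OF has_vector_derivative_add[OF CD_ddelta(2)[OF f x] CD_ddelta(2)[OF g x]] x])

lemma ddelta_linear:
  assumes L: "bounded_linear L" and f: "CD (Suc n) d f" and x: "0 \<le> x" "x < d"
  shows "ddelta (\<lambda>x. L (f x)) x = L (ddelta f x)"
  by (rule ddelta_eq(1)[OF bounded_linear.has_vector_derivative[OF L CD_ddelta(2)[OF f x]] x])

lemma ddelta_cong1:
  assumes "\<And>x. 0 \<le> x \<Longrightarrow> x < d \<Longrightarrow> f x = g x" "0 \<le> x" "x < d"
  shows "ddelta f x = ddelta g x"
  using ddelta_cong[OF assms, where n = 1] by simp

lemma ddelta_add_const:
  assumes f: "CD (Suc n) d f" and x: "0 \<le> x" "x < d"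
  shows "ddelta (\<lambda>x. f x + c) x = ddelta f x"
  using has_vector_derivative_add[OF CD_ddelta(2)[OF f x] has_vector_derivative_const[of c]]
  by (intro ddelta_eq(1)[OF _ x]) simp

lemma leibniz2:
  assumes B: "bounded_bilinear B" and f: "CD 2 d f" and g: "CD 2 d g" and x: "0 \<le> x" "x < d"
  shows "ddelta (ddelta (\<lambda>x. B (f x) (g x))) x =
    B (f x) (ddelta (ddelta g) x) + 2 *\<^sub>R B (ddelta f x) (ddelta g x) + B (ddelta (ddelta f) x) (g x)"
proof -
  note f' = f[unfolded numeral_2_eq_2] and g' = g[unfolded numeral_2_eq_2]
  note f1 = CD_ddelta1[OF f'] and g1 = CD_ddelta1[OF g']
  have "ddelta (ddelta (\<lambda>x. B (f x) (g x))) x = ddelta (\<lambda>x. B (f x) (ddelta g x) + B (ddelta f x) (g x)) x"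
    by (rule ddelta_cong1[OF ddelta_bilinear[OF B f' g'] x])
  also have "\<dots> = ddelta (\<lambda>x. B (f x) (ddelta g x)) x + ddelta (\<lambda>x. B (ddelta f x) (g x)) x"
    by (rule ddelta_add[OF CDT_bilinear[OF B CDT_Suc[OF f'] g1] CDT_bilinear[OF B f1 CDT_Suc[OF g']] x])
  also have "\<dots> = (B (f x) (ddelta (ddelta g) x) + B (ddelta f x) (ddelta g x)) + (B (ddelta f x) (ddelta g x) + B (ddelta (ddelta f) x) (g x))"
    by (simp only: ddelta_bilinear[OF B f' g1 x] ddelta_bilinear[OF B f1 g' x])
  finally show ?thesis by (simp add: scaleR_2 add.assoc)
qed

lemma leibniz3:
  assumes B: "bounded_bilinear B" and f: "CD 3 d f" and g: "CD 3 d g" and x: "0 \<le> x" "x < d"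
  shows "ddelta (ddelta (ddelta (\<lambda>x. B (f x) (g x)))) x =
    B (f x) (ddelta (ddelta (ddelta g)) x) + 3 *\<^sub>R B (ddelta f x) (ddelta (ddelta g) x)
    + 3 *\<^sub>R B (ddelta (ddelta f) x) (ddelta g x) + B (ddelta (ddelta (ddelta f)) x) (g x)"
proof -
  have f': "CD (Suc 2) d f" and g': "CD (Suc 2) d g" using f g by (simp_all add: eval_nat_numeral)
  note f1 = CD_ddelta1[OF f'] and g1 = CD_ddelta1[OF g']
  note f2 = CDT_Suc[OF f'] and g2 = CDT_Suc[OF g']
  have c: "CD 2 d (\<lambda>x. B (f x) (ddelta g x))" "CD 2 d (\<lambda>x. B (ddelta f x) (g x))"
    by (rule CDT_bilinear[OF B f2 g1], rule CDT_bilinear[OF B f1 g2])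
  note c' = c[unfolded numeral_2_eq_2]
  have "ddelta (ddelta (ddelta (\<lambda>x. B (f x) (g x)))) x = (ddelta ^^ 2) (ddelta (\<lambda>x. B (f x) (g x))) x"
    by (simp add: numeral_2_eq_2)
  also have "\<dots> = (ddelta ^^ 2) (\<lambda>x. B (f x) (ddelta g x) + B (ddelta f x) (g x)) x"
    by (rule ddelta_cong[OF ddelta_bilinear[OF B f' g'] x])
  also have "\<dots> = ddelta (ddelta (\<lambda>x. B (f x) (ddelta g x) + B (ddelta f x) (g x))) x"
    by (simp add: numeral_2_eq_2)
  also have "\<dots> = ddelta (\<lambda>x. ddelta (\<lambda>x. B (f x) (ddelta g x)) x + ddelta (\<lambda>x. B (ddelta f x) (g x)) x) x"
    by (rule ddelta_cong1[OF ddelta_add[OF c'] x])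
  also have "\<dots> = ddelta (ddelta (\<lambda>x. B (f x) (ddelta g x))) x + ddelta (ddelta (\<lambda>x. B (ddelta f x) (g x))) x"
    by (rule ddelta_add[OF CD_ddelta1[OF c'(1)] CD_ddelta1[OF c'(2)] x])
  also have "\<dots> = (B (f x) (ddelta (ddelta (ddelta g)) x) + 2 *\<^sub>R B (ddelta f x) (ddelta (ddelta g) x) + B (ddelta (ddelta f) x) (ddelta g x))
     + (B (ddelta f x) (ddelta (ddelta g) x) + 2 *\<^sub>R B (ddelta (ddelta f) x) (ddelta g x) + B (ddelta (ddelta (ddelta f)) x) (g x))"
    by (simp only: leibniz2[OF B f2 g1 x] leibniz2[OF B f1 g2 x])
  finally show ?thesis
    by (simp add: scaleR_2 add_ac) (simp add: scaleR_left_distrib[of 1 2, simplified] scaleR_2 add_ac)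
qed

text \<open>On an interval so short that \<open>e * C \<le> 1 / 2\<close> the maximum of the norm is
  at most half of itself. A short interval suffices, as only the germ at amplitude 0
  matters.\<close>

lemma linear_ode_zero:
  fixes Z :: "real \<Rightarrow> 'a::real_normed_vector"
  assumes d: "d > 0" and Z: "\<And>x. 0 \<le> x \<Longrightarrow> x < d \<Longrightarrow> (Z has_vector_derivative Z' x) (at x within {0..<d})"
    and Z0: "Z 0 = 0" and k: "continuous_on {0..<d} k" and le: "\<And>x. 0 \<le> x \<Longrightarrow> x < d \<Longrightarrow> norm (Z' x) \<le> k x * norm (Z x)"
  obtains e where "0 < e" "e \<le> d" "\<And>x. 0 \<le> x \<Longrightarrow> x < e \<Longrightarrow> Z x = 0"
proof -
  have "continuous_on {0..d/2} k" using d by (intro continuous_on_subset[OF k]) auto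
  then have "bounded (k ` {0..d/2})" by (rule compact_imp_bounded[OF compact_continuous_image[OF _ compact_Icc]])
  then obtain C where C: "C > 0" "\<And>x. x \<in> {0..d/2} \<Longrightarrow> \<bar>k x\<bar> \<le> C" by (auto simp: bounded_pos)
  define e where "e = min (d / 2) (1 / (2 * C))"
  have e: "0 < e" "e \<le> d / 2" "e * C \<le> 1 / 2" using C(1) d by (auto simp: e_def min_def field_simps)
  have cont: "continuous_on {0..e} (\<lambda>x. norm (Z x))"
  proof (rule continuous_on_norm, rule continuous_on_subset)
    show "continuous_on {0..<d} Z"
      by (rule has_vector_derivative_continuous_on) (use Z in auto)
  qed (use e d in auto)
  obtain x0 where x0: "x0 \<in> {0..e}" "\<And>x. x \<in> {0..e} \<Longrightarrow> norm (Z x) \<le> norm (Z x0)"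
    using continuous_attains_sup[OF compact_Icc _ cont] e by auto
  have "norm (Z x0 - Z 0) \<le> (C * norm (Z x0)) * norm (x0 - 0)"
  proof (rule differentiable_bound[of "{0..e}" Z "\<lambda>x h. h *\<^sub>R Z' x"])
    fix x assume x: "x \<in> {0..e}"
    show "(Z has_derivative (\<lambda>h. h *\<^sub>R Z' x)) (at x within {0..e})"
      unfolding has_vector_derivative_def[symmetric]
      using x e d by (intro has_vector_derivative_within_subset[OF Z]) auto
    have "norm (Z' x) \<le> k x * norm (Z x)" using le x e d by auto
    also have "\<dots> \<le> C * norm (Z x0)" using C(2)[of x] x0(2)[OF x] x e C(1) by (intro mult_mono) auto
    finally show "onorm (\<lambda>h. h *\<^sub>R Z' x) \<le> C * norm (Z x0)"
      by (intro onorm_bound) (auto simp: mult.commute C(1) less_imp_le intro: mult_left_mono)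
  qed (use x0 e in auto)
  also have "\<dots> \<le> (C * norm (Z x0)) * e" using x0(1) C(1) by (intro mult_left_mono) auto
  also have "\<dots> \<le> norm (Z x0) / 2" using mult_left_mono[OF e(3), of "norm (Z x0)"] by (simp add: mult_ac)
  finally have "norm (Z x0) = 0" using Z0 by simp
  then show ?thesis using e d x0(2) by (intro that[of e]) auto
qed

subsection \<open>Transport along the spectral projections\<close>

text \<open>Three amplitude derivatives are required because the index is a third derivative.
  \<open>U\<close> is the flow restricted to a short interval on which the circle of radius
  \<open>r\<close> stays in the resolvent set.\<close>

locale spectral_family =
  fixes LS :: "real \<Rightarrow> state \<Rightarrow>\<^sub>L state" and z :: complex and d r b :: real and U :: "real \<Rightarrow> state \<Rightarrow>\<^sub>L state"
  assumes d: "d > 0" and LS: "CD 3 d LS" and r: "0 < r" "r < b"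
    and ann: "\<And>x. 0 \<le> x \<Longrightarrow> x < d \<Longrightarrow> annulus_sym (LS x) z (r / 2) b"
    and U0: "U 0 = id_blinfun"
    and U: "\<And>x. 0 \<le> x \<Longrightarrow> x < d \<Longrightarrow> (U has_vector_derivative
       ((ddelta (\<lambda>x. PP (LS x) z r) x o\<^sub>L PP (LS x) z r) - (PP (LS x) z r o\<^sub>L ddelta (\<lambda>x. PP (LS x) z r) x)) o\<^sub>L U x) (at x within {0..<d})"
begin

definition "Pr x = PP (LS x) z r"
definition "Y x = YY (LS x) z r"
definition "Kt x = (ddelta Pr x o\<^sub>L Pr x) - (Pr x o\<^sub>L ddelta Pr x)"

lemma ann': "0 \<le> x \<Longrightarrow> x < d \<Longrightarrow> annulus (LS x) z (r / 2) b"
  using ann by (simp add: annulus_sym_def)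

lemma rr: "r / 2 \<le> r" "r \<le> b" "r / 2 < r" using r by auto

text \<open>\<open>Y\<close> is the projection with its outer \<open>Sop\<close> removed; its
  regularity gives that of the vector whose image under \<open>Sop\<close> is q_-, and to that
  vector the operators \<open>LS\<close> are applied.\<close>

lemma CD_Y: "CD 3 d Y"
  unfolding Y_def YY_def
proof (rule CDT_integral, rule CDT_bilinear[OF bl_compose])
  have e: "continuous_on {0..1} (\<lambda>t. cmul_op (c + of_real r * ex 1 t))" for c
    by (intro bounded_linear.continuous_on[OF bounded_linear_cmul_op] continuous_intros)
  show "CDT 3 d (\<lambda>x t. cmul_op (of_real r * ex 1 t))" by (rule CDT_param) (use e[of 0] in simp)
  show "CDT 3 d (\<lambda>x t. NN (LS x) (z + of_real r * ex 1 t))"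
  proof (rule CDT_inverse)
    show "CDT 3 d (\<lambda>x t. MM (LS x) (z + of_real r * ex 1 t))"
      unfolding MM_def
      by (intro CDT_diff CDT_param bounded_bilinear.continuous_on[OF bl_compose] e continuous_intros)
        (rule LS)
    show "binv (MM (LS x) (z + of_real r * ex 1 t)) (NN (LS x) (z + of_real r * ex 1 t))" if "0 \<le> x" "x < d" for x t
      using annulus.NN[OF ann'[OF that] annulus.circle_in_K[OF ann'[OF that] rr(1,2)]] .
  qed
qed

lemma Pr_eq: "0 \<le> x \<Longrightarrow> x < d \<Longrightarrow> Pr x = Sop o\<^sub>L Y x"
  unfolding Pr_def Y_def by (rule annulus.PP_YY[OF ann' rr(1,2)])

lemma CD_Pr: "CD 3 d Pr"
  by (rule CDT_cong[OF CDT_bilinear[OF bl_compose CDT_const[of _ _ Sop] CD_Y]]) (simp add: Pr_eq)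

lemma CD_Pr': "CD 2 d (ddelta Pr)"
  using CD_ddelta1[of 2 d Pr] CD_Pr by (simp add: eval_nat_numeral)

lemma CD_Kt: "CD 2 d Kt"
  unfolding Kt_def
  by (intro CDT_diff CDT_bilinear[OF bl_compose] CD_Pr' CDT_mono[OF CD_Pr]) auto

lemma U': "0 \<le> x \<Longrightarrow> x < d \<Longrightarrow> (U has_vector_derivative Kt x o\<^sub>L U x) (at x within {0..<d})"
  using U unfolding Kt_def Pr_def .

text \<open>Bootstrap in the differential equation: two derivatives of the generator give three of
  the flow.\<close>

lemma CD_U: "CD 3 d U"
proof -
  have c: "CD 0 d U"
  proof -
    have "continuous_on {0..<d} U"
      by (rule has_vector_derivative_continuous_on) (use U' in auto)
    then have "continuous_on ({0..<d} \<times> {0..1::real}) (\<lambda>p. U (fst p))" by (rule continuous_on_fstI)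
    then show ?thesis by (simp add: split_beta)
  qed
  have "CD n d U" if "n \<le> 3" for n
    using that
  proof (induction n)
    case (Suc n)
    then show ?case
      by (intro CD_SucI[OF U'] CDT_bilinear[OF bl_compose] CDT_mono[OF CD_Kt]) auto
  qed (rule c)
  then show ?thesis by simp
qed

lemma Pr_idem: "0 \<le> x \<Longrightarrow> x < d \<Longrightarrow> Pr x o\<^sub>L Pr x = Pr x"
  by (rule blinfun_eqI) (simp add: Pr_def annulus.PP_idem[OF ann' rr(3) r(2)])

lemma Pr_sym: "0 \<le> x \<Longrightarrow> x < d \<Longrightarrow> om ((Pr x) f) g = om f ((Pr x) g)"
  unfolding Pr_def by (rule annulus_sym.om_PP[OF ann rr(1,2)])

lemma Pr_deriv: "0 \<le> x \<Longrightarrow> x < d \<Longrightarrow> (Pr has_vector_derivative ddelta Pr x) (at x within {0..<d})"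
  using CD_ddelta(2)[of 2 d Pr] CD_Pr by (simp add: eval_nat_numeral)

lemma Pr'_eq:
  assumes "0 \<le> x" "x < d"
  shows "(ddelta Pr x o\<^sub>L Pr x) + (Pr x o\<^sub>L ddelta Pr x) = ddelta Pr x"
proof -
  have "ddelta (\<lambda>x. Pr x o\<^sub>L Pr x) x = (Pr x o\<^sub>L ddelta Pr x) + (ddelta Pr x o\<^sub>L Pr x)"
    using CD_Pr by (intro ddelta_bilinear[OF bl_compose _ _ assms, of 2 _ 2]) (simp_all add: eval_nat_numeral)
  moreover have "ddelta (\<lambda>x. Pr x o\<^sub>L Pr x) x = ddelta Pr x"
    by (rule ddelta_cong1[OF Pr_idem assms])
  ultimately show ?thesis by (simp add: add.commute)
qed

lemma Pr'_sym:
  assumes "0 \<le> x" "x < d"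
  shows "om ((ddelta Pr x) f) g = om f ((ddelta Pr x) g)"
proof -
  have bl: "bounded_linear (\<lambda>A :: state \<Rightarrow>\<^sub>L state. om (blinfun_apply A f) g)" "bounded_linear (\<lambda>A :: state \<Rightarrow>\<^sub>L state. om f (blinfun_apply A g))"
    by (rule bounded_linear_compose[OF om.bounded_linear_left blinfun.bounded_linear_left],
        rule bounded_linear_compose[OF om.bounded_linear_right blinfun.bounded_linear_left])
  have P: "CD (Suc 2) d Pr" using CD_Pr by (simp add: eval_nat_numeral)
  have "ddelta (\<lambda>x. om ((Pr x) f) g) x = ddelta (\<lambda>x. om f ((Pr x) g)) x"
    by (rule ddelta_cong1[OF Pr_sym assms])
  then show ?thesis
    unfolding ddelta_linear[OF bl(1) P assms] ddelta_linear[OF bl(2) P assms] .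
qed

text \<open>A commutator of two operators symmetric for \<open>om\<close> is antisymmetric for it;
  hence the flow preserves \<open>om\<close>.\<close>

lemma Kt_antisym:
  assumes "0 \<le> x" "x < d"
  shows "om (blinfun_apply (Kt x) f) g = - om f (blinfun_apply (Kt x) g)"
  using Pr_sym[OF assms] Pr'_sym[OF assms]
  by (simp add: Kt_def blinfun.diff_left om.diff_left om.diff_right)

lemma om_const:
  assumes "0 \<le> x" "x < d"
  shows "om ((U x) f) ((U x) g) = om f g"
proof -
  have "((\<lambda>x. om ((U x) f) ((U x) g)) has_vector_derivative 0) (at y within {0..<d})" if "y \<in> {0..<d}" for y
  proof -
    have u: "((\<lambda>x. (U x) h) has_vector_derivative blinfun_apply (Kt y) ((U y) h)) (at y within {0..<d})" for h
      using bounded_linear.has_vector_derivative[OF blinfun.bounded_linear_left U', of y h] that by simp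
    show ?thesis
      using om.has_vector_derivative[OF u[of f] u[of g]] that by (simp add: Kt_antisym)
  qed
  then obtain c where "\<forall>x\<in>{0..<d}. om ((U x) f) ((U x) g) = c"
    using has_derivative_zero_constant[of "{0..<d}" "\<lambda>x. om ((U x) f) ((U x) g)"]
    by (auto simp: has_vector_derivative_def)
  then have "om ((U x) f) ((U x) g) = om ((U 0) f) ((U 0) g)"
    using assms by auto
  then show ?thesis by (simp add: U0)
qed

text \<open>The defect \<open>Z\<close> solves Z' = Kt Z with initial value 0. With P the
  projection, the equation comes from P' + P Kt = Kt P, which holds because P P' P = 0 for a family
  of projections.\<close>

lemma intertwine:
  obtains e where "0 < e" "e \<le> d" "\<And>x. 0 \<le> x \<Longrightarrow> x < e \<Longrightarrow> Pr x o\<^sub>L U x = U x o\<^sub>L Pr 0"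
proof -
  define Z where "Z x = (Pr x o\<^sub>L U x) - (U x o\<^sub>L Pr 0)" for x
  have Z': "(Z has_vector_derivative Kt x o\<^sub>L Z x) (at x within {0..<d})" if x: "0 \<le> x" "x < d" for x
  proof -
    have "(Z has_vector_derivative ((Pr x o\<^sub>L (Kt x o\<^sub>L U x)) + (ddelta Pr x o\<^sub>L U x)) - ((Kt x o\<^sub>L U x) o\<^sub>L Pr 0)) (at x within {0..<d})"
      unfolding Z_def
      by (intro has_vector_derivative_diff bounded_bilinear.has_vector_derivative[OF bl_compose Pr_deriv[OF x] U'[OF x]]
          bounded_linear.has_vector_derivative[OF bounded_bilinear.bounded_linear_left[OF bl_compose] U'[OF x]])
    moreover have "(Pr x o\<^sub>L Kt x) + ddelta Pr x = Kt x o\<^sub>L Pr x"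
    proof -
      let ?P = "Pr x" and ?D = "ddelta Pr x"
      note I = Pr_idem[OF x] and E = Pr'_eq[OF x]
      have "?P o\<^sub>L (?D o\<^sub>L ?P) = 0"
      proof -
        have "?P o\<^sub>L ((?D o\<^sub>L ?P) + (?P o\<^sub>L ?D)) = ?P o\<^sub>L ?D" by (simp only: E)
        then have "(?P o\<^sub>L (?D o\<^sub>L ?P)) + (?P o\<^sub>L ?D) = ?P o\<^sub>L ?D"
          by (simp only: bounded_bilinear.add_right[OF bl_compose] blinfun_compose_assoc[symmetric] I)
        then show ?thesis by simp
      qed
      then have 1: "?P o\<^sub>L Kt x = - (?P o\<^sub>L ?D)" "Kt x o\<^sub>L ?P = ?D o\<^sub>L ?P"
        unfolding Kt_def bounded_bilinear.diff_right[OF bl_compose] bounded_bilinear.diff_left[OF bl_compose]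
        by (simp_all add: blinfun_compose_assoc[symmetric] I) (simp_all add: blinfun_compose_assoc I)
      have "?D - (?P o\<^sub>L ?D) = ((?D o\<^sub>L ?P) + (?P o\<^sub>L ?D)) - (?P o\<^sub>L ?D)" by (simp only: E)
      then show ?thesis unfolding 1 by simp
    qed
    then have "((Pr x o\<^sub>L Kt x) + ddelta Pr x) o\<^sub>L U x = (Kt x o\<^sub>L Pr x) o\<^sub>L U x" by simp
    then have "(Pr x o\<^sub>L (Kt x o\<^sub>L U x)) + (ddelta Pr x o\<^sub>L U x) = Kt x o\<^sub>L (Pr x o\<^sub>L U x)"
      by (simp only: bounded_bilinear.add_left[OF bl_compose] blinfun_compose_assoc)
    ultimately show ?thesis
      by (simp add: Z_def bounded_bilinear.diff_right[OF bl_compose] blinfun_compose_assoc)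
  qed
  have "Z 0 = 0" by (simp add: Z_def U0)
  moreover have "continuous_on {0..<d} (\<lambda>x. norm (Kt x))"
    by (intro continuous_on_norm CD_cont[OF CD_Kt])
  ultimately obtain e where "0 < e" "e \<le> d" "\<And>x. 0 \<le> x \<Longrightarrow> x < e \<Longrightarrow> Z x = 0"
    using linear_ode_zero[where Z = Z and Z' = "\<lambda>x. Kt x o\<^sub>L Z x" and k = "\<lambda>x. norm (Kt x)", OF d Z'] norm_blinfun_compose
    by blast
  then show ?thesis using that[of e] by (simp add: Z_def)
qed

text \<open>Let \<rho> = (L - z) q_-, which lies in the range of the projection. \<open>T0\<close>
  (the eigenvalue at amplitude 0 is semisimple) and \<open>T1\<close> place its first derivative at
  0 in the kernel as well, so \<rho> starts at second order. In the third derivative of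
  \<open>om (f x) (\<rho> x)\<close> the term with the derivative of \<open>f\<close> pairs an
  element of the kernel with one of the range of a projection symmetric for \<open>om\<close> and
  vanishes; the unknown third-order corrector drops out for the same reason.\<close>

lemma third_order:
  assumes yp: "(LS 0) yp = cmul_state z (Sop yp)"
    and y0: "(LS 0) y0 = cmul_state z (Sop y0)"
    and T0: "\<And>y. (Pr 0) ((LS 0) y - cmul_state z (Sop y)) = 0"
    and T1: "(Pr 0) ((ddelta LS 0) y0) = 0"
    and a: "\<And>x y. 0 \<le> x \<Longrightarrow> x < d \<Longrightarrow> (U x) (Sop y0) = Sop y \<Longrightarrow>
      a x = om ((U x) (Sop yp)) ((LS x) y)"
  obtains y1 y2 r2 where
    "(ddelta LS 0) y0 + ((LS 0) y1 - cmul_state z (Sop y1)) = 0"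
    "(Pr 0) (Sop y1) = 0"
    "(ddelta (ddelta LS) 0) y0 + 2 *\<^sub>R (ddelta LS 0) y1
       + ((LS 0) y2 - cmul_state z (Sop y2)) = r2"
    "(Pr 0) r2 = r2"
    "ddelta (ddelta (ddelta a)) 0 = om (Sop yp) (blinfun_apply (ddelta (ddelta (ddelta LS)) 0) y0
       + 3 *\<^sub>R (ddelta (ddelta LS) 0) y1 + 3 *\<^sub>R (ddelta LS 0) y2)"
proof -
  obtain e where e: "0 < e" "e \<le> d" and int: "\<And>x. 0 \<le> x \<Longrightarrow> x < e \<Longrightarrow> Pr x o\<^sub>L U x = U x o\<^sub>L Pr 0"
    using intertwine by blast
  define qp qm where "qp = Sop yp" and "qm = Sop y0"
  define f g where "f x = (U x) qp" and "g x = (U x) qm" for x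
  define y where "y x = (Y x) (g x)" for x
  define T where "T x = LS x + - (cmul_op z o\<^sub>L Sop)" for x
  define \<rho> where "\<rho> x = blinfun_apply (T x) (y x)" for x
  note ba = bounded_bilinear_blinfun_apply
  have CU: "CD 3 e U" and CY: "CD 3 e Y" and CL: "CD 3 e LS" and CP: "CD 3 e Pr"
    using CD_U CD_Y LS CD_Pr e(2) by (auto intro: CDT_restrict)
  have Cf: "CD 3 e f" and Cg: "CD 3 e g"
    unfolding f_def g_def by (intro CDT_bilinear[OF ba] CU CDT_const)+
  have Cy: "CD 3 e y" unfolding y_def by (rule CDT_bilinear[OF ba CY Cg])
  have CT: "CD 3 e T" unfolding T_def by (intro CDT_add CL CDT_const)
  have C\<rho>: "CD 3 e \<rho>" unfolding \<rho>_def by (rule CDT_bilinear[OF ba CT Cy])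
  have z0: "0 \<le> (0 :: real)" by simp
  note at0 = z0 e(1)
  interpret A0: annulus_sym "LS 0" z "r / 2" b by (rule ann) (use d in auto)
  have P0: "(Pr 0) qp = qp" "(Pr 0) qm = qm"
    unfolding Pr_def qp_def qm_def by (rule A0.PP_eigen[OF rr(1,2)], rule yp y0)+
  have Sy: "Sop (y x) = g x" and Prg: "(Pr x) (g x) = g x" if x: "0 \<le> x" "x < e" for x
  proof -
    have "(Pr x o\<^sub>L U x) qm = (U x o\<^sub>L Pr 0) qm" by (simp only: int[OF x])
    then show "(Pr x) (g x) = g x" by (simp add: g_def P0)
    then show "Sop (y x) = g x" using Pr_eq[of x] x e(2) by (simp add: y_def)
  qed
  have U00: "f 0 = qp" "g 0 = qm" by (simp_all add: f_def g_def U0)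
  have y00: "y 0 = y0"
    using Sy[OF at0] U00 Sop_inj by (simp add: qm_def)
  have T_apply: "blinfun_apply (T x) v = (LS x) v - cmul_state z (Sop v)" for x v
    by (simp add: T_def blinfun.diff_left)
  have ax: "a x = om (f x) (\<rho> x) + z * om qp qm" if x: "0 \<le> x" "x < e" for x
  proof -
    have "a x = om (f x) ((LS x) (y x))"
      unfolding f_def qp_def by (rule a) (use x e(2) Sy[OF x] in \<open>auto simp: g_def qm_def\<close>)
    also have "(LS x) (y x) = \<rho> x + cmul_state z (g x)"
      by (simp add: \<rho>_def T_apply Sy[OF x])
    also have "om (f x) (\<rho> x + cmul_state z (g x)) = om (f x) (\<rho> x) + z * om (f x) (g x)"
      by (simp add: om.add_right om_cmul_right)
    also have "om (f x) (g x) = om qp qm" unfolding f_def g_def using x e(2) by (intro om_const) auto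
    finally show ?thesis .
  qed
  have P\<rho>: "(Pr x) (\<rho> x) = \<rho> x" if x: "0 \<le> x" "x < e" for x
  proof -
    have x': "0 \<le> x" "x < d" using x e(2) by auto
    have "(Pr x) ((LS x) (y x)) = (LS x) ((Y x) (Sop (y x)))"
      unfolding Pr_def Y_def by (rule annulus.PP_T[OF ann'[OF x'] rr(1,2)])
    also have "\<dots> = (LS x) (y x)" unfolding Sy[OF x] by (simp add: y_def)
    moreover have "(Pr x) (cmul_state z (g x)) = cmul_state z (g x)"
      using clinD[OF annulus.clin_PP[OF ann'[OF x'] rr(1,2)]] Prg[OF x] by (simp add: Pr_def)
    ultimately show ?thesis by (simp add: \<rho>_def T_apply Sy[OF x] blinfun.diff_right)
  qed
  have S3: "CD (Suc 2) e h" if "CD 3 e h" for h :: "real \<Rightarrow> 'c::real_normed_vector" using that by (simp add: eval_nat_numeral)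
  have S2: "CD 2 e h" if "CD 3 e h" for h :: "real \<Rightarrow> 'c::real_normed_vector" by (rule CDT_mono[OF that]) simp
  have T': "ddelta T x = ddelta LS x" if "0 \<le> x" "x < e" for x
    unfolding T_def by (rule ddelta_add_const[OF S3[OF CL] that])
  have T'': "ddelta (ddelta T) 0 = ddelta (ddelta LS) 0" by (rule ddelta_cong1[OF T' at0])
  have T''': "ddelta (ddelta (ddelta T)) 0 = ddelta (ddelta (ddelta LS)) 0"
    using ddelta_cong[OF T' at0, where n = 2] by (simp add: numeral_2_eq_2)
  define y1 y2 y3 where "y1 = ddelta y 0" and "y2 = ddelta (ddelta y) 0" and "y3 = ddelta (ddelta (ddelta y)) 0"
  define r1 r2 r3 where "r1 = ddelta \<rho> 0" and "r2 = ddelta (ddelta \<rho>) 0" and "r3 = ddelta (ddelta (ddelta \<rho>)) 0"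
  have r0: "\<rho> 0 = 0" by (simp add: \<rho>_def y00 T_apply y0)
  have r1: "r1 = blinfun_apply (T 0) y1 + (ddelta LS 0) y0"
    unfolding r1_def y1_def \<rho>_def ddelta_bilinear[OF ba S3[OF CT] S3[OF Cy] at0] by (simp add: y00 T'[OF at0])
  have r2: "r2 = blinfun_apply (T 0) y2 + 2 *\<^sub>R (ddelta LS 0) y1 + (ddelta (ddelta LS) 0) y0"
    unfolding r2_def y1_def y2_def \<rho>_def leibniz2[OF ba S2[OF CT] S2[OF Cy] at0] by (simp add: y00 T'[OF at0] T'')
  have r3: "r3 = blinfun_apply (T 0) y3 + 3 *\<^sub>R (ddelta LS 0) y2 + 3 *\<^sub>R (ddelta (ddelta LS) 0) y1
      + blinfun_apply (ddelta (ddelta (ddelta LS)) 0) y0"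
    unfolding r3_def y1_def y2_def y3_def \<rho>_def leibniz3[OF ba CT Cy at0] by (simp add: y00 T'[OF at0] T'' T''')
  have PT: "(Pr 0) (blinfun_apply (T 0) v) = 0" for v
    unfolding T_apply by (rule T0)
  \<comment> \<open>As \<rho> vanishes at 0, differentiating Pr \<rho> = \<rho> leaves Pr r1 = r1,
    while \<open>PT\<close> and \<open>T1\<close> give Pr r1 = 0.\<close>
  have "ddelta (\<lambda>x. (Pr x) (\<rho> x)) 0 = r1"
    unfolding r1_def by (rule ddelta_cong1[OF P\<rho> at0])
  then have "(Pr 0) r1 = r1"
    unfolding ddelta_bilinear[OF ba S3[OF CP] S3[OF C\<rho>] at0] by (simp add: r0 r1_def[symmetric])
  then have r1_0: "r1 = 0" by (simp add: r1 blinfun.add_right PT T1)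
  have "ddelta (ddelta (\<lambda>x. (Pr x) (\<rho> x))) 0 = r2"
    unfolding r2_def using ddelta_cong[OF P\<rho> at0, where n = 2] by (simp add: numeral_2_eq_2)
  then have Pr2: "(Pr 0) r2 = r2"
    unfolding leibniz2[OF ba S2[OF CP] S2[OF C\<rho>] at0] by (simp add: r0 r1_def[symmetric] r1_0 r2_def[symmetric])
  \<comment> \<open>On the range of the projection P the generator is (1 - P) P', which P
    annihilates.\<close>
  have PK: "(Pr 0) (blinfun_apply (Kt 0) v) = 0" if "(Pr 0) v = v" for v
  proof -
    have I: "(Pr 0) ((Pr 0) w) = (Pr 0) w" for w
      using Pr_idem[of 0] d by (metis blinfun_apply_blinfun_compose order_refl)
    show ?thesis by (simp add: Kt_def blinfun.diff_left blinfun.diff_right that I)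
  qed
  have dU: "ddelta (\<lambda>x. (U x) v) 0 = blinfun_apply (Kt 0) v" for v
    using ddelta_eq(1)[OF bounded_linear.has_vector_derivative[OF blinfun.bounded_linear_left U', of 0 v] _ d] d by (simp add: U0)
  have Pf1: "(Pr 0) (ddelta f 0) = 0"
    unfolding f_def dU by (rule PK[OF P0(1)])
  have "ddelta (\<lambda>x. Sop (y x)) 0 = ddelta g 0" by (rule ddelta_cong1[OF Sy at0])
  \<comment> \<open>q_- starts to move by the generator, so its first-order corrector has no
    component in the range of the projection; this normalises \<open>y1\<close>.\<close>
  then have Sy1: "Sop y1 = blinfun_apply (Kt 0) qm"
    unfolding ddelta_linear[OF blinfun.bounded_linear_right S3[OF Cy] at0] g_def dU y1_def .
  have "ddelta (ddelta (ddelta a)) 0 = (ddelta ^^ 3) a 0" by (simp add: eval_nat_numeral)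
  also have "\<dots> = (ddelta ^^ 3) (\<lambda>x. om (f x) (\<rho> x) + z * om qp qm) 0" by (rule ddelta_cong[OF ax at0])
  also have "\<dots> = (ddelta ^^ 2) (ddelta (\<lambda>x. om (f x) (\<rho> x) + z * om qp qm)) 0" by (simp add: eval_nat_numeral)
  also have "\<dots> = (ddelta ^^ 2) (ddelta (\<lambda>x. om (f x) (\<rho> x))) 0"
    by (rule ddelta_cong[OF ddelta_add_const[OF S3[OF CDT_bilinear[OF bounded_bilinear_om Cf C\<rho>]]] at0])
  also have "\<dots> = ddelta (ddelta (ddelta (\<lambda>x. om (f x) (\<rho> x)))) 0" by (simp add: eval_nat_numeral)
  also have "\<dots> = om qp r3 + 3 *\<^sub>R om (ddelta f 0) r2"
    unfolding leibniz3[OF bounded_bilinear_om Cf C\<rho> at0]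
    by (simp add: U00 r0 r1_def[symmetric] r1_0 r2_def[symmetric] r3_def[symmetric] om.zero_right)
  also have "om (ddelta f 0) r2 = 0"
    using Pr_sym[of 0 "ddelta f 0" r2] d by (simp add: Pr2 Pf1 om.zero_left)
  also have "om qp r3 = om qp (blinfun_apply (ddelta (ddelta (ddelta LS)) 0) y0 + 3 *\<^sub>R (ddelta (ddelta LS) 0) y1 + 3 *\<^sub>R (ddelta LS 0) y2)"
  proof -
    have "om qp (blinfun_apply (T 0) y3) = 0"
      using Pr_sym[of 0 qp "blinfun_apply (T 0) y3"] d by (simp add: P0 PT om.zero_right)
    then show ?thesis by (simp add: r3 om.add_right)
  qed
  finally show ?thesis
    using r1 r1_0 r2 Pr2 PK[OF P0(2)] Sy1
    by (intro that[of y1 y2 r2]) (simp_all add: T_apply add_ac qp_def)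
qed

end

subsection \<open>Fourier multipliers on the state space\<close>

definition s1 :: "state \<Rightarrow> int \<Rightarrow> complex" where "s1 w n = fc (h1_fun (fst w)) n"
definition s2 :: "state \<Rightarrow> int \<Rightarrow> complex" where "s2 w n = fc (snd w) n"

lemma cfun_s: "cfun (\<lambda>w. s1 w n)" "cfun (\<lambda>w. s2 w n)"
  unfolding s1_def s2_def by (rule cfun_fc)+

lemma s_linear:
  "s1 (v + w) n = s1 v n + s1 w n" "s2 (v + w) n = s2 v n + s2 w n"
  "s1 (v - w) n = s1 v n - s1 w n" "s2 (v - w) n = s2 v n - s2 w n"
  "s1 (r *\<^sub>R v) n = r *\<^sub>R s1 v n" "s2 (r *\<^sub>R v) n = r *\<^sub>R s2 v n"
  "s1 (cmul_state c v) n = c * s1 v n" "s2 (cmul_state c v) n = c * s2 v n"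
  "s1 0 n = 0" "s2 0 n = 0"
  by (simp_all add: s1_def s2_def fc_simps h1_fun_add h1_fun_diff h1_fun_scaleR h1_fun_cmul
      linear_0[OF bounded_linear.linear[OF bounded_linear_h1_fun]])

lemma s_minus: "s1 (- v) n = - s1 v n" "s2 (- v) n = - s2 v n"
  using s_linear(3,4)[of 0 v n] by (simp_all add: s_linear(9,10))

lemma s_eqI:
  assumes "\<And>n. s1 v n = s1 w n" "\<And>n. s2 v n = s2 w n"
  shows "v = w"
  using assms by (intro prod_eqI h1_eqI fc_eqI) (auto simp: s1_def s2_def)

lemma s_Sop: "s1 (Sop y) n = s1 y n / (1 + dfac n)" "s2 (Sop y) n = s2 y n / (1 + dfac n)"
  by (simp_all add: s1_def s2_def Sop_apply fc_Bm)

lemma multiplier_op: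
  assumes K: "\<And>n. cmod (a n) \<le> K"
  obtains F :: "l2 \<Rightarrow>\<^sub>L l2" where "\<And>f n. fc (blinfun_apply F f) n = a n * fc f n"
proof -
  have K0: "K \<ge> 0" using order_trans[OF norm_ge_zero K[of 0]] .
  have le: "cmod (a n * fc f n) \<le> K * cmod (fc f n)" for f n
    using K[of n] by (simp add: norm_mult mult_right_mono)
  have "\<exists>g. \<forall>n. fc g n = a n * fc f n" for f
    using multiplier_ex[of "\<lambda>n. a n * fc f n" K f] le K0 by metis
  then obtain g where g: "\<And>f n. fc (g f) n = a n * fc f n" by metis
  have "bounded_linear g"
  proof (rule bounded_linear_intro)
    show "norm (g f) \<le> norm f * K" for f
      using norm_le_multiplier[of "g f" K f] le K0 by (simp add: g mult.commute)
  qed (rule fc_eqI, simp add: g fc_simps algebra_simps)+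
  then show ?thesis using that[of "Blinfun g"] g by (simp add: bounded_linear_Blinfun_apply)
qed

text \<open>The weights on the off-diagonal entries reflect the spaces: \<open>b\<close> maps L^2
  into H^1 and must gain a factor 1 + \<open>dfac n\<close>, \<open>c\<close> maps H^1 into L^2 and
  may lose one.\<close>

lemma matrix_multiplier_op:
  assumes K: "\<And>n. cmod (a n) \<le> K" "\<And>n. cmod ((1 + dfac n) * b n) \<le> K" "\<And>n. cmod (c n / (1 + dfac n)) \<le> K" "\<And>n. cmod (d n) \<le> K"
  obtains F :: "state \<Rightarrow>\<^sub>L state" where
    "\<And>y n. s1 (blinfun_apply F y) n = a n * s1 y n + b n * s2 y n"
    "\<And>y n. s2 (blinfun_apply F y) n = c n * s1 y n + d n * s2 y n"
proof -
  obtain Fa where Fa: "\<And>f n. fc (blinfun_apply Fa f) n = a n * fc f n" using multiplier_op[of "a" K] K(1) by blast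
  obtain Fb where Fb: "\<And>f n. fc (blinfun_apply Fb f) n = (1 + dfac n) * b n * fc f n" using multiplier_op[of "\<lambda>n. (1 + dfac n) * b n" K] K(2) by blast
  obtain Fc where Fc: "\<And>f n. fc (blinfun_apply Fc f) n = c n / (1 + dfac n) * fc f n" using multiplier_op[of "\<lambda>n. c n / (1 + dfac n)" K] K(3) by blast
  obtain Fd where Fd: "\<And>f n. fc (blinfun_apply Fd f) n = d n * fc f n" using multiplier_op[of "d" K] K(4) by blast
  note F = Fa Fb Fc Fd
  define F where "F = (inl o\<^sub>L bB o\<^sub>L ((Fa o\<^sub>L (hI + hD) o\<^sub>L pfst) + (Fb o\<^sub>L psnd)))
     + (inr o\<^sub>L ((Fc o\<^sub>L (hI + hD) o\<^sub>L pfst) + (Fd o\<^sub>L psnd)))"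
  show ?thesis
  proof (rule that[of F])
    fix y n
    have e: "fc (h1_fun w) n + dfac n * fc (h1_fun w) n = (1 + dfac n) * fc (h1_fun w) n" for w
      by (simp add: algebra_simps)
    have ap: "blinfun_apply F y = (Bm (blinfun_apply Fa (h1_fun (fst y) + dh (fst y)) + blinfun_apply Fb (snd y)),
        blinfun_apply Fc (h1_fun (fst y) + dh (fst y)) + blinfun_apply Fd (snd y))"
      by (simp add: F_def blinfun.add_left)
    show "s1 (blinfun_apply F y) n = a n * s1 y n + b n * s2 y n"
      using dfac_nz[of n] by (simp add: ap s1_def s2_def fc_Bm fc_add F fc_dh e add_divide_distrib)
    show "s2 (blinfun_apply F y) n = c n * s1 y n + d n * s2 y n"
      using dfac_nz[of n] by (simp add: ap s1_def s2_def fc_add F fc_dh e)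
  qed
qed

lemma mode_state:
  obtains y where "\<And>n. s1 (Sop y) n = (if n = m then X else 0)" "\<And>n. s2 (Sop y) n = (if n = m then Z else 0)"
proof -
  let ?y = "(Bm (cmul_l2 ((1 + dfac m) * (1 + dfac m) * X) (em m)), cmul_l2 ((1 + dfac m) * Z) (em m))"
  show ?thesis
    using dfac_nz[of m] by (intro that[of ?y]) (simp_all add: s_Sop, simp_all add: s1_def s2_def fc_Bm fc_cmul fc_em)
qed

subsection \<open>The constant-coefficient operator\<close>

text \<open>L about the constant state, with \<open>c1\<close> = k V and \<open>c3\<close> = k^2
  P'(1). The condition \<open>c3 < c1\<^sup>2\<close> is V^2 > P'(1); it makes the determinant grow
  quadratically in the mode.\<close>

locale constant_symbol =
  fixes c1 c3 \<xi> :: real and z :: complex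
  assumes c: "0 < c3" "0 < c1" "c3 < c1\<^sup>2"
begin

definition wv :: "int \<Rightarrow> complex" where "wv n = dfac n + \<i> * \<xi>"
definition kap :: "int \<Rightarrow> real" where "kap n = 2 * pi * n + \<xi>"
definition pp :: "int \<Rightarrow> complex \<Rightarrow> complex" where "pp n \<mu> = \<mu> - c1 * wv n"
definition qq :: "int \<Rightarrow> complex" where "qq n = 1 - c3 * (wv n)\<^sup>2"
text \<open>The determinant of \<mu> minus the symbol of L at mode \<open>n\<close>, a matrix with
  rows (\<open>pp\<close>, 1) and (- \<open>qq\<close>, \<open>pp\<close>).\<close>

definition Dt :: "int \<Rightarrow> complex \<Rightarrow> complex" where "Dt n \<mu> = (pp n \<mu>)\<^sup>2 + qq n"
definition L0 :: "state \<Rightarrow>\<^sub>L state" where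
  "L0 = IS + LSop \<xi> (\<lambda>x. c1) (\<lambda>x. 1) (\<lambda>x. c3) (\<lambda>x. 0) (\<lambda>x. 0)"

lemma wv_kap: "wv n = \<i> * of_real (kap n)"
  by (simp add: wv_def kap_def dfac_def algebra_simps)

lemma qq_kap: "qq n = of_real (1 + c3 * (kap n)\<^sup>2)"
  by (simp add: qq_def wv_kap power_mult_distrib)

lemma qq_nz: "qq n \<noteq> 0"
proof -
  have "1 + c3 * (kap n)\<^sup>2 > 0" using c by (intro add_pos_nonneg) auto
  then show ?thesis unfolding qq_kap by (simp only: of_real_eq_0_iff)
qed

lemma C1p_const: "C1p (\<lambda>x. r) (\<lambda>x. 0)" by (simp add: C1p_def)

lemma mulh_const: "mulh (\<lambda>x. r) w = r *\<^sub>R w"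
  by (rule h1_eqI) (simp add: mulh[OF C1p_const] mul_l2_const h1_fun_scaleR)

lemma IS_apply: "IS y = (0, h1_fun (Bm (h1_fun (fst y))))"
  by (simp add: IS_def)

lemma s_L0:
  "s1 (blinfun_apply L0 y) n = c1 * wv n * s1 (blinfun_apply Sop y) n - s2 (blinfun_apply Sop y) n"
  "s2 (blinfun_apply L0 y) n = qq n * s1 (blinfun_apply Sop y) n + c1 * wv n * s2 (blinfun_apply Sop y) n"
proof -
  have nz: "1 + dfac n \<noteq> 0" by (rule dfac_nz)
  have G: "fc (h1_fun (Gop \<xi> w)) n = wv n * (fc (h1_fun w) n / (1 + dfac n))" for w
    using nz by (simp add: Gop_apply h1_fun_add h1_fun_cmul fc_add fc_cmul fc_Bm wv_def field_simps)
  have DXf: "fc (DX \<xi> w) n = wv n * fc (h1_fun w) n" for w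
    by (simp add: DX_apply fc_add fc_cmul fc_dh wv_def algebra_simps)
  have ap: "L0 y = (c1 *\<^sub>R Gop \<xi> (fst y) - Bm (snd y),
     h1_fun (Bm (h1_fun (fst y))) + (c1 *\<^sub>R DX \<xi> (Bm (snd y)) - c3 *\<^sub>R DX \<xi> (Gop \<xi> (fst y))))"
    by (simp add: L0_def blinfun.add_left IS_apply LSop_apply[OF C1p_const C1p_const cper_const cper_const cper_const]
        mulh_const mul_l2_const)
  show "s1 (blinfun_apply L0 y) n = c1 * wv n * s1 (blinfun_apply Sop y) n - s2 (blinfun_apply Sop y) n"
    unfolding s_Sop by (simp add: ap s1_def s2_def h1_fun_diff h1_fun_scaleR fc_diff fc_scaleR G fc_Bm scaleR_conv_of_real)
  show "s2 (blinfun_apply L0 y) n = qq n * s1 (blinfun_apply Sop y) n + c1 * wv n * s2 (blinfun_apply Sop y) n"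
    unfolding s_Sop
    by (simp add: ap s1_def s2_def fc_add fc_diff fc_scaleR DXf G fc_Bm scaleR_conv_of_real qq_def power2_eq_square
        algebra_simps diff_divide_distrib)
qed

lemma s_MM:
  "s1 ((MM L0 \<mu>) y) n = pp n \<mu> * s1 (Sop y) n + s2 (Sop y) n"
  "s2 ((MM L0 \<mu>) y) n = - qq n * s1 (Sop y) n + pp n \<mu> * s2 (Sop y) n"
  by (simp_all add: MM_apply s_linear s_L0 pp_def algebra_simps)

definition gap where "gap = c1\<^sup>2 - c3"

lemma gap_pos: "gap > 0" using c by (simp add: gap_def)

text \<open>The determinant is - \<open>gap\<close> \<open>kap\<close>^2 plus terms at most linear
  in \<open>kap\<close>. The first two summands of the threshold bound the linear and the constant
  part by a quarter of the leading term each; the final 1 ensures |kap| \<le> kap^2.\<close>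

lemma Dt_large:
  assumes R: "cmod \<mu> \<le> R" "R \<ge> 0" and k: "\<bar>kap n\<bar> \<ge> 8 * c1 * R / gap + 4 * (R\<^sup>2 + 1) / gap + 1"
  shows "gap / 2 * (kap n)\<^sup>2 \<le> cmod (Dt n \<mu>)"
proof -
  let ?k = "\<bar>kap n\<bar>"
  have D: "Dt n \<mu> = of_real (- gap * (kap n)\<^sup>2) + (\<mu>\<^sup>2 - 2 * \<i> * c1 * kap n * \<mu> + 1)"
    by (simp add: Dt_def pp_def qq_kap wv_kap gap_def power2_eq_square algebra_simps)
  have pos: "0 \<le> 8 * c1 * R / gap" "0 \<le> 4 * (R\<^sup>2 + 1) / gap" using gap_pos c R by simp_all
  then have k1: "1 \<le> ?k" "8 * c1 * R / gap \<le> ?k" "4 * (R\<^sup>2 + 1) / gap \<le> ?k" using k by linarith+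
  have "cmod (\<mu>\<^sup>2 - 2 * \<i> * c1 * kap n * \<mu> + 1) \<le> cmod \<mu> ^ 2 + 2 * c1 * ?k * cmod \<mu> + 1"
    using norm_triangle_ineq[of "\<mu>\<^sup>2 - 2 * \<i> * c1 * kap n * \<mu>" 1] norm_triangle_ineq4[of "\<mu>\<^sup>2" "2 * \<i> * c1 * kap n * \<mu>"] c
    by (simp add: norm_mult norm_power)
  also have "\<dots> \<le> R\<^sup>2 + 2 * c1 * ?k * R + 1"
    using R c by (intro add_mono mult_left_mono power_mono) auto
  also have "\<dots> = (R\<^sup>2 + 1) + 2 * c1 * R * ?k" by simp
  also have "\<dots> \<le> gap / 4 * ?k\<^sup>2 + gap / 4 * ?k\<^sup>2"
  proof (rule add_mono)
    have kk: "?k \<le> ?k\<^sup>2"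
      using mult_left_mono[OF k1(1) abs_ge_zero[of "kap n"]] unfolding power2_eq_square by (simp only: mult_1_right)
    have "R\<^sup>2 + 1 \<le> gap / 4 * ?k" using k1(3) gap_pos by (simp add: field_simps)
    also have "\<dots> \<le> gap / 4 * ?k\<^sup>2" using kk gap_pos by (intro mult_left_mono) auto
    finally show "R\<^sup>2 + 1 \<le> gap / 4 * ?k\<^sup>2" .
    have "2 * c1 * R \<le> gap / 4 * ?k" using k1(2) gap_pos by (simp add: field_simps)
    then have "2 * c1 * R * ?k \<le> gap / 4 * ?k * ?k" by (intro mult_right_mono) auto
    then show "2 * c1 * R * ?k \<le> gap / 4 * ?k\<^sup>2" by (simp add: power2_eq_square mult.assoc)
  qed
  finally have *: "cmod (\<mu>\<^sup>2 - 2 * \<i> * c1 * kap n * \<mu> + 1) \<le> gap / 2 * (kap n)\<^sup>2" by simp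
  have "gap * (kap n)\<^sup>2 = cmod (of_real (- gap * (kap n)\<^sup>2))" using gap_pos by (simp only: norm_of_real) simp
  also have "\<dots> \<le> cmod (Dt n \<mu>) + cmod (\<mu>\<^sup>2 - 2 * \<i> * c1 * kap n * \<mu> + 1)"
    unfolding D using norm_triangle_ineq4[of "of_real (- gap * (kap n)\<^sup>2) + (\<mu>\<^sup>2 - 2 * \<i> * c1 * kap n * \<mu> + 1)" "\<mu>\<^sup>2 - 2 * \<i> * c1 * kap n * \<mu> + 1"]
    by simp
  finally show ?thesis using * by simp
qed

lemma finite_small: "finite {n. \<bar>kap n\<bar> < B}"
proof (rule finite_subset)
  show "{n. \<bar>kap n\<bar> < B} \<subseteq> {- \<lceil>B + \<bar>\<xi>\<bar>\<rceil>..\<lceil>B + \<bar>\<xi>\<bar>\<rceil>}"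
  proof
    fix n assume "n \<in> {n. \<bar>kap n\<bar> < B}"
    then have "\<bar>2 * pi * n\<bar> < B + \<bar>\<xi>\<bar>" by (simp add: kap_def)
    moreover have "\<bar>real_of_int n\<bar> * 1 \<le> \<bar>real_of_int n\<bar> * (2 * pi)" using pi_gt3 by (intro mult_left_mono) auto
    ultimately have "\<bar>real_of_int n\<bar> < B + \<bar>\<xi>\<bar>" by (simp add: abs_mult mult.commute)
    then show "n \<in> {- \<lceil>B + \<bar>\<xi>\<bar>\<rceil>..\<lceil>B + \<bar>\<xi>\<bar>\<rceil>}" by simp linarith
  qed
qed simp

text \<open>Large modes by \<open>Dt_large\<close>, the finitely many others by a minimum over
  positive values. Quadratic growth is what lets the inverse gain the derivatives absorbed in
  \<open>Sop\<close>.\<close>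

lemma Dt_lower_bound:
  assumes "\<And>n. Dt n \<mu> \<noteq> 0"
  obtains C where "C > 0" "\<And>n. C * (cmod (1 + dfac n))\<^sup>2 \<le> cmod (Dt n \<mu>)"
proof -
  define R where "R = cmod \<mu>"
  define B where "B = 8 * c1 * R / gap + 4 * (R\<^sup>2 + 1) / gap + 1"
  have B1: "B \<ge> 1" using gap_pos c by (simp add: B_def R_def)
  define A where "A = {n. \<bar>kap n\<bar> < B}"
  define h where "h n = cmod (Dt n \<mu>) / (cmod (1 + dfac n))\<^sup>2" for n
  have hpos: "h n > 0" for n using assms dfac_nz[of n] by (simp add: h_def)
  define C0 where "C0 = gap / 2 / (2 + \<bar>\<xi>\<bar>)\<^sup>2"
  have C0: "C0 > 0" using gap_pos by (simp add: C0_def add_pos_nonneg)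
  define C where "C = Min (insert C0 (h ` A))"
  have fin: "finite (insert C0 (h ` A))" using finite_small[of B] by (simp add: A_def)
  have "C > 0" unfolding C_def using fin C0 hpos by (subst Min_gr_iff) auto
  moreover have "C * (cmod (1 + dfac n))\<^sup>2 \<le> cmod (Dt n \<mu>)" for n
  proof (cases "n \<in> A")
    case True
    then have "C \<le> h n" unfolding C_def using fin by (intro Min_le) auto
    then show ?thesis using dfac_nz[of n] by (simp add: h_def field_simps)
  next
    case False
    then have k: "B \<le> \<bar>kap n\<bar>" by (simp add: A_def)
    have "cmod (1 + dfac n) \<le> 1 + \<bar>2 * pi * n\<bar>"
      using norm_triangle_ineq[of 1 "dfac n"] by (simp add: dfac_norm abs_mult)
    also have "\<dots> \<le> 1 + (\<bar>kap n\<bar> + \<bar>\<xi>\<bar>)" by (simp add: kap_def)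
    also have "\<dots> \<le> (2 + \<bar>\<xi>\<bar>) * \<bar>kap n\<bar>"
    proof -
      have "1 \<le> \<bar>kap n\<bar>" using k B1 by simp
      then have "\<bar>\<xi>\<bar> * 1 \<le> \<bar>\<xi>\<bar> * \<bar>kap n\<bar>" by (intro mult_left_mono) auto
      then show ?thesis using \<open>1 \<le> \<bar>kap n\<bar>\<close> by (simp add: algebra_simps)
    qed
    finally have "(cmod (1 + dfac n))\<^sup>2 \<le> ((2 + \<bar>\<xi>\<bar>) * \<bar>kap n\<bar>)\<^sup>2" by (intro power_mono) auto
    then have "C0 * (cmod (1 + dfac n))\<^sup>2 \<le> C0 * ((2 + \<bar>\<xi>\<bar>) * \<bar>kap n\<bar>)\<^sup>2" using C0 by (intro mult_left_mono) auto
    also have "\<dots> = gap / 2 * (kap n)\<^sup>2"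
      by (simp add: C0_def power_mult_distrib add_nonneg_eq_0_iff)
    also have "\<dots> \<le> cmod (Dt n \<mu>)" using k by (intro Dt_large[of \<mu> R]) (auto simp: R_def B_def)
    finally have "C0 * (cmod (1 + dfac n))\<^sup>2 \<le> cmod (Dt n \<mu>)" .
    moreover have "C \<le> C0" unfolding C_def using fin by (intro Min_le) auto
    ultimately show ?thesis using mult_right_mono[of C C0 "(cmod (1 + dfac n))\<^sup>2"] by simp
  qed
  ultimately show ?thesis using that by blast
qed

lemma kap_bound: "\<bar>kap n\<bar> \<le> (1 + \<bar>\<xi>\<bar>) * cmod (1 + dfac n)"
proof -
  have "\<bar>kap n\<bar> \<le> \<bar>2 * pi * n\<bar> + \<bar>\<xi>\<bar>" by (simp add: kap_def)
  also have "\<dots> = cmod (dfac n) + \<bar>\<xi>\<bar> * 1" by (simp add: dfac_norm abs_mult)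
  also have "\<dots> \<le> cmod (1 + dfac n) + \<bar>\<xi>\<bar> * cmod (1 + dfac n)"
    by (intro add_mono mult_left_mono dfac_1) auto
  finally show ?thesis by (simp add: algebra_simps)
qed

text \<open>The adjugate divided by the determinant, mode by mode. The additional factor 1 +
  \<open>dfac n\<close> in the entries of \<open>N\<close> undoes \<open>Sop\<close>, whose symbol
  is the reciprocal in both components.\<close>

lemma MM_inverse:
  assumes D: "\<And>n. Dt n \<mu> \<noteq> 0"
  obtains N where "binv (MM L0 \<mu>) N"
    "\<And>y n. s1 (Sop (blinfun_apply N y)) n = (pp n \<mu> * s1 y n - s2 y n) / Dt n \<mu>"
    "\<And>y n. s2 (Sop (blinfun_apply N y)) n = (qq n * s1 y n + pp n \<mu> * s2 y n) / Dt n \<mu>"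
proof -
  obtain C where C: "C > 0" "\<And>n. C * (cmod (1 + dfac n))\<^sup>2 \<le> cmod (Dt n \<mu>)" using Dt_lower_bound[OF D] by blast
  let ?e = "\<lambda>n. cmod (1 + dfac n)"
  define X where "X = 1 + \<bar>\<xi>\<bar>"
  define Kp where "Kp = cmod \<mu> + c1 * X"
  define Kq where "Kq = 1 + c3 * X\<^sup>2"
  have e1: "1 \<le> ?e n" for n by (rule dfac_1)
  have K0: "Kp \<ge> 0" "Kq \<ge> 0" using c by (simp_all add: Kp_def Kq_def X_def)
  have pb: "cmod (pp n \<mu>) \<le> Kp * ?e n" for n
  proof -
    have "cmod (pp n \<mu>) \<le> cmod \<mu> + c1 * \<bar>kap n\<bar>"
      using norm_triangle_ineq4[of \<mu> "c1 * wv n"] c by (simp add: pp_def wv_kap norm_mult)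
    also have "\<dots> \<le> cmod \<mu> * ?e n + c1 * (X * ?e n)"
      using e1[of n] kap_bound[of n] c mult_left_mono[OF e1[of n], of "cmod \<mu>"] unfolding X_def
      by (intro add_mono mult_left_mono) auto
    finally show ?thesis by (simp add: Kp_def algebra_simps)
  qed
  have qb: "cmod (qq n) \<le> Kq * (?e n)\<^sup>2" for n
  proof -
    have "cmod (qq n) = 1 + c3 * \<bar>kap n\<bar>\<^sup>2" using c unfolding qq_kap norm_of_real by simp
    also have "\<dots> \<le> (?e n)\<^sup>2 + c3 * (X * ?e n)\<^sup>2"
      using e1[of n] kap_bound[of n] c unfolding X_def by (intro add_mono mult_left_mono power_mono) auto
    finally show ?thesis by (simp add: Kq_def algebra_simps power_mult_distrib)
  qed
  have frac: "cmod (x / Dt n \<mu>) \<le> K / C" if "cmod x \<le> K * (?e n)\<^sup>2" for x n K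
  proof -
    have e2: "0 < (?e n)\<^sup>2" using e1[of n] by (intro zero_less_power) linarith
    have "K \<ge> 0" using order_trans[OF norm_ge_zero that] e2 by (simp add: zero_le_mult_iff)
    have "cmod x * C \<le> K * (?e n)\<^sup>2 * C" using that C(1) by (intro mult_right_mono) auto
    also have "\<dots> = K * (C * (?e n)\<^sup>2)" by simp
    also have "\<dots> \<le> K * cmod (Dt n \<mu>)" using C(2)[of n] \<open>K \<ge> 0\<close> by (intro mult_left_mono) auto
    finally show ?thesis using C(1) D[of n] by (simp add: norm_divide field_simps)
  qed
  define K where "K = (Kp + 1 + Kq) / C"
  have mono: "x \<le> y / C \<Longrightarrow> y \<le> Kp + 1 + Kq \<Longrightarrow> x \<le> K" for x y :: real
    unfolding K_def by (rule order_trans, assumption) (use C in \<open>auto intro: divide_right_mono\<close>)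
  have 1: "cmod ((1 + dfac n) * pp n \<mu> / Dt n \<mu>) \<le> K" for n
  proof (rule mono, rule frac)
    show "cmod ((1 + dfac n) * pp n \<mu>) \<le> Kp * (?e n)\<^sup>2"
      using mult_left_mono[OF pb[of n], of "?e n"] by (simp add: norm_mult power2_eq_square mult_ac)
  qed (use K0 in simp)
  have 2: "cmod ((1 + dfac n) * (- (1 + dfac n) / Dt n \<mu>)) \<le> K" for n
  proof -
    have "cmod (- ((1 + dfac n) * (1 + dfac n)) / Dt n \<mu>) \<le> 1 / C"
      by (rule frac) (simp only: norm_minus_cancel norm_mult power2_eq_square mult_1_left order_refl)
    then show ?thesis using mono[of _ 1] K0 by (simp add: algebra_simps)
  qed
  have 3: "cmod ((1 + dfac n) * qq n / Dt n \<mu> / (1 + dfac n)) \<le> K" for n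
  proof -
    have "cmod (qq n / Dt n \<mu>) \<le> Kq / C" by (rule frac[OF qb])
    then show ?thesis using mono[of _ Kq] K0 dfac_nz[of n] by (simp add: mult.commute)
  qed
  obtain N where N: "\<And>y n. s1 (blinfun_apply N y) n = (1 + dfac n) * pp n \<mu> / Dt n \<mu> * s1 y n + - (1 + dfac n) / Dt n \<mu> * s2 y n"
    "\<And>y n. s2 (blinfun_apply N y) n = (1 + dfac n) * qq n / Dt n \<mu> * s1 y n + (1 + dfac n) * pp n \<mu> / Dt n \<mu> * s2 y n"
    using matrix_multiplier_op[where a = "\<lambda>n. (1 + dfac n) * pp n \<mu> / Dt n \<mu>" and b = "\<lambda>n. - (1 + dfac n) / Dt n \<mu>"
        and c = "\<lambda>n. (1 + dfac n) * qq n / Dt n \<mu>" and d = "\<lambda>n. (1 + dfac n) * pp n \<mu> / Dt n \<mu>", OF 1 2 3 1] by blast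
  have SN: "s1 (Sop (blinfun_apply N y)) n = (pp n \<mu> * s1 y n - s2 y n) / Dt n \<mu>"
    "s2 (Sop (blinfun_apply N y)) n = (qq n * s1 y n + pp n \<mu> * s2 y n) / Dt n \<mu>" for y n
  proof -
    have e: "E * p / D' * x + - E / D' * v = E * ((p * x - v) / D')" "E * q / D' * x + E * p / D' * v = E * ((q * x + p * v) / D')"
      for E p q D' x v :: complex
      by (simp_all add: algebra_simps diff_divide_distrib add_divide_distrib)
    show "s1 (Sop (blinfun_apply N y)) n = (pp n \<mu> * s1 y n - s2 y n) / Dt n \<mu>"
      "s2 (Sop (blinfun_apply N y)) n = (qq n * s1 y n + pp n \<mu> * s2 y n) / Dt n \<mu>"
      unfolding s_Sop N e by (simp_all only: nonzero_mult_div_cancel_left[OF dfac_nz])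
  qed
  have "binv (MM L0 \<mu>) N"
    unfolding binv_def
  proof (intro conjI blinfun_eqI)
    fix y
    have a: "pp n \<mu> * ((pp n \<mu> * x - v) / Dt n \<mu>) + (qq n * x + pp n \<mu> * v) / Dt n \<mu> = x"
      "- qq n * ((pp n \<mu> * x - v) / Dt n \<mu>) + pp n \<mu> * ((qq n * x + pp n \<mu> * v) / Dt n \<mu>) = v" for n x v
    proof -
      have "pp n \<mu> * ((pp n \<mu> * x - v) / Dt n \<mu>) + (qq n * x + pp n \<mu> * v) / Dt n \<mu> = (Dt n \<mu> * x) / Dt n \<mu>"
        unfolding times_divide_eq_right add_divide_distrib[symmetric] by (simp add: Dt_def power2_eq_square algebra_simps)
      then show "pp n \<mu> * ((pp n \<mu> * x - v) / Dt n \<mu>) + (qq n * x + pp n \<mu> * v) / Dt n \<mu> = x" using D by simp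
      have "- qq n * ((pp n \<mu> * x - v) / Dt n \<mu>) + pp n \<mu> * ((qq n * x + pp n \<mu> * v) / Dt n \<mu>) = (Dt n \<mu> * v) / Dt n \<mu>"
        unfolding times_divide_eq_right add_divide_distrib[symmetric] by (simp add: Dt_def power2_eq_square algebra_simps)
      then show "- qq n * ((pp n \<mu> * x - v) / Dt n \<mu>) + pp n \<mu> * ((qq n * x + pp n \<mu> * v) / Dt n \<mu>) = v" using D by simp
    qed
    show "(MM L0 \<mu> o\<^sub>L N) y = blinfun_apply id_blinfun y"
      by (rule s_eqI; simp only: blinfun_apply_blinfun_compose s_MM SN a blinfun_apply_id_blinfun id_apply)
    show "blinfun_apply (N o\<^sub>L MM L0 \<mu>) y = blinfun_apply id_blinfun y"
    proof -
      have "Sop (blinfun_apply N ((MM L0 \<mu>) y)) = Sop y"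
      proof (rule s_eqI)
        fix n
        let ?x = "s1 (Sop y) n" and ?v = "s2 (Sop y) n"
        have "pp n \<mu> * (pp n \<mu> * ?x + ?v) - (- qq n * ?x + pp n \<mu> * ?v) = Dt n \<mu> * ?x"
          by (simp add: Dt_def power2_eq_square algebra_simps)
        then show "s1 (Sop (blinfun_apply N ((MM L0 \<mu>) y))) n = ?x"
          unfolding SN s_MM using D[of n] by simp
        have "qq n * (pp n \<mu> * ?x + ?v) + pp n \<mu> * (- qq n * ?x + pp n \<mu> * ?v) = Dt n \<mu> * ?v"
          by (simp add: Dt_def power2_eq_square algebra_simps)
        then show "s2 (Sop (blinfun_apply N ((MM L0 \<mu>) y))) n = ?v"
          unfolding SN s_MM using D[of n] by simp
      qed
      then show ?thesis by (simp add: Sop_inj)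
    qed
  qed
  then show ?thesis using that SN by blast
qed

text \<open>The roots of the quadratic in \<mu> are symmetric about \<open>c1 * wv n\<close> and
  differ because \<open>qq n\<close> is nonzero. All roots are simple, which makes the eigenvalue
  semisimple.\<close>

lemma Dt_factor:
  assumes "Dt n z = 0"
  shows "Dt n \<mu> = (\<mu> - z) * (\<mu> - (2 * c1 * wv n - z))" "2 * c1 * wv n - z \<noteq> z"
proof -
  have q: "qq n = - (z - c1 * wv n)\<^sup>2" using assms by (simp add: Dt_def pp_def add_eq_0_iff)
  show "Dt n \<mu> = (\<mu> - z) * (\<mu> - (2 * c1 * wv n - z))"
    unfolding Dt_def q pp_def by (simp add: power2_eq_square algebra_simps)
  show "2 * c1 * wv n - z \<noteq> z"
  proof
    assume "2 * c1 * wv n - z = z"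
    then have "z - c1 * wv n = 0" by (simp add: algebra_simps)
    then show False using q qq_nz[of n] by simp
  qed
qed

text \<open>Within distance 1 of \<open>z\<close> the modes beyond \<open>B\<close> are covered by
  \<open>Dt_large\<close>, with R = |z| + 1; each of the finitely many others has isolated
  roots.\<close>

lemma isolated:
  obtains \<epsilon> where "\<epsilon> > 0" "\<And>\<mu> n. 0 < cmod (\<mu> - z) \<Longrightarrow> cmod (\<mu> - z) < \<epsilon> \<Longrightarrow> Dt n \<mu> \<noteq> 0"
proof -
  define R where "R = cmod z + 1"
  define B where "B = 8 * c1 * R / gap + 4 * (R\<^sup>2 + 1) / gap + 1"
  have R0: "R \<ge> 0" by (simp add: R_def)
  have B1: "B \<ge> 1" using gap_pos c R0 by (simp add: B_def)
  have "\<forall>\<^sub>F \<mu> in at z. Dt n \<mu> \<noteq> 0" for n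
  proof (cases "Dt n z = 0")
    case True
    have "\<forall>\<^sub>F \<mu> in at z. \<mu> \<noteq> 2 * c1 * wv n - z"
      using Dt_factor(2)[OF True] eventually_neq_at_within[of "2 * c1 * wv n - z" z UNIV] by simp
    moreover have "\<forall>\<^sub>F \<mu> in at z. \<mu> \<noteq> z" by (simp add: eventually_at_filter)
    ultimately show ?thesis by eventually_elim (simp add: Dt_factor(1)[OF True])
  next
    case False
    have "isCont (Dt n) z" unfolding Dt_def pp_def by (intro continuous_intros)
    then show ?thesis using False by (simp add: isCont_def tendsto_imp_eventually_ne)
  qed
  then have "\<forall>\<^sub>F \<mu> in at z. \<forall>n\<in>{n. \<bar>kap n\<bar> < B}. Dt n \<mu> \<noteq> 0"
    by (intro eventually_ball_finite finite_small ballI)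
  then obtain e where e: "e > 0" "\<And>\<mu>. \<mu> \<noteq> z \<Longrightarrow> dist \<mu> z < e \<Longrightarrow> \<forall>n\<in>{n. \<bar>kap n\<bar> < B}. Dt n \<mu> \<noteq> 0"
    unfolding eventually_at by auto
  show ?thesis
  proof (rule that[of "min e 1"])
    fix \<mu> n assume \<mu>: "0 < cmod (\<mu> - z)" "cmod (\<mu> - z) < min e 1"
    show "Dt n \<mu> \<noteq> 0"
    proof (cases "\<bar>kap n\<bar> < B")
      case True then show ?thesis using e(2)[of \<mu>] \<mu> by (auto simp: dist_norm)
    next
      case False
      have "cmod \<mu> \<le> R" using \<mu> norm_triangle_sub[of \<mu> z] by (simp add: R_def)
      then have "gap / 2 * (kap n)\<^sup>2 \<le> cmod (Dt n \<mu>)" using False R0 by (intro Dt_large[of \<mu> R]) (auto simp: B_def)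
      moreover have "kap n \<noteq> 0" using False B1 by auto
      then have "0 < gap / 2 * (kap n)\<^sup>2" using gap_pos by simp
      ultimately show ?thesis by auto
    qed
  qed (use e in simp)
qed

lemma clin_L0: "clin L0"
  unfolding clin_def
  by (intro allI s_eqI; simp only: s_L0 clinD[OF clin_Sop] s_linear) (simp_all add: algebra_simps)

lemma annulus_L0:
  assumes "0 < a" "\<And>\<mu> n. a \<le> cmod (\<mu> - z) \<Longrightarrow> cmod (\<mu> - z) \<le> b \<Longrightarrow> Dt n \<mu> \<noteq> 0"
  shows "annulus L0 z a b"
  using assms MM_inverse by unfold_locales (auto intro: clin_L0, metis)

text \<open>At mode \<open>n\<close> the projection integrates (A + (\<mu> - z) C) /
  \<open>Dt n \<mu>\<close>, where A is a component of the adjugate at \<open>z\<close> applied to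
  the mode of \<open>w\<close>. If \<open>z\<close> is a root, A = 0 cancels the simple pole;
  otherwise there is no pole.\<close>

lemma PP_mode_zero:
  assumes ab: "0 < a" "a \<le> r" "r \<le> b" "b < \<epsilon>" and D: "\<And>\<mu> n. 0 < cmod (\<mu> - z) \<Longrightarrow> cmod (\<mu> - z) < \<epsilon> \<Longrightarrow> Dt n \<mu> \<noteq> 0"
    and g: "Dt n z = 0 \<Longrightarrow> pp n z * s1 w n - s2 w n = 0" "Dt n z = 0 \<Longrightarrow> qq n * s1 w n + pp n z * s2 w n = 0"
  shows "s1 ((PP L0 z r) w) n = 0" "s2 ((PP L0 z r) w) n = 0"
proof -
  interpret annulus L0 z a b
    by (rule annulus_L0[OF ab(1)]) (rule D, use ab in auto)
  have RR: "s1 ((RR L0 \<mu>) w) n = (pp n \<mu> * s1 w n - s2 w n) / Dt n \<mu>"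
    "s2 ((RR L0 \<mu>) w) n = (qq n * s1 w n + pp n \<mu> * s2 w n) / Dt n \<mu>" if "\<mu> \<in> K" for \<mu>
  proof -
    have "Dt m \<mu> \<noteq> 0" for m using that ab by (intro D) (auto simp: K_def)
    then obtain N where N: "binv (MM L0 \<mu>) N"
      "\<And>y n. s1 (Sop (blinfun_apply N y)) n = (pp n \<mu> * s1 y n - s2 y n) / Dt n \<mu>"
      "\<And>y n. s2 (Sop (blinfun_apply N y)) n = (qq n * s1 y n + pp n \<mu> * s2 y n) / Dt n \<mu>"
      using MM_inverse by metis
    have "NN L0 \<mu> = N" by (rule binv_unique[OF NN[OF that] N(1)])
    then show "s1 ((RR L0 \<mu>) w) n = (pp n \<mu> * s1 w n - s2 w n) / Dt n \<mu>"
      "s2 ((RR L0 \<mu>) w) n = (qq n * s1 w n + pp n \<mu> * s2 w n) / Dt n \<mu>"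
      by (simp_all add: RR_def N)
  qed
  have key: "contour_integral (circlepath z r) (\<lambda>\<mu>. (A + (\<mu> - z) * C) / Dt n \<mu>) = 0" if AC: "Dt n z = 0 \<Longrightarrow> A = 0" for A C
  proof (cases "Dt n z = 0")
    case True
    let ?z' = "2 * c1 * wv n - z"
    have z': "?z' \<notin> ball z \<epsilon>"
    proof
      assume *: "?z' \<in> ball z \<epsilon>"
      have "Dt n ?z' \<noteq> 0"
      proof (rule D)
        show "0 < cmod (?z' - z)" using Dt_factor(2)[OF True] by simp
        show "cmod (?z' - z) < \<epsilon>" using * by (simp add: dist_norm norm_minus_commute)
      qed
      then show False using Dt_factor(1)[OF True, of ?z'] by simp
    qed
    have "contour_integral (circlepath z r) (\<lambda>\<mu>. (A + (\<mu> - z) * C) / Dt n \<mu>) = contour_integral (circlepath z r) (\<lambda>\<mu>. C / (\<mu> - ?z'))"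
    proof (rule contour_integral_cong)
      fix \<mu> assume "\<mu> \<in> path_image (circlepath z r)"
      then have "\<mu> \<noteq> z" using ab by (auto simp: dist_norm)
      then show "(A + (\<mu> - z) * C) / Dt n \<mu> = C / (\<mu> - ?z')"
        using AC[OF True] by (simp add: Dt_factor(1)[OF True])
    qed simp
    also have "\<dots> = 0"
    proof (rule contour_integral_unique, rule Cauchy_theorem_disc_simple[of _ z \<epsilon>])
      show "(\<lambda>\<mu>. C / (\<mu> - ?z')) holomorphic_on ball z \<epsilon>"
        using z' by (intro holomorphic_intros) auto
    qed (use ab in \<open>auto simp: dist_norm\<close>)
    finally show ?thesis .
  next
    case False
    show ?thesis
    proof (rule contour_integral_unique, rule Cauchy_theorem_disc_simple[of _ z \<epsilon>])
      have "Dt n \<mu> \<noteq> 0" if "\<mu> \<in> ball z \<epsilon>" for \<mu>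
        using D[of \<mu> n] False that by (cases "\<mu> = z") (auto simp: dist_norm norm_minus_commute)
      then show "(\<lambda>\<mu>. (A + (\<mu> - z) * C) / Dt n \<mu>) holomorphic_on ball z \<epsilon>"
        unfolding Dt_def pp_def by (intro holomorphic_intros) auto
    qed (use ab in \<open>auto simp: dist_norm\<close>)
  qed
  have inK: "\<mu> \<in> K" if "\<mu> \<in> path_image (circlepath z r)" for \<mu>
    using that ab by (auto simp: K_def dist_norm norm_minus_commute)
  have "contour_integral (circlepath z r) (\<lambda>\<mu>. s1 ((RR L0 \<mu>) w) n) =
    contour_integral (circlepath z r) (\<lambda>\<mu>. ((pp n z * s1 w n - s2 w n) + (\<mu> - z) * s1 w n) / Dt n \<mu>)"
    by (rule contour_integral_cong) (simp_all only: RR[OF inK], simp add: pp_def algebra_simps)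
  also have "\<dots> = 0" by (rule key) (rule g)
  finally show "s1 ((PP L0 z r) w) n = 0"
    using PP_contour[OF ab(2,3) cfun_s(1), of w n] by simp
  have "contour_integral (circlepath z r) (\<lambda>\<mu>. s2 ((RR L0 \<mu>) w) n) =
    contour_integral (circlepath z r) (\<lambda>\<mu>. ((qq n * s1 w n + pp n z * s2 w n) + (\<mu> - z) * s2 w n) / Dt n \<mu>)"
    by (rule contour_integral_cong) (simp_all only: RR[OF inK], simp add: pp_def algebra_simps)
  also have "\<dots> = 0" by (rule key) (rule g)
  finally show "s2 ((PP L0 z r) w) n = 0"
    using PP_contour[OF ab(2,3) cfun_s(2), of w n] by simp
qed

text \<open>The adjugate at \<open>z\<close> composed with the symbol minus \<open>z\<close> is
  minus the determinant, which vanishes at a root; so \<open>PP_mode_zero\<close> applies at every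
  mode.\<close>

lemma PP_L0_zero:
  assumes ab: "0 < a" "a \<le> r" "r \<le> b" "b < \<epsilon>" and D: "\<And>\<mu> n. 0 < cmod (\<mu> - z) \<Longrightarrow> cmod (\<mu> - z) < \<epsilon> \<Longrightarrow> Dt n \<mu> \<noteq> 0"
  shows "(PP L0 z r) (L0 y - cmul_state z (Sop y)) = 0"
proof -
  let ?w = "L0 y - cmul_state z (Sop y)"
  have g: "pp n z * s1 ?w n - s2 ?w n = 0" "qq n * s1 ?w n + pp n z * s2 ?w n = 0" if d: "Dt n z = 0" for n
  proof -
    let ?x = "s1 (Sop y) n" and ?v = "s2 (Sop y) n"
    have w: "s1 ?w n = - pp n z * ?x - ?v" "s2 ?w n = qq n * ?x - pp n z * ?v"
      by (simp_all add: s_linear s_L0 pp_def algebra_simps)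
    have "pp n z * s1 ?w n - s2 ?w n = - Dt n z * ?x" "qq n * s1 ?w n + pp n z * s2 ?w n = - Dt n z * ?v"
      unfolding w by (simp_all add: Dt_def power2_eq_square algebra_simps)
    then show "pp n z * s1 ?w n - s2 ?w n = 0" "qq n * s1 ?w n + pp n z * s2 ?w n = 0" using d by simp_all
  qed
  show ?thesis
    by (rule s_eqI) (simp_all only: s_linear PP_mode_zero[OF ab D g])
qed

text \<open>The single-mode state with the coefficients of \<open>w\<close> at \<open>n\<close> is
  an eigenvector, hence fixed by the projection. Removing it from \<open>w\<close> leaves a state
  without mode \<open>n\<close>, whose projection has none either; as \<open>w\<close> projects to
  0, the removed state is 0.\<close>

lemma kernel_mode_zero:
  assumes ab: "0 < a" "a \<le> r" "r \<le> b" "b < \<epsilon>" and D: "\<And>\<mu> n. 0 < cmod (\<mu> - z) \<Longrightarrow> cmod (\<mu> - z) < \<epsilon> \<Longrightarrow> Dt n \<mu> \<noteq> 0"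
    and P: "blinfun_apply (PP L0 z r) w = 0"
    and k: "c1 * wv n * s1 w n - s2 w n = z * s1 w n" "qq n * s1 w n + c1 * wv n * s2 w n = z * s2 w n"
  shows "s1 w n = 0" "s2 w n = 0"
proof -
  interpret annulus L0 z a b
    by (rule annulus_L0[OF ab(1)]) (rule D, use ab in auto)
  obtain y where y: "\<And>m. s1 (Sop y) m = (if m = n then s1 w n else 0)" "\<And>m. s2 (Sop y) m = (if m = n then s2 w n else 0)"
    using mode_state by blast
  have "L0 y = cmul_state z (Sop y)"
    by (rule s_eqI; simp add: s_L0 s_linear y k)
  from PP_eigen[OF ab(2,3) this] have e: "(PP L0 z r) (Sop y) = Sop y" .
  have "s1 ((PP L0 z r) (w - Sop y)) n = 0" "s2 ((PP L0 z r) (w - Sop y)) n = 0"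
    by (rule PP_mode_zero[OF ab D]; simp add: s_linear y)+
  then show "s1 w n = 0" "s2 w n = 0" by (simp_all add: blinfun.diff_right P e s_minus y)
qed

end

subsection \<open>Differentiable functions of two real variables\<close>

primrec Cn :: "nat \<Rightarrow> real set \<Rightarrow> (real \<Rightarrow> real) \<Rightarrow> bool" where
  "Cn 0 S g \<longleftrightarrow> continuous_on S g"
| "Cn (Suc n) S g \<longleftrightarrow> (\<exists>g'. (\<forall>x\<in>S. (g has_real_derivative g' x) (at x)) \<and> Cn n S g')"

text \<open>Total derivative on a strip that is two-sided in the amplitude \<open>x\<close>, so that
  0 is an interior point although the waves are given for nonnegative amplitude.\<close>

definition D2 :: "real \<Rightarrow> (real \<Rightarrow> real \<Rightarrow> real) \<Rightarrow> (real \<Rightarrow> real \<Rightarrow> real) \<Rightarrow> (real \<Rightarrow> real \<Rightarrow> real) \<Rightarrow> bool" where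
  "D2 d f fx ft \<longleftrightarrow> (\<forall>x t. \<bar>x\<bar> < d \<longrightarrow>
     ((\<lambda>p. f (fst p) (snd p)) has_derivative (\<lambda>h. fst h * fx x t + snd h * ft x t)) (at (x, t)))"

text \<open>\<open>n\<close> times continuously differentiable functions of two real variables; the
  2 counts variables.\<close>

primrec C2 :: "nat \<Rightarrow> real \<Rightarrow> (real \<Rightarrow> real \<Rightarrow> real) \<Rightarrow> bool" where
  "C2 0 d f \<longleftrightarrow> continuous_on ({-d<..<d} \<times> UNIV) (\<lambda>(x, t). f x t)"
| "C2 (Suc n) d f \<longleftrightarrow> (\<exists>fx ft. D2 d f fx ft \<and> C2 n d fx \<and> C2 n d ft)"

lemma C2_SucI: "D2 d f fx ft \<Longrightarrow> C2 n d fx \<Longrightarrow> C2 n d ft \<Longrightarrow> C2 (Suc n) d f"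
  by auto

lemma Cn_SucI: "(\<And>x. x \<in> S \<Longrightarrow> (g has_real_derivative g' x) (at x)) \<Longrightarrow> Cn n S g' \<Longrightarrow> Cn (Suc n) S g"
  by auto

lemma Cn_SucE:
  assumes "Cn (Suc n) S g"
  obtains g' where "\<And>x. x \<in> S \<Longrightarrow> (g has_real_derivative g' x) (at x)" "Cn n S g'"
  using assms by auto

lemma C2_SucE:
  assumes "C2 (Suc n) d f"
  obtains fx ft where "D2 d f fx ft" "C2 n d fx" "C2 n d ft"
  using assms by auto

declare C2.simps(2) [simp del] Cn.simps(2) [simp del]

lemma Cn_cont: "Cn n S g \<Longrightarrow> continuous_on S g"
  by (cases n) (auto elim!: Cn_SucE intro!: continuous_at_imp_continuous_on DERIV_isCont)

lemma Cn_Suc: "Cn (Suc n) S g \<Longrightarrow> Cn n S g"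
proof (induction n arbitrary: g)
  case 0 then show ?case using Cn_cont by auto
next
  case (Suc n)
  obtain g' where "\<And>x. x \<in> S \<Longrightarrow> (g has_real_derivative g' x) (at x)" "Cn (Suc n) S g'"
    using Cn_SucE[OF Suc.prems] by blast
  then show ?case using Suc.IH by (intro Cn_SucI)
qed

lemma D2_cont:
  assumes "D2 d f fx ft"
  shows "continuous_on ({-d<..<d} \<times> UNIV) (\<lambda>(x, t). f x t)"
proof (rule continuous_at_imp_continuous_on, clarify)
  fix x t :: real assume "x \<in> {-d<..<d}"
  then have "((\<lambda>p. f (fst p) (snd p)) has_derivative (\<lambda>h. fst h * fx x t + snd h * ft x t)) (at (x, t))"
    using assms by (auto simp: D2_def)
  from has_derivative_continuous[OF this] show "isCont (\<lambda>(x, t). f x t) (x, t)"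
    by (simp add: case_prod_unfold)
qed

lemma C2_cont: "C2 n d f \<Longrightarrow> continuous_on ({-d<..<d} \<times> UNIV) (\<lambda>(x, t). f x t)"
  by (cases n) (auto elim!: C2_SucE dest: D2_cont)

lemma C2_Suc: "C2 (Suc n) d f \<Longrightarrow> C2 n d f"
proof (induction n arbitrary: f)
  case 0 then show ?case using C2_cont by auto
next
  case (Suc n)
  obtain fx ft where "D2 d f fx ft" "C2 (Suc n) d fx" "C2 (Suc n) d ft"
    using C2_SucE[OF Suc.prems] by blast
  then show ?case using Suc.IH by (intro C2_SucI)
qed

lemma C2_mono: "C2 n d f \<Longrightarrow> m \<le> n \<Longrightarrow> C2 m d f"
  by (induction n) (auto simp: le_Suc_eq dest: C2_Suc)

lemma D2_add: "D2 d f fx ft \<Longrightarrow> D2 d g gx gt \<Longrightarrow> D2 d (\<lambda>x t. f x t + g x t) (\<lambda>x t. fx x t + gx x t) (\<lambda>x t. ft x t + gt x t)"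
  unfolding D2_def
proof (intro allI impI)
  fix x t assume x: "\<bar>x\<bar> < d"
    and f: "\<forall>x t. \<bar>x\<bar> < d \<longrightarrow> ((\<lambda>p. f (fst p) (snd p)) has_derivative (\<lambda>h. fst h * fx x t + snd h * ft x t)) (at (x, t))"
    and g: "\<forall>x t. \<bar>x\<bar> < d \<longrightarrow> ((\<lambda>p. g (fst p) (snd p)) has_derivative (\<lambda>h. fst h * gx x t + snd h * gt x t)) (at (x, t))"
  show "((\<lambda>p. f (fst p) (snd p) + g (fst p) (snd p)) has_derivative
    (\<lambda>h. fst h * (fx x t + gx x t) + snd h * (ft x t + gt x t))) (at (x, t))"
    by (rule has_derivative_eq_rhs[OF has_derivative_add[OF f[rule_format, OF x] g[rule_format, OF x]]]) (auto simp: algebra_simps)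
qed

lemma D2_mult: "D2 d f fx ft \<Longrightarrow> D2 d g gx gt \<Longrightarrow>
    D2 d (\<lambda>x t. f x t * g x t) (\<lambda>x t. f x t * gx x t + fx x t * g x t) (\<lambda>x t. f x t * gt x t + ft x t * g x t)"
  unfolding D2_def
proof (intro allI impI)
  fix x t assume x: "\<bar>x\<bar> < d"
    and f: "\<forall>x t. \<bar>x\<bar> < d \<longrightarrow> ((\<lambda>p. f (fst p) (snd p)) has_derivative (\<lambda>h. fst h * fx x t + snd h * ft x t)) (at (x, t))"
    and g: "\<forall>x t. \<bar>x\<bar> < d \<longrightarrow> ((\<lambda>p. g (fst p) (snd p)) has_derivative (\<lambda>h. fst h * gx x t + snd h * gt x t)) (at (x, t))"
  show "((\<lambda>p. f (fst p) (snd p) * g (fst p) (snd p)) has_derivative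
    (\<lambda>h. fst h * (f x t * gx x t + fx x t * g x t) + snd h * (f x t * gt x t + ft x t * g x t))) (at (x, t))"
    by (rule has_derivative_eq_rhs[OF has_derivative_mult[OF f[rule_format, OF x] g[rule_format, OF x]]]) (auto simp: algebra_simps)
qed

lemma D2_const: "D2 d (\<lambda>x t. c) (\<lambda>x t. 0) (\<lambda>x t. 0)"
  by (simp add: D2_def)

lemma D2_fst: "D2 d (\<lambda>x t. x) (\<lambda>x t. 1) (\<lambda>x t. 0)"
  by (auto simp: D2_def intro!: derivative_eq_intros)

lemma D2_snd: "D2 d (\<lambda>x t. t) (\<lambda>x t. 0) (\<lambda>x t. 1)"
  by (auto simp: D2_def intro!: derivative_eq_intros)

lemma D2_comp:
  assumes f: "D2 d f fx ft" and g: "\<And>x. x \<in> S \<Longrightarrow> (g has_real_derivative g' x) (at x)"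
    and S: "\<And>x t. \<bar>x\<bar> < d \<Longrightarrow> f x t \<in> S"
  shows "D2 d (\<lambda>x t. g (f x t)) (\<lambda>x t. g' (f x t) * fx x t) (\<lambda>x t. g' (f x t) * ft x t)"
  unfolding D2_def
proof (intro allI impI)
  fix x t assume x: "\<bar>x\<bar> < d"
  have "((\<lambda>p. g (f (fst p) (snd p))) has_derivative (\<lambda>h. g' (f x t) * (fst h * fx x t + snd h * ft x t))) (at (x, t))"
  proof -
    have 1: "((\<lambda>p. f (fst p) (snd p)) has_derivative (\<lambda>h. fst h * fx x t + snd h * ft x t)) (at (x, t))"
      using f x by (simp add: D2_def)
    have 2: "(g has_derivative times (g' (f x t))) (at (f (fst (x, t)) (snd (x, t))))"
      using g[OF S[OF x, of t]] by (simp add: has_field_derivative_def)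
    from has_derivative_compose[OF 1 2] show ?thesis by simp
  qed
  then show "((\<lambda>p. g (f (fst p) (snd p))) has_derivative (\<lambda>h. fst h * (g' (f x t) * fx x t) + snd h * (g' (f x t) * ft x t))) (at (x, t))"
    by (rule has_derivative_eq_rhs) (auto simp: algebra_simps)
qed

lemma D2_param:
  assumes f: "D2 d f fx ft" and \<theta>: "D2 d \<theta> \<theta>x \<theta>t"
  shows "D2 d (\<lambda>x t. f x (\<theta> x t)) (\<lambda>x t. fx x (\<theta> x t) + ft x (\<theta> x t) * \<theta>x x t) (\<lambda>x t. ft x (\<theta> x t) * \<theta>t x t)"
  unfolding D2_def
proof (intro allI impI)
  fix x t assume x: "\<bar>x\<bar> < d"
  have 1: "((\<lambda>p. (fst p, \<theta> (fst p) (snd p))) has_derivative (\<lambda>h. (fst h, fst h * \<theta>x x t + snd h * \<theta>t x t))) (at (x, t))"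
    using \<theta> x by (intro has_derivative_Pair) (auto simp: D2_def intro!: derivative_eq_intros)
  have 2: "((\<lambda>p. f (fst p) (snd p)) has_derivative (\<lambda>h. fst h * fx x (\<theta> x t) + snd h * ft x (\<theta> x t))) (at ((\<lambda>p. (fst p, \<theta> (fst p) (snd p))) (x, t)))"
    using f x by (simp add: D2_def)
  have "((\<lambda>p. f (fst p) (\<theta> (fst p) (snd p))) has_derivative
     (\<lambda>h. fst h * fx x (\<theta> x t) + (fst h * \<theta>x x t + snd h * \<theta>t x t) * ft x (\<theta> x t))) (at (x, t))"
    using has_derivative_compose[OF 1 2] by (simp only: fst_conv snd_conv)
  then show "((\<lambda>p. f (fst p) (\<theta> (fst p) (snd p))) has_derivative
     (\<lambda>h. fst h * (fx x (\<theta> x t) + ft x (\<theta> x t) * \<theta>x x t) + snd h * (ft x (\<theta> x t) * \<theta>t x t))) (at (x, t))"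
    by (rule has_derivative_eq_rhs) (auto simp: algebra_simps)
qed

lemma D2_partial_x:
  assumes "D2 d f fx ft" "\<bar>x\<bar> < d"
  shows "((\<lambda>x. f x t) has_real_derivative fx x t) (at x)"
proof -
  have 1: "((\<lambda>x. (x, t)) has_derivative (\<lambda>h. (h, 0))) (at x)"
    by (auto intro!: derivative_eq_intros)
  have 2: "((\<lambda>p. f (fst p) (snd p)) has_derivative (\<lambda>h. fst h * fx x t + snd h * ft x t)) (at (x, t))"
    using assms by (simp add: D2_def)
  show ?thesis using has_derivative_compose[OF 1 2] by (simp add: has_field_derivative_def mult.commute[of _ "fx x t"])
qed

lemma D2_partial_t:
  assumes "D2 d f fx ft" "\<bar>x\<bar> < d"
  shows "((\<lambda>t. f x t) has_real_derivative ft x t) (at t)"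
proof -
  have 1: "((\<lambda>t. (x, t)) has_derivative (\<lambda>h. (0, h))) (at t)"
    by (auto intro!: derivative_eq_intros)
  have 2: "((\<lambda>p. f (fst p) (snd p)) has_derivative (\<lambda>h. fst h * fx x t + snd h * ft x t)) (at (x, t))"
    using assms by (simp add: D2_def)
  show ?thesis using has_derivative_compose[OF 1 2] by (simp add: has_field_derivative_def mult.commute[of _ "ft x t"])
qed

lemma C2_const: "C2 n d (\<lambda>x t. c)"
proof (induction n arbitrary: c)
  case (Suc n) show ?case by (rule C2_SucI[OF D2_const Suc Suc])
qed simp

lemma C2_fst: "C2 n d (\<lambda>x t. x)"
proof (cases n)
  case (Suc m) show ?thesis unfolding Suc by (rule C2_SucI[OF D2_fst C2_const C2_const])
qed (auto simp: split_beta intro!: continuous_intros)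

lemma C2_snd: "C2 n d (\<lambda>x t. t)"
proof (cases n)
  case (Suc m) show ?thesis unfolding Suc by (rule C2_SucI[OF D2_snd C2_const C2_const])
qed (auto simp: split_beta intro!: continuous_intros)

lemma C2_add: "C2 n d f \<Longrightarrow> C2 n d g \<Longrightarrow> C2 n d (\<lambda>x t. f x t + g x t)"
proof (induction n arbitrary: f g)
  case 0 then show ?case by (auto simp: split_beta intro: continuous_intros)
next
  case (Suc n)
  obtain fx ft where f: "D2 d f fx ft" "C2 n d fx" "C2 n d ft" using C2_SucE[OF Suc.prems(1)] by blast
  obtain gx gt where g: "D2 d g gx gt" "C2 n d gx" "C2 n d gt" using C2_SucE[OF Suc.prems(2)] by blast
  show ?case by (rule C2_SucI[OF D2_add[OF f(1) g(1)] Suc.IH[OF f(2) g(2)] Suc.IH[OF f(3) g(3)]])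
qed

lemma C2_mult: "C2 n d f \<Longrightarrow> C2 n d g \<Longrightarrow> C2 n d (\<lambda>x t. f x t * g x t)"
proof (induction n arbitrary: f g)
  case 0 then show ?case by (auto simp: split_beta intro: continuous_intros)
next
  case (Suc n)
  obtain fx ft where f: "D2 d f fx ft" "C2 n d fx" "C2 n d ft" using C2_SucE[OF Suc.prems(1)] by blast
  obtain gx gt where g: "D2 d g gx gt" "C2 n d gx" "C2 n d gt" using C2_SucE[OF Suc.prems(2)] by blast
  note fg = C2_Suc[OF Suc.prems(1)] C2_Suc[OF Suc.prems(2)]
  show ?case
    by (rule C2_SucI[OF D2_mult[OF f(1) g(1)]]; intro C2_add Suc.IH f g fg)
qed

lemma C2_comp:
  "Cn n S g \<Longrightarrow> C2 n d f \<Longrightarrow> (\<And>x t. \<bar>x\<bar> < d \<Longrightarrow> f x t \<in> S) \<Longrightarrow> C2 n d (\<lambda>x t. g (f x t))"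
proof (induction n arbitrary: g)
  case 0
  have "continuous_on ({-d<..<d} \<times> UNIV) (\<lambda>p. g ((\<lambda>(x, t). f x t) p))"
    by (rule continuous_on_compose2[of S g]) (use 0 in auto)
  then show ?case by (simp add: split_beta)
next
  case (Suc n)
  obtain fx ft where f: "D2 d f fx ft" "C2 n d fx" "C2 n d ft" using C2_SucE[OF Suc.prems(2)] by blast
  obtain g' where g: "\<And>x. x \<in> S \<Longrightarrow> (g has_real_derivative g' x) (at x)" "Cn n S g'" using Cn_SucE[OF Suc.prems(1)] by blast
  have "C2 n d (\<lambda>x t. g' (f x t))" by (rule Suc.IH[OF g(2) C2_Suc[OF Suc.prems(2)] Suc.prems(3)])
  then show ?case
    by (intro C2_SucI[OF D2_comp[OF f(1) g(1) Suc.prems(3)]] C2_mult f)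
qed

lemma C2_param: "C2 n d f \<Longrightarrow> C2 n d \<theta> \<Longrightarrow> C2 n d (\<lambda>x t. f x (\<theta> x t))"
proof (induction n arbitrary: f)
  case 0
  have "continuous_on ({-d<..<d} \<times> UNIV) (\<lambda>p. (\<lambda>(x, t). f x t) (fst p, (\<lambda>(x, t). \<theta> x t) p))"
  proof (rule continuous_on_compose2[of "{-d<..<d} \<times> UNIV" "\<lambda>(x, t). f x t"])
    show "continuous_on ({-d<..<d} \<times> UNIV) (\<lambda>(x, t). f x t)" using 0 by simp
    show "continuous_on ({-d<..<d} \<times> UNIV) (\<lambda>p. (fst p, (\<lambda>(x, t). \<theta> x t) p))"
      using 0(2) by (intro continuous_on_Pair continuous_on_fst continuous_on_id) simp
  qed auto
  then show ?case by (simp add: split_beta)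
next
  case (Suc n)
  obtain fx ft where f: "D2 d f fx ft" "C2 n d fx" "C2 n d ft" using C2_SucE[OF Suc.prems(1)] by blast
  obtain \<theta>x \<theta>t where t: "D2 d \<theta> \<theta>x \<theta>t" "C2 n d \<theta>x" "C2 n d \<theta>t" using C2_SucE[OF Suc.prems(2)] by blast
  note tt = C2_Suc[OF Suc.prems(2)]
  show ?case
    by (rule C2_SucI[OF D2_param[OF f(1) t(1)]]; intro C2_add C2_mult Suc.IH[OF _ tt] f t)
qed

lemma Cn_inverse: "Cn n {0<..} inverse"
proof -
  \<comment> \<open>Generalised to multiples of powers, a class closed under
    differentiation.\<close>
  have "Cn n {0<..} (\<lambda>x. c * inverse x ^ Suc m)" for c m
  proof (induction n arbitrary: c m)
    case 0 show ?case by (auto intro!: continuous_intros)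
  next
    case (Suc n)
    have "((\<lambda>x. c * inverse x ^ Suc m) has_real_derivative (- c * real (Suc m)) * inverse x ^ Suc (Suc m)) (at x)" if "x \<in> {0<..}" for x
    proof -
      have *: "((\<lambda>x. inverse x ^ Suc m) has_real_derivative real (Suc m) * inverse x ^ m * (- (inverse x * inverse x))) (at x)"
        using that DERIV_power[OF DERIV_inverse'[OF DERIV_ident], of x "Suc m"] by (auto simp: ac_simps)
      show ?thesis using DERIV_cmult[OF *, of c] by (simp add: ac_simps)
    qed
    then show ?case by (rule Cn_SucI[OF _ Suc])
  qed
  from this[of 1 0] show ?thesis by simp
qed

lemma Cn_sin_cos: "Cn n UNIV sin" "Cn n UNIV cos"
proof -
  have "Cn n UNIV (\<lambda>x. a * sin x + b * cos x)" for a b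
  proof (induction n arbitrary: a b)
    case 0 show ?case by (auto intro!: continuous_intros)
  next
    case (Suc n)
    have "((\<lambda>x. a * sin x + b * cos x) has_real_derivative (- b) * sin x + a * cos x) (at x)" for x
      by (auto intro!: derivative_eq_intros)
    then show ?case by (rule Cn_SucI) (rule Suc)
  qed
  from this[of 1 0] this[of 0 1] show "Cn n UNIV sin" "Cn n UNIV cos" by simp_all
qed

section \<open>Antiderivatives in the second variable\<close>

definition Aint :: "(real \<Rightarrow> real \<Rightarrow> real) \<Rightarrow> real \<Rightarrow> real \<Rightarrow> real" where
  "Aint f x t = (if 0 \<le> t then integral {0..t} (f x) else - integral {t..0} (f x))"

lemma section_cont:
  assumes "C2 0 d f" "\<bar>x\<bar> < d" shows "continuous_on S (f x)"
proof -
  have "x \<in> {-d<..<d}" using assms(2) by auto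
  from continuous_on_section1[OF _ this, of UNIV f] assms(1) have "continuous_on UNIV (f x)" by simp
  then show ?thesis by (rule continuous_on_subset) simp
qed

text \<open>A base point below both 0 and \<open>t\<close> removes the case distinction on the sign
  of \<open>t\<close>.\<close>

lemma Aint_eq:
  assumes f: "C2 0 d f" "\<bar>x\<bar> < d" and B: "- B \<le> t" "0 \<le> B"
  shows "Aint f x t = integral {-B..t} (f x) - integral {-B..0} (f x)"
proof -
  have i: "f x integrable_on {a..b}" for a b
    by (intro integrable_continuous_real section_cont[OF f])
  show ?thesis
  proof (cases "0 \<le> t")
    case True
    then show ?thesis
      using Henstock_Kurzweil_Integration.integral_combine[of "-B" 0 t "f x"] B i by (simp add: Aint_def)
  next
    case False
    then show ?thesis
      using Henstock_Kurzweil_Integration.integral_combine[of "-B" t 0 "f x"] B i by (simp add: Aint_def)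
  qed
qed

lemma Aint_diff:
  assumes f: "C2 0 d f" "\<bar>x\<bar> < d" and "s \<le> t"
  shows "integral {s..t} (f x) = Aint f x t - Aint f x s"
proof -
  define B where "B = \<bar>s\<bar>"
  have i: "f x integrable_on {a..b}" for a b
    by (intro integrable_continuous_real section_cont[OF f])
  have "- B \<le> s" "- B \<le> t" "0 \<le> B" using \<open>s \<le> t\<close> by (auto simp: B_def)
  then show ?thesis
    using Henstock_Kurzweil_Integration.integral_combine[of "-B" s t "f x"] \<open>s \<le> t\<close> i by (simp add: Aint_eq[OF f, of B])
qed

lemma Aint_deriv_t:
  assumes f: "C2 0 d f" "\<bar>x\<bar> < d"
  shows "(Aint f x has_real_derivative f x t) (at t)"
proof -
  define B where "B = \<bar>t\<bar> + 1"
  have t: "- B < t" "t < B" by (auto simp: B_def)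
  have "((\<lambda>u. integral {-B..u} (f x)) has_real_derivative f x t) (at t within {-B..B})"
    using t by (intro integral_has_real_derivative section_cont[OF f]) auto
  then have "((\<lambda>u. integral {-B..u} (f x)) has_real_derivative f x t) (at t)"
    using t by (simp add: at_within_Icc_at)
  then have "((\<lambda>u. integral {-B..u} (f x) - integral {-B..0} (f x)) has_real_derivative f x t - 0) (at t)"
    by (intro DERIV_diff DERIV_const)
  then have g: "((\<lambda>u. integral {-B..u} (f x) - integral {-B..0} (f x)) has_real_derivative f x t) (at t)" by simp
  show ?thesis
  proof (rule has_field_derivative_transform_within_open[OF g])
    show "open {-B<..<B}" "t \<in> {-B<..<B}" using t by auto
    show "integral {-B..u} (f x) - integral {-B..0} (f x) = Aint f x u" if "u \<in> {-B<..<B}" for u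
      using that t by (intro Aint_eq[OF f, symmetric]) auto
  qed
qed

lemma Aint_deriv_x:
  assumes f: "D2 d f fx ft" and fx: "C2 0 d fx" and x: "\<bar>x\<bar> < d"
  shows "((\<lambda>x. Aint f x t) has_real_derivative Aint fx x t) (at x)"
proof -
  have c: "C2 0 d f" using D2_cont[OF f] by simp
  have I: "((\<lambda>x. integral {a..b} (f x)) has_real_derivative integral {a..b} (fx x)) (at x)" for a b
  proof -
    have "((\<lambda>x. integral (cbox a b) (f x)) has_field_derivative integral (cbox a b) (fx x)) (at x within {-d<..<d})"
    proof (rule leibniz_rule_field_derivative)
      show "((\<lambda>x. f x t) has_real_derivative fx y t) (at y within {-d<..<d})" if "y \<in> {-d<..<d}" for y t
        using that by (intro DERIV_subset[OF D2_partial_x[OF f]]) auto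
      show "f y integrable_on cbox a b" if "y \<in> {-d<..<d}" for y
        using that by (intro integrable_continuous section_cont[OF c]) auto
      show "continuous_on ({-d<..<d} \<times> cbox a b) (\<lambda>(x, t). fx x t)"
        using fx by (auto elim: continuous_on_subset)
    qed (use x in auto)
    moreover have "at x within {-d<..<d} = at x" using x by (intro at_within_open) auto
    ultimately show ?thesis by (simp add: cbox_interval)
  qed
  show ?thesis
    using I DERIV_minus[OF I] by (cases "0 \<le> t") (simp_all add: Aint_def)
qed

lemma Aint_D2:
  assumes f: "D2 d f fx ft" and fx: "C2 0 d fx"
  shows "D2 d (Aint f) (Aint fx) f"
  unfolding D2_def
proof (intro allI impI)
  fix x t :: real assume x: "\<bar>x\<bar> < d"
  have c: "C2 0 d f" using D2_cont[OF f] by simp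
  let ?S = "{-d<..<d}"
  have xS: "x \<in> ?S" using x by auto
  have "((\<lambda>(x, y). Aint f x y) has_derivative (\<lambda>(tx, ty). (\<lambda>h. h * Aint fx x t) tx + blinfun_apply (blinfun_mult_right (f x t)) ty)) (at (x, t) within ?S \<times> UNIV)"
  proof (rule has_derivative_partialsI)
    have "((\<lambda>x. Aint f x t) has_derivative times (Aint fx x t)) (at x)"
      using Aint_deriv_x[OF f fx x, of t] by (simp add: has_field_derivative_def)
    moreover have "times (Aint fx x t) = (\<lambda>h. h * Aint fx x t)" by (auto simp: mult.commute)
    ultimately show "((\<lambda>x. Aint f x t) has_derivative (\<lambda>h. h * Aint fx x t)) (at x within ?S)"
      by (metis has_derivative_at_withinI)
    fix y s assume y: "y \<in> ?S"
    show "(Aint f y has_derivative blinfun_apply (blinfun_mult_right (f y s))) (at s within UNIV)"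
      using Aint_deriv_t[OF c, of y s] y by (auto simp: has_field_derivative_def)
  next
    have 1: "continuous_on (?S \<times> UNIV) (\<lambda>p. blinfun_mult_right ((\<lambda>(x, t). f x t) p))"
      by (rule bounded_linear.continuous_on[OF bounded_linear_blinfun_mult_right c[unfolded C2.simps]])
    have "(x, t) \<in> ?S \<times> UNIV" using xS by simp
    then have "continuous (at (x, t) within ?S \<times> UNIV) (\<lambda>p. blinfun_mult_right ((\<lambda>(x, t). f x t) p))"
      using 1 unfolding continuous_on_eq_continuous_within by blast
    then show "continuous (at (x, t) within ?S \<times> UNIV) (\<lambda>(x, y). blinfun_mult_right (f x y))"
      by (simp add: case_prod_unfold)
  qed (use xS in simp_all)
  moreover have "at (x, t) within ?S \<times> UNIV = at (x, t)"
    by (rule at_within_open) (use xS in \<open>simp_all add: open_Times\<close>)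
  ultimately have "((\<lambda>(x, y). Aint f x y) has_derivative (\<lambda>(tx, ty). tx * Aint fx x t + f x t * ty)) (at (x, t))"
    by simp
  then show "((\<lambda>p. Aint f (fst p) (snd p)) has_derivative (\<lambda>h. fst h * Aint fx x t + snd h * f x t)) (at (x, t))"
    by (simp add: case_prod_unfold mult.commute[of "f x t"])
qed

lemma C2_Aint: "C2 (Suc n) d f \<Longrightarrow> C2 n d (Aint f)"
proof (induction n arbitrary: f)
  case 0
  obtain fx ft where f: "D2 d f fx ft" "C2 0 d fx" "C2 0 d ft" using C2_SucE[OF 0] by blast
  show ?case using D2_cont[OF Aint_D2[OF f(1,2)]] by simp
next
  case (Suc n)
  obtain fx ft where f: "D2 d f fx ft" "C2 (Suc n) d fx" "C2 (Suc n) d ft" using C2_SucE[OF Suc.prems] by blast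
  show ?case
    by (rule C2_SucI[OF Aint_D2[OF f(1) C2_mono[OF f(2)]] Suc.IH[OF f(2)] C2_mono[OF Suc.prems]]) simp_all
qed

text \<open>f(y, s) is f(y, 0) plus the oriented integral of \<open>ft\<close> from 0 to s;
  differentiating under the integral in y and then in s yields \<open>ftx\<close>, by its
  continuity.\<close>

lemma D2_schwarz:
  assumes f: "D2 d f fx ft" and fx: "D2 d fx fxx fxt" and ft: "D2 d ft ftx ftt" and c: "C2 0 d ftx" and x: "\<bar>x\<bar> < d"
  shows "fxt x t = ftx x t"
proof -
  have ct: "C2 0 d ft" using D2_cont[OF ft] by simp
  have eq: "f y s = f y 0 + Aint ft y s" if y: "\<bar>y\<bar> < d" for y s
  proof -
    have "((\<lambda>s. f y s - Aint ft y s) has_real_derivative ft y s - ft y s) (at s)" for s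
      by (intro DERIV_diff D2_partial_t[OF f y] Aint_deriv_t[OF ct y])
    then have "f y s - Aint ft y s = f y 0 - Aint ft y 0"
      by (intro DERIV_isconst_all) simp
    then show ?thesis by (simp add: Aint_def)
  qed
  have eqx: "fx x s = fx x 0 + Aint ftx x s" for s
  proof (rule DERIV_unique)
    show "((\<lambda>y. f y s) has_real_derivative fx x s) (at x)" by (rule D2_partial_x[OF f x])
    have *: "((\<lambda>y. f y 0 + Aint ft y s) has_real_derivative fx x 0 + Aint ftx x s) (at x)"
      by (intro DERIV_add D2_partial_x[OF f x] Aint_deriv_x[OF ft c x])
    show "((\<lambda>y. f y s) has_real_derivative fx x 0 + Aint ftx x s) (at x)"
      by (rule has_field_derivative_transform_within_open[OF *, of "{-d<..<d}"]) (use x in \<open>auto simp: eq[symmetric]\<close>)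
  qed
  have "((\<lambda>s. fx x 0 + Aint ftx x s) has_real_derivative 0 + ftx x t) (at t)"
    by (intro DERIV_add DERIV_const Aint_deriv_t[OF c x])
  then have "((\<lambda>s. fx x s) has_real_derivative ftx x t) (at t)" by (simp add: eqx[symmetric])
  then show ?thesis using D2_partial_t[OF fx x] DERIV_unique by blast
qed

lemma D2_periodic:
  assumes f: "D2 d f fx ft" and p: "\<And>x. \<bar>x\<bar> < d \<Longrightarrow> periodic1 (f x)" and x: "\<bar>x\<bar> < d"
  shows "periodic1 (fx x)" "periodic1 (ft x)"
proof -
  show "periodic1 (fx x)"
    unfolding periodic1_def
  proof
    fix t
    have "((\<lambda>x. f x t) has_real_derivative fx x (t + 1)) (at x)"
      by (rule has_field_derivative_transform_within_open[OF D2_partial_x[OF f x], of "{-d<..<d}"])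
        (use x p in \<open>auto simp: periodic1_def\<close>)
    then show "fx x (t + 1) = fx x t" using D2_partial_x[OF f x] DERIV_unique by blast
  qed
  show "periodic1 (ft x)"
    using D2_partial_t[OF f x] by (intro periodic_deriv[OF p[OF x]]) (simp add: has_real_derivative_iff_has_vector_derivative)
qed

lemma C2_CX0:
  assumes "C2 0 e c" "\<And>x. \<bar>x\<bar> < e \<Longrightarrow> periodic1 (c x)" "d \<le> e"
  shows "CX 0 d c"
  using assms by (auto simp: CX.simps elim!: continuous_on_subset)

lemma D2_pdv: "D2 e c cx ct \<Longrightarrow> d \<le> e \<Longrightarrow> pdv d c cx"
  unfolding pdv_def
proof (intro allI impI)
  fix x t :: real assume "D2 e c cx ct" "d \<le> e" "0 \<le> x" "x < d"
  then have "((\<lambda>x. c x t) has_real_derivative cx x t) (at x)" by (intro D2_partial_x[of e c cx ct]) auto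
  then show "((\<lambda>x. c x t) has_vector_derivative cx x t) (at x within {0..<d})"
    by (simp add: has_real_derivative_iff_has_vector_derivative has_vector_derivative_at_within)
qed

lemma C2_CX:
  "C2 n e c \<Longrightarrow> (\<And>x. \<bar>x\<bar> < e \<Longrightarrow> periodic1 (c x)) \<Longrightarrow> d \<le> e \<Longrightarrow> CX n d c"
proof (induction n arbitrary: c)
  case 0 then show ?case by (rule C2_CX0)
next
  case (Suc n)
  obtain cx ct where c: "D2 e c cx ct" "C2 n e cx" "C2 n e ct" using C2_SucE[OF Suc.prems(1)] by blast
  show ?case
  proof (rule CX_SucI[OF _ pdvD[OF D2_pdv[OF c(1) Suc.prems(3)]]])
    show "CX 0 d c" using C2_mono[OF Suc.prems(1) le0] Suc.prems(2,3) by (intro C2_CX0[of e])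
    show "CX n d cx" using D2_periodic(1)[OF c(1)] Suc.prems by (intro Suc.IH[OF c(2)]) auto
  qed
qed

lemma C2_CH0:
  assumes c: "D2 e c cx ct" "C2 0 e ct" "\<And>x. \<bar>x\<bar> < e \<Longrightarrow> periodic1 (c x)" "d \<le> e"
  shows "CH 0 d c ct"
proof (rule CH_0I)
  have c0: "C2 0 e c" using D2_cont[OF c(1)] by simp
  show "CX 0 d c" "CX 0 d ct"
    using D2_periodic(2)[OF c(1,3)] c by (auto intro!: C2_CX0[of e] simp: c0[simplified])
  fix x assume "0 \<le> x" "x < d"
  then have x: "\<bar>x\<bar> < e" using c by auto
  show "C1p (c x) (ct x)"
    unfolding C1p_def cper_def using c(3)[OF x] D2_periodic(2)[OF c(1,3) x] D2_partial_t[OF c(1) x]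
    by (auto intro: section_cont[OF c0 x] section_cont[OF c(2) x])
qed

text \<open>\<open>CH\<close> wants the amplitude derivative of \<open>ct\<close> to be the spatial
  derivative of \<open>cx\<close>, which \<open>D2_schwarz\<close> provides at every level.\<close>

lemma C2_CH:
  "C2 (Suc n) e c \<Longrightarrow> D2 e c cx ct \<Longrightarrow> C2 n e cx \<Longrightarrow> C2 n e ct \<Longrightarrow> (\<And>x. \<bar>x\<bar> < e \<Longrightarrow> periodic1 (c x)) \<Longrightarrow> d \<le> e \<Longrightarrow> CH n d c ct"
proof (induction n arbitrary: c cx ct)
  case 0 then show ?case by (intro C2_CH0) auto
next
  case (Suc n)
  obtain cxx cxt where x: "D2 e cx cxx cxt" "C2 n e cxx" "C2 n e cxt" using C2_SucE[OF Suc.prems(3)] by blast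
  obtain ctx ctt where t: "D2 e ct ctx ctt" "C2 n e ctx" "C2 n e ctt" using C2_SucE[OF Suc.prems(4)] by blast
  have sw: "cxt y s = ctx y s" if "\<bar>y\<bar> < e" for y s
    by (rule D2_schwarz[OF Suc.prems(2) x(1) t(1) C2_mono[OF t(2)] that]) simp
  show ?case
  proof (rule CH_SucI[OF _ pdvD[OF D2_pdv[OF Suc.prems(2) Suc.prems(6)]]])
    show "CH 0 d c ct" using Suc.prems C2_mono[OF Suc.prems(4), of 0] by (intro C2_CH0[of e]) auto
    show "CH n d cx cxt"
      by (rule Suc.IH[OF Suc.prems(3) x]) (use D2_periodic(1)[OF Suc.prems(2)] Suc.prems in auto)
    fix y s assume y: "0 \<le> y" "y < d"
    show "((\<lambda>x. ct x s) has_vector_derivative cxt y s) (at y within {0..<d})"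
      using pdvD[OF D2_pdv[OF t(1) Suc.prems(6)] y, of s] sw[of y s] y Suc.prems(6) by simp
  qed
qed

subsection \<open>Jets in the amplitude\<close>

definition Csm :: "real \<Rightarrow> (real \<Rightarrow> real \<Rightarrow> real) \<Rightarrow> bool" where
  "Csm d f \<longleftrightarrow> (\<forall>n. C2 n d f)"

definition pdx :: "(real \<Rightarrow> real \<Rightarrow> real) \<Rightarrow> real \<Rightarrow> real \<Rightarrow> real" where
  "pdx f x t = deriv (\<lambda>y. f y t) x"

definition pdt :: "(real \<Rightarrow> real \<Rightarrow> real) \<Rightarrow> real \<Rightarrow> real \<Rightarrow> real" where
  "pdt f x t = deriv (f x) t"

lemma D2_pdx: "D2 d f fx ft \<Longrightarrow> \<bar>x\<bar> < d \<Longrightarrow> pdx f x t = fx x t"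
  unfolding pdx_def by (rule DERIV_imp_deriv[OF D2_partial_x])

lemma D2_pdt: "D2 d f fx ft \<Longrightarrow> \<bar>x\<bar> < d \<Longrightarrow> pdt f x t = ft x t"
  unfolding pdt_def by (rule DERIV_imp_deriv[OF D2_partial_t])

lemma D2_cong:
  assumes "\<And>x t. \<bar>x\<bar> < d \<Longrightarrow> f x t = g x t" "\<And>x t. \<bar>x\<bar> < d \<Longrightarrow> fx x t = gx x t" "\<And>x t. \<bar>x\<bar> < d \<Longrightarrow> ft x t = gt x t"
    and f: "D2 d f fx ft"
  shows "D2 d g gx gt"
  unfolding D2_def
proof (intro allI impI)
  fix x t :: real assume x: "\<bar>x\<bar> < d"
  then have xS: "(x, t) \<in> {-d<..<d} \<times> UNIV" by auto
  have "((\<lambda>p. f (fst p) (snd p)) has_derivative (\<lambda>h. fst h * gx x t + snd h * gt x t)) (at (x, t))"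
    using f assms(2,3) x by (simp add: D2_def)
  then show "((\<lambda>p. g (fst p) (snd p)) has_derivative (\<lambda>h. fst h * gx x t + snd h * gt x t)) (at (x, t))"
    by (rule has_derivative_transform_within_open[OF _ _ xS]) (auto simp: assms(1) open_Times)
qed

lemma C2_cong: "(\<And>x t. \<bar>x\<bar> < d \<Longrightarrow> f x t = g x t) \<Longrightarrow> C2 n d f \<Longrightarrow> C2 n d g"
proof (cases n)
  case 0
  assume *: "\<And>x t. \<bar>x\<bar> < d \<Longrightarrow> f x t = g x t" "C2 n d f"
  show ?thesis unfolding 0 C2.simps
    by (rule continuous_on_eq[OF *(2)[unfolded 0 C2.simps]]) (auto intro!: *(1))
next
  case (Suc m)
  assume *: "\<And>x t. \<bar>x\<bar> < d \<Longrightarrow> f x t = g x t" "C2 n d f"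
  obtain fx ft where f: "D2 d f fx ft" "C2 m d fx" "C2 m d ft" using C2_SucE *(2) Suc by blast
  show ?thesis unfolding Suc
    by (rule C2_SucI[OF D2_cong[OF *(1) _ _ f(1)] f(2,3)]) simp_all
qed

lemma Csm_D2:
  assumes "Csm d f"
  shows "D2 d f (pdx f) (pdt f)" "Csm d (pdx f)" "Csm d (pdt f)"
proof -
  have e: "\<exists>fx ft. D2 d f fx ft \<and> C2 n d fx \<and> C2 n d ft" for n
    using assms C2_SucE[of n d f] unfolding Csm_def by metis
  from e[of 0] show "D2 d f (pdx f) (pdt f)"
    using D2_cong D2_pdx D2_pdt by (metis (no_types, lifting))
  have "C2 n d (pdx f) \<and> C2 n d (pdt f)" for n
    using e[of n] D2_pdx D2_pdt C2_cong by (metis (no_types, lifting))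
  then show "Csm d (pdx f)" "Csm d (pdt f)" by (simp_all add: Csm_def)
qed

lemma Csm_closure:
  "Csm d (\<lambda>x t. c)" "Csm d (\<lambda>x t. x)" "Csm d (\<lambda>x t. t)"
  "Csm d f \<Longrightarrow> Csm d g \<Longrightarrow> Csm d (\<lambda>x t. f x t + g x t)"
  "Csm d f \<Longrightarrow> Csm d g \<Longrightarrow> Csm d (\<lambda>x t. f x t * g x t)"
  "Csm d f \<Longrightarrow> Csm d g \<Longrightarrow> Csm d (\<lambda>x t. f x (g x t))"
  "Csm d f \<Longrightarrow> Csm d (Aint f)"
  by (auto simp: Csm_def C2_const C2_fst C2_snd C2_add C2_mult C2_param C2_Aint)

lemma Csm_comp: "(\<And>n. Cn n S g) \<Longrightarrow> Csm d f \<Longrightarrow> (\<And>x t. \<bar>x\<bar> < d \<Longrightarrow> f x t \<in> S) \<Longrightarrow> Csm d (\<lambda>x t. g (f x t))"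
  unfolding Csm_def using C2_comp by blast

lemma Csm_schwarz: "Csm d f \<Longrightarrow> \<bar>x\<bar> < d \<Longrightarrow> pdt (pdx f) x t = pdx (pdt f) x t"
  by (rule D2_schwarz[OF Csm_D2(1) Csm_D2(1)[OF Csm_D2(2)] Csm_D2(1)[OF Csm_D2(3)]])
    (use Csm_D2(2)[OF Csm_D2(3)] in \<open>auto simp: Csm_def simp del: C2.simps\<close>)

text \<open>Frequencies 1 and -1, without mean; \<open>TP2\<close> has frequencies 0, 2 and -2.
  Products of two members of \<open>TP1\<close> fall into \<open>TP2\<close>, the grading by parity
  behind \<open>jet\<close>.\<close>

definition TP1 :: "(real \<Rightarrow> real) \<Rightarrow> bool" where
  "TP1 f \<longleftrightarrow> (\<exists>A B. \<forall>t. f t = A * cos (2 * pi * t) + B * sin (2 * pi * t))"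

definition TP2 :: "(real \<Rightarrow> real) \<Rightarrow> bool" where
  "TP2 f \<longleftrightarrow> (\<exists>A B C. \<forall>t. f t = A + B * cos (4 * pi * t) + C * sin (4 * pi * t))"

lemma TP1_add: "TP1 f \<Longrightarrow> TP1 g \<Longrightarrow> TP1 (\<lambda>t. f t + g t)"
  unfolding TP1_def
  by (elim exE, rule_tac x = "A + Aa" in exI, rule_tac x = "B + Ba" in exI) (simp add: algebra_simps)

lemma TP1_cmul: "TP1 f \<Longrightarrow> TP1 (\<lambda>t. c * f t)"
  unfolding TP1_def
  by (elim exE, rule_tac x = "c * A" in exI, rule_tac x = "c * B" in exI) (simp add: algebra_simps)

lemma TP2_add: "TP2 f \<Longrightarrow> TP2 g \<Longrightarrow> TP2 (\<lambda>t. f t + g t)"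
  unfolding TP2_def
  by (elim exE, rule_tac x = "A + Aa" in exI, rule_tac x = "B + Ba" in exI, rule_tac x = "C + Ca" in exI) (simp add: algebra_simps)

lemma TP2_cmul: "TP2 f \<Longrightarrow> TP2 (\<lambda>t. c * f t)"
  unfolding TP2_def
  by (elim exE, rule_tac x = "c * A" in exI, rule_tac x = "c * B" in exI, rule_tac x = "c * C" in exI) (simp add: algebra_simps)

lemma TP_const: "TP1 (\<lambda>t. 0)" "TP2 (\<lambda>t. c)"
  unfolding TP1_def TP2_def
  by (intro exI[of _ 0]; simp) (rule exI[of _ c], rule exI[of _ 0], rule exI[of _ 0], simp)

lemma TP1_mult:
  assumes "TP1 f" "TP1 g" shows "TP2 (\<lambda>t. f t * g t)"
proof -
  obtain A B where f: "\<And>t. f t = A * cos (2 * pi * t) + B * sin (2 * pi * t)" using assms(1) by (auto simp: TP1_def)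
  obtain A' B' where g: "\<And>t. g t = A' * cos (2 * pi * t) + B' * sin (2 * pi * t)" using assms(2) by (auto simp: TP1_def)
  have "f t * g t = (A * A' + B * B') / 2 + (A * A' - B * B') / 2 * cos (4 * pi * t) + (A * B' + A' * B) / 2 * sin (4 * pi * t)" for t
  proof -
    define c s where "c = cos (2 * pi * t)" and "s = sin (2 * pi * t)"
    have e: "4 * pi * t = 2 * (2 * pi * t)" by simp
    have "cos (4 * pi * t) = 2 * c\<^sup>2 - 1" "sin (4 * pi * t) = 2 * s * c"
      unfolding c_def s_def e by (rule cos_double_cos sin_double)+
    moreover have "s * s = 1 - c\<^sup>2" using sin_cos_squared_add[of "2 * pi * t"] by (simp add: c_def s_def power2_eq_square)
    then have "B * B' * (s * s) = B * B' * (1 - c\<^sup>2)" by simp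
    ultimately show ?thesis unfolding f g c_def[symmetric] s_def[symmetric]
      by (simp only: add_divide_distrib diff_divide_distrib ring_distribs times_divide_eq_left) (simp add: algebra_simps power2_eq_square)
  qed
  then show ?thesis unfolding TP2_def by blast
qed

text \<open>
  Closed under products and compositions; it is the reason why the order-$m$ part of \<open>L\<close> couples only modes whose
  indices differ by at most $m$ and by the parity of $m$.
\<close>

definition jet :: "real \<Rightarrow> (real \<Rightarrow> real \<Rightarrow> real) \<Rightarrow> bool" where
  "jet d f \<longleftrightarrow> (\<exists>fx ft fxx fxt a. D2 d f fx ft \<and> D2 d fx fxx fxt \<and> (\<forall>t. f 0 t = a) \<and> TP1 (fx 0) \<and> TP2 (fxx 0))"

lemma jetE:
  assumes "jet d f"
  obtains fx ft fxx fxt a where "D2 d f fx ft" "D2 d fx fxx fxt" "\<And>t. f 0 t = a" "TP1 (fx 0)" "TP2 (fxx 0)"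
  using assms by (auto simp: jet_def)

lemma jetI: "D2 d f fx ft \<Longrightarrow> D2 d fx fxx fxt \<Longrightarrow> (\<And>t. f 0 t = a) \<Longrightarrow> TP1 (fx 0) \<Longrightarrow> TP2 (fxx 0) \<Longrightarrow> jet d f"
  by (auto simp: jet_def)

lemma jet_const: "jet d (\<lambda>x t. c)"
  by (rule jetI[OF D2_const D2_const]) (simp_all add: TP_const)

lemma jet_add:
  assumes "jet d f" "jet d g" shows "jet d (\<lambda>x t. f x t + g x t)"
proof -
  obtain fx ft fxx fxt a where f: "D2 d f fx ft" "D2 d fx fxx fxt" "\<And>t. f 0 t = a" "TP1 (fx 0)" "TP2 (fxx 0)"
    using jetE[OF assms(1)] by metis
  obtain gx gt gxx gxt b where g: "D2 d g gx gt" "D2 d gx gxx gxt" "\<And>t. g 0 t = b" "TP1 (gx 0)" "TP2 (gxx 0)"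
    using jetE[OF assms(2)] by metis
  show ?thesis
    by (rule jetI[OF D2_add[OF f(1) g(1)] D2_add[OF f(2) g(2)], of "a + b"])
      (simp_all add: f(3) g(3) TP1_add[OF f(4) g(4)] TP2_add[OF f(5) g(5)])
qed

lemma jet_mult:
  assumes "jet d f" "jet d g" shows "jet d (\<lambda>x t. f x t * g x t)"
proof -
  obtain fx ft fxx fxt a where f: "D2 d f fx ft" "D2 d fx fxx fxt" "\<And>t. f 0 t = a" "TP1 (fx 0)" "TP2 (fxx 0)"
    using jetE[OF assms(1)] by metis
  obtain gx gt gxx gxt b where g: "D2 d g gx gt" "D2 d gx gxx gxt" "\<And>t. g 0 t = b" "TP1 (gx 0)" "TP2 (gxx 0)"
    using jetE[OF assms(2)] by metis
  show ?thesis
  proof (rule jetI[OF D2_mult[OF f(1) g(1)] D2_add[OF D2_mult[OF f(1) g(2)] D2_mult[OF f(2) g(1)]], of "a * b"])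
    show "TP1 (\<lambda>t. f 0 t * gx 0 t + fx 0 t * g 0 t)"
      unfolding f(3) g(3) using TP1_add[OF TP1_cmul[OF g(4), of a] TP1_cmul[OF f(4), of b]] by (simp add: mult.commute)
    show "TP2 (\<lambda>t. (f 0 t * gxx 0 t + fx 0 t * gx 0 t) + (fx 0 t * gx 0 t + fxx 0 t * g 0 t))"
      unfolding f(3) g(3)
      by (intro TP2_add TP1_mult[OF f(4) g(4)] TP2_cmul[OF g(5)]) (use TP2_cmul[OF f(5), of b] in \<open>simp add: mult.commute\<close>)
  qed (simp add: f g)
qed

lemma jet_comp:
  assumes "jet d f" "Cn 2 S g" "\<And>x t. \<bar>x\<bar> < d \<Longrightarrow> f x t \<in> S"
  shows "jet d (\<lambda>x t. g (f x t))"
proof -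
  obtain fx ft fxx fxt a where f: "D2 d f fx ft" "D2 d fx fxx fxt" "\<And>t. f 0 t = a" "TP1 (fx 0)" "TP2 (fxx 0)"
    using jetE[OF assms(1)] by metis
  obtain g' where g: "\<And>x. x \<in> S \<Longrightarrow> (g has_real_derivative g' x) (at x)" "Cn 1 S g'"
    using Cn_SucE[of 1 S g] assms(2) by (auto simp: numeral_2_eq_2)
  obtain g'' where g': "\<And>x. x \<in> S \<Longrightarrow> (g' has_real_derivative g'' x) (at x)"
    using Cn_SucE[of 0 S g'] g(2) by auto
  show ?thesis
  proof (rule jetI[OF D2_comp[OF f(1) g(1) assms(3)] D2_mult[OF D2_comp[OF f(1) g' assms(3)] f(2)], of "g a"])
    show "TP1 (\<lambda>t. g' (f 0 t) * fx 0 t)" unfolding f(3) by (rule TP1_cmul[OF f(4)])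
    show "TP2 (\<lambda>t. g' (f 0 t) * fxx 0 t + g'' (f 0 t) * fx 0 t * fx 0 t)"
      unfolding f(3) mult.assoc by (intro TP2_add TP2_cmul f TP1_mult)
  qed (simp_all add: f)
qed

lemma jet_pdx:
  assumes "jet d f" "0 < d"
  shows "\<exists>a. \<forall>t. f 0 t = a" "TP1 (pdx f 0)" "TP2 (pdx (pdx f) 0)"
proof -
  obtain fx ft fxx fxt a where f: "D2 d f fx ft" "D2 d fx fxx fxt" "\<And>t. f 0 t = a" "TP1 (fx 0)" "TP2 (fxx 0)"
    using jetE[OF assms(1)] by metis
  show "\<exists>a. \<forall>t. f 0 t = a" using f(3) by blast
  have 0: "\<bar>0\<bar> < d" using assms by simp
  have "pdx f 0 = fx 0" using D2_pdx[OF f(1) 0] by (intro ext) simp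
  then show "TP1 (pdx f 0)" using f by simp
  have "D2 d (pdx f) fxx fxt"
    by (rule D2_cong[OF _ _ _ f(2)]) (simp_all add: D2_pdx[OF f(1)])
  then have "pdx (pdx f) 0 = fxx 0" using D2_pdx[OF _ 0] by (intro ext) simp
  then show "TP2 (pdx (pdx f) 0)" using f by simp
qed

text \<open>Coefficients for which the multiplication operators on L^2 and on H^1 are smooth in the
  amplitude to all orders (\<open>fam_CX\<close>, \<open>fam_CH\<close>).\<close>

definition fam :: "real \<Rightarrow> (real \<Rightarrow> real \<Rightarrow> real) \<Rightarrow> bool" where
  "fam d f \<longleftrightarrow> Csm d f \<and> (\<forall>x. \<bar>x\<bar> < d \<longrightarrow> periodic1 (f x))"

lemma fam_pdx: "fam d f \<Longrightarrow> fam d (pdx f)" "fam d f \<Longrightarrow> fam d (pdt f)"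
  unfolding fam_def using Csm_D2 D2_periodic[OF Csm_D2(1)] by blast+

lemma fam_CX: "fam d f \<Longrightarrow> CX n d f"
  using C2_CX[of n d f d] by (auto simp: fam_def Csm_def)

lemma fam_CH: "fam d f \<Longrightarrow> CH n d f (pdt f)"
  using C2_CH[of n d f "pdx f" "pdt f" d] Csm_D2[of d f] by (auto simp: fam_def Csm_def simp del: C2.simps)

lemma fam_pdv: "fam d f \<Longrightarrow> pdv d f (pdx f)"
  using D2_pdv[OF Csm_D2(1)] by (auto simp: fam_def)

lemma fam_pdv_t:
  assumes "fam d f" shows "pdv d (pdt f) (pdt (pdx f))"
proof -
  have "pdv d (pdt f) (pdx (pdt f))" by (rule fam_pdv[OF fam_pdx(2)[OF assms]])
  moreover have "pdt (pdx f) x t = pdx (pdt f) x t" if "0 \<le> x" "x < d" for x t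
    using Csm_schwarz[of d f x t] assms that by (simp add: fam_def)
  ultimately show ?thesis by (simp add: pdv_def)
qed

lemma fam_closure:
  "fam d (\<lambda>x t. c)"
  "fam d f \<Longrightarrow> fam d g \<Longrightarrow> fam d (\<lambda>x t. f x t + g x t)"
  "fam d f \<Longrightarrow> fam d g \<Longrightarrow> fam d (\<lambda>x t. f x t * g x t)"
  by (auto simp: fam_def Csm_closure periodic1_def)

lemma fam_comp: "(\<And>n. Cn n S g) \<Longrightarrow> fam d f \<Longrightarrow> (\<And>x t. \<bar>x\<bar> < d \<Longrightarrow> f x t \<in> S) \<Longrightarrow> fam d (\<lambda>x t. g (f x t))"
  using Csm_comp[of S g d f] by (auto simp: fam_def periodic1_def)

definition famj :: "real \<Rightarrow> (real \<Rightarrow> real \<Rightarrow> real) \<Rightarrow> bool" where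
  "famj d f \<longleftrightarrow> fam d f \<and> jet d f"

lemma famj_closure:
  "famj d (\<lambda>x t. c)"
  "famj d f \<Longrightarrow> famj d g \<Longrightarrow> famj d (\<lambda>x t. f x t + g x t)"
  "famj d f \<Longrightarrow> famj d g \<Longrightarrow> famj d (\<lambda>x t. f x t * g x t)"
  by (auto simp: famj_def fam_closure jet_const jet_add jet_mult)

lemma famj_comp: "(\<And>n. Cn n S g) \<Longrightarrow> famj d f \<Longrightarrow> (\<And>x t. \<bar>x\<bar> < d \<Longrightarrow> f x t \<in> S) \<Longrightarrow> famj d (\<lambda>x t. g (f x t))"
  unfolding famj_def using fam_comp[of S g d f] jet_comp[of d f S g] by blast

subsection \<open>Smooth functions, inverse functions, and a second-order equation\<close>

lemma deriv_eq_vector_derivative: "deriv f x = vector_derivative f (at (x::real))" for f :: "real \<Rightarrow> real"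
  by (simp add: deriv_def vector_derivative_def has_real_derivative_iff_has_vector_derivative)

lemma smooth_on_Cn:
  fixes f :: "real \<Rightarrow> real"
  assumes "smooth_on S f"
  shows "Cn n S ((deriv ^^ m) f)" "x \<in> S \<Longrightarrow> ((deriv ^^ m) f has_real_derivative (deriv ^^ Suc m) f x) (at x)"
proof -
  have eq: "(\<lambda>g y. vector_derivative g (at y)) = (deriv :: (real \<Rightarrow> real) \<Rightarrow> real \<Rightarrow> real)"
    by (intro ext) (simp add: deriv_eq_vector_derivative)
  have d: "(deriv ^^ m) f differentiable (at x)" if "x \<in> S" for m x
    using assms that by (simp add: smooth_on_def eq)
  have D: "((deriv ^^ m) f has_real_derivative (deriv ^^ Suc m) f x) (at x)" if "x \<in> S" for m x
    using d[OF that, of m] DERIV_deriv_iff_real_differentiable by auto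
  then show "x \<in> S \<Longrightarrow> ((deriv ^^ m) f has_real_derivative (deriv ^^ Suc m) f x) (at x)" by blast
  show "Cn n S ((deriv ^^ m) f)"
  proof (induction n arbitrary: m)
    case 0 show ?case using D[of _ m] DERIV_isCont by (auto intro!: continuous_at_imp_continuous_on)
  next
    case (Suc n) show ?case by (rule Cn_SucI[OF D Suc])
  qed
qed

lemma Cn_subset: "Cn n S g \<Longrightarrow> T \<subseteq> S \<Longrightarrow> Cn n T g"
proof (induction n arbitrary: g)
  case 0 then show ?case by (auto elim: continuous_on_subset)
next
  case (Suc n)
  obtain g' where "\<And>x. x \<in> S \<Longrightarrow> (g has_real_derivative g' x) (at x)" "Cn n S g'" using Cn_SucE[OF Suc.prems(1)] by blast
  then show ?case using Suc.IH Suc.prems(2) by (intro Cn_SucI) auto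
qed

lemma Cn_add: "Cn n S f \<Longrightarrow> Cn n S g \<Longrightarrow> Cn n S (\<lambda>x. f x + g x)"
proof (induction n arbitrary: f g)
  case 0 then show ?case by (auto intro: continuous_intros)
next
  case (Suc n)
  obtain f' where f: "\<And>x. x \<in> S \<Longrightarrow> (f has_real_derivative f' x) (at x)" "Cn n S f'" using Cn_SucE[OF Suc.prems(1)] by blast
  obtain g' where g: "\<And>x. x \<in> S \<Longrightarrow> (g has_real_derivative g' x) (at x)" "Cn n S g'" using Cn_SucE[OF Suc.prems(2)] by blast
  show ?case by (rule Cn_SucI[OF DERIV_add[OF f(1) g(1)] Suc.IH[OF f(2) g(2)]])
qed

lemma Cn_mult: "Cn n S f \<Longrightarrow> Cn n S g \<Longrightarrow> Cn n S (\<lambda>x. f x * g x)"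
proof (induction n arbitrary: f g)
  case 0 then show ?case by (auto intro: continuous_intros)
next
  case (Suc n)
  obtain f' where f: "\<And>x. x \<in> S \<Longrightarrow> (f has_real_derivative f' x) (at x)" "Cn n S f'" using Cn_SucE[OF Suc.prems(1)] by blast
  obtain g' where g: "\<And>x. x \<in> S \<Longrightarrow> (g has_real_derivative g' x) (at x)" "Cn n S g'" using Cn_SucE[OF Suc.prems(2)] by blast
  show ?case
    by (rule Cn_SucI[OF DERIV_mult'[OF f(1) g(1)]])
      (auto intro!: Cn_add Suc.IH f g Cn_Suc[OF Suc.prems(1)] Cn_Suc[OF Suc.prems(2)])
qed

lemma Cn_const: "Cn n S (\<lambda>x. c)"
proof (induction n arbitrary: c)
  case (Suc n) show ?case by (rule Cn_SucI[OF DERIV_const Suc])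
qed simp

lemma Cn_id: "Cn n S (\<lambda>x. x)"
proof (cases n)
  case (Suc m) show ?thesis unfolding Suc by (rule Cn_SucI[OF DERIV_ident Cn_const])
qed (simp add: continuous_on_id)

lemma Cn_compose: "Cn n T g \<Longrightarrow> Cn n S f \<Longrightarrow> f ` S \<subseteq> T \<Longrightarrow> Cn n S (\<lambda>x. g (f x))"
proof (induction n arbitrary: g)
  case 0 then show ?case by (auto intro: continuous_on_compose2)
next
  case (Suc n)
  obtain f' where f: "\<And>x. x \<in> S \<Longrightarrow> (f has_real_derivative f' x) (at x)" "Cn n S f'" using Cn_SucE[OF Suc.prems(2)] by blast
  obtain g' where g: "\<And>x. x \<in> T \<Longrightarrow> (g has_real_derivative g' x) (at x)" "Cn n T g'" using Cn_SucE[OF Suc.prems(1)] by blast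
  have "((\<lambda>x. g (f x)) has_real_derivative g' (f x) * f' x) (at x)" if "x \<in> S" for x
    using DERIV_chain2[OF g(1) f(1)] that Suc.prems(3) by auto
  moreover have "Cn n S (\<lambda>x. g' (f x) * f' x)"
    by (rule Cn_mult[OF Suc.IH[OF g(2) Cn_Suc[OF Suc.prems(2)] Suc.prems(3)] f(2)])
  ultimately show ?case by (rule Cn_SucI)
qed

text \<open>The inverse function theorem for (x, t) \<mapsto> (x, X x t), whose derivative is
  triangular with diagonal entries 1 and \<open>Xt\<close>; the global inverse is given and its
  derivative is at stake.\<close>

lemma D2_inverse:
  assumes X: "D2 d X Xx Xt" and p: "\<And>x t. \<bar>x\<bar> < d \<Longrightarrow> Xt x t \<noteq> 0"
    and i: "\<And>x t. \<bar>x\<bar> < d \<Longrightarrow> X x (\<theta> x t) = t" "\<And>x t. \<bar>x\<bar> < d \<Longrightarrow> \<theta> x (X x t) = t"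
  shows "D2 d \<theta> (\<lambda>x t. - Xx x (\<theta> x t) * inverse (Xt x (\<theta> x t))) (\<lambda>x t. inverse (Xt x (\<theta> x t)))"
  unfolding D2_def
proof (intro allI impI)
  fix x t :: real assume x: "\<bar>x\<bar> < d"
  define s where "s = \<theta> x t"
  define \<alpha> \<beta> where "\<alpha> = Xx x s" and "\<beta> = Xt x s"
  have \<beta>: "\<beta> \<noteq> 0" using p x by (simp add: \<beta>_def)
  let ?f = "\<lambda>p. (fst p, X (fst p) (snd p))"
  let ?g = "\<lambda>p. (fst p, \<theta> (fst p) (snd p))"
  let ?f' = "\<lambda>h. (fst h, fst h * \<alpha> + snd h * \<beta>)"
  let ?g' = "\<lambda>h. (fst h, fst h * (- \<alpha> * inverse \<beta>) + snd h * inverse \<beta>)"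
  let ?S = "{-d<..<d} \<times> (UNIV :: real set)"
  have "(?g has_derivative ?g') (at (?f (x, s)))"
  proof (rule has_derivative_inverse_strong[where f = ?f and g = ?g and f' = ?f'])
    show "open ?S" by (simp add: open_Times)
    show "(x, s) \<in> ?S" using x by auto
    show "continuous_on ?S ?f"
      by (intro continuous_on_Pair continuous_on_fst continuous_on_id) (use D2_cont[OF X] in \<open>simp add: case_prod_unfold\<close>)
    show "?g (?f q) = q" if "q \<in> ?S" for q using that i by auto
    show "(?f has_derivative ?f') (at (x, s))"
      using X x by (intro has_derivative_Pair) (auto simp: D2_def \<alpha>_def \<beta>_def intro!: derivative_eq_intros)
    show "?f' \<circ> ?g' = id" using \<beta> by (auto simp: fun_eq_iff algebra_simps)
  qed
  then have "(?g has_derivative ?g') (at (x, t))" using i(1)[OF x, of t] by (simp add: s_def)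
  then have "((\<lambda>p. snd (?g p)) has_derivative (\<lambda>h. snd (?g' h))) (at (x, t))"
    by (rule has_derivative_snd)
  then show "((\<lambda>p. \<theta> (fst p) (snd p)) has_derivative (\<lambda>h. fst h * (- Xx x (\<theta> x t) * inverse (Xt x (\<theta> x t))) + snd h * inverse (Xt x (\<theta> x t)))) (at (x, t))"
    by (simp add: \<alpha>_def \<beta>_def s_def)
qed

text \<open>Bootstrap: the partial derivatives of \<theta> are expressed by those of
  \<open>X\<close> at \<theta>, hence are as regular as \<theta> is already known to be.\<close>

lemma Csm_inverse_fun:
  assumes X: "Csm d X" and p: "\<And>x t. \<bar>x\<bar> < d \<Longrightarrow> 0 < pdt X x t"
    and i: "\<And>x t. \<bar>x\<bar> < d \<Longrightarrow> X x (\<theta> x t) = t" "\<And>x t. \<bar>x\<bar> < d \<Longrightarrow> \<theta> x (X x t) = t"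
  shows "Csm d \<theta>"
proof -
  note D = D2_inverse[OF Csm_D2(1)[OF X] _ i, OF p[THEN less_imp_neq, THEN not_sym]]
  have "C2 n d \<theta>" for n
  proof (induction n)
    case 0 show ?case using D2_cont[OF D] by simp
  next
    case (Suc n)
    have c: "C2 n d (\<lambda>x t. pdx X x (\<theta> x t))" "C2 n d (\<lambda>x t. pdt X x (\<theta> x t))"
      using C2_param[OF _ Suc] Csm_D2(2,3)[OF X] unfolding Csm_def by blast+
    have iv: "C2 n d (\<lambda>x t. inverse (pdt X x (\<theta> x t)))"
      by (rule C2_comp[where g = inverse and S = "{0<..}", OF Cn_inverse c(2)]) (simp add: p)
    have "C2 n d (\<lambda>x t. (-1) * pdx X x (\<theta> x t) * inverse (pdt X x (\<theta> x t)))"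
      by (rule C2_mult[OF C2_mult[OF C2_const c(1)] iv])
    then show ?case by (intro C2_SucI[OF D]) (use iv in simp_all)
  qed
  then show ?thesis by (simp add: Csm_def)
qed

text \<open>The weights exp(- C t) to the right of \<open>t0\<close> and exp(C t) to its left make
  the weighted \<open>w\<close> decrease away from \<open>t0\<close>, so it cannot leave 0.\<close>

lemma gronwall_zero:
  assumes "0 < e" and d: "\<And>t. \<bar>t - t0\<bar> < e \<Longrightarrow> (w has_real_derivative w' t) (at t)"
    and w: "\<And>t. \<bar>t - t0\<bar> < e \<Longrightarrow> 0 \<le> w t \<and> \<bar>w' t\<bar> \<le> C * w t" and 0: "w t0 = 0" and t: "\<bar>t - t0\<bar> < e"
  shows "w t = (0::real)"
proof -
  have D: "((\<lambda>t. exp (b * t) * w t) has_real_derivative exp (b * s) * (b * w s + w' s)) (at s)" if "\<bar>s - t0\<bar> < e" for b s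
    by (auto intro!: derivative_eq_intros d[OF that] simp: algebra_simps)
  show ?thesis
  proof (cases "t0 \<le> t")
    case True
    have "exp (- C * t) * w t \<le> exp (- C * t0) * w t0"
    proof (rule DERIV_nonpos_imp_nonincreasing[OF True])
      fix s assume s: "t0 \<le> s" "s \<le> t"
      then have se: "\<bar>s - t0\<bar> < e" using t by auto
      have "exp (- C * s) * (- C * w s + w' s) \<le> 0"
        using w[OF se] by (intro mult_nonneg_nonpos) auto
      with D[OF se] show "\<exists>y. ((\<lambda>t. exp (- C * t) * w t) has_real_derivative y) (at s) \<and> y \<le> 0" by blast
    qed
    then have "exp (- C * t) * w t \<le> 0" using 0 by simp
    then have "w t \<le> 0" by (simp add: mult_le_0_iff)
    then show ?thesis using w[OF t] by simp
  next
    case False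
    then have le: "t \<le> t0" by simp
    have "exp (C * t) * w t \<le> exp (C * t0) * w t0"
    proof (rule DERIV_nonneg_imp_nondecreasing[OF le])
      fix s assume s: "t \<le> s" "s \<le> t0"
      then have se: "\<bar>s - t0\<bar> < e" using t by auto
      have "0 \<le> exp (C * s) * (C * w s + w' s)"
        using w[OF se] by (intro mult_nonneg_nonneg) auto
      with D[OF se] show "\<exists>y. ((\<lambda>t. exp (C * t) * w t) has_real_derivative y) (at s) \<and> 0 \<le> y" by blast
    qed
    then have "exp (C * t) * w t \<le> 0" using 0 by simp
    then have "w t \<le> 0" by (simp add: mult_le_0_iff)
    then show ?thesis using w[OF t] by simp
  qed
qed

text \<open>Only local Lipschitz continuity of \<open>g\<close> is available, so the set of agreement is shown to be open and closed.\<close>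

lemma second_order_unique:
  fixes y z p q g :: "real \<Rightarrow> real"
  assumes S: "open S" and g: "Cn 1 S g"
    and y: "\<And>t. (y has_real_derivative p t) (at t)" "\<And>t. (p has_real_derivative - y t * g (p t)) (at t)"
    and z: "\<And>t. (z has_real_derivative q t) (at t)" "\<And>t. (q has_real_derivative - z t * g (q t)) (at t)"
    and qS: "\<And>t. q t \<in> S" and 0: "y 0 = z 0" "p 0 = q 0"
  shows "y = z"
proof -
  obtain g' where g': "\<And>x. x \<in> S \<Longrightarrow> (g has_real_derivative g' x) (at x)" "continuous_on S g'"
    using g by (auto simp: Cn.simps)
  define Z where "Z = {t. y t = z t \<and> p t = q t}"
  have c: "continuous_on UNIV y" "continuous_on UNIV z" "continuous_on UNIV p" "continuous_on UNIV q"
    using y z by (auto intro!: continuous_at_imp_continuous_on DERIV_isCont)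
  have "closed Z"
    unfolding Z_def by (intro closed_Collect_conj closed_Collect_eq c)
  moreover have "open Z"
    unfolding open_dist
  proof
    fix t0 assume "t0 \<in> Z"
    then have t0: "y t0 = z t0" "p t0 = q t0" by (auto simp: Z_def)
    obtain r where r: "0 < r" "cball (q t0) r \<subseteq> S" using S qS[of t0] open_contains_cball by blast
    let ?K = "cball (q t0) r"
    have "bounded (g' ` ?K)" "bounded (g ` ?K)"
      using r(2) Cn_cont[OF g] g'(2)
      by (auto intro!: compact_imp_bounded compact_continuous_image elim: continuous_on_subset)
    then obtain B1 B2 where "\<forall>x\<in>g' ` ?K. norm x \<le> B1" "\<forall>x\<in>g ` ?K. norm x \<le> B2"
      unfolding bounded_iff by blast
    then have B: "\<And>x. x \<in> ?K \<Longrightarrow> \<bar>g' x\<bar> \<le> B1" "\<And>x. x \<in> ?K \<Longrightarrow> \<bar>g x\<bar> \<le> B2"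
      by auto
    have lip: "\<bar>g u - g v\<bar> \<le> B1 * \<bar>u - v\<bar>" if "u \<in> ?K" "v \<in> ?K" for u v
    proof -
      have "norm (g u - g v) \<le> B1 * norm (u - v)"
      proof (rule field_differentiable_bound[of ?K g g'])
        show "(g has_real_derivative g' x) (at x within ?K)" if "x \<in> ?K" for x
          by (rule has_field_derivative_at_within[OF g'(1)[OF subsetD[OF r(2) that]]])
      qed (use that B in auto)
      then show ?thesis by simp
    qed
    have "(p \<longlongrightarrow> p t0) (nhds t0)" "(q \<longlongrightarrow> q t0) (nhds t0)" "(z \<longlongrightarrow> z t0) (nhds t0)"
      using y z DERIV_isCont unfolding isCont_def tendsto_at_iff_tendsto_nhds by blast+
    then have "\<forall>\<^sub>F t in nhds t0. dist (p t) (p t0) < r \<and> dist (q t) (q t0) < r \<and> dist (z t) (z t0) < 1"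
      using r(1) by (intro eventually_conj tendstoD) simp_all
    then obtain e where e: "0 < e" "\<And>t. dist t t0 < e \<Longrightarrow> dist (p t) (p t0) < r \<and> dist (q t) (q t0) < r \<and> dist (z t) (z t0) < 1"
      unfolding eventually_nhds_metric by blast
    define B where "B = \<bar>z t0\<bar> + 1"
    define C where "C = 1 + B2 + 2 * B * B1"
    define w where "w = (\<lambda>t. (y t - z t)\<^sup>2 + (p t - q t)\<^sup>2)"
    define w' where "w' = (\<lambda>t. 2 * (y t - z t) * (p t - q t) + 2 * (p t - q t) * (- y t * g (p t) - - z t * g (q t)))"
    have "w t = 0" if "\<bar>t - t0\<bar> < e" for t
    proof (rule gronwall_zero[where w = w and w' = w' and C = C, OF e(1) _ _ _ that])
      show "w t0 = 0" using t0 by (simp add: w_def)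
      fix t assume "\<bar>t - t0\<bar> < e"
      then have t: "\<bar>q t0 - p t\<bar> < r" "\<bar>q t0 - q t\<bar> < r" "\<bar>z t\<bar> \<le> B" 
        using e(2)[of t] t0 by (auto simp: dist_real_def B_def)
      then have K: "p t \<in> ?K" "q t \<in> ?K" by (auto simp: dist_real_def)
      show "(w has_real_derivative w' t) (at t)"
        unfolding w_def w'_def by (auto intro!: derivative_eq_intros y z simp: algebra_simps)
      define a b where "a = y t - z t" and "b = p t - q t"
      have w'e: "w' t = 2 * a * b + 2 * b * (- a * g (p t) - z t * (g (p t) - g (q t)))"
        by (simp add: w'_def a_def b_def algebra_simps)
      have 1: "\<bar>z t * (g (p t) - g (q t))\<bar> \<le> B * (B1 * \<bar>b\<bar>)"
        unfolding abs_mult b_def using t(3) lip[OF K] by (intro mult_mono) auto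
      have 2: "\<bar>a * g (p t)\<bar> \<le> \<bar>a\<bar> * B2"
        unfolding abs_mult using B(2)[OF K(1)] by (intro mult_left_mono) auto
      have B2: "0 \<le> B2" using B(2)[OF K(1)] by simp
      have B1: "0 \<le> B1" "0 \<le> B" using B(1)[OF K(1)] by (simp_all add: B_def)
      have ab: "2 * (\<bar>a\<bar> * \<bar>b\<bar>) \<le> a\<^sup>2 + b\<^sup>2" using sum_squares_bound[of "\<bar>a\<bar>" "\<bar>b\<bar>"] by (simp add: mult.assoc)
      have "\<bar>w' t\<bar> \<le> 2 * \<bar>a\<bar> * \<bar>b\<bar> + 2 * \<bar>b\<bar> * \<bar>- a * g (p t) - z t * (g (p t) - g (q t))\<bar>"
        unfolding w'e by (rule order_trans[OF abs_triangle_ineq]) (simp add: abs_mult)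
      also have "\<dots> \<le> 2 * \<bar>a\<bar> * \<bar>b\<bar> + 2 * \<bar>b\<bar> * (\<bar>a\<bar> * B2 + B * (B1 * \<bar>b\<bar>))"
        using 1 2 by (intro add_left_mono mult_left_mono) auto
      also have "\<dots> = (1 + B2) * (2 * (\<bar>a\<bar> * \<bar>b\<bar>)) + 2 * B * B1 * b\<^sup>2"
        by (simp add: algebra_simps power2_eq_square)
      also have "\<dots> \<le> (1 + B2) * (a\<^sup>2 + b\<^sup>2) + 2 * B * B1 * (a\<^sup>2 + b\<^sup>2)"
        using ab B1 B2 by (intro add_mono mult_left_mono) auto
      also have "\<dots> = C * w t" by (simp add: C_def w_def a_def b_def algebra_simps)
      finally show "0 \<le> w t \<and> \<bar>w' t\<bar> \<le> C * w t" by (simp add: w_def)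
    qed
    then have "t \<in> Z" if "\<bar>t - t0\<bar> < e" for t
      using that by (auto simp: w_def Z_def sum_power2_eq_zero_iff)
    then show "\<exists>e>0. \<forall>t. dist t t0 < e \<longrightarrow> t \<in> Z" using e(1) by (auto simp: dist_real_def)
  qed
  ultimately have "Z = {} \<or> Z = UNIV" using clopen by blast
  moreover have "0 \<in> Z" using 0 by (simp add: Z_def)
  ultimately have "Z = UNIV" by blast
  then show ?thesis by (auto simp: Z_def)
qed

subsection \<open>The wave profiles\<close>

lemma Aint_FTC:
  assumes f: "C2 0 d f" "\<bar>x\<bar> < d" and G: "\<And>t. (G has_real_derivative f x t) (at t)"
  shows "Aint f x t = G t - G 0"
proof -
  have "((\<lambda>t. Aint f x t - G t) has_real_derivative f x t - f x t) (at t)" for t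
    by (intro DERIV_diff Aint_deriv_t[OF f] G)
  then have "Aint f x t - G t = Aint f x 0 - G 0" by (intro DERIV_isconst_all) simp
  then show ?thesis by (simp add: Aint_def)
qed

text \<open>The factor \<open>x\<close> shifts orders: the first derivative at 0 is
  \<open>q 0\<close> and the second is twice \<open>pdx q 0\<close>, so first-order information
  about \<open>q\<close> determines the jet.\<close>

lemma jet_amplitude_mult:
  assumes q: "Csm d q" "TP1 (q 0)" "TP2 (pdx q 0)"
  shows "jet d (\<lambda>x t. x * q x t)"
proof -
  note q1 = Csm_D2[OF q(1)] and q2 = Csm_D2[OF Csm_D2(2)[OF q(1)]]
  show ?thesis
  proof (rule jetI[OF D2_mult[OF D2_fst q1(1)] D2_add[OF D2_mult[OF D2_fst q2(1)] D2_mult[OF D2_const q1(1)]]])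
    show "TP1 (\<lambda>t. 0 * pdx q 0 t + 1 * q 0 t)" using q(2) by simp
    show "TP2 (\<lambda>t. 0 * pdx (pdx q) 0 t + 1 * pdx q 0 t + (1 * pdx q 0 t + 0 * q 0 t))"
      using TP2_add[OF q(3) q(3)] by simp
  qed simp
qed

locale wave_hyp = wave_data P F Wd V E for P F Wd :: "real \<Rightarrow> real" and V :: real and E :: "real \<Rightarrow> real \<Rightarrow> real" +
  fixes W :: "real \<Rightarrow> real"
  assumes c_pos: "deriv P 1 > 0" and V_gt: "V > sqrt (deriv P 1)"
    and smooth_F: "smooth_near 1 F" and F_P: "\<forall>\<^sub>F \<rho> in nhds 1. deriv (deriv F) \<rho> = deriv P \<rho> / \<rho>"
    and W_deriv: "\<forall>\<^sub>F \<rho> in nhds 1. (W has_real_derivative (\<rho> - 1) * h \<rho>) (at \<rho>)"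
    and smooth_Wd: "smooth_near 0 Wd" and Wd_0: "Wd 0 = 1"
    and W_eq: "\<forall>\<^sub>F \<zeta> in nhds 0. W (1 + \<zeta> * Wd \<zeta>) = \<zeta>\<^sup>2 * h 1 / 2"
    and wave_ode: "\<exists>\<delta>0>0. \<forall>\<delta>\<in>{0..\<delta>0}.
           (\<forall>x. E \<delta> differentiable (at x)) \<and>
           (\<forall>x. (deriv (E \<delta>) has_real_derivative
              - E \<delta> x / ((k \<delta>)\<^sup>2 * h (1 + k \<delta> * deriv (E \<delta>) x))) (at x)) \<and>
           E \<delta> 0 = 0 \<and> deriv (E \<delta>) 0 = \<delta> * Wd \<delta> / k \<delta> \<and>
           periodic1 (E \<delta>)"
begin

lemma V_pos: "0 < V" and V_sq: "deriv P 1 < V\<^sup>2"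
proof -
  show "0 < V" using V_gt c_pos real_sqrt_gt_zero by (meson less_trans)
  have "(sqrt (deriv P 1))\<^sup>2 < V\<^sup>2" using V_gt c_pos by (intro power_strict_mono) auto
  then show "deriv P 1 < V\<^sup>2" using c_pos by simp
qed

lemma F_1: "deriv (deriv F) 1 = deriv P 1"
  using eventually_nhds_x_imp_x[OF F_P] by simp

lemma h_1: "h 1 = V\<^sup>2 - deriv P 1" "0 < h 1"
  using V_sq by (simp_all add: h_def F_1)

lemma h_Cn:
  assumes "smooth_on S F" "\<And>x. x \<in> S \<Longrightarrow> 0 < x"
  shows "Cn n S h"
proof -
  have h: "h = (\<lambda>x. V\<^sup>2 * (inverse x * (inverse x * inverse x)) + (-1) * (deriv ^^ 2) F x)"
    by (simp add: h_def fun_eq_iff divide_inverse power3_eq_cube numeral_2_eq_2 mult.assoc)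
  have iv: "Cn n S inverse" by (rule Cn_subset[OF Cn_inverse]) (use assms(2) in auto)
  show ?thesis unfolding h by (intro Cn_add Cn_mult Cn_const smooth_on_Cn(1)[OF assms(1)] iv)
qed

lemma radius_r:
  obtains r where "0 < r" "r \<le> 1" "smooth_on (ball 1 r) F"
    "\<And>\<rho>. \<rho> \<in> ball 1 r \<Longrightarrow> 0 < h \<rho>" "\<And>\<rho>. \<rho> \<in> ball 1 r \<Longrightarrow> (W has_real_derivative (\<rho> - 1) * h \<rho>) (at \<rho>)"
proof -
  obtain r0 where r0: "0 < r0" "smooth_on (ball 1 r0) F" using smooth_F by (auto simp: smooth_near_def)
  define r1 where "r1 = min 1 r0"
  have sm: "smooth_on (ball 1 r1) F" using r0 by (auto simp: smooth_on_def r1_def)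
  have "continuous_on (ball 1 r1) h"
    by (rule Cn_cont[OF h_Cn[OF sm, of 0]]) (auto simp: r1_def dist_real_def)
  then have "isCont h 1" using r0 by (intro continuous_on_interior[of "ball 1 r1"]) (auto simp: r1_def)
  then have "(h \<longlongrightarrow> h 1) (nhds 1)" unfolding isCont_def tendsto_at_iff_tendsto_nhds .
  then have "\<forall>\<^sub>F \<rho> in nhds 1. 0 < h \<rho>" by (rule order_tendstoD(1)) (rule h_1)
  then have "\<forall>\<^sub>F \<rho> in nhds 1. 0 < h \<rho> \<and> (W has_real_derivative (\<rho> - 1) * h \<rho>) (at \<rho>)"
    by (rule eventually_conj[OF _ W_deriv])
  then obtain e where e: "0 < e" "\<And>\<rho>. dist \<rho> 1 < e \<Longrightarrow> 0 < h \<rho> \<and> (W has_real_derivative (\<rho> - 1) * h \<rho>) (at \<rho>)"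
    unfolding eventually_nhds_metric by blast
  show ?thesis
  proof (rule that[of "min r1 e"])
    show "smooth_on (ball 1 (min r1 e)) F" using sm by (auto simp: smooth_on_def)
  qed (use e r0 in \<open>auto simp: r1_def dist_commute\<close>)
qed

lemma radius_s:
  assumes "0 < r"
  obtains s where "0 < s" "smooth_on (ball 0 s) Wd"
    "\<And>\<zeta>. \<zeta> \<in> ball 0 s \<Longrightarrow> 0 < Wd \<zeta>" "\<And>\<zeta>. \<zeta> \<in> ball 0 s \<Longrightarrow> 1 + \<zeta> * Wd \<zeta> \<in> ball 1 r"
    "\<And>\<zeta>. \<zeta> \<in> ball 0 s \<Longrightarrow> W (1 + \<zeta> * Wd \<zeta>) = \<zeta>\<^sup>2 * h 1 / 2"
proof -
  obtain s0 where s0: "0 < s0" "smooth_on (ball 0 s0) Wd" using smooth_Wd by (auto simp: smooth_near_def)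
  have "continuous_on (ball 0 s0) Wd"
    using Cn_cont[OF smooth_on_Cn(1)[OF s0(2), of 0 0]] by simp
  then have "isCont Wd 0" using s0 by (intro continuous_on_interior[of "ball 0 s0"]) auto
  then have "(Wd \<longlongrightarrow> Wd 0) (nhds 0)" unfolding isCont_def tendsto_at_iff_tendsto_nhds .
  then have t: "(Wd \<longlongrightarrow> 1) (nhds 0)" unfolding Wd_0 .
  then have 1: "\<forall>\<^sub>F \<zeta> in nhds 0. 0 < Wd \<zeta>" by (rule order_tendstoD(1)) simp
  have "((\<lambda>\<zeta>. 1 + \<zeta> * Wd \<zeta>) \<longlongrightarrow> 1 + 0 * 1) (nhds 0)"
    by (intro tendsto_add tendsto_mult tendsto_const t tendsto_ident_at filterlim_ident)
  then have "\<forall>\<^sub>F \<zeta> in nhds 0. dist (1 + \<zeta> * Wd \<zeta>) (1 + 0 * 1) < r" by (rule tendstoD) (rule assms)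
  with 1 W_eq have "\<forall>\<^sub>F \<zeta> in nhds 0. 0 < Wd \<zeta> \<and> dist (1 + \<zeta> * Wd \<zeta>) 1 < r \<and> W (1 + \<zeta> * Wd \<zeta>) = \<zeta>\<^sup>2 * h 1 / 2"
    by (simp add: eventually_conj)
  then obtain e where e: "0 < e" "\<And>\<zeta>. dist \<zeta> 0 < e \<Longrightarrow> 0 < Wd \<zeta> \<and> dist (1 + \<zeta> * Wd \<zeta>) 1 < r \<and> W (1 + \<zeta> * Wd \<zeta>) = \<zeta>\<^sup>2 * h 1 / 2"
    unfolding eventually_nhds_metric by blast
  show ?thesis
  proof (rule that[of "min s0 e"])
    show "smooth_on (ball 0 (min s0 e)) Wd" using s0(2) by (auto simp: smooth_on_def)
    fix \<zeta> :: real assume "\<zeta> \<in> ball 0 (min s0 e)"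
    then have "dist \<zeta> 0 < e" by (simp add: dist_commute)
    from e(2)[OF this] show "0 < Wd \<zeta>" "1 + \<zeta> * Wd \<zeta> \<in> ball 1 r" "W (1 + \<zeta> * Wd \<zeta>) = \<zeta>\<^sup>2 * h 1 / 2"
      by (simp_all add: dist_commute)
  qed (use e s0 in auto)
qed

end

text \<open>The radii are such that \<open>F\<close> is smooth and \<open>h\<close> positive at all
  densities that occur, and the parametrization of densities by \<zeta> takes the ball of radius
  \<open>s\<close> into that of radius \<open>r\<close>.\<close>

locale wave_local = wave_hyp +
  fixes r s :: real
  assumes r: "0 < r" "r \<le> 1" "smooth_on (ball 1 r) F"
    "\<And>\<rho>. \<rho> \<in> ball 1 r \<Longrightarrow> 0 < h \<rho>" "\<And>\<rho>. \<rho> \<in> ball 1 r \<Longrightarrow> (W has_real_derivative (\<rho> - 1) * h \<rho>) (at \<rho>)"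
  and s: "0 < s" "smooth_on (ball 0 s) Wd"
    "\<And>\<zeta>. \<zeta> \<in> ball 0 s \<Longrightarrow> 0 < Wd \<zeta>" "\<And>\<zeta>. \<zeta> \<in> ball 0 s \<Longrightarrow> 1 + \<zeta> * Wd \<zeta> \<in> ball 1 r"
    "\<And>\<zeta>. \<zeta> \<in> ball 0 s \<Longrightarrow> W (1 + \<zeta> * Wd \<zeta>) = \<zeta>\<^sup>2 * h 1 / 2"
begin

text \<open>The density at \<zeta>, where \<zeta> is the coordinate in which the potential
  \<open>W\<close> is exactly quadratic. In it the orbits of the profile equation become circles,
  Z^2 + Y^2 = \<delta>^2.\<close>

definition Rh :: "real \<Rightarrow> real" where "Rh \<zeta> = 1 + \<zeta> * Wd \<zeta>"
definition Rh' :: "real \<Rightarrow> real" where "Rh' \<zeta> = Wd \<zeta> + \<zeta> * deriv Wd \<zeta>"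

lemma Wd_Cn: "Cn n (ball 0 s) Wd" "Cn n (ball 0 s) (deriv Wd)"
  using smooth_on_Cn(1)[OF s(2), of n 0] smooth_on_Cn(1)[OF s(2), of n 1] by simp_all

lemma Wd_deriv: "\<zeta> \<in> ball 0 s \<Longrightarrow> (Wd has_real_derivative deriv Wd \<zeta>) (at \<zeta>)"
  using smooth_on_Cn(2)[OF s(2), of \<zeta> 0] by simp

lemma Rh_deriv: "\<zeta> \<in> ball 0 s \<Longrightarrow> (Rh has_real_derivative Rh' \<zeta>) (at \<zeta>)"
  unfolding Rh_def Rh'_def by (auto intro!: derivative_eq_intros Wd_deriv)

lemma Rh_Cn: "Cn n (ball 0 s) Rh" "Cn n (ball 0 s) Rh'"
proof -
  have "Rh = (\<lambda>\<zeta>. 1 + \<zeta> * Wd \<zeta>)" "Rh' = (\<lambda>\<zeta>. Wd \<zeta> + \<zeta> * deriv Wd \<zeta>)" by (auto simp: Rh_def Rh'_def)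
  then show "Cn n (ball 0 s) Rh" "Cn n (ball 0 s) Rh'"
    by (auto intro!: Cn_add Cn_mult Cn_const Cn_id Wd_Cn)
qed

text \<open>The derivative of the defining equation of $\mathcal{W}^\dagger$, divided by $\zeta$.\<close>

lemma Rh_equation:
  assumes z: "\<zeta> \<in> ball 0 s"
  shows "Wd \<zeta> * h (Rh \<zeta>) * Rh' \<zeta> = h 1"
proof (cases "\<zeta> = 0")
  case True then show ?thesis by (simp add: Wd_0 Rh_def Rh'_def)
next
  case False
  have "((\<lambda>\<zeta>. W (Rh \<zeta>)) has_real_derivative (Rh \<zeta> - 1) * h (Rh \<zeta>) * Rh' \<zeta>) (at \<zeta>)"
    using s(4)[OF z] by (intro DERIV_chain2[OF r(5) Rh_deriv[OF z]]) (simp add: Rh_def)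
  moreover have "((\<lambda>\<zeta>. W (Rh \<zeta>)) has_real_derivative \<zeta> * h 1) (at \<zeta>)"
  proof (rule has_field_derivative_transform_within_open[OF _ open_ball z])
    show "((\<lambda>\<zeta>. \<zeta>\<^sup>2 * h 1 / 2) has_real_derivative \<zeta> * h 1) (at \<zeta>)" by (auto intro!: derivative_eq_intros)
    show "\<eta>\<^sup>2 * h 1 / 2 = W (Rh \<eta>)" if "\<eta> \<in> ball 0 s" for \<eta> using s(5)[OF that] by (simp add: Rh_def)
  qed
  ultimately have "(Rh \<zeta> - 1) * h (Rh \<zeta>) * Rh' \<zeta> = \<zeta> * h 1" by (rule DERIV_unique)
  then show ?thesis using False by (simp add: Rh_def mult.assoc)
qed

section \<open>The phase along the orbit and its inverse\<close>

definition Phi :: "real \<Rightarrow> real \<Rightarrow> real" where "Phi \<delta> t = inverse (Wd (\<delta> * cos t))"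
text \<open>The second argument is a dummy: it lets this function of the amplitude enter the
  two-variable calculus.\<close>

definition II :: "real \<Rightarrow> real \<Rightarrow> real" where "II \<delta> t = Aint Phi \<delta> pi + (-1) * Aint Phi \<delta> (- pi)"
text \<open>Position as a function of the phase, normalised so that a turn of 2 pi is one spatial
  period.\<close>

definition X :: "real \<Rightarrow> real \<Rightarrow> real" where "X \<delta> t = Aint Phi \<delta> t * inverse (II \<delta> t)"

lemma cos_ball: "\<bar>\<delta>\<bar> < s \<Longrightarrow> \<delta> * cos t \<in> ball 0 s"
proof -
  assume d: "\<bar>\<delta>\<bar> < s"
  have "\<bar>\<delta> * cos t\<bar> \<le> \<bar>\<delta>\<bar> * 1" unfolding abs_mult by (intro mult_left_mono) auto
  then show ?thesis using d by simp
qed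

lemma Csm_dcos: "Csm s (\<lambda>\<delta> t. \<delta> * cos t)"
  by (rule Csm_closure(5)[OF Csm_closure(2) Csm_comp[OF Cn_sin_cos(2) Csm_closure(3)]]) simp

lemma Csm_Wd: "Csm s (\<lambda>\<delta> t. Wd (\<delta> * cos t))"
  by (rule Csm_comp[OF Wd_Cn(1) Csm_dcos]) (rule cos_ball)

lemma Phi_pos: "\<bar>\<delta>\<bar> < s \<Longrightarrow> 0 < Phi \<delta> t"
  using s(3)[OF cos_ball] by (simp add: Phi_def)

lemma Csm_Phi: "Csm s Phi"
proof -
  have "Csm s (\<lambda>\<delta> t. inverse (Wd (\<delta> * cos t)))"
    by (rule Csm_comp[where g = inverse and S = "{0<..}", OF Cn_inverse Csm_Wd]) (use s(3)[OF cos_ball] in simp)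
  then show ?thesis by (simp add: Phi_def[abs_def])
qed

lemma C2_Phi: "C2 0 s Phi" using Csm_Phi unfolding Csm_def by blast

lemma A_deriv: "\<bar>\<delta>\<bar> < s \<Longrightarrow> (Aint Phi \<delta> has_real_derivative Phi \<delta> t) (at t)"
  by (rule Aint_deriv_t[OF C2_Phi])

lemma Csm_II: "Csm s II"
proof -
  note A = Csm_closure(7)[OF Csm_Phi]
  have "Csm s (\<lambda>\<delta> t. Aint Phi \<delta> pi + (-1) * Aint Phi \<delta> (- pi))"
    using Csm_closure(6)[OF A Csm_closure(1)[of s pi]] Csm_closure(6)[OF A Csm_closure(1)[of s "-pi"]]
    by (intro Csm_closure(4) Csm_closure(5)[OF Csm_closure(1)])
  then show ?thesis by (simp add: II_def[abs_def])
qed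

lemma II_pos: "\<bar>\<delta>\<bar> < s \<Longrightarrow> 0 < II \<delta> t"
proof -
  assume d: "\<bar>\<delta>\<bar> < s"
  have "Aint Phi \<delta> (- pi) < Aint Phi \<delta> pi"
    by (rule DERIV_pos_imp_increasing) (use A_deriv[OF d] Phi_pos[OF d] pi_gt_zero in \<open>auto simp: less_trans[of "-pi" 0 pi]\<close>)
  then show ?thesis by (simp add: II_def)
qed

lemma II_eq: "II \<delta> t = II \<delta> 0" by (simp add: II_def)

lemma k_eq: "\<bar>\<delta>\<bar> < s \<Longrightarrow> k \<delta> = inverse (sqrt (h 1)) * inverse (II \<delta> t)"
proof -
  assume d: "\<bar>\<delta>\<bar> < s"
  have "(\<lambda>\<theta>. 1 / Wd (\<delta> * cos \<theta>)) = Phi \<delta>" by (simp add: Phi_def fun_eq_iff divide_inverse)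
  moreover have "integral {-pi..pi} (Phi \<delta>) = II \<delta> t"
    using Aint_diff[OF C2_Phi d, of "-pi" pi] by (simp add: II_def)
  ultimately show ?thesis by (simp add: k_def divide_inverse)
qed

lemma k_pos: "\<bar>\<delta>\<bar> < s \<Longrightarrow> 0 < k \<delta>"
  using k_eq[of \<delta> 0] II_pos[of \<delta> 0] h_1(2) by simp

lemma Csm_invII: "Csm s (\<lambda>\<delta> t. inverse (II \<delta> t))"
  by (rule Csm_comp[where g = inverse and S = "{0<..}", OF Cn_inverse Csm_II]) (simp add: II_pos)

lemma Csm_X: "Csm s X"
proof -
  have "Csm s (\<lambda>\<delta> t. Aint Phi \<delta> t * inverse (II \<delta> t))"
    by (rule Csm_closure(5)[OF Csm_closure(7)[OF Csm_Phi] Csm_invII])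
  then show ?thesis by (simp add: X_def[abs_def])
qed

lemma X_deriv: "\<bar>\<delta>\<bar> < s \<Longrightarrow> (X \<delta> has_real_derivative Phi \<delta> t * inverse (II \<delta> 0)) (at t)"
  using DERIV_cmult_right[OF A_deriv, of \<delta> "inverse (II \<delta> 0)" t]
  by (simp add: X_def[abs_def] II_eq[of \<delta> _, symmetric] II_def)

lemma pdt_X: "\<bar>\<delta>\<bar> < s \<Longrightarrow> pdt X \<delta> t = Phi \<delta> t * inverse (II \<delta> 0)"
  unfolding pdt_def by (rule DERIV_imp_deriv[OF X_deriv])

lemma pdt_X_pos: "\<bar>\<delta>\<bar> < s \<Longrightarrow> 0 < pdt X \<delta> t"
  by (simp add: pdt_X Phi_pos II_pos)

lemma X_strict: "\<bar>\<delta>\<bar> < s \<Longrightarrow> t < t' \<Longrightarrow> X \<delta> t < X \<delta> t'"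
  by (rule DERIV_pos_imp_increasing) (use X_deriv[of \<delta>] Phi_pos[of \<delta>] II_pos[of \<delta> 0] in \<open>auto intro!: exI mult_pos_pos\<close>)

lemma X_0: "X \<delta> 0 = 0" by (simp add: X_def Aint_def)

text \<open>The increment over a turn does not depend on \<open>t\<close> because \<open>Phi\<close>
  is 2 pi-periodic; taken from - pi to pi it is \<open>II\<close> divided by itself.\<close>

lemma X_shift: "\<bar>\<delta>\<bar> < s \<Longrightarrow> X \<delta> (t + 2 * pi) = X \<delta> t + 1"
proof -
  assume d: "\<bar>\<delta>\<bar> < s"
  have per: "Phi \<delta> (t + 2 * pi) = Phi \<delta> t" for t by (simp add: Phi_def)
  have "((\<lambda>t. X \<delta> (t + 2 * pi) - X \<delta> t) has_real_derivative 0) (at t)" for t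
    using DERIV_diff[OF DERIV_chain2[OF X_deriv[OF d, of "t + 2 * pi"] DERIV_add[OF DERIV_ident DERIV_const]] X_deriv[OF d, of t]]
    by (simp add: per)
  then have "X \<delta> (t + 2 * pi) - X \<delta> t = X \<delta> (- pi + 2 * pi) - X \<delta> (- pi)"
    using DERIV_isconst_all[of "\<lambda>t. X \<delta> (t + 2 * pi) - X \<delta> t" t "- pi"] by simp
  also have "\<dots> = II \<delta> 0 * inverse (II \<delta> 0)"
    by (simp add: X_def II_eq[of \<delta> pi] II_eq[of \<delta> "-pi"] algebra_simps) (simp add: II_def algebra_simps)
  also have "\<dots> = 1" using II_pos[OF d, of 0] by simp
  finally show ?thesis by simp
qed

lemma X_multiples: "\<bar>\<delta>\<bar> < s \<Longrightarrow> X \<delta> (2 * pi * real n) = real n \<and> X \<delta> (- (2 * pi * real n)) = - real n"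
proof (induction n)
  case (Suc n)
  then show ?case
    using X_shift[of \<delta> "2 * pi * real n"] X_shift[of \<delta> "- (2 * pi * real (Suc n))"] by (simp add: algebra_simps)
qed (simp add: X_0)

lemma X_bij: "\<bar>\<delta>\<bar> < s \<Longrightarrow> bij (X \<delta>)"
  unfolding bij_def
proof
  assume d: "\<bar>\<delta>\<bar> < s"
  show "inj (X \<delta>)" by (rule linorder_injI) (use X_strict[OF d] in \<open>auto simp: less_imp_neq\<close>)
  show "surj (X \<delta>)" unfolding surj_def
  proof
    fix y :: real
    obtain n where n: "\<bar>y\<bar> \<le> real n" using real_arch_simple by blast
    have "\<exists>t. - (2 * pi * real n) \<le> t \<and> t \<le> 2 * pi * real n \<and> X \<delta> t = y"
    proof (rule IVT')
      show "continuous_on {- (2 * pi * real n)..2 * pi * real n} (X \<delta>)"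
        using X_deriv[OF d] by (auto intro!: continuous_at_imp_continuous_on DERIV_isCont)
    qed (use n X_multiples[OF d, of n] in auto)
    then show "\<exists>x. y = X \<delta> x" by auto
  qed
qed

definition th :: "real \<Rightarrow> real \<Rightarrow> real" where "th \<delta> = inv (X \<delta>)"

lemma X_th: "\<bar>\<delta>\<bar> < s \<Longrightarrow> X \<delta> (th \<delta> x) = x" and th_X: "\<bar>\<delta>\<bar> < s \<Longrightarrow> th \<delta> (X \<delta> t) = t"
  using X_bij[of \<delta>] by (simp_all add: th_def bij_is_surj surj_f_inv_f bij_is_inj)

lemma th_0: "\<bar>\<delta>\<bar> < s \<Longrightarrow> th \<delta> 0 = 0"
  using th_X[of \<delta> 0] by (simp add: X_0)

lemma th_shift: "\<bar>\<delta>\<bar> < s \<Longrightarrow> th \<delta> (x + 1) = th \<delta> x + 2 * pi"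
  using th_X[of \<delta> "th \<delta> x + 2 * pi"] by (simp add: X_shift X_th)

lemma Csm_th: "Csm s th"
  by (rule Csm_inverse_fun[OF Csm_X pdt_X_pos X_th th_X])

lemma th_D2: "D2 s th (\<lambda>\<delta> x. - pdx X \<delta> (th \<delta> x) * inverse (pdt X \<delta> (th \<delta> x))) (\<lambda>\<delta> x. inverse (pdt X \<delta> (th \<delta> x)))"
  by (rule D2_inverse[OF Csm_D2(1)[OF Csm_X] _ X_th th_X]) (use pdt_X_pos in \<open>auto simp: less_imp_neq[THEN not_sym]\<close>)

text \<open>\<open>Z\<close> and \<open>Y\<close> are the orbit in Cartesian form, at the phase
  \<open>th\<close> of position \<open>x\<close>; \<open>R\<close> is the density and
  \<open>Rx\<close> its spatial derivative. The wave will be sqrt(h 1) times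
  \<open>Y\<close>.\<close>

definition Z :: "real \<Rightarrow> real \<Rightarrow> real" where "Z \<delta> x = \<delta> * cos (th \<delta> x)"
definition Y :: "real \<Rightarrow> real \<Rightarrow> real" where "Y \<delta> x = \<delta> * sin (th \<delta> x)"
definition R :: "real \<Rightarrow> real \<Rightarrow> real" where "R \<delta> x = Rh (Z \<delta> x)"
definition Rx :: "real \<Rightarrow> real \<Rightarrow> real" where "Rx \<delta> x = (-1) * (Rh' (Z \<delta> x) * (Y \<delta> x * (II \<delta> x * Wd (Z \<delta> x))))"

lemma zero_lt: "\<bar>0\<bar> < s" using s by simp

lemma at_0: "Phi 0 t = 1" "Aint Phi 0 t = t" "II 0 t = 2 * pi" "X 0 t = t / (2 * pi)" "th 0 t = 2 * pi * t"
proof -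
  show P: "Phi 0 t = 1" for t by (simp add: Phi_def Wd_0)
  show A: "Aint Phi 0 t = t" for t
    using Aint_FTC[OF C2_Phi zero_lt, of "\<lambda>t. t" t] DERIV_ident by (simp add: P)
  show I: "II 0 t = 2 * pi" for t by (simp add: II_def A)
  show Xe: "X 0 t = t / (2 * pi)" for t by (simp add: X_def A I field_simps)
  show "th 0 t = 2 * pi * t" using th_X[OF zero_lt, of "2 * pi * t"] by (simp add: Xe)
qed

lemma A_pdx: "\<bar>\<delta>\<bar> < s \<Longrightarrow> pdx (Aint Phi) \<delta> t = Aint (pdx Phi) \<delta> t"
  by (rule D2_pdx[OF Aint_D2[OF Csm_D2(1)[OF Csm_Phi]]]) (use Csm_D2(2)[OF Csm_Phi] in \<open>auto simp: Csm_def simp del: C2.simps\<close>)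

lemma pdx_Phi_0: "pdx Phi 0 t = - deriv Wd 0 * cos t"
proof -
  have "((\<lambda>\<delta>. Wd (\<delta> * cos t)) has_real_derivative deriv Wd (0 * cos t) * cos t) (at 0)"
    by (rule DERIV_chain2[where f = Wd and g = "\<lambda>\<delta>. \<delta> * cos t"], rule Wd_deriv[OF cos_ball[OF zero_lt]])
      (auto intro!: derivative_eq_intros)
  then have "((\<lambda>\<delta>. inverse (Wd (\<delta> * cos t))) has_real_derivative - (inverse (Wd (0 * cos t)) * (deriv Wd (0 * cos t) * cos t) * inverse (Wd (0 * cos t)))) (at 0)"
    by (rule DERIV_inverse') (simp add: Wd_0)
  then show ?thesis unfolding pdx_def Phi_def by (intro DERIV_imp_deriv) (simp add: Wd_0)
qed

lemma pdx_A_0: "pdx (Aint Phi) 0 t = - deriv Wd 0 * sin t"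
proof -
  have "Aint (pdx Phi) 0 t = - deriv Wd 0 * sin t - - deriv Wd 0 * sin 0"
  proof (rule Aint_FTC[OF _ zero_lt])
    show "C2 0 s (pdx Phi)" using Csm_D2(2)[OF Csm_Phi] unfolding Csm_def by blast
    show "((\<lambda>t. - deriv Wd 0 * sin t) has_real_derivative pdx Phi 0 t) (at t)" for t
      unfolding pdx_Phi_0 by (auto intro!: derivative_eq_intros)
  qed
  then show ?thesis by (simp add: A_pdx[OF zero_lt])
qed

text \<open>The first-order part of \<open>Phi\<close> is a multiple of cos t, whose integral over a
  full turn is 0: the wave number has no first-order correction. This makes \<open>II\<close> fit
  \<open>jet\<close>, since the only constant in \<open>TP1\<close> is 0.\<close>

lemma pdx_II_0: "pdx II 0 t = 0"
proof -
  note A = D2_partial_x[OF Csm_D2(1)[OF Csm_closure(7)[OF Csm_Phi]] zero_lt]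
  have "((\<lambda>\<delta>. II \<delta> t) has_real_derivative pdx (Aint Phi) 0 pi + (-1) * pdx (Aint Phi) 0 (- pi)) (at 0)"
    unfolding II_def by (intro DERIV_add DERIV_cmult A)
  then show ?thesis unfolding pdx_def by (intro DERIV_imp_deriv) (simp add: pdx_A_0[unfolded pdx_def])
qed

lemma pdx_X_0: "pdx X 0 t = - deriv Wd 0 * sin t / (2 * pi)"
proof -
  have I: "((\<lambda>\<delta>. II \<delta> t) has_real_derivative 0) (at 0)"
    using D2_partial_x[OF Csm_D2(1)[OF Csm_II] zero_lt, of t] by (simp add: pdx_II_0)
  have "((\<lambda>\<delta>. inverse (II \<delta> t)) has_real_derivative 0) (at 0)"
    using DERIV_inverse'[OF I] by (simp add: at_0)
  then have "((\<lambda>\<delta>. Aint Phi \<delta> t * inverse (II \<delta> t)) has_real_derivative Aint Phi 0 t * 0 + (- deriv Wd 0 * sin t) * inverse (II 0 t)) (at 0)"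
    using D2_partial_x[OF Csm_D2(1)[OF Csm_closure(7)[OF Csm_Phi]] zero_lt, of t]
    by (intro DERIV_mult') (simp_all add: pdx_A_0)
  then show ?thesis unfolding pdx_def X_def by (intro DERIV_imp_deriv) (simp add: at_0 field_simps)
qed

lemma pdx_th_0: "pdx th 0 t = deriv Wd 0 * sin (2 * pi * t)"
  by (subst D2_pdx[OF th_D2 zero_lt]) (simp add: pdx_X_0 pdt_X[OF zero_lt] at_0)

lemma famj_Z: "famj s Z" and famj_Y: "famj s Y"
proof -
  have c: "Csm s (\<lambda>\<delta> x. cos (th \<delta> x))" "Csm s (\<lambda>\<delta> x. sin (th \<delta> x))"
    by (rule Csm_comp[OF Cn_sin_cos(2) Csm_th] Csm_comp[OF Cn_sin_cos(1) Csm_th]; simp)+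
  \<comment> \<open>At first order the phase moves by a multiple of sin(2 pi t), so these
    derivatives are products of two functions of frequency one and lie in
    \<open>TP2\<close>.\<close>
  have p: "pdx (\<lambda>\<delta> x. cos (th \<delta> x)) 0 = (\<lambda>t. - sin (2 * pi * t) * (deriv Wd 0 * sin (2 * pi * t)))"
    "pdx (\<lambda>\<delta> x. sin (th \<delta> x)) 0 = (\<lambda>t. cos (2 * pi * t) * (deriv Wd 0 * sin (2 * pi * t)))"
    unfolding fun_eq_iff using D2_pdx[OF D2_comp[OF Csm_D2(1)[OF Csm_th] DERIV_cos, of UNIV] zero_lt]
      D2_pdx[OF D2_comp[OF Csm_D2(1)[OF Csm_th] DERIV_sin, of UNIV] zero_lt]
    by (simp_all add: pdx_th_0 at_0)
  have T: "TP1 (\<lambda>t. A * cos (2 * pi * t) + B * sin (2 * pi * t))" for A B by (auto simp: TP1_def)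
  note T1 = T[of 1 0, simplified] T[of 0 1, simplified] and T2 = T[of 0 "-1", simplified] T[of 0 "deriv Wd 0", simplified]
  have "jet s (\<lambda>\<delta> x. \<delta> * cos (th \<delta> x))"
    by (rule jet_amplitude_mult[OF c(1)]) (use T1 TP1_mult[OF T2] in \<open>simp_all add: at_0 p\<close>)
  moreover have "jet s (\<lambda>\<delta> x. \<delta> * sin (th \<delta> x))"
    by (rule jet_amplitude_mult[OF c(2)]) (use T1 TP1_mult[OF T1(1) T2(2)] in \<open>simp_all add: at_0 p\<close>)
  moreover have "Csm s (\<lambda>\<delta> x. \<delta> * cos (th \<delta> x))" "Csm s (\<lambda>\<delta> x. \<delta> * sin (th \<delta> x))"
    by (rule Csm_closure(5)[OF Csm_closure(2) c(1)] Csm_closure(5)[OF Csm_closure(2) c(2)])+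
  moreover have "periodic1 (Z \<delta>)" "periodic1 (Y \<delta>)" if "\<bar>\<delta>\<bar> < s" for \<delta>
    using th_shift[OF that] by (simp_all add: periodic1_def Z_def Y_def)
  ultimately show "famj s Z" "famj s Y"
    by (simp_all add: famj_def fam_def Z_def[abs_def] Y_def[abs_def])
qed

lemma Z_ball: "\<bar>\<delta>\<bar> < s \<Longrightarrow> Z \<delta> x \<in> ball 0 s"
  unfolding Z_def by (rule cos_ball)

lemma famj_II: "famj s II"
proof -
  have "jet s II"
  proof (rule jetI[OF Csm_D2(1)[OF Csm_II] Csm_D2(1)[OF Csm_D2(2)[OF Csm_II]], of "2 * pi"])
    have "pdx II 0 = (\<lambda>t. 0)" using pdx_II_0 by auto
    then show "TP1 (pdx II 0)" by (simp add: TP_const)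
    have "pdx (pdx II) 0 = (\<lambda>t. pdx (pdx II) 0 0)" by (intro ext) (simp add: pdx_def II_def)
    then show "TP2 (pdx (pdx II) 0)" by (metis TP_const(2))
  qed (simp add: at_0)
  then show ?thesis by (simp add: famj_def fam_def Csm_II periodic1_def II_def)
qed

lemma famj_k: "famj s (\<lambda>\<delta> x. inverse (sqrt (h 1)) * inverse (II \<delta> x))"
  by (rule famj_closure(3)[OF famj_closure(1) famj_comp[where g = inverse and S = "{0<..}", OF Cn_inverse famj_II]]) (simp add: II_pos)

lemma famj_R: "famj s R"
  unfolding R_def[abs_def] by (rule famj_comp[OF Rh_Cn(1) famj_Z Z_ball])

lemma famj_Rx: "famj s Rx"
  unfolding Rx_def[abs_def]
  by (rule famj_closure(3)[OF famj_closure(1) famj_closure(3)[OF famj_comp[OF Rh_Cn(2) famj_Z Z_ball]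
      famj_closure(3)[OF famj_Y famj_closure(3)[OF famj_II famj_comp[OF Wd_Cn(1) famj_Z Z_ball]]]]])

lemma R_ball: "\<bar>\<delta>\<bar> < s \<Longrightarrow> R \<delta> x \<in> ball 1 r"
  using s(4)[OF Z_ball] by (simp add: R_def Rh_def)

lemma R_pos: "\<bar>\<delta>\<bar> < s \<Longrightarrow> 0 < R \<delta> x"
  using R_ball[of \<delta> x] r(2) by (auto simp: dist_real_def)

lemma th_deriv: "\<bar>\<delta>\<bar> < s \<Longrightarrow> (th \<delta> has_real_derivative II \<delta> 0 * Wd (Z \<delta> x)) (at x)"
  using D2_partial_t[OF th_D2, of \<delta> x] by (simp add: pdt_X Phi_def Z_def mult.commute)

lemma R_deriv: "\<bar>\<delta>\<bar> < s \<Longrightarrow> (R \<delta> has_real_derivative Rx \<delta> x) (at x)"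
proof -
  assume d: "\<bar>\<delta>\<bar> < s"
  have "((\<lambda>x. \<delta> * cos (th \<delta> x)) has_real_derivative \<delta> * (- sin (th \<delta> x) * (II \<delta> 0 * Wd (Z \<delta> x)))) (at x)"
    by (rule DERIV_cmult[OF DERIV_chain2[OF DERIV_cos th_deriv[OF d]]])
  then have "(Z \<delta> has_real_derivative \<delta> * (- sin (th \<delta> x) * (II \<delta> 0 * Wd (Z \<delta> x)))) (at x)"
    by (simp add: Z_def[abs_def])
  from DERIV_chain2[OF Rh_deriv[OF Z_ball[OF d, of x]] this] show ?thesis
    by (simp add: R_def[abs_def] Rx_def Y_def II_eq[of \<delta> x] mult.assoc)
qed

lemma Y_deriv: "\<bar>\<delta>\<bar> < s \<Longrightarrow> (Y \<delta> has_real_derivative Z \<delta> x * (II \<delta> 0 * Wd (Z \<delta> x))) (at x)"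
proof -
  assume d: "\<bar>\<delta>\<bar> < s"
  have "((\<lambda>x. \<delta> * sin (th \<delta> x)) has_real_derivative \<delta> * (cos (th \<delta> x) * (II \<delta> 0 * Wd (Z \<delta> x)))) (at x)"
    by (rule DERIV_cmult[OF DERIV_chain2[OF DERIV_sin th_deriv[OF d]]])
  then show ?thesis by (simp add: Y_def[abs_def] Z_def mult.assoc)
qed

text \<open>The first equation holds because \<open>k\<close> is the reciprocal of sqrt(h 1)
  \<open>II\<close>; the second is \<open>Rh_equation\<close> solved for the derivative of
  \<open>Rh\<close>.\<close>

lemma explicit_ode:
  assumes d: "\<bar>\<delta>\<bar> < s"
  shows "((\<lambda>x. sqrt (h 1) * Y \<delta> x) has_real_derivative (R \<delta> x - 1) / k \<delta>) (at x)"
    "((\<lambda>x. (R \<delta> x - 1) / k \<delta>) has_real_derivative - (sqrt (h 1) * Y \<delta> x) * inverse ((k \<delta>)\<^sup>2 * h (R \<delta> x))) (at x)"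
proof -
  define i where "i = II \<delta> 0"
  define q where "q = sqrt (h 1)"
  have i: "0 < i" and q: "0 < q" "h 1 = q * q" using II_pos[OF d, of 0] h_1(2) by (auto simp: i_def q_def)
  have kk: "k \<delta> = inverse q * inverse i" using k_eq[OF d, of 0] by (simp add: i_def q_def)
  have "((\<lambda>x. q * Y \<delta> x) has_real_derivative q * (Z \<delta> x * (i * Wd (Z \<delta> x)))) (at x)"
    unfolding i_def by (intro DERIV_cmult Y_deriv[OF d])
  moreover have "q * (Z \<delta> x * (i * Wd (Z \<delta> x))) = (R \<delta> x - 1) / k \<delta>"
    using i q by (simp add: kk R_def Rh_def field_simps)
  ultimately show "((\<lambda>x. sqrt (h 1) * Y \<delta> x) has_real_derivative (R \<delta> x - 1) / k \<delta>) (at x)"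
    by (simp add: q_def)
  have "((\<lambda>x. (R \<delta> x - 1) / k \<delta>) has_real_derivative (Rx \<delta> x - 0) / k \<delta>) (at x)"
    by (intro DERIV_cdivide DERIV_diff R_deriv[OF d] DERIV_const)
  moreover have "(Rx \<delta> x - 0) / k \<delta> = - (q * Y \<delta> x) * inverse ((k \<delta>)\<^sup>2 * h (R \<delta> x))"
  proof -
    define hR where "hR = h (R \<delta> x)"
    have hR: "0 < hR" unfolding hR_def using r(4)[OF R_ball[OF d]] .
    have e: "Wd (Z \<delta> x) * hR * Rh' (Z \<delta> x) = q * q"
      using Rh_equation[OF Z_ball[OF d, of x]] by (simp add: hR_def R_def q(2))
    have "Rx \<delta> x * hR = - (Y \<delta> x * i * (Wd (Z \<delta> x) * hR * Rh' (Z \<delta> x)))"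
      by (simp add: Rx_def i_def II_eq[of \<delta> x])
    also have "\<dots> = - (Y \<delta> x * i * (q * q))" unfolding e ..
    finally have "Rx \<delta> x * hR / hR = - (Y \<delta> x * i * (q * q)) / hR" by simp
    then have Rxe: "Rx \<delta> x = - (Y \<delta> x * i * (q * q)) / hR" using hR by simp
    show ?thesis unfolding hR_def[symmetric] Rxe using hR i q(1)
      by (simp add: kk power2_eq_square field_simps)
  qed
  ultimately show "((\<lambda>x. (R \<delta> x - 1) / k \<delta>) has_real_derivative - (sqrt (h 1) * Y \<delta> x) * inverse ((k \<delta>)\<^sup>2 * h (R \<delta> x))) (at x)"
    by (simp add: q_def)
qed

text \<open>The explicit profile is known to keep its slopes in \<open>S\<close>, where the
  right-hand side is continuously differentiable; \<open>second_order_unique\<close> asks this of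
  one of the two solutions.\<close>

lemma E_explicit:
  obtains d where "0 < d" "d \<le> s" "\<And>\<delta> x. 0 \<le> \<delta> \<Longrightarrow> \<delta> < d \<Longrightarrow> E \<delta> x = sqrt (h 1) * Y \<delta> x"
proof -
  obtain \<delta>0 where \<delta>0: "0 < \<delta>0" "\<And>\<delta>. \<delta> \<in> {0..\<delta>0} \<Longrightarrow> (\<forall>x. E \<delta> differentiable (at x)) \<and>
           (\<forall>x. (deriv (E \<delta>) has_real_derivative
              - E \<delta> x / ((k \<delta>)\<^sup>2 * h (1 + k \<delta> * deriv (E \<delta>) x))) (at x)) \<and>
           E \<delta> 0 = 0 \<and> deriv (E \<delta>) 0 = \<delta> * Wd \<delta> / k \<delta>"
    using wave_ode by blast
  have "E \<delta> = (\<lambda>x. sqrt (h 1) * Y \<delta> x)" if d: "0 \<le> \<delta>" "\<delta> < min s \<delta>0" for \<delta>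
  proof -
    have ds: "\<bar>\<delta>\<bar> < s" using d by simp
    note E = \<delta>0(2)[of \<delta>]
    define g where "g = (\<lambda>p. inverse ((k \<delta>)\<^sup>2 * h (1 + k \<delta> * p)))"
    define S where "S = (\<lambda>p. 1 + k \<delta> * p) -` ball 1 r"
    have kp: "0 < k \<delta>" by (rule k_pos[OF ds])
    show ?thesis
    proof (rule second_order_unique[where S = S and g = g and p = "deriv (E \<delta>)" and q = "\<lambda>x. (R \<delta> x - 1) / k \<delta>"])
      show "open S" unfolding S_def by (intro open_vimage open_ball continuous_intros)
      have "Cn 1 S (\<lambda>p. h (1 + k \<delta> * p))"
        by (rule Cn_compose[OF h_Cn[OF r(3)]])
          (use r(2) in \<open>auto simp: S_def dist_real_def intro!: Cn_add Cn_mult Cn_const Cn_id\<close>)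
      then have "Cn 1 S (\<lambda>p. (k \<delta>)\<^sup>2 * h (1 + k \<delta> * p))" by (intro Cn_mult Cn_const)
      then show "Cn 1 S g" unfolding g_def
        by (rule Cn_compose[where g = inverse and T = "{0<..}", OF Cn_inverse]) (use kp r(4) in \<open>auto simp: S_def\<close>)
      show "(E \<delta> has_real_derivative deriv (E \<delta>) t) (at t)" for t
        using E d DERIV_deriv_iff_real_differentiable by auto
      show "(deriv (E \<delta>) has_real_derivative - E \<delta> t * g (deriv (E \<delta>) t)) (at t)" for t
        using E d by (simp add: g_def divide_inverse)
      show "((\<lambda>x. sqrt (h 1) * Y \<delta> x) has_real_derivative (R \<delta> t - 1) / k \<delta>) (at t)" for t
        by (rule explicit_ode(1)[OF ds])
      show "((\<lambda>x. (R \<delta> x - 1) / k \<delta>) has_real_derivative - (sqrt (h 1) * Y \<delta> t) * g ((R \<delta> t - 1) / k \<delta>)) (at t)" for t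
        using explicit_ode(2)[OF ds, of t] kp by (simp add: g_def)
      show "(R \<delta> t - 1) / k \<delta> \<in> S" for t using R_ball[OF ds, of t] kp by (simp add: S_def)
      show "E \<delta> 0 = sqrt (h 1) * Y \<delta> 0" "deriv (E \<delta>) 0 = (R \<delta> 0 - 1) / k \<delta>"
        using E d by (simp_all add: Y_def R_def Rh_def Z_def th_0[OF ds])
    qed
  qed
  then show ?thesis using that[of "min s \<delta>0"] s(1) \<delta>0(1) by simp
qed

end

subsection \<open>Skew symmetry of the linearized operator\<close>

lemma Gop_DX: "h1_fun (Gop \<xi> w) = DX \<xi> (Bm (h1_fun w))"
proof -
  have "cmul_l2 (\<i> * \<xi> - 1) f = cmul_l2 (\<i> * \<xi>) f - f" for f
    by (simp add: cmul_l2.diff_left cmul_l2_1)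
  then show ?thesis by (simp add: Gop_apply DX_apply h1_fun_add h1_fun_cmul dh_Bm)
qed

lemma cip_DX: "cip (h1_fun v) (DX \<xi> w) = - cip (DX \<xi> v) (h1_fun w)"
  by (simp add: DX_apply cip.add_left cip.add_right cip_cmul_left cip_cmul_right cip_dh)

lemma DX_mulh:
  assumes "C1p c ct"
  shows "DX \<xi> (mulh c w) = mul_l2 c (DX \<xi> w) + mul_l2 ct (h1_fun w)"
  using mulh[OF assms] C1pD[OF assms] by (simp add: DX_apply mul_l2_add mul_l2_cmul)

text \<open>With the last two coefficients tied to the derivatives of \<open>c3\<close> and
  \<open>c1\<close>, the second row takes the divergence form e + D(c1 v) - D(c3 D e); since the
  Bloch derivative is skew (\<open>cip_DX\<close>), J^{-1} L is symmetric.\<close>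

lemma LSop_skew:
  assumes c: "C1p c1 c1t" "C1p c2 c2t" "C1p c3 c3t"
  shows "om (blinfun_apply (IS + LSop \<xi> c1 c2 c3 c3t (\<lambda>x. - c1t x)) y) (Sop y') =
    - om (Sop y) (blinfun_apply (IS + LSop \<xi> c1 c2 c3 c3t (\<lambda>x. - c1t x)) y')"
proof -
  note cp = C1pD(1)[OF c(1)] C1pD(1)[OF c(2)] C1pD(1)[OF c(3)]
  have ct: "cper c1t" "cper c3t" "cper (\<lambda>x. - c1t x)" using C1pD[OF c(1)] C1pD[OF c(3)] by (auto intro: cper_minus)
  have nm: "mul_l2 (\<lambda>x. - c1t x) f = - mul_l2 c1t f" for f
    using mul_l2_scale[OF ct(1), of "-1" f] by simp
  define A where "A y = IS + LSop \<xi> c1 c2 c3 c3t (\<lambda>x. - c1t x)" for y :: state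
  have ap: "blinfun_apply (IS + LSop \<xi> c1 c2 c3 c3t (\<lambda>x. - c1t x)) y =
      (mulh c1 (Gop \<xi> (fst y)) - mulh c2 (Bm (snd y)),
       h1_fun (Bm (h1_fun (fst y))) + DX \<xi> (mulh c1 (Bm (snd y)))
         - DX \<xi> (mulh c3 (Gop \<xi> (fst y))))" for y
    by (simp add: blinfun.add_left LSop_apply[OF c(1,2) cp(3) ct(2,3)] IS_def DX_mulh[OF c(1)] DX_mulh[OF c(3)] nm algebra_simps)
  have D: "cip (DX \<xi> v) (h1_fun w) = - cip (h1_fun v) (DX \<xi> w)" for v w
    by (simp add: cip_DX)
  show ?thesis
    unfolding ap
    by (simp add: om_def Sop_apply h1_fun_diff mulh[OF c(1)] mulh[OF c(2)] mulh[OF c(3)] Gop_DX cip.add_left cip.add_right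
        cip.diff_left cip.diff_right D)
      (simp add: cip_DX mulh[OF c(1)] mulh[OF c(3)] Gop_DX cip_mul_l2[OF cp(1)] cip_mul_l2[OF cp(2)] cip_mul_l2[OF cp(3)])
qed

subsection \<open>Coupling of Fourier modes\<close>

lemma fc_mul_trig:
  assumes c: "cper c" and K: "finite K" "\<And>x. of_real (c x) = (\<Sum>k\<in>K. \<alpha> k * ex k x)"
  shows "fc (mul_l2 c f) n = (\<Sum>k\<in>K. \<alpha> k * fc f (n - k))"
proof -
  have i: "set_integrable lborel {0..1} (\<lambda>x. ex m x * rep_l2 f x)" for m
    using sq_int_prod[OF sq_int_ex[of "-m"] sq_int_rep[of f]] by (simp add: cnj_ex)
  have "fc (mul_l2 c f) n = (LINT x:{0..1}|lborel. ex (- n) x * (of_real (c x) * rep_l2 f x))"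
    unfolding mul_l2_def by (rule fc_abs[OF sq_int_mul[OF c sq_int_rep]])
  also have "\<dots> = (LINT x:{0..1}|lborel. (\<Sum>k\<in>K. \<alpha> k * (ex (- (n - k)) x * rep_l2 f x)))"
    unfolding K(2) by (simp add: sum_distrib_left sum_distrib_right ac_simps flip: ex_add)
  also have "\<dots> = (\<Sum>k\<in>K. (LINT x:{0..1}|lborel. \<alpha> k * (ex (- (n - k)) x * rep_l2 f x)))"
    unfolding set_lebesgue_integral_def scaleR_sum_right
    using set_integrable_mult_right[OF i] by (intro Bochner_Integration.integral_sum) (auto simp: set_integrable_def)
  also have "\<dots> = (\<Sum>k\<in>K. \<alpha> k * fc f (n - k))"
    by (simp add: fc_lint)
  finally show ?thesis .
qed

lemma cos_sin_ex:
  "of_real (cos (2 * pi * of_int k * x)) = (ex k x + ex (- k) x) / 2"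
  "of_real (sin (2 * pi * of_int k * x)) = (ex k x - ex (- k) x) / (2 * \<i>)"
proof -
  have e: "ex k x = exp (\<i> * of_real (2 * pi * of_int k * x))" "ex (- k) x = exp (- (\<i> * of_real (2 * pi * of_int k * x)))"
    by (simp_all add: ex_def ac_simps)
  show "of_real (cos (2 * pi * of_int k * x)) = (ex k x + ex (- k) x) / 2"
    "of_real (sin (2 * pi * of_int k * x)) = (ex k x - ex (- k) x) / (2 * \<i>)"
    unfolding e by (simp_all only: cos_of_real[symmetric] sin_of_real[symmetric] cos_exp_eq sin_exp_eq)
qed

lemma TP1_couple:
  assumes c: "cper c" "TP1 c" and z: "fc f (n - 1) = 0" "fc f (n + 1) = 0"
  shows "fc (mul_l2 c f) n = 0"
proof -
  obtain A B where AB: "\<And>t. c t = A * cos (2 * pi * t) + B * sin (2 * pi * t)" using c(2) by (auto simp: TP1_def)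
  define \<alpha> where "\<alpha> k = of_real A / 2 + (if k = 1 then 1 else -1) * of_real B / (2 * \<i>)" for k :: int
  have "of_real (c x) = (\<Sum>k\<in>{1, -1}. \<alpha> k * ex k x)" for x
    using cos_sin_ex[of 1 x] by (simp add: AB \<alpha>_def) (simp add: field_simps)
  from fc_mul_trig[OF c(1) _ this, of f n] z show ?thesis by simp
qed

lemma TP2_couple:
  assumes c: "cper c" "TP2 c" and z: "fc f (n - 2) = 0" "fc f n = 0" "fc f (n + 2) = 0"
  shows "fc (mul_l2 c f) n = 0"
proof -
  obtain A B C where AB: "\<And>t. c t = A + B * cos (4 * pi * t) + C * sin (4 * pi * t)" using c(2) by (auto simp: TP2_def)
  define \<alpha> where "\<alpha> k = (if k = 0 then of_real A else of_real B / 2 + (if k = 2 then 1 else -1) * of_real C / (2 * \<i>))" for k :: int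
  have e0: "ex 0 x = 1" for x by (simp add: ex_def)
  have "of_real (c x) = (\<Sum>k\<in>{0, 2, -2}. \<alpha> k * ex k x)" for x
    using cos_sin_ex[of 2 x] by (simp add: AB \<alpha>_def e0) (simp add: field_simps)
  from fc_mul_trig[OF c(1) _ this, of f n] z show ?thesis by simp
qed

definition modes_vanish :: "state \<Rightarrow> int \<Rightarrow> bool" where
  "modes_vanish w n \<longleftrightarrow> s1 w n = 0 \<and> s2 w n = 0"

lemma modes_fc:
  assumes "modes_vanish (Sop y) n"
  shows "fc (h1_fun (Gop \<xi> (fst y))) n = 0" "fc (DX \<xi> (Gop \<xi> (fst y))) n = 0"
    "fc (h1_fun (Bm (snd y))) n = 0" "fc (DX \<xi> (Bm (snd y))) n = 0"
  using assms
  by (simp_all add: modes_vanish_def s1_def s2_def Sop_apply Gop_DX DX_apply fc_simps fc_dh)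

text \<open>Everything in \<open>LSop\<close> except the multiplications is diagonal in Fourier
  modes, so the modes it couples are those coupled by its coefficients.\<close>

lemma LSop_couple:
  assumes r: "C1p c1 c1t" "C1p c2 c2t" "cper c3" "cper c4" "cper c5"
    and z: "\<And>c f. c \<in> {c1, c2, c3, c4, c5} \<Longrightarrow> (\<And>m. m \<in> M \<Longrightarrow> fc f m = 0) \<Longrightarrow> fc (mul_l2 c f) n = 0"
    and y: "\<And>m. m \<in> M \<Longrightarrow> modes_vanish (Sop y) m"
  shows "modes_vanish ((LSop \<xi> c1 c2 c3 c4 c5) y) n"
  unfolding modes_vanish_def s1_def s2_def
  by (simp add: LSop_apply[OF r] h1_fun_diff mulh[OF r(1)] mulh[OF r(2)] fc_simps z modes_fc[OF y])

lemma LSop_TP1: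
  assumes r: "C1p c1 c1t" "C1p c2 c2t" "cper c3" "cper c4" "cper c5" and t: "TP1 c1" "TP1 c2" "TP1 c3" "TP1 c4" "TP1 c5"
    and y: "modes_vanish (Sop y) (n - 1)" "modes_vanish (Sop y) (n + 1)"
  shows "modes_vanish ((LSop \<xi> c1 c2 c3 c4 c5) y) n"
  by (rule LSop_couple[OF r, where M = "{n - 1, n + 1}"])
    (use t r C1pD(1)[OF r(1)] C1pD(1)[OF r(2)] y in \<open>auto intro!: TP1_couple\<close>)

lemma LSop_TP2:
  assumes r: "C1p c1 c1t" "C1p c2 c2t" "cper c3" "cper c4" "cper c5" and t: "TP2 c1" "TP2 c2" "TP2 c3" "TP2 c4" "TP2 c5"
    and y: "modes_vanish (Sop y) (n - 2)" "modes_vanish (Sop y) n" "modes_vanish (Sop y) (n + 2)"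
  shows "modes_vanish ((LSop \<xi> c1 c2 c3 c4 c5) y) n"
  by (rule LSop_couple[OF r, where M = "{n - 2, n, n + 2}"])
    (use t r C1pD(1)[OF r(1)] C1pD(1)[OF r(2)] y in \<open>auto intro!: TP2_couple\<close>)

subsection \<open>Fourier modes and the pairing\<close>

definition vec2 :: "complex \<Rightarrow> complex \<Rightarrow> complex^2" where "vec2 a b = vector [a, b]"

lemma vec2_nth [simp]: "vec2 a b $ 1 = a" "vec2 a b $ 2 = b"
  by (simp_all add: vec2_def vector_2)

definition sv :: "state \<Rightarrow> int \<Rightarrow> complex^2" where "sv w n = vec2 (s1 w n) (s2 w n)"

lemma sv_nth [simp]: "sv w n $ 1 = s1 w n" "sv w n $ 2 = s2 w n" by (simp_all add: sv_def)

lemma sv_linear: "sv (v + w) n = sv v n + sv w n" "sv (v - w) n = sv v n - sv w n" "sv (r *\<^sub>R v) n = of_real r *s sv v n"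
  by (simp_all add: vec_eq_iff forall_2 s_linear scaleR_conv_of_real)

lemma sv_zero: "modes_vanish w n \<longleftrightarrow> sv w n = 0"
  by (simp add: modes_vanish_def vec_eq_iff forall_2)

lemma mode_sv:
  "s1 (mode m X) n = (if n = m then X $ 1 else 0)" "s2 (mode m X) n = (if n = m then X $ 2 else 0)"
proof -
  have e: "exp (2 * pi * \<i> * of_int m * x) = ex m x" for x :: real by (simp add: ex_def ac_simps)
  have sq: "sq_int (\<lambda>x. ex m x * c)" for c using sq_int_cmul[OF sq_int_ex, of c m] by (simp add: mult.commute)
  have ab: "abs_l2 (\<lambda>x. ex m x * c) = cmul_l2 c (em m)" for c
  proof -
    have "cmul_l2 c (em m) = abs_l2 (rep_l2 (cmul_l2 c (em m)))" by (simp add: abs_rep_l2)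
    also have "\<dots> = abs_l2 (\<lambda>x. ex m x * c)"
      by (rule abs_l2_eqI[OF sq_int_rep sq])
        (use rep_cmul_l2[of c "em m"] rep_abs_l2[OF sq_int_ex[of m]] in \<open>auto simp: em_def elim!: eventually_elim2\<close>)
    finally show ?thesis by simp
  qed
  have md: "mode m X = (to_h1 (cmul_l2 (X $ 1) (em m)), cmul_l2 (X $ 2) (em m))"
    unfolding mode_def of_fun_def e by (simp add: ab)
  have "weak_deriv (cmul_l2 (X $ 1) (em m)) (cmul_l2 (dfac m * X $ 1) (em m))"
    unfolding weak_deriv_iff_fc by (simp add: fc_simps fc_em)
  then have "in_H1 (cmul_l2 (X $ 1) (em m))" by (auto simp: in_H1_def)
  from in_H1_D[OF this] show "s1 (mode m X) n = (if n = m then X $ 1 else 0)" "s2 (mode m X) n = (if n = m then X $ 2 else 0)"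
    by (simp_all add: md s1_def s2_def fc_simps fc_em)
qed

lemma sv_mode: "sv (mode m X) n = (if n = m then X else 0)"
  by (simp add: vec_eq_iff forall_2 mode_sv)

lemma mode_Sop: obtains y where "Sop y = mode m X"
proof -
  obtain y where "\<And>n. s1 (Sop y) n = (if n = m then X $ 1 else 0)" "\<And>n. s2 (Sop y) n = (if n = m then X $ 2 else 0)"
    using mode_state by metis
  then have "Sop y = mode m X" by (intro s_eqI) (simp_all add: mode_sv)
  then show ?thesis by (rule that)
qed

lemma vec2_lint:
  fixes f :: "real \<Rightarrow> complex^2"
  assumes "\<And>i. integrable M (\<lambda>x. f x $ i)"
  shows "(LINT x|M. f x) $ i = (LINT x|M. f x $ i)"
proof -
  have "integrable M f"
  proof -
    have eq: "(\<lambda>x. \<Sum>i\<in>UNIV. axis i (f x $ i)) = f"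
      by (auto simp: fun_eq_iff vec_eq_iff axis_def if_distrib cong: if_cong)
    have "integrable M (\<lambda>x. axis i (f x $ i))" for i
    proof (rule integrable_bounded_linear[OF _ assms])
      have "linear (axis i :: complex \<Rightarrow> complex^2)" by (rule linearI) (auto simp: axis_def vec_eq_iff)
      then show "bounded_linear (axis i :: complex \<Rightarrow> complex^2)" by (simp add: linear_conv_bounded_linear)
    qed
    then have "integrable M (\<lambda>x. \<Sum>i\<in>UNIV. axis i (f x $ i))" by (rule Bochner_Integration.integrable_sum)
    then show ?thesis unfolding eq .
  qed
  then show ?thesis using integral_bounded_linear[OF bounded_linear_vec_nth, of M f i] by simp
qed

text \<open>\<open>coef\<close> integrates representatives of the two components against an
  exponential, which gives Fourier coefficients of the state whatever the representatives.\<close>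

lemma coef_sv: "coef M m p X = sv (M (mode m X)) (m + p)"
proof -
  define w where "w = M (mode m X)"
  have e: "exp (- 2 * pi * \<i> * of_int (m + p) * x) = ex (- (m + p)) x" for x :: real by (simp add: ex_def algebra_simps)
  have i: "integrable lborel (\<lambda>x. indicat_real {0..1} x *\<^sub>R (ex m x * rep_l2 f x))" for m f
    using sq_int_prod[OF sq_int_ex[of "-m"] sq_int_rep[of f]] by (simp add: cnj_ex set_integrable_def)
  have n: "to_fun w x $ 1 = rep_l2 (h1_fun (fst w)) x" "to_fun w x $ 2 = rep_l2 (snd w) x" for x
    by (simp_all add: to_fun_def vector_2)
  have ii: "integrable lborel (\<lambda>x. (indicat_real {0..1} x *\<^sub>R (ex (- (m + p)) x *s to_fun w x)) $ i)" for i
    using i exhaust_2[of i] by (auto simp: n)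
  show ?thesis
    unfolding coef_def w_def[symmetric] e set_lebesgue_integral_def
    by (subst vec_eq_iff, unfold vec2_lint[OF ii])
      (simp add: forall_2 n s1_def s2_def fc_lint set_lebesgue_integral_def)
qed

lemma cdot_J: "cdot (J *v X) Y = cnj (X $ 1) * Y $ 2 - cnj (X $ 2) * Y $ 1"
  by (simp add: cdot_def J_def sum_2 matrix_vector_mult_def vector_2)

text \<open>Only mode \<open>m\<close> of \<open>w\<close> pairs with the exponential; this is the
  origin of J V_+ in the index formula.\<close>

lemma om_mode: "om (mode m X) w = cdot (J *v X) (sv w m)"
proof -
  have c: "cip f g = cnj c * fc g m" if "\<And>n. fc f n = (if n = m then c else 0)" for f g c
  proof -
    have "f = cmul_l2 c (em m)" by (rule fc_eqI) (simp add: that fc_simps fc_em)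
    then show ?thesis by (simp add: cip_cmul_left fc_def)
  qed
  have "cip (h1_fun (fst (mode m X))) (snd w) = cnj (X $ 1) * fc (snd w) m"
    by (rule c) (use mode_sv(1)[of m X] in \<open>simp add: s1_def\<close>)
  moreover have "cip (snd (mode m X)) (h1_fun (fst w)) = cnj (X $ 2) * fc (h1_fun (fst w)) m"
    by (rule c) (use mode_sv(2)[of m X] in \<open>simp add: s2_def\<close>)
  ultimately show ?thesis by (simp add: om_def cdot_J s1_def s2_def)
qed

lemma matrix_inv_eqI:
  assumes "A ** B = mat 1" "B ** A = mat (1 :: complex)"
  shows "matrix_inv A = (B :: complex^'n^'n)"
proof -
  have "A ** matrix_inv A = mat 1 \<and> matrix_inv A ** A = mat 1"
    unfolding matrix_inv_def by (rule someI[of _ B]) (use assms in auto)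
  then have "matrix_inv A = (B ** A) ** matrix_inv A" "B = B ** (A ** matrix_inv A)" using assms by auto
  then show ?thesis by (metis matrix_mul_assoc)
qed

lemma matrix_inv_J: "matrix_inv J *v X = vec2 (X $ 2) (- X $ 1)"
proof -
  define K :: "complex^2^2" where "K = vector [vector [0, 1], vector [-1, 0]]"
  have "J ** K = mat 1" "K ** J = mat 1"
    by (simp_all add: J_def K_def matrix_matrix_mult_def mat_def vec_eq_iff forall_2 sum_2 vector_2)
  then have "matrix_inv J = K" by (rule matrix_inv_eqI)
  then show ?thesis by (simp add: K_def matrix_vector_mult_def vec_eq_iff forall_2 sum_2 vector_2)
qed

lemma om_lint: "(LINT x:{0..1}|lborel. cdot (to_fun v x) (matrix_inv J *v to_fun w x)) = om v w"
proof -
  have i: "set_integrable lborel {0..1} (\<lambda>x. cnj (rep_l2 f x) * rep_l2 g x)" for f g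
    by (rule sq_int_prod[OF sq_int_rep sq_int_rep])
  have "cdot (to_fun v x) (matrix_inv J *v to_fun w x) =
      cnj (rep_l2 (h1_fun (fst v)) x) * rep_l2 (snd w) x - cnj (rep_l2 (snd v) x) * rep_l2 (h1_fun (fst w)) x" for x
    by (simp add: matrix_inv_J cdot_def sum_2 to_fun_def vector_2)
  then show ?thesis using set_integral_diff(2)[OF i i] by (simp add: om_def cip_def)
qed

subsection \<open>The linearization about a wave\<close>

lemma clin_LSop:
  assumes "C1p c1 c1t" "C1p c2 c2t" "cper c3" "cper c4" "cper c5"
  shows "clin (IS + LSop \<xi> c1 c2 c3 c4 c5)"
proof -
  note cp = C1pD(1)[OF assms(1)] C1pD(1)[OF assms(2)] assms(3-5)
  have mh: "mulh c (cmul_h1 r w) = cmul_h1 r (mulh c w)" if "C1p c ct" for c ct r w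
    by (rule h1_eqI) (simp add: mulh[OF that] h1_fun_cmul mul_l2_cmul[OF C1pD(1)[OF that]])
  have G: "Gop \<xi> (cmul_h1 r w) = cmul_h1 r (Gop \<xi> w)" for r w
    by (simp add: Gop_apply h1_fun_cmul Bm_cmul cmul_h1_mult cmul_h1.add_right mult.commute)
  have DXc: "DX \<xi> (cmul_h1 r w) = cmul_l2 r (DX \<xi> w)" for r w
    by (simp add: DX_apply h1_fun_cmul dh_cmul cmul_l2_mult cmul_l2.add_right mult.commute)
  show ?thesis
    unfolding clin_def
    by (simp add: blinfun.add_left LSop_apply[OF assms] IS_def cmul_state_def mh[OF assms(1)] mh[OF assms(2)] G DXc Bm_cmul h1_fun_cmul
        mul_l2_cmul[OF cp(1)] mul_l2_cmul[OF cp(3)] mul_l2_cmul[OF cp(4)] mul_l2_cmul[OF cp(5)]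
        cmul_h1.diff_right cmul_l2.diff_right cmul_l2.add_right)
qed

locale wave_branch = wave_local +
  fixes d :: real
  assumes d: "0 < d" "d \<le> s" and E_eq: "\<And>\<delta> x. 0 \<le> \<delta> \<Longrightarrow> \<delta> < d \<Longrightarrow> E \<delta> x = sqrt (h 1) * Y \<delta> x"
begin

text \<open>The wave coefficients are written in terms of the explicit profile, hence for both signs
  of the amplitude; they agree with those of L for 0 \<le> \<delta> < \<open>d\<close>.
  \<open>kk\<close> is the wave number as a function of two variables, and \<open>R\<close> serves
  as the second coefficient.\<close>

definition kk :: "real \<Rightarrow> real \<Rightarrow> real" where "kk \<delta> x = inverse (sqrt (h 1)) * inverse (II \<delta> x)"
definition C1 :: "real \<Rightarrow> real \<Rightarrow> real" where "C1 \<delta> x = V * (kk \<delta> x * inverse (R \<delta> x))"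
definition C3 :: "real \<Rightarrow> real \<Rightarrow> real" where "C3 \<delta> x = kk \<delta> x * (kk \<delta> x * (deriv ^^ 2) F (R \<delta> x))"
definition C4 :: "real \<Rightarrow> real \<Rightarrow> real" where "C4 \<delta> x = kk \<delta> x * (kk \<delta> x * ((deriv ^^ 3) F (R \<delta> x) * Rx \<delta> x))"
definition C5 :: "real \<Rightarrow> real \<Rightarrow> real" where "C5 \<delta> x = V * (kk \<delta> x * (Rx \<delta> x * (inverse (R \<delta> x) * inverse (R \<delta> x))))"

lemma kk_k: "\<bar>\<delta>\<bar> < s \<Longrightarrow> kk \<delta> x = k \<delta>" by (simp add: kk_def k_eq[of \<delta> x])

lemma famj_iR: "famj s (\<lambda>\<delta> x. inverse (R \<delta> x))"
  by (rule famj_comp[where g = inverse and S = "{0<..}", OF Cn_inverse famj_R]) (simp add: R_pos)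

lemma famj_kk: "famj s kk"
  unfolding kk_def[abs_def] by (rule famj_k)

lemma famj_C: "famj s C1" "famj s R" "famj s C3" "famj s C4" "famj s C5"
proof -
  have F: "famj s (\<lambda>\<delta> x. (deriv ^^ m) F (R \<delta> x))" for m
    by (rule famj_comp[OF smooth_on_Cn(1)[OF r(3)] famj_R R_ball])
  show "famj s C1" "famj s C3" "famj s C4" "famj s C5"
    unfolding C1_def[abs_def] C3_def[abs_def] C4_def[abs_def] C5_def[abs_def]
    by (rule famj_closure(3) famj_closure(1) famj_kk famj_iR famj_Rx F)+
qed (rule famj_R)

lemmas fam_C = famj_C[unfolded famj_def, THEN conjunct1]
lemmas jet_C = famj_C[unfolded famj_def, THEN conjunct2]

lemma fam_C1p: "fam s c \<Longrightarrow> 0 \<le> \<delta> \<Longrightarrow> \<delta> < s \<Longrightarrow> C1p (c \<delta>) (pdt c \<delta>)"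
  by (rule CH_0D(3)[OF fam_CH])

lemma fam_cper: "fam s c \<Longrightarrow> 0 \<le> \<delta> \<Longrightarrow> \<delta> < s \<Longrightarrow> cper (c \<delta>)"
  by (rule CX_cper[OF fam_CX])

lemma C1p_C:
  assumes "0 \<le> \<delta>" "\<delta> < s"
  shows "C1p (C1 \<delta>) (\<lambda>x. - C5 \<delta> x)" "C1p (C3 \<delta>) (C4 \<delta>)" "C1p (R \<delta>) (Rx \<delta>)"
proof -
  have ds: "\<bar>\<delta>\<bar> < s" using assms by simp
  have nz: "R \<delta> x \<noteq> 0" for x using R_pos[OF ds, of x] by simp
  have "((\<lambda>x. V * (k \<delta> * inverse (R \<delta> x))) has_real_derivative V * (k \<delta> * - (inverse (R \<delta> x) * Rx \<delta> x * inverse (R \<delta> x)))) (at x)" for x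
    by (rule DERIV_cmult[OF DERIV_cmult[OF DERIV_inverse'[OF R_deriv[OF ds] nz]]])
  then have 1: "(C1 \<delta> has_real_derivative - C5 \<delta> x) (at x)" for x
    by (simp add: C1_def[abs_def] C5_def kk_k[OF ds] ac_simps)
  have "((\<lambda>x. k \<delta> * (k \<delta> * (deriv ^^ 2) F (R \<delta> x))) has_real_derivative k \<delta> * (k \<delta> * ((deriv ^^ Suc 2) F (R \<delta> x) * Rx \<delta> x))) (at x)" for x
    by (rule DERIV_cmult[OF DERIV_cmult[OF DERIV_chain2[OF smooth_on_Cn(2)[OF r(3) R_ball[OF ds]] R_deriv[OF ds]]]])
  moreover have "Suc 2 = 3" by simp
  ultimately have 3: "(C3 \<delta> has_real_derivative C4 \<delta> x) (at x)" for x
    unfolding C3_def[abs_def] C4_def kk_k[OF ds] by metis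
  show "C1p (C1 \<delta>) (\<lambda>x. - C5 \<delta> x)" "C1p (C3 \<delta>) (C4 \<delta>)" "C1p (R \<delta>) (Rx \<delta>)"
    unfolding C1p_def using 1 3 R_deriv[OF ds] famj_Rx[unfolded famj_def]
    by (auto intro!: fam_cper[OF _ assms] fam_C cper_minus)
qed

definition LS :: "real \<Rightarrow> state \<Rightarrow>\<^sub>L state" where
  "LS \<delta> = IS + LSop xi0 (C1 \<delta>) (R \<delta>) (C3 \<delta>) (C4 \<delta>) (C5 \<delta>)"

lemma clin_LS: "0 \<le> \<delta> \<Longrightarrow> \<delta> < s \<Longrightarrow> clin (LS \<delta>)"
  unfolding LS_def by (intro clin_LSop[OF C1p_C(1,3)] fam_cper fam_C)

lemma LS_skew:
  assumes "0 \<le> \<delta>" "\<delta> < s"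
  shows "om ((LS \<delta>) y) (Sop y') = - om (Sop y) ((LS \<delta>) y')"
  using LSop_skew[OF C1p_C(1)[OF assms] C1p_C(3)[OF assms] C1p_C(2)[OF assms], of xi0 y y'] by (simp add: LS_def)

lemma wave_eqs:
  assumes "0 \<le> \<delta>" "\<delta> < d"
  shows "rho \<delta> = R \<delta>" "V - u \<delta> x = V * inverse (R \<delta> x)" "k \<delta> * (deriv ^^ 2) (E \<delta>) x = Rx \<delta> x"
    "deriv (u \<delta>) x = V * (Rx \<delta> x * (inverse (R \<delta> x) * inverse (R \<delta> x)))"
proof -
  have ds: "\<bar>\<delta>\<bar> < s" using assms d by simp
  have kp: "k \<delta> \<noteq> 0" using k_pos[OF ds] by simp
  have nz: "R \<delta> x \<noteq> 0" for x using R_pos[OF ds, of x] by simp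
  have "E \<delta> = (\<lambda>x. sqrt (h 1) * Y \<delta> x)" using E_eq[OF assms] by auto
  then have dE: "deriv (E \<delta>) = (\<lambda>x. (R \<delta> x - 1) / k \<delta>)"
    using DERIV_imp_deriv[OF explicit_ode(1)[OF ds]] by auto
  then show rho: "rho \<delta> = R \<delta>" using kp by (auto simp: rho_def)
  have uR: "u \<delta> x = V - V * inverse (R \<delta> x)" for x
    using kp nz[of x] by (simp add: u_def rho dE field_simps)
  then show "V - u \<delta> x = V * inverse (R \<delta> x)" by simp
  have "((\<lambda>x. (R \<delta> x - 1) / k \<delta>) has_real_derivative (Rx \<delta> x - 0) / k \<delta>) (at x)"
    by (intro DERIV_cdivide DERIV_diff R_deriv[OF ds] DERIV_const)
  from DERIV_imp_deriv[OF this] show "k \<delta> * (deriv ^^ 2) (E \<delta>) x = Rx \<delta> x"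
    using kp by (simp add: numeral_2_eq_2 dE)
  have "u \<delta> = (\<lambda>x. V - V * inverse (R \<delta> x))" using uR by auto
  moreover have "((\<lambda>x. V - V * inverse (R \<delta> x)) has_real_derivative 0 - V * - (inverse (R \<delta> x) * Rx \<delta> x * inverse (R \<delta> x))) (at x)"
    by (rule DERIV_diff[OF DERIV_const DERIV_cmult[OF DERIV_inverse'[OF R_deriv[OF ds] nz]]])
  ultimately show "deriv (u \<delta>) x = V * (Rx \<delta> x * (inverse (R \<delta> x) * inverse (R \<delta> x)))"
    using DERIV_imp_deriv by (simp add: ac_simps)
qed

lemma D_h1: "D \<xi> \<delta> (h1_fun w) = k \<delta> *\<^sub>R DX \<xi> w"
  by (simp add: D_def DX_apply)

lemma L_LS:
  assumes "0 \<le> \<delta>" "\<delta> < d"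
  shows "L xi0 \<delta> (Sop y) = (LS \<delta>) y"
proof -
  have ds: "\<bar>\<delta>\<bar> < s" "\<delta> < s" using assms d by simp_all
  let ?g = "Gop xi0 (fst y)" and ?b = "Bm (snd y)" and ?e = "Bm (h1_fun (fst y))"
  note cp = C1pD(1)[OF C1p_C(1)[OF assms(1) ds(2)]] C1pD(1)[OF C1p_C(3)[OF assms(1) ds(2)]]
    fam_cper[OF fam_C(3) assms(1) ds(2)] fam_cper[OF fam_C(4) assms(1) ds(2)] fam_cper[OF fam_C(5) assms(1) ds(2)]
  have sc: "mul_l2 (\<lambda>x. r * c x) f = mul_l2 c (r *\<^sub>R f)" if "cper c" for r c f
    by (simp add: mul_l2_scale[OF that] mul_l2_scaleR[OF that])
  have inv: "cper (\<lambda>x. V * inverse (R \<delta> x))"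
  proof -
    have "k \<delta> \<noteq> 0" using k_pos[OF ds(1)] by simp
    then have "(\<lambda>x. V * inverse (R \<delta> x)) = (\<lambda>x. inverse (k \<delta>) * C1 \<delta> x)" by (simp add: C1_def kk_k[OF ds(1)] fun_eq_iff)
    then show ?thesis by (simp add: cper_mult cp(1))
  qed
  have D1: "D xi0 \<delta> (h1_fun ?e) = k \<delta> *\<^sub>R h1_fun ?g" by (simp add: D_h1 Gop_DX)
  have D2: "D xi0 \<delta> (k \<delta> *\<^sub>R h1_fun ?g) = k \<delta> *\<^sub>R k \<delta> *\<^sub>R DX xi0 ?g"
    using D_h1[of xi0 \<delta> "k \<delta> *\<^sub>R ?g"] by (simp add: h1_fun_scaleR blinfun.scaleR_right)
  have D3: "D xi0 \<delta> (h1_fun ?b) = k \<delta> *\<^sub>R DX xi0 ?b" by (rule D_h1)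
  have m1: "mul_l2 (\<lambda>x. V - u \<delta> x) (k \<delta> *\<^sub>R f) = mul_l2 (C1 \<delta>) f" for f
    unfolding wave_eqs(2)[OF assms] sc[OF inv, symmetric] by (simp add: C1_def[abs_def] kk_k[OF ds(1)] ac_simps)
  have F2: "cper (\<lambda>x. (deriv ^^ 2) F (R \<delta> x))" "cper (\<lambda>x. (deriv ^^ 3) F (R \<delta> x) * Rx \<delta> x)"
  proof -
    have "k \<delta> \<noteq> 0" using k_pos[OF ds(1)] by simp
    then have "(\<lambda>x. (deriv ^^ 2) F (R \<delta> x)) = (\<lambda>x. inverse (k \<delta>) * inverse (k \<delta>) * C3 \<delta> x)"
      "(\<lambda>x. (deriv ^^ 3) F (R \<delta> x) * Rx \<delta> x) = (\<lambda>x. inverse (k \<delta>) * inverse (k \<delta>) * C4 \<delta> x)"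
      by (simp_all add: C3_def C4_def kk_k[OF ds(1)] fun_eq_iff field_simps)
    then show "cper (\<lambda>x. (deriv ^^ 2) F (R \<delta> x))" "cper (\<lambda>x. (deriv ^^ 3) F (R \<delta> x) * Rx \<delta> x)"
      by (simp_all add: cper_mult cp)
  qed
  have m3: "mul_l2 (\<lambda>x. (deriv ^^ 2) F (R \<delta> x)) (k \<delta> *\<^sub>R k \<delta> *\<^sub>R f) = mul_l2 (C3 \<delta>) f" for f
    unfolding sc[OF F2(1), symmetric] sc[OF cper_mult[OF cper_const F2(1)], symmetric] by (simp add: C3_def[abs_def] kk_k[OF ds(1)])
  have c4: "(\<lambda>x. (deriv ^^ 3) F (R \<delta> x) * (k \<delta>)\<^sup>2 * (deriv ^^ 2) (E \<delta>) x) = (\<lambda>x. k \<delta> * ((deriv ^^ 3) F (R \<delta> x) * Rx \<delta> x))"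
    by (simp add: wave_eqs(3)[OF assms, symmetric] power2_eq_square ac_simps fun_eq_iff)
  have m4: "mul_l2 (\<lambda>x. k \<delta> * ((deriv ^^ 3) F (R \<delta> x) * Rx \<delta> x)) (k \<delta> *\<^sub>R f) = mul_l2 (C4 \<delta>) f" for f
    unfolding sc[OF cper_mult[OF cper_const F2(2)], symmetric] by (simp add: C4_def[abs_def] kk_k[OF ds(1)])
  have m5: "(\<lambda>x. k \<delta> * deriv (u \<delta>) x) = C5 \<delta>"
    by (simp add: wave_eqs(4)[OF assms] C5_def kk_k[OF ds(1)] fun_eq_iff ac_simps)
  have 1: "to_h1 (mul_l2 (C1 \<delta>) (h1_fun ?g) - mul_l2 (R \<delta>) (h1_fun ?b)) = mulh (C1 \<delta>) ?g - mulh (R \<delta>) ?b"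
    using to_h1_fun[of "mulh (C1 \<delta>) ?g - mulh (R \<delta>) ?b"]
    by (simp add: h1_fun_diff mulh[OF C1p_C(1)[OF assms(1) ds(2)]] mulh[OF C1p_C(3)[OF assms(1) ds(2)]])
  show ?thesis
    unfolding L_def Let_def LS_def Sop_apply fst_conv snd_conv D1 D2 D3 wave_eqs(1)[OF assms] m1 m3 m5 c4 m4 1
    by (simp add: blinfun.add_left IS_def LSop_apply[OF C1p_C(1,3)[OF assms(1) ds(2)] cp(3-5)])
qed

text \<open>The preimage under \<open>Sop\<close> is obtained by applying 1 + d/dx to each
  component, which the regularity in \<open>dom\<close> permits.\<close>

lemma dom_Sop: "dom = range (blinfun_apply Sop)"
proof (intro equalityI subsetI)
  fix w assume "w \<in> dom"
  then have w: "in_H1 (dh (fst w))" "in_H1 (snd w)" by (auto simp: dom_def in_H2_def)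
  define y where "y = (fst w + to_h1 (dh (fst w)), snd w + dh (to_h1 (snd w)))"
  have "Sop y = w"
    using Bm_unique[of "fst w"] Bm_unique[of "to_h1 (snd w)"]
    by (auto simp: Sop_apply y_def h1_fun_add in_H1_D[OF w(1)] in_H1_D[OF w(2)] intro!: prod_eqI)
  then show "w \<in> range (blinfun_apply Sop)" by (metis rangeI)
next
  fix w assume "w \<in> range (blinfun_apply Sop)"
  then obtain y where y: "w = Sop y" by auto
  have "dh (Bm (h1_fun (fst y))) = h1_fun (fst y - Bm (h1_fun (fst y)))" by (simp add: dh_Bm h1_fun_diff)
  then show "w \<in> dom" by (simp add: y dom_def in_H2_def Sop_apply in_H1_fun)
qed

text \<open>The description by \<open>THE\<close> has a unique witness because \<open>dom\<close> is
  the range of \<open>Sop\<close> and \<mu> - L composed with \<open>Sop\<close> is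
  invertible.\<close>

lemma resolvent_RR:
  assumes "0 \<le> \<delta>" "\<delta> < d" and N: "binv (MM (LS \<delta>) \<mu>) (NN (LS \<delta>) \<mu>)"
  shows "resolvent xi0 \<delta> \<mu> = RR (LS \<delta>) \<mu>"
proof -
  have "(THE w. w \<in> dom \<and> cmul_state \<mu> w - L xi0 \<delta> w = f) = (RR (LS \<delta>) \<mu>) f" for f
  proof (rule the_equality)
    show "(RR (LS \<delta>) \<mu>) f \<in> dom \<and>
        cmul_state \<mu> ((RR (LS \<delta>) \<mu>) f) - L xi0 \<delta> ((RR (LS \<delta>) \<mu>) f) = f"
      using binvD(1)[OF N, of f] by (simp add: RR_def dom_Sop L_LS[OF assms(1,2)] MM_apply)
    fix w assume w: "w \<in> dom \<and> cmul_state \<mu> w - L xi0 \<delta> w = f"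
    then obtain y where y: "w = Sop y" by (auto simp: dom_Sop)
    have "(MM (LS \<delta>) \<mu>) y = f" using w by (simp add: y L_LS[OF assms(1,2)] MM_apply)
    then show "w = (RR (LS \<delta>) \<mu>) f" using binvD(2)[OF N, of y] by (simp add: RR_def y)
  qed
  then show ?thesis unfolding resolvent_def by (simp add: blinfun_apply_inverse)
qed

text \<open>The velocity of the circle contributes a factor 2 pi i that the prefactor of
  \<open>Proj\<close> removes, leaving the weight used in \<open>PP\<close>.\<close>

lemma Proj_PP:
  assumes "0 \<le> \<delta>" "\<delta> < d" and ann: "annulus (LS \<delta>) lambda0 a1 b1" and \<epsilon>: "a1 \<le> \<epsilon>" "\<epsilon> \<le> b1"
  shows "Proj \<epsilon> \<delta> = PP (LS \<delta>) lambda0 \<epsilon>"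
proof -
  interpret annulus "LS \<delta>" lambda0 a1 b1 by (rule ann)
  let ?g = "\<lambda>t. cmul_op (of_real \<epsilon> * ex 1 t) o\<^sub>L RR (LS \<delta>) (lambda0 + of_real \<epsilon> * ex 1 t)"
  have c: "circlepath lambda0 \<epsilon> t = lambda0 + of_real \<epsilon> * ex 1 t" for t
    by (simp add: circlepath ex_def)
  have cm: "cmul_op (1 / (2 * \<i> * pi)) o\<^sub>L (cmul_op (2 * of_real pi * \<i> * of_real \<epsilon> * ex 1 t) o\<^sub>L A) = cmul_op (of_real \<epsilon> * ex 1 t) o\<^sub>L A" for t A
    by (rule blinfun_eqI) (simp add: cmul_state_mult)
  have f: "cmul_op (vector_derivative (circlepath lambda0 \<epsilon>) (at t within {0..1})) o\<^sub>L resolvent xi0 \<delta> (circlepath lambda0 \<epsilon> t) =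
      cmul_op (2 * of_real pi * \<i>) o\<^sub>L ?g t" if "t \<in> {0..1}" for t
  proof -
    have v: "vector_derivative (circlepath lambda0 \<epsilon>) (at t within {0..1}) = 2 * of_real pi * \<i> * of_real \<epsilon> * ex 1 t"
      using vector_derivative_circlepath01[of t lambda0 \<epsilon>] that by (simp add: ex_def)
    show ?thesis unfolding v c resolvent_RR[OF assms(1,2) NN[OF circle_in_K[OF \<epsilon>]]]
      by (rule blinfun_eqI) (simp add: cmul_state_mult mult.assoc)
  qed
  have cont: "continuous_on {0..1} (\<lambda>t. lambda0 + of_real \<epsilon> * ex 1 t)" by (intro continuous_intros)
  have "continuous_on {0..1} ?g"
    by (intro bounded_bilinear.continuous_on[OF bl_compose] bounded_linear.continuous_on[OF bounded_linear_cmul_op]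
        continuous_on_compose2[OF continuous_RR cont] continuous_intros) (use circle_in_K[OF \<epsilon>] in auto)
  then have i: "?g integrable_on {0..1}" by (rule integrable_continuous_real)
  have "Proj \<epsilon> \<delta> = cmul_op (1 / (2 * \<i> * pi)) o\<^sub>L integral {0..1} (\<lambda>t. cmul_op (2 * of_real pi * \<i>) o\<^sub>L ?g t)"
    unfolding Proj_def using f by (metis (no_types, lifting) Henstock_Kurzweil_Integration.integral_cong)
  also have "integral {0..1} (\<lambda>t. cmul_op (2 * of_real pi * \<i>) o\<^sub>L ?g t) = cmul_op (2 * of_real pi * \<i>) o\<^sub>L integral {0..1} ?g"
    using integral_linear[OF i bounded_bilinear.bounded_linear_right[OF bl_compose], of "cmul_op (2 * of_real pi * \<i>)"]
    by (simp add: o_def)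
  also have "cmul_op (1 / (2 * \<i> * pi)) o\<^sub>L (cmul_op (2 * of_real pi * \<i>) o\<^sub>L integral {0..1} ?g) = PP (LS \<delta>) lambda0 \<epsilon>"
    unfolding PP_def by (rule blinfun_eqI) (simp add: cmul_state_mult)
  finally show ?thesis .
qed

lemma a_om:
  assumes "0 \<le> \<delta>" "\<delta> < d" and "blinfun_apply (U \<delta>) (mode j V_minus) = blinfun_apply Sop y"
  shows "a U \<delta> = om ((U \<delta>) (mode j' V_plus)) ((LS \<delta>) y)"
  unfolding a_def A_def Let_def assms(3) L_LS[OF assms(1,2)] om_lint ..

text \<open>The n-th amplitude derivative of \<open>LS\<close> for n > 0; at n = 0 it differs from
  \<open>LS\<close> by the constant \<open>IS\<close>.\<close>

definition LSn :: "nat \<Rightarrow> real \<Rightarrow> state \<Rightarrow>\<^sub>L state" where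
  "LSn n \<delta> = LSop xi0 ((pdx ^^ n) C1 \<delta>) ((pdx ^^ n) R \<delta>) ((pdx ^^ n) C3 \<delta>) ((pdx ^^ n) C4 \<delta>) ((pdx ^^ n) C5 \<delta>)"

lemma fam_n: "fam s f \<Longrightarrow> fam s ((pdx ^^ n) f)"
  by (induction n) (auto intro: fam_pdx)

lemma LSn_deriv: "0 \<le> x \<Longrightarrow> x < s \<Longrightarrow> (LSn n has_vector_derivative LSn (Suc n) x) (at x within {0..<s})"
proof -
  assume x: "0 \<le> x" "x < s"
  note f = fam_n[OF fam_C(1), of n] fam_n[OF fam_C(2), of n] fam_n[OF fam_C(3), of n] fam_n[OF fam_C(4), of n] fam_n[OF fam_C(5), of n]
  note p = f[THEN fam_pdx(1)]
  show ?thesis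
    unfolding LSn_def[abs_def] funpow.simps o_apply
    by (rule LSop_deriv[OF fam_CH[OF f(1)] fam_CH[OF p(1)] fam_CH[OF f(2)] fam_CH[OF p(2)] fam_CX[OF f(3)] fam_CX[OF p(3)]
        fam_CX[OF f(4)] fam_CX[OF p(4)] fam_CX[OF f(5)] fam_CX[OF p(5)] fam_pdv[OF f(1)] fam_pdv_t[OF f(1)]
        fam_pdv[OF f(2)] fam_pdv_t[OF f(2)] fam_pdv[OF f(3)] fam_pdv[OF f(4)] fam_pdv[OF f(5)] x])
qed

lemma LS_CD: "CD n s LS"
  unfolding LS_def[abs_def]
  by (intro CDT_add CDT_const LSop_CD[OF fam_CH[OF fam_C(1)] fam_CH[OF fam_C(2)]] fam_CX fam_C)

lemma LS_deriv: "0 \<le> x \<Longrightarrow> x < s \<Longrightarrow> (LS has_vector_derivative LSn 1 x) (at x within {0..<s})"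
proof -
  assume x: "0 \<le> x" "x < s"
  have "LS = (\<lambda>x. IS + LSn 0 x)" by (simp add: LS_def LSn_def fun_eq_iff)
  then show ?thesis using has_vector_derivative_add[OF has_vector_derivative_const LSn_deriv[OF x, of 0], of IS] by simp
qed

lemma ddelta_LS: "0 \<le> x \<Longrightarrow> x < s \<Longrightarrow> (ddelta ^^ Suc n) LS x = LSn (Suc n) x"
proof (induction n arbitrary: x)
  case 0 then show ?case using ddelta_eq(1)[OF LS_deriv] by simp
next
  case (Suc n)
  have "(ddelta ^^ Suc (Suc n)) LS x = ddelta ((ddelta ^^ Suc n) LS) x" by simp
  also have "\<dots> = ddelta (LSn (Suc n)) x" by (rule ddelta_cong1[OF Suc.IH Suc.prems])
  also have "\<dots> = LSn (Suc (Suc n)) x" by (rule ddelta_eq(1)[OF LSn_deriv Suc.prems]) fact+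
  finally show ?case .
qed

lemma L_taylor_LSn: "L_taylor (Suc n) (Sop y) = (1 / fact (Suc n)) *\<^sub>R (LSn (Suc n) 0) y"
proof -
  have ds: "0 \<le> (0::real)" "0 < d" "0 < s" using d s by auto
  have "0 \<le> x \<Longrightarrow> x < d \<Longrightarrow> (ddelta ^^ Suc n) (\<lambda>\<delta>. L xi0 \<delta> (Sop y)) x = (LSn (Suc n) x) y" for x
  proof (induction n arbitrary: x)
    case 0
    have "ddelta (\<lambda>\<delta>. L xi0 \<delta> (Sop y)) x = ddelta (\<lambda>\<delta>. (LS \<delta>) y) x"
      by (rule ddelta_cong1[OF L_LS 0])
    also have "\<dots> = (LSn 1 x) y"
      by (rule ddelta_eq(1)[OF bounded_linear.has_vector_derivative[OF blinfun.bounded_linear_left LS_deriv]]) (use 0 d in auto)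
    finally show ?case by simp
  next
    case (Suc n)
    have "(ddelta ^^ Suc (Suc n)) (\<lambda>\<delta>. L xi0 \<delta> (Sop y)) x = ddelta ((ddelta ^^ Suc n) (\<lambda>\<delta>. L xi0 \<delta> (Sop y))) x" by simp
    also have "\<dots> = ddelta (\<lambda>x. (LSn (Suc n) x) y) x" by (rule ddelta_cong1[OF Suc.IH Suc.prems])
    also have "\<dots> = blinfun_apply (LSn (Suc (Suc n)) x) y"
      by (rule ddelta_eq(1)[OF bounded_linear.has_vector_derivative[OF blinfun.bounded_linear_left LSn_deriv]]) (use Suc.prems d in auto)
    finally show ?case .
  qed
  from this[OF ds(1,2)] show ?thesis unfolding L_taylor_def by simp
qed

text \<open>The coefficients of \<open>LSn 1 0\<close> and \<open>LSn 2 0\<close> are first and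
  second amplitude derivatives of families in \<open>jet\<close>, hence in \<open>TP1\<close> and
  \<open>TP2\<close>.\<close>

lemma LSn_couple:
  "modes_vanish (Sop y) (n - 1) \<Longrightarrow> modes_vanish (Sop y) (n + 1) \<Longrightarrow> modes_vanish ((LSn 1 0) y) n"
  "modes_vanish (Sop y) (n - 2) \<Longrightarrow> modes_vanish (Sop y) n \<Longrightarrow> modes_vanish (Sop y) (n + 2) \<Longrightarrow>
    modes_vanish ((LSn 2 0) y) n"
proof -
  have C1p: "C1p ((pdx ^^ n) c 0) (pdt ((pdx ^^ n) c) 0)" "cper ((pdx ^^ n) c 0)" if "fam s c" for n c
    using fam_C1p[OF fam_n[OF that], of 0 n] fam_cper[OF fam_n[OF that], of 0 n] s by auto
  have T: "TP1 ((pdx ^^ 1) c 0)" "TP2 ((pdx ^^ 2) c 0)" if "jet s c" for c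
    using jet_pdx(2,3)[OF that s(1)] by (simp_all add: numeral_2_eq_2)
  show "modes_vanish (Sop y) (n - 1) \<Longrightarrow> modes_vanish (Sop y) (n + 1) \<Longrightarrow> modes_vanish ((LSn 1 0) y) n"
    unfolding LSn_def by (rule LSop_TP1[OF C1p(1)[OF fam_C(1)] C1p(1)[OF fam_C(2)] C1p(2)[OF fam_C(3)] C1p(2)[OF fam_C(4)] C1p(2)[OF fam_C(5)]
        T(1)[OF jet_C(1)] T(1)[OF jet_C(2)] T(1)[OF jet_C(3)] T(1)[OF jet_C(4)] T(1)[OF jet_C(5)]])
  show "modes_vanish (Sop y) (n - 2) \<Longrightarrow> modes_vanish (Sop y) n \<Longrightarrow> modes_vanish (Sop y) (n + 2) \<Longrightarrow>
    modes_vanish ((LSn 2 0) y) n"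
    unfolding LSn_def by (rule LSop_TP2[OF C1p(1)[OF fam_C(1)] C1p(1)[OF fam_C(2)] C1p(2)[OF fam_C(3)] C1p(2)[OF fam_C(4)] C1p(2)[OF fam_C(5)]
        T(2)[OF jet_C(1)] T(2)[OF jet_C(2)] T(2)[OF jet_C(3)] T(2)[OF jet_C(4)] T(2)[OF jet_C(5)]])
qed

end

subsection \<open>The double eigenvalue\<close>

lemma cdot_scale: "cdot X (c *s v) = c * cdot X v"
  by (simp add: cdot_def sum_distrib_left ac_simps)

context wave_branch
begin

text \<open>\<open>q\<close> is the sound speed, \<open>g\<close> is sqrt 5, \<open>sh\<close>
  equals 2 pi \<open>k0\<close> and \<open>w\<close> equals 2 \<open>z\<close> - 4. With the
  relations of \<open>arith\<close> the dispersion identities become polynomial in these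
  letters.\<close>

definition q where "q = sqrt (deriv P 1)"
definition g :: real where "g = sqrt 5"
definition sh where "sh = inverse (sqrt (h 1))"
definition w where "w = g * V / q"

lemma arith: "q * q = deriv P 1" "0 < q" "g * g = 5" "0 < g" "0 < sh" "sh * sh * (V * V - q * q) = 1" "q * w = g * V"
proof -
  show q: "q * q = deriv P 1" "0 < q" using c_pos by (simp_all add: q_def)
  show "g * g = 5" "0 < g" by (simp_all add: g_def)
  show "0 < sh" using h_1 by (simp add: sh_def)
  show "q * w = g * V" using q by (simp add: w_def)
  have "sqrt (h 1) * sqrt (h 1) = V * V - q * q" "0 < sqrt (h 1)"
    using h_1 q by (simp_all add: power2_eq_square)
  then show "sh * sh * (V * V - q * q) = 1" by (simp add: sh_def field_simps)
qed

lemma k0_sh: "k0 = sh * inverse (2 * pi)"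
  using k_eq[OF zero_lt, of 0] by (simp add: k0_def sh_def at_0)

lemma k0_pos: "0 < k0" using arith(5) by (simp add: k0_sh)

lemma coefficients_0: "C1 0 = (\<lambda>x. V * k0)" "R 0 = (\<lambda>x. 1)" "C3 0 = (\<lambda>x. k0 * (k0 * deriv P 1))" "C4 0 = (\<lambda>x. 0)" "C5 0 = (\<lambda>x. 0)"
proof -
  have ZY: "Z 0 x = 0" "Y 0 x = 0" for x by (simp_all add: Z_def Y_def)
  have R: "R 0 x = 1" "Rx 0 x = 0" for x by (simp_all add: R_def Rx_def Rh_def ZY)
  have k: "kk 0 x = k0" for x using kk_k[OF zero_lt, of x] by (simp add: k0_def)
  show "C1 0 = (\<lambda>x. V * k0)" "R 0 = (\<lambda>x. 1)" "C3 0 = (\<lambda>x. k0 * (k0 * deriv P 1))" "C4 0 = (\<lambda>x. 0)" "C5 0 = (\<lambda>x. 0)"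
    by (simp_all add: fun_eq_iff C1_def C3_def C4_def C5_def R k F_1 numeral_2_eq_2)
qed

sublocale cs: constant_symbol "V * k0" "k0 * (k0 * deriv P 1)" xi0 lambda0
proof
  show "0 < k0 * (k0 * deriv P 1)" "0 < V * k0" using k0_pos c_pos V_pos by simp_all
  have "(k0 * k0) * deriv P 1 < (k0 * k0) * V\<^sup>2" using V_sq k0_pos by (intro mult_strict_left_mono) auto
  then show "k0 * (k0 * deriv P 1) < (V * k0)\<^sup>2" by (simp add: power2_eq_square ac_simps)
qed

lemma LS_0: "LS 0 = cs.L0"
  by (simp add: LS_def cs.L0_def coefficients_0)

text \<open>\<open>xi0\<close> carries the fractional part of \<open>z\<close>, so the floor cancels
  and the shifted wave numbers depend on n - j and \<open>z\<close> alone.\<close>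

lemma k0_kap: "2 * (k0 * cs.kap n) = sh * (2 * (real_of_int (n - j)) + 3 + w)"
proof -
  have "xi0 = 2 * pi * (z - real_of_int j - 1 / 2)" by (simp add: xi0_def j_def)
  moreover have z2: "2 * z = 4 + w" by (simp add: z_def w_def g_def q_def)
  ultimately have kap: "cs.kap n = pi * (2 * real_of_int (n - j) + 3 + w)"
    by (simp add: cs.kap_def algebra_simps)
  show ?thesis unfolding kap k0_sh by (simp add: field_simps)
qed

lemma omega_kap: "omega n xi0 = sqrt (1 + deriv P 1 * (k0 * cs.kap n)\<^sup>2)"
  by (simp add: omega_def cs.kap_def power_mult_distrib mult.assoc)

text \<open>The constant sqrt 5 makes the radicand a perfect square: (3V + gq)^2 - (3q + gV)^2 = (9
  - g^2)(V^2 - q^2), and 9 - 5 = 4 is four times the 1 under the root.\<close>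

lemma omega_j: "2 * omega j xi0 = sh * (3 * V + g * q)"
proof -
  define k where "k = 2 * (k0 * cs.kap j)"
  have k: "k = sh * (3 + w)" using k0_kap[of j] by (simp add: k_def)
  have "(sh * (3 * V + g * q))\<^sup>2 = (sh * (3 * q + q * w))\<^sup>2 + sh * sh * (V * V - q * q) * (9 - g * g)"
    unfolding arith(7) by (simp add: power2_eq_square algebra_simps)
  then have "(sh * (3 * V + g * q))\<^sup>2 = 4 + q * q * k\<^sup>2"
    unfolding arith(3,6) k by (simp add: power2_eq_square algebra_simps)
  then have "4 * (1 + deriv P 1 * (k0 * cs.kap j)\<^sup>2) = (sh * (3 * V + g * q))\<^sup>2"
    by (simp add: k_def arith(1) power_mult_distrib algebra_simps)
  then have "1 + deriv P 1 * (k0 * cs.kap j)\<^sup>2 = (sh * (3 * V + g * q) / 2)\<^sup>2" by (simp add: power_divide)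
  moreover have "0 \<le> sh * (3 * V + g * q) / 2" using arith V_pos by simp
  ultimately show ?thesis by (simp add: omega_kap)
qed

lemma omega_j': "2 * omega j' xi0 = sh * (3 * V - g * q)"
proof -
  define k where "k = 2 * (k0 * cs.kap j')"
  have k: "k = sh * (w - 3)" using k0_kap[of j'] by (simp add: k_def j'_def)
  have "(sh * (3 * V - g * q))\<^sup>2 = (sh * (q * w - 3 * q))\<^sup>2 + sh * sh * (V * V - q * q) * (9 - g * g)"
    unfolding arith(7) by (simp add: power2_eq_square algebra_simps)
  then have "(sh * (3 * V - g * q))\<^sup>2 = 4 + q * q * k\<^sup>2"
    unfolding arith(3,6) k by (simp add: power2_eq_square algebra_simps)
  then have "4 * (1 + deriv P 1 * (k0 * cs.kap j')\<^sup>2) = (sh * (3 * V - g * q))\<^sup>2"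
    by (simp add: k_def arith(1) power_mult_distrib algebra_simps)
  then have "1 + deriv P 1 * (k0 * cs.kap j')\<^sup>2 = (sh * (3 * V - g * q) / 2)\<^sup>2" by (simp add: power_divide)
  moreover have "0 \<le> sh * (3 * V - g * q) / 2"
  proof -
    \<comment> \<open>Selects the nonnegative root: sqrt 5 \<le> 3, and the sound speed is below
      \<open>V\<close>.\<close>
    have "g \<le> 3" by (simp add: g_def real_le_lsqrt)
    then have "g * q \<le> 3 * V" using V_gt arith by (intro mult_mono) (auto simp: q_def)
    then show ?thesis using arith by simp
  qed
  ultimately show ?thesis by (simp add: omega_kap)
qed

lemma lambda0_eq: "lambda0 = \<i> * of_real (sh * (V * w - g * q) / 2)"
proof -
  have "V * k0 * (2 * pi * j + xi0) - omega j xi0 = sh * (V * w - g * q) / 2"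
    using arg_cong[OF k0_kap[of j], of "\<lambda>t. V * t"] omega_j by (simp add: cs.kap_def algebra_simps)
  then show ?thesis by (simp only: lambda0_def lambda_minus_def)
qed

text \<open>The minus branch at \<open>j\<close> and the plus branch at \<open>j'\<close> meet at
  \<open>lambda0\<close>: both reduce to the value in \<open>lambda0_eq\<close>.\<close>

lemma lambda_eq: "lambda0 = \<i> * of_real (V * k0 * cs.kap j - omega j xi0)" "lambda0 = \<i> * of_real (V * k0 * cs.kap j' + omega j' xi0)"
proof -
  show "lambda0 = \<i> * of_real (V * k0 * cs.kap j - omega j xi0)"
    by (simp add: lambda0_def lambda_minus_def cs.kap_def)
  have "2 * (k0 * cs.kap j') = sh * (w - 3)" using k0_kap[of j'] by (simp add: j'_def)
  then have "V * (2 * (k0 * cs.kap j')) = V * (sh * (w - 3))" by simp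
  then have "V * k0 * cs.kap j' + omega j' xi0 = sh * (V * w - g * q) / 2"
    using omega_j' by (simp add: algebra_simps)
  then show "lambda0 = \<i> * of_real (V * k0 * cs.kap j' + omega j' xi0)" by (simp only: lambda0_eq)
qed

text \<open>At \<open>lambda0\<close> the determinant is quadratic in n with roots j and j - 3, and
  its leading coefficient is - (2 pi k0)^2 (V^2 - q^2) = -1.\<close>

lemma Dt_eq: "cs.Dt n lambda0 = of_int (- ((n - j) * (n - j + 3)))"
proof -
  define \<mu> where "\<mu> = sh * (V * w - g * q)"
  define k where "k = 2 * (k0 * cs.kap n)"
  define m where "m = real_of_int (n - j)"
  have k: "k = sh * (2 * m + 3 + w)" unfolding k_def m_def by (rule k0_kap)
  have "cs.pp n lambda0 = \<i> * of_real ((\<mu> - V * k) / 2)"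
    unfolding cs.pp_def lambda0_eq cs.wv_kap \<mu>_def k_def by (simp add: algebra_simps diff_divide_distrib)
  then have "(cs.pp n lambda0)\<^sup>2 = of_real (- ((\<mu> - V * k) / 2)\<^sup>2)"
    by (simp only: power_mult_distrib power2_i of_real_minus of_real_power mult_minus_left mult_1_left)
  moreover have "cs.qq n = of_real (1 + q * q * (k / 2)\<^sup>2)"
    unfolding cs.qq_kap k_def arith(1) by (simp add: power2_eq_square ac_simps)
  ultimately have "cs.Dt n lambda0 = of_real (- ((\<mu> - V * k) / 2)\<^sup>2 + (1 + q * q * (k / 2)\<^sup>2))"
    by (simp add: cs.Dt_def)
  also have "- ((\<mu> - V * k) / 2)\<^sup>2 + (1 + q * q * (k / 2)\<^sup>2) = - (m * (m + 3))"
  proof -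
    have "- (\<mu> - V * k)\<^sup>2 + 4 + q * q * k\<^sup>2 = - 4 * (m * (m + 3))"
    proof -
      have "q * q * k\<^sup>2 = (sh * (q * (2 * m + 3) + q * w))\<^sup>2" by (simp add: k power2_eq_square algebra_simps)
      also have "\<dots> = (\<mu> - V * k)\<^sup>2 + sh * sh * (V * V - q * q) * (g * g - (2 * m + 3)\<^sup>2)"
        unfolding k \<mu>_def arith(7) by (simp add: power2_eq_square algebra_simps)
      finally show ?thesis unfolding arith(3,6) by (simp add: power2_eq_square algebra_simps)
    qed
    then show ?thesis by (simp add: power_divide field_simps)
  qed
  also have "of_real (- (m * (m + 3))) = of_int (- ((n - j) * (n - j + 3)))" by (simp add: m_def)
  finally show ?thesis .
qed

lemma Dt_zero: "cs.Dt n lambda0 = 0 \<longleftrightarrow> n = j \<or> n = j - 3"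
  unfolding Dt_eq of_int_eq_0_iff by auto

lemma Re_lambda0: "Re lambda0 = 0" by (simp add: lambda0_eq)

lemma qq_omega: "cs.qq n = (of_real (omega n xi0))\<^sup>2"
proof -
  have "0 \<le> deriv P 1 * (k0 * cs.kap n)\<^sup>2" using c_pos by simp
  then have "(omega n xi0)\<^sup>2 = 1 + deriv P 1 * (k0 * cs.kap n)\<^sup>2" by (simp add: omega_kap)
  then have "of_real (1 + k0 * (k0 * deriv P 1) * (cs.kap n)\<^sup>2) = (of_real (omega n xi0) :: complex)\<^sup>2"
    by (simp add: power_mult_distrib power2_eq_square ac_simps flip: of_real_power of_real_mult)
  then show ?thesis by (simp add: cs.qq_kap)
qed

lemma eigenvector:
  assumes y: "blinfun_apply Sop y = mode n (vec2 1 (\<i> * c))"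
    and c: "lambda0 = V * k0 * cs.wv n - \<i> * c" "c\<^sup>2 = cs.qq n"
  shows "blinfun_apply (LS 0) y = cmul_state lambda0 (blinfun_apply Sop y)"
proof (rule s_eqI)
  fix m
  have v: "V * k0 * cs.wv n = lambda0 + \<i> * c" using c(1) by simp
  show "s1 ((LS 0) y) m = s1 (cmul_state lambda0 (Sop y)) m"
    using v by (auto simp: LS_0 cs.s_L0 y mode_sv s_linear)
  have "cs.qq n + (lambda0 + \<i> * c) * (\<i> * c) = lambda0 * (\<i> * c)"
    unfolding c(2)[symmetric] by (simp add: power2_eq_square algebra_simps)
  then show "s2 ((LS 0) y) m = s2 (cmul_state lambda0 (Sop y)) m"
    using v by (auto simp: LS_0 cs.s_L0 y mode_sv s_linear)
qed

lemma V_plus_vec2: "V_plus = vec2 1 (\<i> * (- of_real (omega j' xi0)))"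
  and V_minus_vec2: "V_minus = vec2 1 (\<i> * of_real (omega j xi0))"
  by (simp_all add: V_plus_def V_minus_def vec2_def)

lemma eigenvectors:
  "Sop y = mode j' V_plus \<Longrightarrow> (LS 0) y = cmul_state lambda0 (Sop y)"
  "Sop y = mode j V_minus \<Longrightarrow> (LS 0) y = cmul_state lambda0 (Sop y)"
proof -
  show "Sop y = mode j' V_plus \<Longrightarrow> (LS 0) y = cmul_state lambda0 (Sop y)"
    unfolding V_plus_vec2
    by (rule eigenvector) (assumption, simp_all only: lambda_eq(2) cs.wv_kap qq_omega power2_minus, simp add: ring_distribs)
  show "Sop y = mode j V_minus \<Longrightarrow> (LS 0) y = cmul_state lambda0 (Sop y)"
    unfolding V_minus_vec2
    by (rule eigenvector) (assumption, simp_all only: lambda_eq(1) cs.wv_kap qq_omega, simp add: ring_distribs)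
qed

lemma G_apply:
  assumes "cs.Dt n lambda0 \<noteq> 0"
  shows "G n *v f = vec2 ((cs.pp n lambda0 * f $ 1 - f $ 2) / cs.Dt n lambda0) ((cs.qq n * f $ 1 + cs.pp n lambda0 * f $ 2) / cs.Dt n lambda0)"
proof -
  define p q' \<Delta> where "p = cs.pp n lambda0" and "q' = cs.qq n" and "\<Delta> = cs.Dt n lambda0"
  have \<Delta>: "\<Delta> \<noteq> 0" "\<Delta> = p * p + q'" using assms by (simp_all add: \<Delta>_def p_def q'_def cs.Dt_def power2_eq_square)
  define B :: "complex^2^2" where "B = vector [vector [p / \<Delta>, - 1 / \<Delta>], vector [q' / \<Delta>, p / \<Delta>]]"
  define M :: "complex^2^2" where "M = vector [vector [p, 1], vector [- q', p]]"
  have wv: "\<i> * k0 * (2 * pi * n + xi0) = k0 * cs.wv n"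
    by (simp add: cs.wv_kap cs.kap_def)
  have "mat lambda0 - Sigma0 (\<i> * k0 * (2 * pi * n + xi0)) = M"
    unfolding wv by (simp add: M_def vec_eq_iff forall_2 vector_2 mat_def Sigma0_def p_def q'_def cs.pp_def cs.qq_def F_1 power2_eq_square)
  moreover have "p * p / \<Delta> + q' / \<Delta> = 1" "q' / \<Delta> + p * p / \<Delta> = 1"
    using \<Delta> by (simp_all add: add.commute flip: add_divide_distrib)
  then have "M ** B = mat 1" "B ** M = mat 1"
    by (simp_all add: M_def B_def matrix_matrix_mult_def mat_def vec_eq_iff forall_2 sum_2 vector_2 mult.commute)
  ultimately have "G n = B" unfolding G_def using matrix_inv_eqI by metis
  then show ?thesis
    by (simp add: B_def p_def q'_def \<Delta>_def vec_eq_iff forall_2 vector_2 matrix_vector_mult_def sum_2 diff_divide_distrib add_divide_distrib)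
qed

text \<open>Solves the equation for a corrector at one nonresonant mode, which is how the matrices
  \<open>G\<close> enter the index formula.\<close>

lemma G_solve:
  assumes "cs.Dt n lambda0 \<noteq> 0" "sv ((MM cs.L0 lambda0) y) n = f"
  shows "sv (Sop y) n = G n *v f"
proof -
  define p q' \<Delta> x v where "p = cs.pp n lambda0" and "q' = cs.qq n" and "\<Delta> = cs.Dt n lambda0"
    and "x = s1 (Sop y) n" and "v = s2 (Sop y) n"
  have \<Delta>: "\<Delta> \<noteq> 0" "\<Delta> = p * p + q'" using assms by (simp_all add: \<Delta>_def p_def q'_def cs.Dt_def power2_eq_square)
  have f: "f $ 1 = p * x + v" "f $ 2 = - q' * x + p * v"
    using assms(2) by (auto simp: cs.s_MM p_def q'_def x_def v_def)
  have "p * f $ 1 - f $ 2 = \<Delta> * x" "q' * f $ 1 + p * f $ 2 = \<Delta> * v"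
    by (simp_all add: f \<Delta>(2) algebra_simps)
  then show ?thesis using \<Delta>(1)
    by (simp add: G_apply[OF assms(1)] vec_eq_iff forall_2 flip: p_def q'_def \<Delta>_def x_def v_def)
qed

subsection \<open>The index as a third-order coefficient\<close>

lemma coef_L_taylor:
  assumes "Sop y = mode m f"
  shows "coef (L_taylor (Suc n)) m p f = of_real (1 / fact (Suc n)) *s sv ((LSn (Suc n) 0) y) (m + p)"
  unfolding coef_sv assms[symmetric] L_taylor_LSn sv_linear ..

lemma modes_vanish_diff:
  "sv (Sop y) n = sv (Sop y') n \<Longrightarrow> modes_vanish (Sop (y - y')) n"
  by (simp add: sv_zero sv_linear blinfun.diff_right)

lemma mode_vanish: "Sop y = mode m f \<Longrightarrow> n \<noteq> m \<Longrightarrow> modes_vanish (Sop y) n"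
  by (simp add: sv_zero sv_mode)

text \<open>The correctors live on few modes: \<open>y1\<close> on j - 1 and j + 1, and of
  \<open>y2\<close> only j - 2 and j - 4 are seen from j - 3. Comparing them with single-mode states
  turns each contribution into a \<open>coef\<close>.\<close>

theorem Gamma_formula:
  "\<exists>\<epsilon>0>0. \<forall>\<epsilon>1\<in>{0<..<\<epsilon>0}. \<forall>U. kato_flow \<epsilon>1 U \<longrightarrow> Gamma U = cdot (J *v V_plus) (N V_minus)"
proof -
  obtain \<epsilon> where \<epsilon>: "0 < \<epsilon>" "\<And>\<mu> n. 0 < cmod (\<mu> - lambda0) \<Longrightarrow> cmod (\<mu> - lambda0) < \<epsilon> \<Longrightarrow> cs.Dt n \<mu> \<noteq> 0"
    using cs.isolated by metis
  have "Gamma U = cdot (J *v V_plus) (N V_minus)" if e1: "0 < \<epsilon>1" "\<epsilon>1 < \<epsilon>" and kato: "kato_flow \<epsilon>1 U" for \<epsilon>1 U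
  proof -
    \<comment> \<open>The circle of radius \<open>\<epsilon>1\<close> lies inside the annulus from
      \<open>\<epsilon>1 / 2\<close> to \<open>b\<close>, and \<open>b\<close> stays below the
      isolation radius \<epsilon>.\<close>
    define b where "b = (\<epsilon>1 + \<epsilon>) / 2"
    have b: "0 < \<epsilon>1 / 2" "\<epsilon>1 / 2 \<le> \<epsilon>1" "\<epsilon>1 < b" "\<epsilon>1 \<le> b" "b < \<epsilon>" using e1 by (simp_all add: b_def)
    have "annulus cs.L0 lambda0 (\<epsilon>1 / 2) b"
      by (rule cs.annulus_L0[OF b(1)]) (rule \<epsilon>(2); use b in linarith)
    from annulus_neighborhood[OF this b(1)] obtain e where
      e: "0 < e" "\<And>T' \<mu>. norm (T' - cs.L0) < e \<Longrightarrow> \<epsilon>1 / 2 \<le> cmod (\<mu> - lambda0) \<Longrightarrow> cmod (\<mu> - lambda0) \<le> b \<Longrightarrow> \<exists>N. binv (MM T' \<mu>) N"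
      by metis
    have "continuous (at 0 within {0..<s}) LS"
      by (rule has_vector_derivative_continuous[OF LS_deriv]) (use s in auto)
    \<comment> \<open>Continuity of \<open>LS\<close> at 0 in operator norm keeps the annulus in the
      resolvent set for small amplitudes.\<close>
    then obtain d1 where d1: "0 < d1" "\<And>x. x \<in> {0..<s} \<Longrightarrow> dist x 0 < d1 \<Longrightarrow> dist (LS x) (LS 0) < e"
      using e(1) unfolding continuous_within_eps_delta by metis
    define d2 where "d2 = min (min d d1) \<epsilon>1"
    have d2: "0 < d2" "d2 \<le> d" "d2 \<le> d1" "d2 \<le> \<epsilon>1" "d2 \<le> s" using d d1(1) e1 by (auto simp: d2_def)
    have ann: "annulus_sym (LS x) lambda0 (\<epsilon>1 / 2) b" if x: "0 \<le> x" "x < d2" for x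
    proof
      have xs: "x < s" using x d2 by simp
      have "norm (LS x - cs.L0) < e" using d1(2)[of x] x d2 xs by (simp add: dist_norm LS_0)
      then show "\<exists>N. binv (MM (LS x) \<mu>) N" if "\<epsilon>1 / 2 \<le> cmod (\<mu> - lambda0)" "cmod (\<mu> - lambda0) \<le> b" for \<mu>
        using e(2) that by blast
      show "clin (LS x)" "om ((LS x) y) (Sop y') = - om (Sop y) ((LS x) y')" for y y'
        by (rule clin_LS[OF x(1) xs] LS_skew[OF x(1) xs])+
    qed (use b Re_lambda0 in auto)
    have Pj: "Proj \<epsilon>1 x = PP (LS x) lambda0 \<epsilon>1" if "0 \<le> x" "x < d2" for x
      by (rule Proj_PP[OF that(1) _ annulus_sym.axioms(1)[OF ann[OF that]] b(2,4)]) (use that d2 in simp)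
    have U_deriv: "(U has_vector_derivative
       ((ddelta (\<lambda>x. PP (LS x) lambda0 \<epsilon>1) x o\<^sub>L PP (LS x) lambda0 \<epsilon>1) - (PP (LS x) lambda0 \<epsilon>1 o\<^sub>L ddelta (\<lambda>x. PP (LS x) lambda0 \<epsilon>1) x)) o\<^sub>L U x)
       (at x within {0..<d2})" if x: "0 \<le> x" "x < d2" for x
    proof -
      \<comment> \<open>The flow is defined with derivatives within \<open>{0..\<epsilon>1}\<close>,
        the index with right derivatives on the half-line; below \<open>\<epsilon>1\<close> the two
        filters agree.\<close>
      have "vector_derivative (Proj \<epsilon>1) (at x within {0..\<epsilon>1}) = ddelta (Proj \<epsilon>1) x"
        unfolding ddelta_def
        by (rule arg_cong[where f = "vector_derivative (Proj \<epsilon>1)"], rule at_within_nhd[of x "{..<\<epsilon>1}"]) (use x d2 in auto)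
      also have "\<dots> = ddelta (\<lambda>x. PP (LS x) lambda0 \<epsilon>1) x" by (rule ddelta_cong1[OF Pj x])
      finally have v: "vector_derivative (Proj \<epsilon>1) (at x within {0..\<epsilon>1}) = ddelta (\<lambda>x. PP (LS x) lambda0 \<epsilon>1) x" .
      have xe: "x \<in> {0..\<epsilon>1}" using x d2 by auto
      have "(U has_vector_derivative
         ((ddelta (\<lambda>x. PP (LS x) lambda0 \<epsilon>1) x o\<^sub>L PP (LS x) lambda0 \<epsilon>1) - (PP (LS x) lambda0 \<epsilon>1 o\<^sub>L ddelta (\<lambda>x. PP (LS x) lambda0 \<epsilon>1) x)) o\<^sub>L U x)
         (at x within {0..\<epsilon>1})"
        using kato[unfolded kato_flow_def Let_def, THEN conjunct2, rule_format, OF xe] unfolding v Pj[OF x] .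
      then show ?thesis by (rule has_vector_derivative_within_subset) (use d2 in auto)
    qed
    have "U 0 = id_blinfun" using kato by (simp add: kato_flow_def)
    then interpret sf: spectral_family LS lambda0 d2 \<epsilon>1 b U
      by (intro spectral_family.intro CDT_restrict[OF LS_CD d2(5)] d2(1) e1(1) b(3) U_deriv ann)
    have Pr0: "sf.Pr 0 = PP cs.L0 lambda0 \<epsilon>1" by (simp add: sf.Pr_def LS_0)
    obtain yp where yp: "Sop yp = mode j' V_plus" by (rule mode_Sop)
    obtain y0 where y0: "Sop y0 = mode j V_minus" by (rule mode_Sop)
    have zs: "0 \<le> (0::real)" "(0::real) < s" using s by auto
    have T: "ddelta LS 0 = LSn 1 0" "ddelta (ddelta LS) 0 = LSn 2 0" "ddelta (ddelta (ddelta LS)) 0 = LSn 3 0"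
      using ddelta_LS[OF zs, of 0] ddelta_LS[OF zs, of 1] ddelta_LS[OF zs, of 2] by (simp_all add: eval_nat_numeral)
    have v0: "modes_vanish (Sop y0) n" if "n \<noteq> j" for n by (rule mode_vanish[OF y0 that])
    \<comment> \<open>\<open>y0\<close> sits at mode j, so the first-order part of L moves it to the
      nonresonant modes j - 1 and j + 1; this yields the hypothesis that the projection kills
      it.\<close>
    have t1: "modes_vanish ((LSn 1 0) y0) n" if "n \<noteq> j - 1" "n \<noteq> j + 1" for n
      using that by (intro LSn_couple(1) v0) auto
    obtain y1 y2 r2 where yr:
      "(ddelta LS 0) y0 + ((LS 0) y1 - cmul_state lambda0 (Sop y1)) = 0"
      "(sf.Pr 0) (Sop y1) = 0"
      "(ddelta (ddelta LS) 0) y0 + 2 *\<^sub>R (ddelta LS 0) y1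
         + ((LS 0) y2 - cmul_state lambda0 (Sop y2)) = r2"
      "(sf.Pr 0) r2 = r2"
      "ddelta (ddelta (ddelta (a U))) 0 = om (Sop yp) (blinfun_apply (ddelta (ddelta (ddelta LS)) 0) y0
         + 3 *\<^sub>R (ddelta (ddelta LS) 0) y1 + 3 *\<^sub>R (ddelta LS 0) y2)"
    proof (rule sf.third_order[OF eigenvectors(1)[OF yp] eigenvectors(2)[OF y0]])
      show "(sf.Pr 0) ((LS 0) y - cmul_state lambda0 (Sop y)) = 0" for y
        unfolding Pr0 LS_0 by (rule cs.PP_L0_zero[OF b(1,2,4,5) \<epsilon>(2)])
      show "(sf.Pr 0) ((ddelta LS 0) y0) = 0"
      proof (rule s_eqI)
        fix n
        have m: "cs.Dt n lambda0 = 0 \<Longrightarrow> s1 ((LSn 1 0) y0) n = 0 \<and> s2 ((LSn 1 0) y0) n = 0"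
          using t1[of n] by (auto simp: Dt_zero modes_vanish_def)
        have g: "cs.pp n lambda0 * s1 ((LSn 1 0) y0) n - s2 ((LSn 1 0) y0) n = 0"
          "cs.qq n * s1 ((LSn 1 0) y0) n + cs.pp n lambda0 * s2 ((LSn 1 0) y0) n = 0"
          if "cs.Dt n lambda0 = 0"
          using m[OF that] by simp_all
        show "s1 ((sf.Pr 0) ((ddelta LS 0) y0)) n = s1 0 n"
          unfolding Pr0 T s_linear by (rule cs.PP_mode_zero(1)[OF b(1,2,4,5) \<epsilon>(2) g])
        show "s2 ((sf.Pr 0) ((ddelta LS 0) y0)) n = s2 0 n"
          unfolding Pr0 T s_linear by (rule cs.PP_mode_zero(2)[OF b(1,2,4,5) \<epsilon>(2) g])
      qed
      show "a U x = om ((U x) (Sop yp)) ((LS x) y)"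
        if "0 \<le> x" "x < d2" "(U x) (Sop y0) = Sop y" for x y
        unfolding yp by (rule a_om) (use that d2 y0 in auto)
    qed (rule that)
    have M1: "(MM cs.L0 lambda0) y1 = (LSn 1 0) y0"
      using yr(1) by (simp add: MM_apply LS_0 T algebra_simps)
    have M2: "(MM cs.L0 lambda0) y2 = (LSn 2 0) y0 + 2 *\<^sub>R (LSn 1 0) y1 - r2"
      using yr(3) by (simp add: MM_apply LS_0 T algebra_simps)
    \<comment> \<open>Where the right-hand side has no mode, the mode of \<open>y1\<close> solves
      the homogeneous equation; the normalisation by the projection excludes a nonzero kernel
      element, at j and j - 3 in particular.\<close>
    have v1: "modes_vanish (Sop y1) n" if n: "n \<noteq> j - 1" "n \<noteq> j + 1" for n
    proof -
      have "s1 ((MM cs.L0 lambda0) y1) n = 0" "s2 ((MM cs.L0 lambda0) y1) n = 0"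
        using t1[OF n] unfolding M1 by (simp_all add: modes_vanish_def)
      then have "V * k0 * cs.wv n * s1 (blinfun_apply Sop y1) n - s2 (blinfun_apply Sop y1) n = lambda0 * s1 (blinfun_apply Sop y1) n"
        "cs.qq n * s1 (blinfun_apply Sop y1) n + V * k0 * cs.wv n * s2 (blinfun_apply Sop y1) n = lambda0 * s2 (blinfun_apply Sop y1) n"
        unfolding cs.s_MM cs.pp_def by (simp_all add: algebra_simps)
      from cs.kernel_mode_zero[OF b(1,2,4,5) \<epsilon>(2) yr(2)[unfolded Pr0] this] show ?thesis by (simp add: modes_vanish_def)
    qed
    \<comment> \<open>The residual is in the range of the projection, which carries the resonant
      modes only; it is invisible in the equations at j - 2 and j - 4.\<close>
    have r2: "sv r2 n = 0" if "n \<noteq> j" "n \<noteq> j - 3" for n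
    proof -
      have D: "cs.Dt n lambda0 = 0 \<Longrightarrow> Q" for Q using that by (simp add: Dt_zero)
      have "s1 ((PP cs.L0 lambda0 \<epsilon>1) r2) n = 0"
        by (rule cs.PP_mode_zero(1)[OF b(1,2,4,5) \<epsilon>(2) D D])
      moreover have "s2 ((PP cs.L0 lambda0 \<epsilon>1) r2) n = 0"
        by (rule cs.PP_mode_zero(2)[OF b(1,2,4,5) \<epsilon>(2) D D])
      ultimately show ?thesis using yr(4) unfolding Pr0 by (simp add: vec_eq_iff forall_2)
    qed
    define X1 where "X1 = G (j - 1) *v coef (L_taylor 1) j (-1) V_minus"
    define A where "A = coef (L_taylor 2) j (-2) V_minus"
    define B where "B = coef (L_taylor 1) (j - 1) (-1) X1"
    obtain \<eta>1 where \<eta>1: "blinfun_apply Sop \<eta>1 = mode (j - 1) X1" by (rule mode_Sop)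
    obtain \<eta>A where \<eta>A: "blinfun_apply Sop \<eta>A = mode (j - 2) (G (j - 2) *v A)" by (rule mode_Sop)
    obtain \<eta>B where \<eta>B: "blinfun_apply Sop \<eta>B = mode (j - 2) (G (j - 2) *v B)" by (rule mode_Sop)
    have L: "coef (L_taylor 1) m p X = sv ((LSn 1 0) y) (m + p)"
      "2 *s coef (L_taylor 2) m p X = sv ((LSn 2 0) y) (m + p)"
      "6 *s coef (L_taylor 3) m p X = sv ((LSn 3 0) y) (m + p)" if "Sop y = mode m X" for m p X y
      using coef_L_taylor[OF that, of 0 p] coef_L_taylor[OF that, of 1 p] coef_L_taylor[OF that, of 2 p]
      by (simp_all add: eval_nat_numeral vec_eq_iff mult.commute[of 2] mult.commute[of 6])
    have "sv (Sop y1) (j - 1) = X1"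
      unfolding X1_def using L(1)[OF y0, of "-1"] by (intro G_solve) (simp_all add: Dt_zero M1)
    \<comment> \<open>Mode j + 1 of \<open>y1\<close> stays unspecified: it is three away from j -
      2, where the first-order part of L acts on \<open>y1\<close>, and four away from j - 3, where
      the second-order part does.\<close>
    then have y1: "modes_vanish (Sop (y1 - \<eta>1)) n" if "n \<noteq> j + 1" for n
      using v1[of n] that by (intro modes_vanish_diff) (auto simp: \<eta>1 sv_mode sv_zero)
    have T1y1: "sv ((LSn 1 0) y1) (j - 2) = B"
    proof -
      have "modes_vanish ((LSn 1 0) (y1 - \<eta>1)) (j - 2)" by (intro LSn_couple(1) y1) auto
      then have "sv ((LSn 1 0) y1) (j - 2) = sv ((LSn 1 0) \<eta>1) (j - 2)"
        by (simp add: sv_zero sv_linear blinfun.diff_right)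
      then show ?thesis using L(1)[OF \<eta>1, of "-1"] by (simp add: B_def)
    qed
    have "sv ((MM cs.L0 lambda0) y2) (j - 2) = 2 *s A + 2 *s B"
      using T1y1 L(2)[OF y0, of "-2"] by (simp add: M2 sv_linear r2 A_def)
    then have "sv (Sop y2) (j - 2) = G (j - 2) *v (2 *s A + 2 *s B)"
      by (intro G_solve) (simp_all add: Dt_zero)
    \<comment> \<open>Mode j - 4 is the other neighbour of j - 3; neither \<open>y0\<close> at
      second order nor \<open>y1\<close> at first order reaches it.\<close>
    moreover have "sv (Sop y2) (j - 4) = G (j - 4) *v 0"
    proof (rule G_solve)
      have "modes_vanish ((LSn 2 0) y0) (j - 4)" by (intro LSn_couple(2) v0) auto
      moreover have "modes_vanish ((LSn 1 0) y1) (j - 4)" by (intro LSn_couple(1) v1) auto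
      ultimately show "sv ((MM cs.L0 lambda0) y2) (j - 4) = 0"
        by (simp add: M2 sv_linear r2 sv_zero)
    qed (simp add: Dt_zero)
    ultimately have y2: "modes_vanish (Sop (y2 - (2 *\<^sub>R \<eta>A + 2 *\<^sub>R \<eta>B))) (j - 2)"
      "modes_vanish (Sop (y2 - (2 *\<^sub>R \<eta>A + 2 *\<^sub>R \<eta>B))) (j - 4)"
      by (auto intro!: modes_vanish_diff simp: blinfun.add_right blinfun.scaleR_right sv_linear \<eta>A \<eta>B sv_mode
          matrix_vector_right_distrib vector_scalar_commute)
    have T2y1: "sv ((LSn 2 0) y1) (j - 3) = 2 *s coef (L_taylor 2) (j - 1) (-2) X1"
    proof -
      have "modes_vanish ((LSn 2 0) (y1 - \<eta>1)) (j - 3)" by (intro LSn_couple(2) y1) auto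
      then have "sv ((LSn 2 0) y1) (j - 3) = sv ((LSn 2 0) \<eta>1) (j - 3)"
        by (simp add: sv_zero sv_linear blinfun.diff_right)
      then show ?thesis using L(2)[OF \<eta>1, of "-2"] by simp
    qed
    have T1y2: "sv ((LSn 1 0) y2) (j - 3) =
        2 *s coef (L_taylor 1) (j - 2) (-1) (G (j - 2) *v A) + 2 *s coef (L_taylor 1) (j - 2) (-1) (G (j - 2) *v B)"
    proof -
      have "modes_vanish ((LSn 1 0) (y2 - (2 *\<^sub>R \<eta>A + 2 *\<^sub>R \<eta>B))) (j - 3)"
        using y2 by (intro LSn_couple(1)) (simp_all add: algebra_simps)
      then have "sv ((LSn 1 0) y2) (j - 3) =
          sv (2 *\<^sub>R (LSn 1 0) \<eta>A + 2 *\<^sub>R (LSn 1 0) \<eta>B) (j - 3)"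
        by (simp add: sv_zero sv_linear blinfun.diff_right blinfun.add_right blinfun.scaleR_right)
      then show ?thesis using L(1)[OF \<eta>A, of "-1"] L(1)[OF \<eta>B, of "-1"] by (simp add: sv_linear)
    qed
    have "(ddelta ^^ 3) (a U) 0 = cdot (J *v V_plus) (sv ((LSn 3 0) y0
         + 3 *\<^sub>R (LSn 2 0) y1 + 3 *\<^sub>R (LSn 1 0) y2) (j - 3))"
      using yr(5) unfolding T yp om_mode by (simp add: eval_nat_numeral j'_def)
    \<comment> \<open>The common factor 6: \<open>LSn 3\<close> is 3! times the Taylor coefficient,
      and elsewhere the Leibniz factor 3 meets the 2 from \<open>LSn 2\<close> or from
      \<open>y2\<close>.\<close>
    also have "sv ((LSn 3 0) y0 + 3 *\<^sub>R (LSn 2 0) y1 + 3 *\<^sub>R (LSn 1 0) y2) (j - 3) = 6 *s N V_minus"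
    proof -
      have T3y0: "sv ((LSn 3 0) y0) (j - 3) = 6 *s coef (L_taylor 3) j (-3) V_minus"
        using L(3)[OF y0, of "-3"] by simp
      have "N V_minus = coef (L_taylor 3) j (-3) V_minus + coef (L_taylor 1) (j - 2) (-1) (G (j - 2) *v A)
          + coef (L_taylor 2) (j - 1) (-2) X1 + coef (L_taylor 1) (j - 2) (-1) (G (j - 2) *v B)"
        unfolding N_def A_def B_def X1_def ..
      then show ?thesis
        unfolding sv_linear T1y2 T2y1 T3y0 by (simp add: vec_eq_iff algebra_simps)
    qed
    finally show ?thesis by (simp add: Gamma_def cdot_scale)
  qed
  then show ?thesis using \<epsilon>(1) by (intro exI[of _ \<epsilon>]) auto
qed

end

theorem proposition5p5:
  fixes P F W Wd :: "real \<Rightarrow> real" and V :: real and E :: "real \<Rightarrow> real \<Rightarrow> real"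
  assumes "smooth_near 1 P" and "deriv P 1 > 0" and "V > sqrt (deriv P 1)"
    and "smooth_near 1 F" and "\<forall>\<^sub>F \<rho> in nhds 1. deriv (deriv F) \<rho> = deriv P \<rho> / \<rho>"
    and "W 1 = 0"
    and "\<forall>\<^sub>F \<rho> in nhds 1. (W has_real_derivative (\<rho> - 1) * wave_data.h F V \<rho>) (at \<rho>)"
    and "smooth_near 0 Wd" and "Wd 0 = 1"
    and "\<forall>\<^sub>F \<zeta> in nhds 0. W (1 + \<zeta> * Wd \<zeta>) = \<zeta>\<^sup>2 * wave_data.h F V 1 / 2"
    and "\<exists>\<delta>0>0. \<forall>\<delta>\<in>{0..\<delta>0}.
           (\<forall>x. E \<delta> differentiable (at x)) \<and>
           (\<forall>x. (deriv (E \<delta>) has_real_derivative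
              - E \<delta> x / ((wave_data.k F Wd V \<delta>)\<^sup>2 *
                 wave_data.h F V (1 + wave_data.k F Wd V \<delta> * deriv (E \<delta>) x))) (at x)) \<and>
           E \<delta> 0 = 0 \<and> deriv (E \<delta>) 0 = \<delta> * Wd \<delta> / wave_data.k F Wd V \<delta> \<and>
           periodic1 (E \<delta>)"
  shows "\<exists>\<epsilon>0>0. \<forall>\<epsilon>1\<in>{0<..<\<epsilon>0}. \<forall>U. wave_data.kato_flow P F Wd V E \<epsilon>1 U \<longrightarrow>
           wave_data.Gamma P F Wd V E U =
             cdot (J *v wave_data.V_plus P F Wd V)
               (wave_data.N P F Wd V E (wave_data.V_minus P F Wd V))"
proof -
  interpret wave_hyp P F Wd V E W
    by unfold_locales (use assms in auto)
  obtain r where r: "0 < r" "r \<le> 1" "smooth_on (ball 1 r) F"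
    "\<And>\<rho>. \<rho> \<in> ball 1 r \<Longrightarrow> 0 < h \<rho>" "\<And>\<rho>. \<rho> \<in> ball 1 r \<Longrightarrow> (W has_real_derivative (\<rho> - 1) * h \<rho>) (at \<rho>)"
    using radius_r by metis
  obtain s where s: "0 < s" "smooth_on (ball 0 s) Wd"
    "\<And>\<zeta>. \<zeta> \<in> ball 0 s \<Longrightarrow> 0 < Wd \<zeta>" "\<And>\<zeta>. \<zeta> \<in> ball 0 s \<Longrightarrow> 1 + \<zeta> * Wd \<zeta> \<in> ball 1 r"
    "\<And>\<zeta>. \<zeta> \<in> ball 0 s \<Longrightarrow> W (1 + \<zeta> * Wd \<zeta>) = \<zeta>\<^sup>2 * h 1 / 2"
    using radius_s[OF r(1)] by metis
  interpret wave_local P F Wd V E W r s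
    by unfold_locales (fact r s)+
  obtain d where d: "0 < d" "d \<le> s" "\<And>\<delta> x. 0 \<le> \<delta> \<Longrightarrow> \<delta> < d \<Longrightarrow> E \<delta> x = sqrt (h 1) * Y \<delta> x"
    using E_explicit by metis
  interpret wave_branch P F Wd V E W r s d
    by unfold_locales (fact d)+
  show ?thesis by (rule Gamma_formula)
qed

end
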